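(* Let $U,V$ be separable Banach spaces, let $T>0$, and let $L$ be a Lévy process in $U$ with weak second moments, decomposed as $L(t)=bt+W(t)+M(t)$. Let $F\colon[0,T]\to\mathcal{L}(U,V)$ be a function such that for all $v^*\in V^*$: $$\langle F(\cdot)\,\cdot\,,v^*\rangle\in H_M,\qquad i_C^*F^*(\cdot)v^*\in L^2([0,T];K),\qquad \langle F^*(\cdot)v^*,b\rangle\in L^1([0,T];\mathbb{R}).$$ Then $F$ is stochastically integrable with respect to $L$ if and only if the following three conditions are satisfied: (i) $F(\cdot)b\colon[0,T]\to V$ is Pettis integrable; (ii) $j_W\colon H_W\to V$ is $\gamma$-radonifying; (iii) $j_M\colon H_M\to V$ is $\theta_M$-radonifying.
   Context: All spaces are real; $\mathcal{L}(U,V)$ denotes bounded linear operators, $\langle\cdot,\cdot\rangle$ dual pairings or inner products, $F^*(s):=F(s)^*$, and $(\Omega,\mathcal{A},P)$ is the underlying probability space. $L^0_P(\Omega;V)$ denotes the space of (equivalence classes of) $V$-valued random variables. Cylindrical notions. For a separable Banach space $V$, cylindrical sets are the sets $\{v\in V:(\langle v,v_1^*\rangle,\dots,\langle v,v_n^*\rangle)\in B\}$ with $n\in\mathbb{N}$, $v_i^*\in V^*$, $B\in\mathcal{B}(\mathbb{R}^n)$; they form the algebra $\mathcal{Z}(V)$. A cylindrical probability measure $\eta$ on $\mathcal{Z}(V)$ is a set function with $\eta(V)=1$ whose restriction to the $\sigma$-algebra generated by any finite set of functionals in $V^*$ is a measure; characteristic functions $v^*\mapsto\int_V e^{i\langle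 v,v^*\rangle}\eta(dv)$ are assumed continuous. A cylindrical random variable $Z$ in $V$ is a continuous linear map $Z\colon V^*\to L^0_P(\Omega;\mathbb{R})$ (convergence in probability); its cylindrical distribution assigns to the cylindrical set above the value $P((Zv_1^*,\dots,Zv_n^* )\in B)$. For a separable Hilbert space $H$, a cylindrical probability measure $\theta$ on $\mathcal{Z}(H)$ and $j\in\mathcal{L}(H,V)$, the operator $j$ is called $\theta$-radonifying if the image cylindrical measure $\theta\circ j^{-1}$, $C\mapsto\theta(j^{-1}(C))$, extends from $\mathcal{Z}(V)$ to a probability measure on $\mathcal{B}(V)$. Decomposition of $L$. Here $b\in U$; $W$ is a Wiener process in $U$ with covariance operator $C\in\mathcal{L}(U^*,U)$; and $M$, independent of $W$, is a purely discontinuous Lévy process in $U$ with weak second moments and weak mean zero (a discontinuous martingale), with Lévy measure $\mu$ on $U$. Gaussian part. $K$ is the reproducing kernel Hilbert space of $C$ with embedding $i_C\colon K\to U$, so $C=i_Ci_C^*$. $H_W:=L^2([0,T];K)$, $\gamma$ is the canonical Gaussian cylindrical measure on $H_W$ (characteristic function $h\mapsto\exp(-\tfrac12\|h\|^2)$), and $j_W\colon H_W\to V$ is defined by $$\langle j_Wf,v^*\rangle=\int_0^T\langle i_C^*F^*(s)v^*,f(s)\rangle\,ds,\qquad v^*\in V^*.$$ Jump part. $\rho:=\lambda\otimes\mu$ with $\lambda$ Lebesgue measure on $[0,T]$, $H_M:=L^2_\rho([0,T]\times U;\mathbb{R})$, and $j_M\colon H_M\to V$ is defined by $$\langle j_Mf,v^*\rangle=\int_{[0,T]\times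 U}\langle F(s)u,v^*\rangle f(s,u)\,\rho(ds,du),\qquad v^*\in V^*,$$ so that $j_M^*v^*=\langle F(\cdot)\,\cdot\,,v^*\rangle$. The cylindrical random variable $\Theta_M\colon H_M\to L^2_P(\Omega;\mathbb{R})$ is $\Theta_Mf=\int_{[0,T]\times U}f(s,u)\,M(ds,du)$, where $M(ds,du)$ is the compensated Poisson random measure of the jumps of $M$ (intensity $\rho$); $\theta_M$ is the cylindrical distribution of $\Theta_M$. Integrals. For a deterministic $U^*$-valued function $g$, $\int_0^Tg(s)\,dW(s)$ and $\int_0^Tg(s)\,dM(s)$ are the usual real-valued $L^2$-stochastic integrals; in particular $\int_0^T F^*(s)v^*\,dM(s)=\Theta_M(j_M^*v^* )$. For $A\in\mathcal{B}([0,T])$ define the cylindrical random variable $I_A\colon V^*\to L^2_P(\Omega;\mathbb{R})$ by $$I_Av^*=\int_0^T\mathbf{1}_A(s)\langle F^*(s)v^*,b\rangle\,ds+\int_0^T\mathbf{1}_A(s)F^*(s)v^*\,dW(s)+\int_0^T\mathbf{1}_A(s)F^*(s)v^*\,dM(s).$$ $F$ is called stochastically integrable with respect to $L$ if for each $A\in\mathcal{B}([0,T])$ there exists a random variable $Y_A\in L^0_P(\Omega;V)$ with $\langle Y_A,v^*\rangle=I_Av^*$ for all $v^*\in V^*$. Pettis integrability of $F(\cdot)b$ means that $\langle F(\cdot)b,v^*\rangle\in L^1([0,T];\mathbb{R})$ for all $v^*\in V^*$ and for each $A\in\mathcal{B}([0,T])$ there is $v^A\in V$ with $\langle v^A,v^*\rangle=\int_A\langle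 F(s)b,v^*\rangle\,ds$ for all $v^*\in V^*$. *)

theory Defs
  imports "HOL-Probability.Probability"
begin

section \<open>Square integrable functions\<close>

text \<open>
  Elements of the spaces \<open>L\<^sup>2\<close> are represented by square integrable functions.  Everything below
  that takes such a function as an argument depends only on its almost-everywhere class.
\<close>

definition L2_fun :: "'a measure \<Rightarrow> ('a \<Rightarrow> 'b::{real_normed_vector, second_countable_topology}) set"
  where "L2_fun m = {f \<in> borel_measurable m. integrable m (\<lambda>x. (norm (f x))\<^sup>2)}"

definition L2_inner :: "'a measure \<Rightarrow> ('a \<Rightarrow> 'b::real_inner) \<Rightarrow> ('a \<Rightarrow> 'b) \<Rightarrow> real"
  where "L2_inner m f g = (LINT x|m. f x \<bullet> g x)"

definition L2_tendsto ::
    "'a measure \<Rightarrow> (nat \<Rightarrow> 'a \<Rightarrow> 'b::{real_normed_vector, second_countable_topology}) \<Rightarrow> ('a \<Rightarrow> 'b) \<Rightarrow> bool"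
  where "L2_tendsto m f g \<longleftrightarrow>
    g \<in> L2_fun m \<and> (\<lambda>n. \<integral>\<^sup>+ x. ennreal ((norm (f n x - g x))\<^sup>2) \<partial>m) \<longlonglongrightarrow> 0"

abbreviation lborel_upto :: "real \<Rightarrow> real measure"
  where "lborel_upto T \<equiv> restrict_space lborel {0..T}"


section \<open>Cylindrical measures\<close>

text \<open>
  The notions are relative to a carrier \<open>X\<close>, a set \<open>D\<close> of functionals and the pairing of the two.
  For a Banach space this is the whole type with its dual (\<open>dual_pairing\<close>); for a Hilbert space
  \<open>L\<^sup>2\<close>, identified with its own dual, it is \<open>X = D = L2_fun m\<close> with the pairing \<open>L2_inner m\<close>.
  A set function on the cylindrical sets is a total function whose other values are irrelevant.
\<close>

definition dual_pairing :: "'v::real_normed_vector \<Rightarrow> ('v \<Rightarrow>\<^sub>L real) \<Rightarrow> real"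
  where "dual_pairing x f = blinfun_apply f x"

definition cylinder ::
    "'x set \<Rightarrow> ('x \<Rightarrow> 'd \<Rightarrow> real) \<Rightarrow> nat \<Rightarrow> (nat \<Rightarrow> 'd) \<Rightarrow> (nat \<Rightarrow> real) set \<Rightarrow> 'x set"
  where "cylinder X pair n \<phi> B = {x \<in> X. (\<lambda>i\<in>{..<n}. pair x (\<phi> i)) \<in> B}"

abbreviation borel_fin :: "nat \<Rightarrow> (nat \<Rightarrow> real) measure"
  where "borel_fin n \<equiv> PiM {..<n} (\<lambda>_. borel)"

definition cylinder_sigma ::
    "'x set \<Rightarrow> ('x \<Rightarrow> 'd \<Rightarrow> real) \<Rightarrow> nat \<Rightarrow> (nat \<Rightarrow> 'd) \<Rightarrow> 'x set set"
  where "cylinder_sigma X pair n \<phi> = cylinder X pair n \<phi> ` sets (borel_fin n)"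

definition cylindrical_sets :: "'x set \<Rightarrow> ('x \<Rightarrow> 'd \<Rightarrow> real) \<Rightarrow> 'd set \<Rightarrow> 'x set set"
  where "cylindrical_sets X pair D = (\<Union>n. \<Union>\<phi>\<in>{\<phi>. \<forall>i<n. \<phi> i \<in> D}. cylinder_sigma X pair n \<phi>)"

definition cylindrical_prob ::
    "'x set \<Rightarrow> ('x \<Rightarrow> 'd \<Rightarrow> real) \<Rightarrow> 'd set \<Rightarrow> ('x set \<Rightarrow> ennreal) \<Rightarrow> bool"
  where "cylindrical_prob X pair D \<eta> \<longleftrightarrow> \<eta> X = 1 \<and>
    (\<forall>n \<phi>. (\<forall>i<n. \<phi> i \<in> D) \<longrightarrow> measure_space X (cylinder_sigma X pair n \<phi>) \<eta>)"

definition cylindrical_char ::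
    "'x set \<Rightarrow> ('x \<Rightarrow> 'd \<Rightarrow> real) \<Rightarrow> ('x set \<Rightarrow> ennreal) \<Rightarrow> 'd \<Rightarrow> complex"
  where "cylindrical_char X pair \<eta> d =
    (CLINT x|measure_of X (cylinder_sigma X pair 1 (\<lambda>_. d)) \<eta>. iexp (pair x d))"

text \<open>
  The canonical Gaussian cylindrical measure on \<open>L\<^sup>2\<close>.  Its values on cylindrical sets are determined
  by the characteristic function, whose continuity is evident from the formula.
\<close>

definition canonical_gaussian ::
    "'a measure \<Rightarrow> (('a \<Rightarrow> 'b::{real_inner, second_countable_topology}) set \<Rightarrow> ennreal) \<Rightarrow> bool"
  where "canonical_gaussian m \<gamma> \<longleftrightarrow> cylindrical_prob (L2_fun m) (L2_inner m) (L2_fun m) \<gamma> \<and>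
    (\<forall>h\<in>L2_fun m. cylindrical_char (L2_fun m) (L2_inner m) \<gamma> h = of_real (exp (- L2_inner m h h / 2)))"

definition cylindrical_distribution ::
    "'w measure \<Rightarrow> 'x set \<Rightarrow> ('x \<Rightarrow> 'd \<Rightarrow> real) \<Rightarrow> 'd set \<Rightarrow> ('d \<Rightarrow> 'w \<Rightarrow> real) \<Rightarrow> ('x set \<Rightarrow> ennreal) \<Rightarrow> bool"
  where "cylindrical_distribution P X pair D Z \<theta> \<longleftrightarrow>
    (\<forall>n \<phi> B. (\<forall>i<n. \<phi> i \<in> D) \<longrightarrow> B \<in> sets (borel_fin n) \<longrightarrow>
      \<theta> (cylinder X pair n \<phi> B) = emeasure P {\<omega> \<in> space P. (\<lambda>i\<in>{..<n}. Z (\<phi> i) \<omega>) \<in> B})"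

definition radonifying ::
    "'x set \<Rightarrow> ('x set \<Rightarrow> ennreal) \<Rightarrow> ('x \<Rightarrow> 'v::{banach, second_countable_topology}) \<Rightarrow> bool"
  where "radonifying X \<theta> j \<longleftrightarrow>
    (\<exists>\<nu> :: 'v measure. prob_space \<nu> \<and> sets \<nu> = sets borel \<and>
      (\<forall>C\<in>cylindrical_sets UNIV dual_pairing UNIV. emeasure \<nu> C = \<theta> (j -` C \<inter> X)))"


section \<open>Levy processes in a Banach space\<close>

definition levy_process ::
    "'w measure \<Rightarrow> (real \<Rightarrow> 'w \<Rightarrow> 'u::{banach, second_countable_topology}) \<Rightarrow> bool"
  where "levy_process P X \<longleftrightarrow> prob_space P \<and>
    (\<forall>t\<ge>0. X t \<in> borel_measurable P) \<and>
    (AE \<omega> in P. X 0 \<omega> = 0) \<and>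
    (\<forall>n (t :: nat \<Rightarrow> real). 0 \<le> t 0 \<and> mono t \<longrightarrow>
      prob_space.indep_vars P (\<lambda>_. borel) (\<lambda>i \<omega>. X (t (Suc i)) \<omega> - X (t i) \<omega>) {..<n}) \<and>
    (\<forall>s t. 0 \<le> s \<and> s \<le> t \<longrightarrow>
      distr P borel (\<lambda>\<omega>. X t \<omega> - X s \<omega>) = distr P borel (X (t - s))) \<and>
    (\<forall>t\<ge>0. \<forall>e>0.
      ((\<lambda>s. measure P {\<omega> \<in> space P. e < dist (X s \<omega>) (X t \<omega>)}) \<longlongrightarrow> 0) (at t within {0..}))"

definition weak_second_moments ::
    "'w measure \<Rightarrow> (real \<Rightarrow> 'w \<Rightarrow> 'u::real_normed_vector) \<Rightarrow> bool"
  where "weak_second_moments P X \<longleftrightarrow>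
    (\<forall>t\<ge>0. \<forall>u :: 'u \<Rightarrow>\<^sub>L real. integrable P (\<lambda>\<omega>. (blinfun_apply u (X t \<omega>))\<^sup>2))"

definition weak_mean_zero ::
    "'w measure \<Rightarrow> (real \<Rightarrow> 'w \<Rightarrow> 'u::real_normed_vector) \<Rightarrow> bool"
  where "weak_mean_zero P X \<longleftrightarrow>
    (\<forall>t\<ge>0. \<forall>u :: 'u \<Rightarrow>\<^sub>L real. (LINT \<omega>|P. blinfun_apply u (X t \<omega>)) = 0)"

definition indep_processes ::
    "'w measure \<Rightarrow> (real \<Rightarrow> 'w \<Rightarrow> 'u::topological_space) \<Rightarrow> (real \<Rightarrow> 'w \<Rightarrow> 'u) \<Rightarrow> bool"
  where "indep_processes P X Y \<longleftrightarrow> prob_space.indep_set P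
    (sigma_sets (space P) (\<Union>t\<in>{0..}. {X t -` B \<inter> space P | B. B \<in> sets borel}))
    (sigma_sets (space P) (\<Union>t\<in>{0..}. {Y t -` B \<inter> space P | B. B \<in> sets borel}))"

definition wiener_process ::
    "'w measure \<Rightarrow> (real \<Rightarrow> 'w \<Rightarrow> 'u::{banach, second_countable_topology}) \<Rightarrow>
     (('u \<Rightarrow>\<^sub>L real) \<Rightarrow>\<^sub>L 'u) \<Rightarrow> bool"
  where "wiener_process P W C \<longleftrightarrow> levy_process P W \<and>
    (AE \<omega> in P. continuous_on {0..} (\<lambda>t. W t \<omega>)) \<and>
    (\<forall>t\<ge>0. \<forall>u x. char (distr P borel (\<lambda>\<omega>. blinfun_apply u (W t \<omega>))) x
        = of_real (exp (- (t * blinfun_apply u (blinfun_apply C u) * x\<^sup>2 / 2))))"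

definition cadlag :: "'w measure \<Rightarrow> (real \<Rightarrow> 'w \<Rightarrow> 'u::topological_space) \<Rightarrow> bool"
  where "cadlag P X \<longleftrightarrow> (\<forall>\<omega>\<in>space P.
    (\<forall>t\<ge>0. ((\<lambda>s. X s \<omega>) \<longlongrightarrow> X t \<omega>) (at_right t)) \<and>
    (\<forall>t>0. \<exists>l. ((\<lambda>s. X s \<omega>) \<longlongrightarrow> l) (at_left t)))"

definition jump :: "(real \<Rightarrow> 'w \<Rightarrow> 'u::real_normed_vector) \<Rightarrow> 'w \<Rightarrow> real \<Rightarrow> 'u"
  where "jump X \<omega> t = X t \<omega> - Lim (at_left t) (\<lambda>s. X s \<omega>)"

text \<open>The random measure assigning to \<open>G\<close> the number of times \<open>t > 0\<close> with a jump \<open>x \<noteq> 0\<close> and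
  \<open>(t, x) \<in> G\<close>.\<close>

definition jump_measure ::
    "(real \<Rightarrow> 'w \<Rightarrow> 'u::real_normed_vector) \<Rightarrow> 'w \<Rightarrow> (real \<times> 'u) measure"
  where "jump_measure X \<omega> =
    distr (count_space {t. 0 < t \<and> jump X \<omega> t \<noteq> 0}) (borel \<Otimes>\<^sub>M borel) (\<lambda>t. (t, jump X \<omega> t))"

definition poisson_random_measure ::
    "'w measure \<Rightarrow> 'a measure \<Rightarrow> ('w \<Rightarrow> 'a measure) \<Rightarrow> bool"
  where "poisson_random_measure P \<nu> N \<longleftrightarrow>
    (\<forall>G\<in>sets \<nu>. (\<lambda>\<omega>. emeasure (N \<omega>) G) \<in> borel_measurable P) \<and>
    (\<forall>G\<in>sets \<nu>. emeasure \<nu> G < \<infinity> \<longrightarrow>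
      (\<forall>k :: nat. measure P {\<omega> \<in> space P. emeasure (N \<omega>) G = of_nat k}
        = measure \<nu> G ^ k / fact k * exp (- measure \<nu> G))) \<and>
    (\<forall>n (G :: nat \<Rightarrow> 'a set).
      (\<forall>i<n. G i \<in> sets \<nu> \<and> emeasure \<nu> (G i) < \<infinity>) \<and> disjoint_family_on G {..<n} \<longrightarrow>
      prob_space.indep_vars P (\<lambda>_. borel) (\<lambda>i \<omega>. emeasure (N \<omega>) (G i)) {..<n})"

text \<open>
  The Levy measure is the measure on \<open>U\<close> for which the jumps form a Poisson random measure with
  intensity Lebesgue measure times \<open>\<mu>\<close>; in particular \<open>\<mu> B\<close> is the expected number of jumps in \<open>B\<close>
  per unit of time.
\<close>

definition levy_measure ::
    "'w measure \<Rightarrow> (real \<Rightarrow> 'w \<Rightarrow> 'u::{banach, second_countable_topology}) \<Rightarrow> 'u measure \<Rightarrow> bool"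
  where "levy_measure P M \<mu> \<longleftrightarrow>
    sets \<mu> = sets borel \<and> emeasure \<mu> {0} = 0 \<and>
    (\<forall>e>0. emeasure \<mu> {u. e \<le> norm u} < \<infinity>) \<and>
    poisson_random_measure P (restrict_space lborel {0..} \<Otimes>\<^sub>M \<mu>) (jump_measure M)"

text \<open>
  Absence of a Gaussian part: the Levy-Khintchine formula with jump term only.  The compensator
  \<open>\<i> u\<close> (no truncation) goes with weak mean zero and weak second moments.
\<close>

definition purely_discontinuous ::
    "'w measure \<Rightarrow> (real \<Rightarrow> 'w \<Rightarrow> 'u::{banach, second_countable_topology}) \<Rightarrow> 'u measure \<Rightarrow> bool"
  where "purely_discontinuous P M \<mu> \<longleftrightarrow>
    (\<forall>t\<ge>0. \<forall>u x. char (distr P borel (\<lambda>\<omega>. blinfun_apply u (M t \<omega>))) x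
      = exp (of_real t * (CLINT y|\<mu>. iexp (x * blinfun_apply u y) - 1
                                        - \<i> * of_real (x * blinfun_apply u y))))"


section \<open>The reproducing kernel Hilbert space and the Wiener integral\<close>

definition hilbert_adjoint ::
    "('k::{real_inner, banach} \<Rightarrow>\<^sub>L 'u::real_normed_vector) \<Rightarrow> ('u \<Rightarrow>\<^sub>L real) \<Rightarrow> 'k"
  where "hilbert_adjoint i u = (THE k. \<forall>h. k \<bullet> h = blinfun_apply u (blinfun_apply i h))"

text \<open>These conditions determine the pair of \<open>K\<close> and \<open>i\<close> up to isometry.\<close>

definition rkhs_embedding ::
    "(('u::banach \<Rightarrow>\<^sub>L real) \<Rightarrow>\<^sub>L 'u) \<Rightarrow> ('k::{real_inner, banach} \<Rightarrow>\<^sub>L 'u) \<Rightarrow> bool"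
  where "rkhs_embedding C i \<longleftrightarrow> inj (blinfun_apply i) \<and>
    (\<forall>u. blinfun_apply C u = blinfun_apply i (hilbert_adjoint i u))"

text \<open>A list of triples \<open>(r, t, g)\<close> stands for the step function that is the sum of the \<open>g\<close> on
  the intervals \<open>{r<..t}\<close>.\<close>

definition step_fun :: "(real \<times> real \<times> 'd::real_vector) list \<Rightarrow> real \<Rightarrow> 'd"
  where "step_fun S s = (\<Sum>(r, t, g)\<leftarrow>S. indicator {r<..t} s *\<^sub>R g)"

definition step_integral ::
    "(real \<Rightarrow> 'w \<Rightarrow> 'u::real_normed_vector) \<Rightarrow> (real \<times> real \<times> ('u \<Rightarrow>\<^sub>L real)) list \<Rightarrow> 'w \<Rightarrow> real"
  where "step_integral W S \<omega> = (\<Sum>(r, t, g)\<leftarrow>S. blinfun_apply g (W t \<omega> - W r \<omega>))"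

text \<open>The \<open>L\<^sup>2\<close>-extension of the integral from step functions, with respect to the norm of
  \<open>i\<^sup>*g\<close> in \<open>L\<^sup>2([0,T];K)\<close>.\<close>

definition has_wiener_integral ::
    "'w measure \<Rightarrow> real \<Rightarrow> ('k::{real_inner, banach, second_countable_topology} \<Rightarrow>\<^sub>L 'u::real_normed_vector) \<Rightarrow>
     (real \<Rightarrow> 'w \<Rightarrow> 'u) \<Rightarrow> (real \<Rightarrow> 'u \<Rightarrow>\<^sub>L real) \<Rightarrow> ('w \<Rightarrow> real) \<Rightarrow> bool"
  where "has_wiener_integral P T i W g Y \<longleftrightarrow>
    (\<exists>S. (\<forall>n. \<forall>(r, t, _)\<in>set (S n). 0 \<le> r \<and> r \<le> t \<and> t \<le> T) \<and>
      L2_tendsto (lborel_upto T) (\<lambda>n s. hilbert_adjoint i (step_fun (S n) s)) (\<lambda>s. hilbert_adjoint i (g s)) \<and>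
      L2_tendsto P (\<lambda>n. step_integral W (S n)) Y)"

definition wiener_integral ::
    "'w measure \<Rightarrow> real \<Rightarrow> ('k::{real_inner, banach, second_countable_topology} \<Rightarrow>\<^sub>L 'u::real_normed_vector) \<Rightarrow>
     (real \<Rightarrow> 'w \<Rightarrow> 'u) \<Rightarrow> (real \<Rightarrow> 'u \<Rightarrow>\<^sub>L real) \<Rightarrow> 'w \<Rightarrow> real"
  where "wiener_integral P T i W g = (SOME Y. has_wiener_integral P T i W g Y)"


section \<open>The integral with respect to the compensated Poisson random measure\<close>

abbreviation jump_intensity :: "real \<Rightarrow> 'u measure \<Rightarrow> (real \<times> 'u) measure"
  where "jump_intensity T \<mu> \<equiv> lborel_upto T \<Otimes>\<^sub>M \<mu>"

definition simple_fun :: "(real \<times> 'a set) list \<Rightarrow> 'a \<Rightarrow> real"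
  where "simple_fun S z = (\<Sum>(a, G)\<leftarrow>S. a * indicator G z)"

definition compensated_simple_integral ::
    "('w \<Rightarrow> 'a measure) \<Rightarrow> 'a measure \<Rightarrow> (real \<times> 'a set) list \<Rightarrow> 'w \<Rightarrow> real"
  where "compensated_simple_integral N \<rho> S \<omega> = (\<Sum>(a, G)\<leftarrow>S. a * (measure (N \<omega>) G - measure \<rho> G))"

definition has_compensated_integral ::
    "'w measure \<Rightarrow> ('w \<Rightarrow> 'a measure) \<Rightarrow> 'a measure \<Rightarrow> ('a \<Rightarrow> real) \<Rightarrow> ('w \<Rightarrow> real) \<Rightarrow> bool"
  where "has_compensated_integral P N \<rho> f Y \<longleftrightarrow>
    (\<exists>S. (\<forall>n. \<forall>(_, G)\<in>set (S n). G \<in> sets \<rho> \<and> emeasure \<rho> G < \<infinity>) \<and>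
      L2_tendsto \<rho> (\<lambda>n. simple_fun (S n)) f \<and>
      L2_tendsto P (\<lambda>n. compensated_simple_integral N \<rho> (S n)) Y)"

definition Theta_M ::
    "'w measure \<Rightarrow> real \<Rightarrow> (real \<Rightarrow> 'w \<Rightarrow> 'u::real_normed_vector) \<Rightarrow> 'u measure \<Rightarrow>
     (real \<times> 'u \<Rightarrow> real) \<Rightarrow> 'w \<Rightarrow> real"
  where "Theta_M P T M \<mu> f =
    (SOME Y. has_compensated_integral P (jump_measure M) (jump_intensity T \<mu>) f Y)"

definition jump_integral ::
    "'w measure \<Rightarrow> real \<Rightarrow> (real \<Rightarrow> 'w \<Rightarrow> 'u::real_normed_vector) \<Rightarrow> 'u measure \<Rightarrow>
     (real \<Rightarrow> 'u \<Rightarrow>\<^sub>L real) \<Rightarrow> 'w \<Rightarrow> real"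
  where "jump_integral P T M \<mu> g = Theta_M P T M \<mu> (\<lambda>(s, u). blinfun_apply (g s) u)"


section \<open>Operators and integrability of the integrand\<close>

text \<open>The adjoint \<open>F\<^sup>*(s)\<close> applied to \<open>v\<close> is \<open>v o\<^sub>L F s\<close>.\<close>

definition j_W ::
    "real \<Rightarrow> ('k::{real_inner, banach, second_countable_topology} \<Rightarrow>\<^sub>L 'u::real_normed_vector) \<Rightarrow>
     (real \<Rightarrow> 'u \<Rightarrow>\<^sub>L 'v::real_normed_vector) \<Rightarrow> (real \<Rightarrow> 'k) \<Rightarrow> 'v"
  where "j_W T i F f = (THE x. \<forall>v :: 'v \<Rightarrow>\<^sub>L real.
    blinfun_apply v x = L2_inner (lborel_upto T) (\<lambda>s. hilbert_adjoint i (v o\<^sub>L F s)) f)"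

definition j_M ::
    "real \<Rightarrow> 'u measure \<Rightarrow> (real \<Rightarrow> 'u::real_normed_vector \<Rightarrow>\<^sub>L 'v::real_normed_vector) \<Rightarrow>
     (real \<times> 'u \<Rightarrow> real) \<Rightarrow> 'v"
  where "j_M T \<mu> F f = (THE x. \<forall>v :: 'v \<Rightarrow>\<^sub>L real.
    blinfun_apply v x = L2_inner (jump_intensity T \<mu>) (\<lambda>(s, u). blinfun_apply v (blinfun_apply (F s) u)) f)"

definition pettis_integrable :: "'a measure \<Rightarrow> ('a \<Rightarrow> 'v::real_normed_vector) \<Rightarrow> bool"
  where "pettis_integrable m f \<longleftrightarrow>
    (\<forall>v :: 'v \<Rightarrow>\<^sub>L real. integrable m (\<lambda>s. blinfun_apply v (f s))) \<and>
    (\<forall>A\<in>sets m. \<exists>x. \<forall>v :: 'v \<Rightarrow>\<^sub>L real. blinfun_apply v x = (LINT s:A|m. blinfun_apply v (f s)))"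

definition cyl_integral ::
    "'w measure \<Rightarrow> real \<Rightarrow> 'u::real_normed_vector \<Rightarrow>
     ('k::{real_inner, banach, second_countable_topology} \<Rightarrow>\<^sub>L 'u) \<Rightarrow>
     (real \<Rightarrow> 'w \<Rightarrow> 'u) \<Rightarrow> (real \<Rightarrow> 'w \<Rightarrow> 'u) \<Rightarrow> 'u measure \<Rightarrow>
     (real \<Rightarrow> 'u \<Rightarrow>\<^sub>L 'v::real_normed_vector) \<Rightarrow> real set \<Rightarrow> ('v \<Rightarrow>\<^sub>L real) \<Rightarrow> 'w \<Rightarrow> real"
  where "cyl_integral P T b i W M \<mu> F A v \<omega> =
    (LINT s|lborel_upto T. indicator A s * blinfun_apply (v o\<^sub>L F s) b) +
    wiener_integral P T i W (\<lambda>s. indicator A s *\<^sub>R (v o\<^sub>L F s)) \<omega> +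
    jump_integral P T M \<mu> (\<lambda>s. indicator A s *\<^sub>R (v o\<^sub>L F s)) \<omega>"

definition stochastically_integrable ::
    "'w measure \<Rightarrow> real \<Rightarrow> 'u::real_normed_vector \<Rightarrow>
     ('k::{real_inner, banach, second_countable_topology} \<Rightarrow>\<^sub>L 'u) \<Rightarrow>
     (real \<Rightarrow> 'w \<Rightarrow> 'u) \<Rightarrow> (real \<Rightarrow> 'w \<Rightarrow> 'u) \<Rightarrow> 'u measure \<Rightarrow>
     (real \<Rightarrow> 'u \<Rightarrow>\<^sub>L 'v::{banach, second_countable_topology}) \<Rightarrow> bool"
  where "stochastically_integrable P T b i W M \<mu> F \<longleftrightarrow>
    (\<forall>A\<in>sets (lborel_upto T). \<exists>Y\<in>borel_measurable P.
      \<forall>v. AE \<omega> in P. blinfun_apply v (Y \<omega>) = cyl_integral P T b i W M \<mu> F A v \<omega>)"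

end

theory Submission
  imports Defs "HOL-Analysis.Urysohn"
begin

text \<open>
  Call a map from functionals on \<open>V\<close> to real random variables induced if it arises by
  pairing the functionals with one \<open>V\<close>-valued random variable. Stochastic
  integrability says that the cylindrical variable \<open>I\<^sub>A = drift + Wiener part + jump
  part\<close> is induced for every Borel set \<open>A\<close>. Each of the three conditions on
  the other side says that one of these summands is induced. For the drift, a constant, this is
  Pettis integrability (\<open>induced_deterministic\<close>). For the two random parts over
  \<open>A = [0,T]\<close> it is radonification (\<open>radonifying_iff_induced\<close>): the
  image cylindrical measure is the cylindrical distribution of the integral of
  \<open>F\<^sup>*v\<close>, and a cylindrical variable whose distribution extends to a Borel
  measure \<open>\<nu>\<close> is induced. Indeed, choose countably many functionals
  \<open>w\<^sub>n\<close> that determine the norm; evaluation \<open>x \<mapsto> (w\<^sub>n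
  x)\<close> has a measurable left inverse \<open>R\<close> on real sequences, the sequence of the
  \<open>X w\<^sub>n\<close> has the same law as evaluation under \<open>\<nu>\<close>, so it lies
  almost surely in the range of evaluation, and \<open>R\<close> applied to it is the variable
  sought.

  What remains is to pass between sums and summands. The tool is
  \<open>induced_cancel_independent_summand\<close>: if \<open>X + Y\<close> is induced,
  \<open>X\<close> and \<open>Y\<close> are independent, and \<open>Y\<close> is centred and
  bounded from \<open>V\<^sup>*\<close> to \<open>L\<^sup>2\<close>, then \<open>X\<close> is
  induced. On the product space \<open>X(\<omega>) + Y(\<omega>')\<close> has the law of \<open>X
  + Y\<close>, so it is induced by some \<open>Z'(\<omega>, \<omega>')\<close>; for fixed
  \<open>\<omega>\<close> the weak second moments of \<open>Z'(\<omega>, \<cdot>)\<close> are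
  bounded, so its weak integral exists in \<open>V\<close>, and integrating over
  \<open>\<omega>'\<close> removes \<open>Y\<close> and leaves \<open>X(\<omega>)\<close>.
  Independence enters only through the product formula for characteristic functions.

  If \<open>I\<^sub>A\<close> is induced, cancel first the jump part, which is independent of the
  Wiener part, and then the Wiener part; differences give all three summands. Conversely, if the
  Wiener part over \<open>[0,T]\<close> is induced, then so is the Wiener part over
  \<open>A\<close>, because the part over the complement of \<open>A\<close> is an independent
  centred summand that can be cancelled; the same holds for the jump part. The product formulas
  come from the Gaussian characteristic function (\<open>cf_wiener\<close>), from the independence
  of a Poisson random measure on disjoint sets (\<open>cf_disjoint_supports\<close>), and, for
  Wiener against jump part, from the fact that the jump measure of a cadlag process is determined
  by the process (\<open>cf_wiener_plus_poisson\<close>).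
\<close>

section \<open>The Hahn-Banach theorem and norming sequences of functionals\<close>

definition sublinear :: "('a::real_vector \<Rightarrow> real) \<Rightarrow> bool"
  where "sublinear p \<longleftrightarrow> (\<forall>x y. p (x + y) \<le> p x + p y) \<and> (\<forall>c\<ge>0. \<forall>x. p (c *\<^sub>R x) = c * p x)"

lemma sublinear_lower_bound:
  assumes "sublinear q"
  shows "- q (- x) \<le> q x"
proof -
  have "q (x + - x) \<le> q x + q (- x)" "q (0 *\<^sub>R 0) = 0 * q 0"
    using assms unfolding sublinear_def by (blast, metis order_refl)
  then show ?thesis by simp
qed

lemma sublinear_INF:
  fixes Q :: "('a::real_vector \<Rightarrow> real) set"
  assumes "Q \<noteq> {}" and bdd: "\<And>x. bdd_below ((\<lambda>q. q x) ` Q)"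
    and add: "\<And>q r x y. q \<in> Q \<Longrightarrow> r \<in> Q \<Longrightarrow> \<exists>s\<in>Q. s (x + y) \<le> q x + r y"
    and scale: "\<And>q c x. q \<in> Q \<Longrightarrow> c > 0 \<Longrightarrow> \<exists>s\<in>Q. s (c *\<^sub>R x) \<le> c * q x"
  shows "sublinear (\<lambda>x. INF q\<in>Q. q x)"
proof -
  let ?u = "\<lambda>x. INF q\<in>Q. q x"
  have lower: "?u x \<le> q x" if "q \<in> Q" for q x
    using that bdd by (intro cINF_lower)
  have le: "?u (c *\<^sub>R x) \<le> c * ?u x" if "c > 0" for c x
  proof -
    have "?u (c *\<^sub>R x) / c \<le> q x" if q: "q \<in> Q" for q
    proof -
      obtain s where "s \<in> Q" "s (c *\<^sub>R x) \<le> c * q x" using scale[OF q \<open>c > 0\<close>, of x] by blast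
      with lower[of s "c *\<^sub>R x"] \<open>c > 0\<close> show ?thesis by (simp add: field_simps)
    qed
    with \<open>Q \<noteq> {}\<close> have "?u (c *\<^sub>R x) / c \<le> ?u x" by (intro cINF_greatest) auto
    with \<open>c > 0\<close> show ?thesis by (simp add: field_simps)
  qed
  have zero: "?u 0 = 0" using le[of 2 0] le[of "1/2" 0] by simp
  have "?u (c *\<^sub>R x) = c * ?u x" if "c \<ge> 0" for c x
  proof (cases "c = 0")
    case False
    then have "c > 0" using that by simp
    then have "?u x \<le> ?u (c *\<^sub>R x) / c"
      using le[of "1/c" "c *\<^sub>R x"] by simp
    with le[of c x] \<open>c > 0\<close> show ?thesis by (simp add: field_simps)
  qed (simp add: zero)
  moreover have "?u (x + y) \<le> ?u x + ?u y" for x y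
  proof -
    have "?u (x + y) - r y \<le> ?u x" if r: "r \<in> Q" for r
    proof (rule cINF_greatest[OF \<open>Q \<noteq> {}\<close>])
      fix q assume "q \<in> Q"
      from add[OF this r] obtain s where "s \<in> Q" "s (x + y) \<le> q x + r y" by blast
      with lower[of s "x + y"] show "?u (x + y) - r y \<le> q x" by simp
    qed
    then have "?u (x + y) - ?u x \<le> ?u y"
      by (intro cINF_greatest[OF \<open>Q \<noteq> {}\<close>]) (simp add: algebra_simps)
    then show ?thesis by simp
  qed
  ultimately show ?thesis unfolding sublinear_def by blast
qed

text \<open>
  If \<open>q\<close> is a minimal sublinear functional, then \<open>q\<close> equals each of
  these smaller functionals, and the bound at \<open>t = 1\<close> makes \<open>q\<close>
  additive. This is how Zorn's lemma yields a linear functional below.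
\<close>

lemma sublinear_shift:
  fixes q :: "'a::real_vector \<Rightarrow> real"
  assumes q: "sublinear q"
  defines "r \<equiv> \<lambda>y x. INF t\<in>{0..}. q (x + t *\<^sub>R y) - t * q y"
  shows "sublinear (r y)" "t \<ge> 0 \<Longrightarrow> r y x \<le> q (x + t *\<^sub>R y) - t * q y"
proof -
  have sub: "q (x + y) \<le> q x + q y" and hom: "c \<ge> 0 \<Longrightarrow> q (c *\<^sub>R x) = c * q x" for x y c
    using q unfolding sublinear_def by blast+
  have bound: "- q (- x) \<le> q (x + t *\<^sub>R y) - t * q y" if "t \<ge> 0" for t x
    using sub[of "x + t *\<^sub>R y" "- x"] hom[OF that, of y] by simp
  define Q where "Q = (\<lambda>t x. q (x + t *\<^sub>R y) - t * q y) ` {0..}"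
  have eq: "r y = (\<lambda>x. INF p\<in>Q. p x)" by (simp add: r_def Q_def image_image)
  have bdd: "bdd_below ((\<lambda>p. p x) ` Q)" for x
    unfolding Q_def image_image using bound[of _ x] by (intro bdd_belowI2[where m="- q (- x)"]) auto
  show "sublinear (r y)" unfolding eq
  proof (rule sublinear_INF)
    show "Q \<noteq> {}" by (simp add: Q_def)
  next
    fix p1 p2 x z assume "p1 \<in> Q" "p2 \<in> Q"
    then obtain t1 t2 where t: "t1 \<ge> 0" "t2 \<ge> 0" "p1 = (\<lambda>x. q (x + t1 *\<^sub>R y) - t1 * q y)"
      "p2 = (\<lambda>x. q (x + t2 *\<^sub>R y) - t2 * q y)" by (auto simp: Q_def)
    define s where "s = (\<lambda>x. q (x + (t1 + t2) *\<^sub>R y) - (t1 + t2) * q y)"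
    have "s (x + z) \<le> p1 x + p2 z"
      unfolding s_def using sub[of "x + t1 *\<^sub>R y" "z + t2 *\<^sub>R y"] t by (simp add: algebra_simps)
    moreover have "s \<in> Q"
      unfolding Q_def s_def by (rule image_eqI[OF refl]) (use t in simp)
    ultimately show "\<exists>s\<in>Q. s (x + z) \<le> p1 x + p2 z" by blast
  next
    fix p c x assume "p \<in> Q" "(c::real) > 0"
    then obtain t where t: "t \<ge> 0" "p = (\<lambda>x. q (x + t *\<^sub>R y) - t * q y)" by (auto simp: Q_def)
    have "q (c *\<^sub>R x + (c * t) *\<^sub>R y) - (c * t) * q y = c * p x"
      using hom[of c "x + t *\<^sub>R y"] \<open>c > 0\<close> t by (simp add: algebra_simps)
    moreover have "(\<lambda>x. q (x + (c * t) *\<^sub>R y) - (c * t) * q y) \<in> Q"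
      unfolding Q_def by (rule image_eqI[OF refl]) (use t \<open>c > 0\<close> in simp)
    ultimately show "\<exists>s\<in>Q. s (c *\<^sub>R x) \<le> c * p x" by (metis order_refl)
  qed (fact bdd)
  show "t \<ge> 0 \<Longrightarrow> r y x \<le> q (x + t *\<^sub>R y) - t * q y"
    unfolding r_def using bound[of _ x]
    by (intro cINF_lower bdd_belowI2[where m="- q (- x)"]) auto
qed

text \<open>
  The analytic Hahn-Banach theorem in a form without subspaces: a minimal sublinear functional
  below \<open>p\<close> is linear.
\<close>

lemma linear_below_sublinear:
  fixes p :: "'a::real_vector \<Rightarrow> real"
  assumes p: "sublinear p"
  obtains f where "linear f" "\<And>x. f x \<le> p x"
proof -
  (* Minimality is sought downwards, so the order given to Zorn's lemma is reversed. *)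
  define A where "A = {q. sublinear q \<and> q \<le> p}"
  define R where "R = relation_of (\<lambda>q r :: 'a \<Rightarrow> real. r \<le> q) A"
  have po: "partial_order_on A R" unfolding R_def
    by (rule partial_order_on_relation_ofI) auto
  have ch: "\<exists>u\<in>A. \<forall>q\<in>Q. u \<le> q" if Q: "Q \<in> Chains R" for Q
  proof (cases "Q = {}")
    case True then show ?thesis using p by (auto simp: A_def)
  next
    case False
    have QA: "q \<in> A" if "q \<in> Q" for q
      using Q that by (auto simp: Chains_def R_def relation_of_def)
    have chain: "q \<le> r \<or> r \<le> q" if "q \<in> Q" "r \<in> Q" for q r
      using Q that by (auto simp: Chains_def R_def relation_of_def)
    have lb: "- p (- x) \<le> q x" if "q \<in> Q" for q x
    proof -
      have "q (- x) \<le> p (- x)" "sublinear q" using QA[OF that] by (auto simp: A_def le_fun_def)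
      with sublinear_lower_bound[of q x] show ?thesis by simp
    qed
    have bdd: "bdd_below ((\<lambda>q. q x) ` Q)" for x
      using lb by (intro bdd_belowI2[where m="- p (- x)"]) auto
    have "sublinear (\<lambda>x. INF q\<in>Q. q x)"
    proof (rule sublinear_INF[OF False bdd])
      fix q r x y assume qr: "q \<in> Q" "r \<in> Q"
      obtain s where s: "s \<in> Q" "s \<le> q" "s \<le> r" using chain[OF qr] qr by blast
      have "s (x + y) \<le> s x + s y" using QA[OF s(1)] by (simp add: A_def sublinear_def)
      also have "\<dots> \<le> q x + r y" using s by (intro add_mono) (auto simp: le_fun_def)
      finally show "\<exists>s\<in>Q. s (x + y) \<le> q x + r y" using s by blast
    next
      fix q and c :: real and x assume "q \<in> Q" "c > 0"
      then have "q (c *\<^sub>R x) = c * q x" using QA[of q] unfolding A_def sublinear_def by auto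
      then show "\<exists>s\<in>Q. s (c *\<^sub>R x) \<le> c * q x" using \<open>q \<in> Q\<close> by (metis order_refl)
    qed
    moreover have low: "(INF q\<in>Q. q x) \<le> q x" if "q \<in> Q" for q x
      using that bdd by (intro cINF_lower)
    moreover have "(INF q\<in>Q. q x) \<le> p x" for x
    proof -
      obtain q where "q \<in> Q" using False by blast
      with low[of q x] QA[of q] show ?thesis by (auto simp: A_def le_fun_def intro: order_trans)
    qed
    ultimately show ?thesis
      by (intro bexI[of _ "\<lambda>x. INF q\<in>Q. q x"]) (auto simp: A_def le_fun_def)
  qed
  obtain q where qA: "q \<in> A" and min: "\<And>r. r \<in> A \<Longrightarrow> r \<le> q \<Longrightarrow> r = q"
    using predicate_Zorn[OF po[unfolded R_def]] ch unfolding R_def by metis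
  have q: "sublinear q" "q \<le> p" using qA by (auto simp: A_def)
  have sub: "q (x + y) \<le> q x + q y" and hom: "c \<ge> 0 \<Longrightarrow> q (c *\<^sub>R x) = c * q x" for x y c
    using q unfolding sublinear_def by blast+
  (* By minimality q agrees with its shift; evaluate the bound for the shift at t = 1. *)
  have add: "q (x + y) = q x + q y" for x y
  proof -
    let ?r = "\<lambda>x. INF t\<in>{0..}. q (x + t *\<^sub>R y) - t * q y"
    have "?r x \<le> q x" for x using sublinear_shift(2)[OF q(1), of 0 x y] by simp
    then have "?r \<le> q" by (rule le_funI)
    moreover from this have "?r \<in> A"
      unfolding A_def using sublinear_shift(1)[OF q(1)] order_trans[OF _ q(2)] by blast
    ultimately have "?r = q" by (rule min[rotated])
    then have "q x = ?r x" by (rule fun_cong[OF sym])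
    also have "\<dots> \<le> q (x + y) - q y" using sublinear_shift(2)[OF q(1), of 1 x y] by simp
    finally show ?thesis using sub[of x y] by simp
  qed
  have "q 0 = 0" using hom[of 0 0] by simp
  then have neg: "q (- x) = - q x" for x using add[of x "- x"] by simp
  have "q (c *\<^sub>R x) = c * q x" for c x
    using hom[of c x] hom[of "- c" x] neg[of "c *\<^sub>R x"] by (cases "c \<ge> 0") auto
  then have "linear q" by (intro linearI) (auto simp: add)
  with q(2) show ?thesis by (intro that) (auto simp: le_fun_def)
qed

text \<open>
  The sublinear functional below which a linear one is sought is the shift of the norm in the
  direction of \<open>x0\<close>; its value at \<open>- x0\<close> is at most \<open>- norm
  x0\<close>.
\<close>

theorem Hahn_Banach_norming_functional:
  fixes x0 :: "'a::real_normed_vector"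
  obtains f :: "'a \<Rightarrow>\<^sub>L real" where "norm f \<le> 1" "blinfun_apply f x0 = norm x0"
proof -
  have p: "sublinear (norm :: 'a \<Rightarrow> real)" by (auto simp: sublinear_def norm_triangle_ineq)
  let ?q = "\<lambda>x. INF t\<in>{0..}. norm (x + t *\<^sub>R x0) - t * norm x0"
  obtain f where f: "linear f" "\<And>x. f x \<le> ?q x"
    using linear_below_sublinear[OF sublinear_shift(1)[OF p, of x0]] by blast
  have fn: "f x \<le> norm x" for x
    using f(2)[of x] sublinear_shift(2)[OF p, of 0 x x0] by simp
  have abs: "norm (f x) \<le> norm x * 1" for x
    using fn[of x] fn[of "- x"] linear_neg[OF f(1), of x] by (simp add: abs_le_iff)
  have bl: "bounded_linear f"
    using f(1) abs by (intro bounded_linear_intro[where K=1]) (auto simp: linear_add linear_scale)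
  have "f (- x0) \<le> - norm x0"
    using f(2)[of "- x0"] sublinear_shift(2)[OF p, of 1 "- x0" x0] by simp
  then have "f x0 = norm x0" using fn[of x0] linear_neg[OF f(1), of x0] by simp
  moreover have "norm (Blinfun f) \<le> 1"
    using abs by (intro norm_blinfun_bound) (simp_all add: bounded_linear_Blinfun_apply[OF bl])
  ultimately show ?thesis
    by (intro that[of "Blinfun f"]) (simp_all add: bounded_linear_Blinfun_apply[OF bl])
qed

lemma functionals_separate_points:
  fixes x y :: "'a::real_normed_vector"
  assumes "\<And>v :: 'a \<Rightarrow>\<^sub>L real. blinfun_apply v x = blinfun_apply v y"
  shows "x = y"
proof -
  obtain f :: "'a \<Rightarrow>\<^sub>L real" where "blinfun_apply f (x - y) = norm (x - y)"
    using Hahn_Banach_norming_functional by blast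
  then show ?thesis using assms[of f] by (simp add: blinfun.diff_right)
qed

definition norming :: "(nat \<Rightarrow> 'v::real_normed_vector \<Rightarrow>\<^sub>L real) \<Rightarrow> bool"
  where "norming w \<longleftrightarrow> (\<forall>n. norm (w n) \<le> 1) \<and>
    (\<forall>x a. (\<forall>n. blinfun_apply (w n) x \<le> a) \<longrightarrow> norm x \<le> a)"

lemma dense_sequence:
  obtains d :: "nat \<Rightarrow> 'v::{metric_space, second_countable_topology}"
  where "\<And>x e. e > 0 \<Longrightarrow> \<exists>k. dist x (d k) < e"
proof -
  obtain D :: "'v set" where D: "countable D" "\<And>X. open X \<Longrightarrow> X \<noteq> {} \<Longrightarrow> \<exists>d\<in>D. d \<in> X"
    by (erule countable_dense_setE)
  have "D \<noteq> {}" using D(2)[of UNIV] by auto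
  show thesis
  proof (rule that)
    fix x :: 'v and e :: real assume "e > 0"
    then have "ball x e \<noteq> {}" by simp
    then obtain y where "y \<in> D" "dist x y < e" using D(2)[of "ball x e"] by auto
    then show "\<exists>k. dist x (from_nat_into D k) < e"
      using from_nat_into_surj[OF D(1)] by metis
  qed
qed

lemma norming_sequence_exists:
  obtains w :: "nat \<Rightarrow> 'v::{real_normed_vector, second_countable_topology} \<Rightarrow>\<^sub>L real"
  where "norming w"
proof -
  obtain d :: "nat \<Rightarrow> 'v" where d: "\<And>x e. e > 0 \<Longrightarrow> \<exists>k. dist x (d k) < e"
    using dense_sequence by blast
  have "\<exists>f :: 'v \<Rightarrow>\<^sub>L real. norm f \<le> 1 \<and> blinfun_apply f (d n) = norm (d n)" for n
    using Hahn_Banach_norming_functional by metis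
  then obtain w :: "nat \<Rightarrow> 'v \<Rightarrow>\<^sub>L real"
    where w: "\<And>n. norm (w n) \<le> 1" "\<And>n. blinfun_apply (w n) (d n) = norm (d n)" by metis
  (* A point d k close to x is normed by w k, and w k takes almost the same value at x. *)
  have "norm x \<le> a" if a: "\<And>n. blinfun_apply (w n) x \<le> a" for x a
  proof (rule field_le_epsilon)
    fix e :: real assume "e > 0"
    then obtain k where k: "dist x (d k) < e / 2" using d[of "e/2" x] by auto
    have "blinfun_apply (w k) (d k - x) \<le> norm (w k) * norm (d k - x)"
      using norm_blinfun[of "w k" "d k - x"] by simp
    also have "\<dots> \<le> 1 * norm (d k - x)" by (intro mult_right_mono w) auto
    finally have "norm (d k) \<le> blinfun_apply (w k) x + norm (d k - x)"
      using w(2)[of k] by (simp add: blinfun.diff_right)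
    moreover have "norm x \<le> norm (d k) + norm (d k - x)"
      by (metis norm_minus_commute norm_triangle_sub)
    ultimately show "norm x \<le> a + e" using k a[of k] by (simp add: dist_norm norm_minus_commute)
  qed
  then show thesis by (intro that[of w]) (auto simp: norming_def w)
qed

lemma norming_separates:
  assumes "norming w" "\<And>n. blinfun_apply (w n) x = blinfun_apply (w n) y"
  shows "x = y"
proof -
  have "norm (x - y) \<le> 0"
  proof -
    have "\<forall>n. blinfun_apply (w n) (x - y) \<le> 0" by (simp add: blinfun.diff_right assms(2))
    with assms(1) show ?thesis unfolding norming_def by blast
  qed
  then show ?thesis by simp
qed

text \<open>
  Any given functional, after scaling, may be a member of a norming sequence. This is what lets a
  random variable found from one norming sequence be tested against all functionals.
\<close>

lemma norming_adjoin:
  assumes "norming w"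
  shows "norming (case_nat (v /\<^sub>R (1 + norm v)) w)"
proof -
  have "norm (v /\<^sub>R (1 + norm v)) \<le> 1"
  proof -
    have "norm v / (1 + norm v) \<le> 1"
      by (auto simp: divide_le_eq not_less add_nonneg_nonneg)
    then show ?thesis by (simp add: divide_inverse mult.commute add_nonneg_nonneg)
  qed
  then have "norm (case_nat (v /\<^sub>R (1 + norm v)) w n) \<le> 1" for n
    using assms by (cases n) (auto simp: norming_def)
  moreover have "norm x \<le> a"
    if "\<forall>n. blinfun_apply (case_nat (v /\<^sub>R (1 + norm v)) w n) x \<le> a" for x a
  proof -
    have "\<forall>n. blinfun_apply (w n) x \<le> a" using that[rule_format, of "Suc _"] by simp
    then show ?thesis using assms by (auto simp: norming_def)
  qed
  ultimately show ?thesis by (simp add: norming_def)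
qed

text \<open>
  Evaluation along a norming sequence is an isometry into bounded sequences. Its inverse extends
  to a measurable map on all real sequences: in step \<open>j\<close> take the first member of a
  dense sequence whose evaluations are within \<open>1 / (j + 1)\<close> of the given ones, and
  let \<open>j\<close> tend to infinity.
\<close>

lemma measurable_left_inverse_of_evaluation:
  fixes w :: "nat \<Rightarrow> 'v::{banach, second_countable_topology} \<Rightarrow>\<^sub>L real"
  assumes w: "norming w"
  obtains R where "R \<in> borel_measurable (PiM UNIV (\<lambda>_::nat. borel))"
    "\<And>x. R (\<lambda>n. blinfun_apply (w n) x) = x"
proof -
  obtain d :: "nat \<Rightarrow> 'v" where d: "\<And>x e. e > 0 \<Longrightarrow> \<exists>k. dist x (d k) < e"
    using dense_sequence by blast
  define near where "near j y k \<longleftrightarrow> (\<forall>n. \<bar>y n - blinfun_apply (w n) (d k)\<bar> \<le> 1 / Suc j)"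
    for j :: nat and y :: "nat \<Rightarrow> real" and k
  define S where "S j y = d (LEAST k. near j y k)" for j y
  have [measurable]: "Measurable.pred (PiM UNIV (\<lambda>_::nat. borel)) (\<lambda>y. near j y k)" for j k
    unfolding near_def by measurable
  have "d \<in> measurable (count_space UNIV) borel" by simp
  then have [measurable]: "S j \<in> borel_measurable (PiM UNIV (\<lambda>_::nat. borel))" for j
    unfolding S_def by (rule measurable_compose[rotated]) measurable
  have close: "dist (S j (\<lambda>n. blinfun_apply (w n) x)) x \<le> 1 / Suc j" for j x
  proof -
    let ?y = "\<lambda>n. blinfun_apply (w n) x"
    obtain k where k: "dist x (d k) < 1 / Suc j" using d[of "1 / Suc j" x] by auto
    have "\<bar>blinfun_apply (w n) x - blinfun_apply (w n) (d k)\<bar> \<le> 1 / Suc j" for n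
    proof -
      have "\<bar>blinfun_apply (w n) (x - d k)\<bar> \<le> norm (w n) * norm (x - d k)"
        using norm_blinfun[of "w n" "x - d k"] by simp
      also have "\<dots> \<le> 1 * norm (x - d k)"
        using w by (intro mult_right_mono) (auto simp: norming_def)
      finally show ?thesis using k by (simp add: blinfun.diff_right dist_norm)
    qed
    then have "near j ?y k" unfolding near_def by blast
    then have "near j ?y (LEAST k. near j ?y k)" by (rule LeastI)
    then have "blinfun_apply (w n) (x - S j ?y) \<le> 1 / Suc j" for n
      unfolding near_def S_def by (auto simp: blinfun.diff_right abs_le_iff)
    then have "norm (x - S j ?y) \<le> 1 / Suc j" using w unfolding norming_def by blast
    then show ?thesis by (simp add: dist_norm norm_minus_commute)
  qed
  have "(\<lambda>j. S j (\<lambda>n. blinfun_apply (w n) x)) \<longlonglongrightarrow> x" for x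
  proof (rule metric_tendsto_imp_tendsto)
    show "(\<lambda>j. 1 / real (Suc j)) \<longlonglongrightarrow> 0" by (rule LIMSEQ_Suc[OF lim_const_over_n])
    show "\<forall>\<^sub>F j in sequentially. dist (S j (\<lambda>n. blinfun_apply (w n) x)) x \<le> dist (1 / real (Suc j)) 0"
      using close by (intro always_eventually) (auto simp del: of_nat_Suc)
  qed
  then show thesis
    by (intro that[of "\<lambda>y. lim (\<lambda>j. S j y)"] borel_measurable_lim_metric) (auto intro: limI)
qed

lemma weakly_measurable_imp_measurable:
  fixes f :: "'a \<Rightarrow> 'v::{banach, second_countable_topology}"
  assumes "\<And>v :: 'v \<Rightarrow>\<^sub>L real. (\<lambda>x. blinfun_apply v (f x)) \<in> borel_measurable m"
  shows "f \<in> borel_measurable m"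
proof -
  obtain w :: "nat \<Rightarrow> 'v \<Rightarrow>\<^sub>L real" where w: "norming w" using norming_sequence_exists by blast
  obtain R where R: "R \<in> borel_measurable (PiM UNIV (\<lambda>_::nat. borel))"
    "\<And>x. R (\<lambda>n. blinfun_apply (w n) x) = x"
    using measurable_left_inverse_of_evaluation[OF w] by blast
  have "(\<lambda>x n. blinfun_apply (w n) (f x)) \<in> measurable m (PiM UNIV (\<lambda>_::nat. borel))"
    using assms by (intro measurable_PiM_single') auto
  from measurable_compose[OF this R(1)] show ?thesis by (simp add: R(2))
qed

section \<open>Square integrable functions\<close>

definition sqnorm :: "'a measure \<Rightarrow> ('a \<Rightarrow> 'b::real_normed_vector) \<Rightarrow> ennreal"
  where "sqnorm m f = (\<integral>\<^sup>+ x. ennreal ((norm (f x))\<^sup>2) \<partial>m)"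

definition norm2 :: "'a measure \<Rightarrow> ('a \<Rightarrow> 'b::real_normed_vector) \<Rightarrow> real"
  where "norm2 m f = sqrt (enn2real (sqnorm m f))"

lemma norm2_nonneg [simp]: "0 \<le> norm2 m f"
  by (simp add: norm2_def)

lemma L2_fun_iff: "f \<in> L2_fun m \<longleftrightarrow> f \<in> borel_measurable m \<and> sqnorm m f < \<infinity>"
  unfolding L2_fun_def sqnorm_def by (auto simp: integrable_iff_bounded)

lemma L2_funD [measurable_dest]: "f \<in> L2_fun m \<Longrightarrow> f \<in> borel_measurable m"
  by (simp add: L2_fun_iff)

lemma sqnorm_eq_norm2: "f \<in> L2_fun m \<Longrightarrow> sqnorm m f = ennreal ((norm2 m f)\<^sup>2)"
  by (simp add: L2_fun_iff norm2_def)

lemma sqnorm_eq_integral: "f \<in> L2_fun m \<Longrightarrow> sqnorm m f = ennreal (LINT x|m. (norm (f x))\<^sup>2)"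
  unfolding sqnorm_def L2_fun_def by (intro nn_integral_eq_integral) auto

lemma norm2_power2: "f \<in> L2_fun m \<Longrightarrow> (norm2 m f)\<^sup>2 = (LINT x|m. (norm (f x))\<^sup>2)"
  using sqnorm_eq_norm2[of f m] sqnorm_eq_integral[of f m] by (simp add: integral_nonneg)

lemma sqnorm_cong: "(\<And>x. x \<in> space m \<Longrightarrow> f x = g x) \<Longrightarrow> sqnorm m f = sqnorm m g"
  unfolding sqnorm_def by (intro nn_integral_cong) auto

lemma norm2_cong: "(\<And>x. x \<in> space m \<Longrightarrow> f x = g x) \<Longrightarrow> norm2 m f = norm2 m g"
  unfolding norm2_def by (simp cong: sqnorm_cong)

lemma L2_fun_cong: "(\<And>x. x \<in> space m \<Longrightarrow> f x = g x) \<Longrightarrow> f \<in> L2_fun m \<longleftrightarrow> g \<in> L2_fun m"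
  unfolding L2_fun_iff by (simp cong: sqnorm_cong measurable_cong)

lemma sqnorm_mono: "(\<And>x. x \<in> space m \<Longrightarrow> norm (f x) \<le> norm (g x)) \<Longrightarrow> sqnorm m f \<le> sqnorm m g"
  unfolding sqnorm_def by (intro nn_integral_mono) (auto intro!: ennreal_leI power_mono)

lemma L2_fun_bound:
  assumes "g \<in> L2_fun m" "f \<in> borel_measurable m"
    "\<And>x. x \<in> space m \<Longrightarrow> norm (f x) \<le> norm (g x)"
  shows "f \<in> L2_fun m"
  using assms sqnorm_mono[of m f g] unfolding L2_fun_iff by (auto intro: le_less_trans)

lemma norm2_mono:
  assumes "g \<in> L2_fun m" "\<And>x. x \<in> space m \<Longrightarrow> norm (f x) \<le> norm (g x)"
  shows "norm2 m f \<le> norm2 m g"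
  using assms sqnorm_mono[of m f g] unfolding norm2_def L2_fun_iff
  by (auto intro!: enn2real_mono real_sqrt_le_mono)

lemma sqnorm_scaleR: 
  assumes "f \<in> borel_measurable m"
  shows "sqnorm m (\<lambda>x. c *\<^sub>R f x) = ennreal (c\<^sup>2) * sqnorm m f"
  unfolding sqnorm_def using assms
  by (subst nn_integral_cmult[symmetric])
     (auto simp: power_mult_distrib ennreal_mult[symmetric] intro!: nn_integral_cong)

lemma L2_fun_scaleR [intro]:
  fixes f :: "'a \<Rightarrow> 'b::{real_normed_vector, second_countable_topology}"
  shows "f \<in> L2_fun m \<Longrightarrow> (\<lambda>x. c *\<^sub>R f x) \<in> L2_fun m"
  by (auto simp: L2_fun_iff sqnorm_scaleR ennreal_mult_less_top)

lemma norm2_scaleR: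
  fixes f :: "'a \<Rightarrow> 'b::{real_normed_vector, second_countable_topology}"
  shows "f \<in> L2_fun m \<Longrightarrow> norm2 m (\<lambda>x. c *\<^sub>R f x) = \<bar>c\<bar> * norm2 m f"
  by (simp add: norm2_def sqnorm_scaleR L2_funD enn2real_mult real_sqrt_mult)

lemma norm_add_power2_le: "(norm (a + b))\<^sup>2 \<le> 2 * (norm a)\<^sup>2 + 2 * (norm b)\<^sup>2"
  for a b :: "'b::real_normed_vector"
proof -
  have "(norm (a + b))\<^sup>2 \<le> (norm a + norm b)\<^sup>2" by (intro power_mono norm_triangle_ineq) simp
  also have "\<dots> \<le> 2 * (norm a)\<^sup>2 + 2 * (norm b)\<^sup>2"
    using sum_squares_bound[of "norm a" "norm b"] by (simp add: power2_sum)
  finally show ?thesis .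
qed

lemma sqnorm_add_le:
  assumes "f \<in> borel_measurable m" "g \<in> borel_measurable m"
  shows "sqnorm m (\<lambda>x. f x + g x) \<le> 2 * sqnorm m f + 2 * sqnorm m g"
proof -
  have "sqnorm m (\<lambda>x. f x + g x) \<le>
    (\<integral>\<^sup>+ x. 2 * ennreal ((norm (f x))\<^sup>2) + 2 * ennreal ((norm (g x))\<^sup>2) \<partial>m)"
    unfolding sqnorm_def
  proof (rule nn_integral_mono)
    fix x
    have "ennreal ((norm (f x + g x))\<^sup>2) \<le> ennreal (2 * (norm (f x))\<^sup>2 + 2 * (norm (g x))\<^sup>2)"
      by (intro ennreal_leI norm_add_power2_le)
    then show "ennreal ((norm (f x + g x))\<^sup>2) \<le> 2 * ennreal ((norm (f x))\<^sup>2) + 2 * ennreal ((norm (g x))\<^sup>2)"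
      by (simp add: ennreal_plus ennreal_mult)
  qed
  also have "\<dots> = 2 * sqnorm m f + 2 * sqnorm m g"
    unfolding sqnorm_def using assms by (subst nn_integral_add) (auto simp: nn_integral_cmult)
  finally show ?thesis .
qed

lemma L2_fun_add [intro]:
  fixes f g :: "'a \<Rightarrow> 'b::{real_normed_vector, second_countable_topology}"
  assumes "f \<in> L2_fun m" "g \<in> L2_fun m"
  shows "(\<lambda>x. f x + g x) \<in> L2_fun m"
  using assms sqnorm_add_le[of f m g] unfolding L2_fun_iff
  by (auto intro: le_less_trans simp: ennreal_mult_less_top)

lemma L2_fun_diff [intro]:
  fixes f g :: "'a \<Rightarrow> 'b::{real_normed_vector, second_countable_topology}"
  assumes "f \<in> L2_fun m" "g \<in> L2_fun m"
  shows "(\<lambda>x. f x - g x) \<in> L2_fun m"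
  using L2_fun_add[OF assms(1) L2_fun_scaleR[OF assms(2), of "-1"]] by simp

lemma L2_fun_zero [simp]: "(\<lambda>x. 0) \<in> L2_fun m"
  by (simp add: L2_fun_iff sqnorm_def)

lemma norm2_zero [simp]: "norm2 m (\<lambda>x. 0) = 0"
  by (simp add: norm2_def sqnorm_def)

lemma L2_fun_sum [intro]:
  fixes f :: "'i \<Rightarrow> 'a \<Rightarrow> 'b::{real_normed_vector, second_countable_topology}"
  assumes "\<And>i. i \<in> A \<Longrightarrow> f i \<in> L2_fun m"
  shows "(\<lambda>x. \<Sum>i\<in>A. f i x) \<in> L2_fun m"
  using assms by (induction A rule: infinite_finite_induct) auto

lemma L2_fun_indicator:
  fixes f :: "'a \<Rightarrow> 'b::{real_normed_vector, second_countable_topology}"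
  assumes "f \<in> L2_fun m" "{x \<in> space m. x \<in> A} \<in> sets m"
  shows "(\<lambda>x. indicator A x *\<^sub>R f x) \<in> L2_fun m"
proof (rule L2_fun_bound[OF assms(1)])
  have "(\<lambda>x. indicat_real A x) \<in> borel_measurable m"
    using assms(2) by (subst borel_measurable_indicator_iff) (simp add: Int_def conj_commute)
  then show "(\<lambda>x. indicator A x *\<^sub>R f x) \<in> borel_measurable m" using assms(1) by measurable
qed (auto split: split_indicator)

lemma L2_Cauchy_Schwarz:
  fixes f :: "'a \<Rightarrow> 'b::{real_normed_vector, second_countable_topology}"
    and g :: "'a \<Rightarrow> 'c::{real_normed_vector, second_countable_topology}"
  assumes f: "f \<in> L2_fun m" and g: "g \<in> L2_fun m"
  shows "integrable m (\<lambda>x. norm (f x) * norm (g x))"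
    and "(LINT x|m. norm (f x) * norm (g x)) \<le> norm2 m f * norm2 m g"
proof -
  have meas: "(\<lambda>x. norm (f x) * norm (g x)) \<in> borel_measurable m"
    using f g by measurable
  let ?I = "\<integral>\<^sup>+ x. ennreal (norm (f x) * norm (g x)) \<partial>m"
  have "?I\<^sup>2 \<le> sqnorm m f * sqnorm m g"
    using Cauchy_Schwarz_nn_integral[of "\<lambda>x. ennreal (norm (f x))" m "\<lambda>x. ennreal (norm (g x))"]
      measurable_compose[OF L2_funD[OF f] borel_measurable_norm]
      measurable_compose[OF L2_funD[OF g] borel_measurable_norm]
    unfolding sqnorm_def by (simp add: ennreal_mult[symmetric] ennreal_power)
  also have "\<dots> = ennreal ((norm2 m f * norm2 m g)\<^sup>2)"
    by (simp add: sqnorm_eq_norm2 f g ennreal_mult[symmetric] power_mult_distrib)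
  finally have *: "?I\<^sup>2 \<le> ennreal ((norm2 m f * norm2 m g)\<^sup>2)" .
  have le: "?I \<le> ennreal (norm2 m f * norm2 m g)"
  proof (cases "?I" rule: ennreal_cases)
    case (real i)
    then have "i\<^sup>2 \<le> (norm2 m f * norm2 m g)\<^sup>2" using * by (simp add: ennreal_power)
    then have "i \<le> norm2 m f * norm2 m g" by (rule power2_le_imp_le) simp
    then show ?thesis unfolding real(2) by (rule ennreal_leI)
  next
    case top
    then show ?thesis using * by (simp add: top_unique)
  qed
  then show int: "integrable m (\<lambda>x. norm (f x) * norm (g x))"
    using meas by (subst integrable_iff_bounded) (auto intro: le_less_trans)
  show "(LINT x|m. norm (f x) * norm (g x)) \<le> norm2 m f * norm2 m g"
    using le nn_integral_eq_integral[OF int] by simp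
qed

lemma norm2_triangle:
  fixes f g :: "'a \<Rightarrow> 'b::{real_normed_vector, second_countable_topology}"
  assumes f: "f \<in> L2_fun m" and g: "g \<in> L2_fun m"
  shows "norm2 m (\<lambda>x. f x + g x) \<le> norm2 m f + norm2 m g"
proof (rule power2_le_imp_le)
  have if2: "integrable m (\<lambda>x. (norm (f x))\<^sup>2)" and ig2: "integrable m (\<lambda>x. (norm (g x))\<^sup>2)"
    using f g by (auto simp: L2_fun_def)
  have "(norm2 m (\<lambda>x. f x + g x))\<^sup>2 = (LINT x|m. (norm (f x + g x))\<^sup>2)"
    by (intro norm2_power2 L2_fun_add f g)
  also have "\<dots> \<le> (LINT x|m. (norm (f x))\<^sup>2 + 2 * (norm (f x) * norm (g x)) + (norm (g x))\<^sup>2)"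
  proof (rule integral_mono)
    show "integrable m (\<lambda>x. (norm (f x + g x))\<^sup>2)"
      using L2_fun_add[OF f g] by (simp add: L2_fun_def)
    show "integrable m (\<lambda>x. (norm (f x))\<^sup>2 + 2 * (norm (f x) * norm (g x)) + (norm (g x))\<^sup>2)"
      by (intro Bochner_Integration.integrable_add integrable_mult_right if2 ig2 L2_Cauchy_Schwarz f g)
    fix x
    have "(norm (f x + g x))\<^sup>2 \<le> (norm (f x) + norm (g x))\<^sup>2"
      by (intro power_mono norm_triangle_ineq) simp
    then show "(norm (f x + g x))\<^sup>2 \<le> (norm (f x))\<^sup>2 + 2 * (norm (f x) * norm (g x)) + (norm (g x))\<^sup>2"
      by (simp add: power2_sum)
  qed
  also have "\<dots> = (norm2 m f)\<^sup>2 + 2 * (LINT x|m. norm (f x) * norm (g x)) + (norm2 m g)\<^sup>2"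
    using if2 ig2 L2_Cauchy_Schwarz(1)[OF f g] by (simp add: norm2_power2 f g)
  also have "\<dots> \<le> (norm2 m f + norm2 m g)\<^sup>2"
    using L2_Cauchy_Schwarz(2)[OF f g] by (simp add: power2_sum)
  finally show "(norm2 m (\<lambda>x. f x + g x))\<^sup>2 \<le> (norm2 m f + norm2 m g)\<^sup>2" .
qed simp

lemma norm2_minus_commute: "norm2 m (\<lambda>x. f x - g x) = norm2 m (\<lambda>x. g x - f x)"
  by (simp add: norm2_def sqnorm_def norm_minus_commute)

lemma norm2_triangle_diff:
  fixes f g h :: "'a \<Rightarrow> 'b::{real_normed_vector, second_countable_topology}"
  assumes "f \<in> L2_fun m" "g \<in> L2_fun m" "h \<in> L2_fun m"
  shows "norm2 m (\<lambda>x. f x - h x) \<le> norm2 m (\<lambda>x. f x - g x) + norm2 m (\<lambda>x. g x - h x)"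
  using norm2_triangle[OF L2_fun_diff[OF assms(1,2)] L2_fun_diff[OF assms(2,3)]] by simp

lemma norm2_diff_bound:
  fixes f g :: "'a \<Rightarrow> 'b::{real_normed_vector, second_countable_topology}"
  assumes "f \<in> L2_fun m" "g \<in> L2_fun m"
  shows "\<bar>norm2 m f - norm2 m g\<bar> \<le> norm2 m (\<lambda>x. f x - g x)"
  using norm2_triangle[OF L2_fun_diff[OF assms] assms(2)]
    norm2_triangle[OF L2_fun_diff[OF assms(2,1)] assms(1)]
  by (simp add: norm2_minus_commute[of m g f])

lemma L2_tendsto_iff:
  fixes f :: "nat \<Rightarrow> 'a \<Rightarrow> 'b::{real_normed_vector, second_countable_topology}"
  assumes "\<And>n. f n \<in> L2_fun m"
  shows "L2_tendsto m f g \<longleftrightarrow> g \<in> L2_fun m \<and> (\<lambda>n. norm2 m (\<lambda>x. f n x - g x)) \<longlonglongrightarrow> 0"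
proof (cases "g \<in> L2_fun m")
  case True
  have "(\<lambda>n. sqnorm m (\<lambda>x. f n x - g x)) \<longlonglongrightarrow> 0 \<longleftrightarrow>
    (\<lambda>n. (norm2 m (\<lambda>x. f n x - g x))\<^sup>2) \<longlonglongrightarrow> 0"
    by (simp add: sqnorm_eq_norm2[OF L2_fun_diff[OF assms True]] tendsto_ennreal_iff[where x=0, simplified])
  also have "\<dots> \<longleftrightarrow> (\<lambda>n. norm2 m (\<lambda>x. f n x - g x)) \<longlonglongrightarrow> 0"
  proof
    assume "(\<lambda>n. (norm2 m (\<lambda>x. f n x - g x))\<^sup>2) \<longlonglongrightarrow> 0"
    from tendsto_real_sqrt[OF this] show "(\<lambda>n. norm2 m (\<lambda>x. f n x - g x)) \<longlonglongrightarrow> 0" by simp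
  next
    assume "(\<lambda>n. norm2 m (\<lambda>x. f n x - g x)) \<longlonglongrightarrow> 0"
    from tendsto_power[OF this, of 2] show "(\<lambda>n. (norm2 m (\<lambda>x. f n x - g x))\<^sup>2) \<longlonglongrightarrow> 0" by simp
  qed
  finally show ?thesis using True by (simp add: L2_tendsto_def sqnorm_def)
qed (simp add: L2_tendsto_def)

lemma norm2_tendsto:
  fixes f :: "nat \<Rightarrow> 'a \<Rightarrow> 'b::{real_normed_vector, second_countable_topology}"
  assumes "\<And>n. f n \<in> L2_fun m" "L2_tendsto m f g"
  shows "(\<lambda>n. norm2 m (f n)) \<longlonglongrightarrow> norm2 m g"
proof (rule LIM_zero_cancel, rule Lim_null_comparison)
  show "(\<lambda>n. norm2 m (\<lambda>x. f n x - g x)) \<longlonglongrightarrow> 0"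
    using assms by (simp add: L2_tendsto_iff)
  show "\<forall>\<^sub>F n in sequentially. norm (norm2 m (f n) - norm2 m g) \<le> norm2 m (\<lambda>x. f n x - g x)"
    using assms by (intro always_eventually allI) (simp add: L2_tendsto_iff norm2_diff_bound)
qed

lemma L2_tendsto_add_scaleR:
  fixes f g :: "nat \<Rightarrow> 'a \<Rightarrow> 'b::{real_normed_vector, second_countable_topology}"
  assumes fL: "\<And>n. f n \<in> L2_fun m" and f: "L2_tendsto m f f'"
    and gL: "\<And>n. g n \<in> L2_fun m" and g: "L2_tendsto m g g'"
  shows "L2_tendsto m (\<lambda>n x. f n x + c *\<^sub>R g n x) (\<lambda>x. f' x + c *\<^sub>R g' x)"
proof -
  have f': "f' \<in> L2_fun m" "(\<lambda>n. norm2 m (\<lambda>x. f n x - f' x)) \<longlonglongrightarrow> 0"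
    and g': "g' \<in> L2_fun m" "(\<lambda>n. norm2 m (\<lambda>x. g n x - g' x)) \<longlonglongrightarrow> 0"
    using f g fL gL by (auto simp: L2_tendsto_iff)
  have bound: "norm2 m (\<lambda>x. f n x + c *\<^sub>R g n x - (f' x + c *\<^sub>R g' x))
    \<le> norm2 m (\<lambda>x. f n x - f' x) + \<bar>c\<bar> * norm2 m (\<lambda>x. g n x - g' x)" for n
  proof -
    have "(\<lambda>x. f n x + c *\<^sub>R g n x - (f' x + c *\<^sub>R g' x)) = (\<lambda>x. (f n x - f' x) + c *\<^sub>R (g n x - g' x))"
      by (simp add: algebra_simps)
    then show ?thesis
      using norm2_triangle[OF L2_fun_diff[OF fL[of n] f'(1)] L2_fun_scaleR[OF L2_fun_diff[OF gL[of n] g'(1)], of c]]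
      by (simp only: norm2_scaleR[OF L2_fun_diff[OF gL[of n] g'(1)]])
  qed
  have "(\<lambda>n. norm2 m (\<lambda>x. f n x + c *\<^sub>R g n x - (f' x + c *\<^sub>R g' x))) \<longlonglongrightarrow> 0"
  proof (rule Lim_null_comparison)
    show "(\<lambda>n. norm2 m (\<lambda>x. f n x - f' x) + \<bar>c\<bar> * norm2 m (\<lambda>x. g n x - g' x)) \<longlonglongrightarrow> 0"
      using tendsto_add[OF f'(2) tendsto_mult_left[OF g'(2), of "\<bar>c\<bar>"]] by simp
  qed (use bound in \<open>intro always_eventually; simp\<close>)
  then show ?thesis
    using fL gL f' g' by (subst L2_tendsto_iff) (auto intro!: L2_fun_add L2_fun_scaleR)
qed

lemma L2_tendsto_cong:
  assumes "\<And>x. x \<in> space m \<Longrightarrow> g x = h x" "L2_tendsto m f g"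
  shows "L2_tendsto m f h"
proof -
  have "(\<lambda>n. \<integral>\<^sup>+ x. ennreal ((norm (f n x - h x))\<^sup>2) \<partial>m) = (\<lambda>n. \<integral>\<^sup>+ x. ennreal ((norm (f n x - g x))\<^sup>2) \<partial>m)"
    by (intro ext nn_integral_cong) (simp add: assms(1))
  then show ?thesis using assms L2_fun_cong[of m g h] by (auto simp: L2_tendsto_def)
qed

text \<open>
  A subsequence with geometrically decreasing distances converges almost surely, and Fatou's lemma
  carries the distances over to the limit.
\<close>

lemma L2_complete:
  fixes Y :: "nat \<Rightarrow> 'w \<Rightarrow> real"
  assumes P: "prob_space P" and Y: "\<And>n. Y n \<in> L2_fun P"
    and cauchy: "\<And>e. e > 0 \<Longrightarrow> \<exists>N. \<forall>m\<ge>N. \<forall>n\<ge>N. norm2 P (\<lambda>\<omega>. Y m \<omega> - Y n \<omega>) < e"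
  obtains Z where "L2_tendsto P Y Z"
proof -
  interpret prob_space P by fact
  have YM[measurable]: "Y n \<in> borel_measurable P" for n using Y by (rule L2_funD)
  have "\<forall>k. \<exists>N. \<forall>m\<ge>N. \<forall>n\<ge>N. norm2 P (\<lambda>\<omega>. Y m \<omega> - Y n \<omega>) < (1/2)^k"
    using cauchy by simp
  from choice[OF this] obtain N
    where N: "\<And>k m n. m \<ge> N k \<Longrightarrow> n \<ge> N k \<Longrightarrow> norm2 P (\<lambda>\<omega>. Y m \<omega> - Y n \<omega>) < (1/2)^k"
    by blast
  (* Partial sums make the subsequence monotone while staying above N k. *)
  define r where "r k = (\<Sum>j\<le>k. N j)" for k
  have rN: "r k \<ge> N k" for k
    unfolding r_def by (intro member_le_sum) auto
  have rmono: "r (Suc k) \<ge> r k" for k by (simp add: r_def)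
  let ?d = "\<lambda>k \<omega>. \<bar>Y (r (Suc k)) \<omega> - Y (r k) \<omega>\<bar>"
  have d1: "(\<integral>\<^sup>+ \<omega>. ennreal (?d k \<omega>) \<partial>P) \<le> ennreal ((1/2)^k)" for k
  proof -
    have one: "(\<lambda>_. 1::real) \<in> L2_fun P" "norm2 P (\<lambda>_. 1::real) = 1"
      by (auto simp: L2_fun_iff norm2_def sqnorm_def emeasure_space_1)
    note L = L2_fun_diff[OF Y[of "r (Suc k)"] Y[of "r k"]]
    have "(\<integral>\<^sup>+ \<omega>. ennreal (?d k \<omega>) \<partial>P) = ennreal (LINT \<omega>|P. ?d k \<omega>)"
      using L2_Cauchy_Schwarz(1)[OF L one(1)] by (intro nn_integral_eq_integral) auto
    also have "\<dots> \<le> ennreal ((1/2)^k)"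
      using L2_Cauchy_Schwarz(2)[OF L one(1)] N[of k "r (Suc k)" "r k"] rN[of k] rmono[of k]
      by (intro ennreal_leI) (simp add: one(2))
    finally show ?thesis .
  qed
  have "(\<integral>\<^sup>+ \<omega>. (\<Sum>k. ennreal (?d k \<omega>)) \<partial>P) = (\<Sum>k. \<integral>\<^sup>+ \<omega>. ennreal (?d k \<omega>) \<partial>P)"
    by (intro nn_integral_suminf) measurable
  also have "\<dots> \<le> (\<Sum>k. ennreal ((1/2)^k))" by (intro suminf_le d1) auto
  also have "\<dots> < \<infinity>" by (subst suminf_ennreal2) (auto intro: summable_geometric)
  finally have "AE \<omega> in P. (\<Sum>k. ennreal (?d k \<omega>)) \<noteq> \<infinity>"
    by (intro nn_integral_noteq_infinite) auto
  then have conv: "AE \<omega> in P. convergent (\<lambda>k. Y (r k) \<omega>)"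
  proof eventually_elim
    case (elim \<omega>)
    have "summable (\<lambda>k. ?d k \<omega>)"
      by (rule summable_suminf_not_top[OF abs_ge_zero elim[unfolded infinity_ennreal_def]])
    then have "summable (\<lambda>k. Y (r (Suc k)) \<omega> - Y (r k) \<omega>)"
      by (rule summable_rabs_cancel)
    then have "convergent (\<lambda>n. Y (r n) \<omega> - Y (r 0) \<omega>)"
      unfolding summable_iff_convergent by (subst (asm) sum_lessThan_telescope[where f="\<lambda>k. Y (r k) \<omega>"])
    then show ?case by (simp only: convergent_diff_const_right_iff)
  qed
  define Z where "Z \<omega> = lim (\<lambda>k. Y (r k) \<omega>)" for \<omega>
  have [measurable]: "Z \<in> borel_measurable P"
    unfolding Z_def by (intro borel_measurable_lim_metric) measurable
  (* Fatou's lemma along the subsequence, for every n beyond N k. *)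
  have bound: "sqnorm P (\<lambda>\<omega>. Y n \<omega> - Z \<omega>) \<le> ennreal (((1/2)^k)\<^sup>2)" if "n \<ge> N k" for n k
  proof -
    have "sqnorm P (\<lambda>\<omega>. Y n \<omega> - Z \<omega>)
      = (\<integral>\<^sup>+ \<omega>. liminf (\<lambda>j. ennreal ((norm (Y n \<omega> - Y (r j) \<omega>))\<^sup>2)) \<partial>P)"
      unfolding sqnorm_def
    proof (rule nn_integral_cong_AE, use conv in eventually_elim)
      case (elim \<omega>)
      then have "(\<lambda>k. Y (r k) \<omega>) \<longlonglongrightarrow> Z \<omega>" by (simp add: Z_def convergent_LIMSEQ_iff)
      then have "(\<lambda>j. ennreal ((norm (Y n \<omega> - Y (r j) \<omega>))\<^sup>2)) \<longlonglongrightarrow> ennreal ((norm (Y n \<omega> - Z \<omega>))\<^sup>2)"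
        by (intro tendsto_intros)
      then show ?case by (rule lim_imp_Liminf[OF sequentially_bot, symmetric])
    qed
    also have "\<dots> \<le> liminf (\<lambda>j. sqnorm P (\<lambda>\<omega>. Y n \<omega> - Y (r j) \<omega>))"
      unfolding sqnorm_def by (intro nn_integral_liminf) measurable
    also have "\<dots> \<le> limsup (\<lambda>j. sqnorm P (\<lambda>\<omega>. Y n \<omega> - Y (r j) \<omega>))"
      by (intro Liminf_le_Limsup) simp
    also have "\<dots> \<le> ennreal (((1/2)^k)\<^sup>2)"
    proof (rule Limsup_bounded, rule eventually_sequentiallyI[of k])
      fix j assume "j \<ge> k"
      then have "r j \<ge> r k" by (rule lift_Suc_mono_le[of r, OF rmono])
      then have "norm2 P (\<lambda>\<omega>. Y n \<omega> - Y (r j) \<omega>) \<le> (1/2)^k"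
        using N[OF that, of "r j"] rN[of k] by simp
      then show "sqnorm P (\<lambda>\<omega>. Y n \<omega> - Y (r j) \<omega>) \<le> ennreal (((1/2)^k)\<^sup>2)"
        by (simp add: sqnorm_eq_norm2[OF L2_fun_diff[OF Y Y]] ennreal_leI power_mono)
    qed
    finally show ?thesis .
  qed
  have "(\<lambda>\<omega>. Y (N 0) \<omega> - Z \<omega>) \<in> L2_fun P"
    unfolding L2_fun_iff using le_less_trans[OF bound[of 0 "N 0"]] by simp
  from L2_fun_diff[OF Y[of "N 0"] this] have Z: "Z \<in> L2_fun P" by simp
  have "(\<lambda>n. norm2 P (\<lambda>\<omega>. Y n \<omega> - Z \<omega>)) \<longlonglongrightarrow> 0"
  proof (rule LIMSEQ_I)
    fix e :: real assume "e > 0"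
    obtain k where k: "(1/2)^k < e" using real_arch_pow_inv[OF \<open>e > 0\<close>, of "1/2"] by auto
    have "norm2 P (\<lambda>\<omega>. Y n \<omega> - Z \<omega>) < e" if "n \<ge> N k" for n
    proof -
      have "(norm2 P (\<lambda>\<omega>. Y n \<omega> - Z \<omega>))\<^sup>2 \<le> ((1/2)^k)\<^sup>2"
        using bound[OF that] by (simp add: sqnorm_eq_norm2[OF L2_fun_diff[OF Y Z]])
      then have "norm2 P (\<lambda>\<omega>. Y n \<omega> - Z \<omega>) \<le> (1/2)^k" by (rule power2_le_imp_le) simp
      with k show ?thesis by simp
    qed
    then show "\<exists>no. \<forall>n\<ge>no. norm (norm2 P (\<lambda>\<omega>. Y n \<omega> - Z \<omega>) - 0) < e" by auto
  qed
  with Z Y show thesis by (intro that[of Z]) (simp add: L2_tendsto_iff)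
qed

lemma L2_dominated_convergence:
  fixes f :: "nat \<Rightarrow> 'a \<Rightarrow> 'b::{real_normed_vector, second_countable_topology}"
    and g :: "'a \<Rightarrow> 'c::{real_normed_vector, second_countable_topology}"
  assumes f[measurable]: "\<And>n. f n \<in> borel_measurable m" and h[measurable]: "h \<in> borel_measurable m"
    and g: "g \<in> L2_fun m" and bound: "\<And>n x. x \<in> space m \<Longrightarrow> norm (f n x) \<le> norm (g x)"
    and lim: "\<And>x. x \<in> space m \<Longrightarrow> (\<lambda>n. f n x) \<longlonglongrightarrow> h x"
  shows "L2_tendsto m f h"
proof -
  have adj_M[measurable]: "g \<in> borel_measurable m" using g by (rule L2_funD)
  have hg: "norm (h x) \<le> norm (g x)" if "x \<in> space m" for x
    by (rule LIMSEQ_le_const2[OF tendsto_norm[OF lim[OF that]]]) (use bound[OF that] in blast)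
  have "sqnorm m h \<le> sqnorm m g"
    unfolding sqnorm_def using hg by (intro nn_integral_mono ennreal_leI power_mono) auto
  then have hL: "h \<in> L2_fun m" using g by (auto simp: L2_fun_iff intro: le_less_trans)
  have "(\<lambda>n. \<integral>\<^sup>+ x. ennreal ((norm (f n x - h x))\<^sup>2) \<partial>m) \<longlonglongrightarrow> (\<integral>\<^sup>+ x. 0 \<partial>m)"
  proof (rule nn_integral_dominated_convergence)
    show "(\<integral>\<^sup>+ x. ennreal ((norm (2 *\<^sub>R g x))\<^sup>2) \<partial>m) < \<infinity>"
      using L2_fun_scaleR[OF g, of 2] by (simp add: L2_fun_iff sqnorm_def)
    show "AE x in m. ennreal ((norm (f n x - h x))\<^sup>2) \<le> ennreal ((norm (2 *\<^sub>R g x))\<^sup>2)" for n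
    proof (rule AE_I2)
      fix x assume "x \<in> space m"
      then have "norm (f n x - h x) \<le> norm (2 *\<^sub>R g x)"
        using bound[of x n] hg[of x] norm_triangle_ineq4[of "f n x" "h x"] by simp
      then show "ennreal ((norm (f n x - h x))\<^sup>2) \<le> ennreal ((norm (2 *\<^sub>R g x))\<^sup>2)"
        by (intro ennreal_leI power_mono) auto
    qed
    show "AE x in m. (\<lambda>n. ennreal ((norm (f n x - h x))\<^sup>2)) \<longlonglongrightarrow> 0"
    proof (rule AE_I2)
      fix x assume "x \<in> space m"
      then have "(\<lambda>n. ennreal ((norm (f n x - h x))\<^sup>2)) \<longlonglongrightarrow> ennreal ((norm (h x - h x))\<^sup>2)"
        by (intro tendsto_intros lim)
      then show "(\<lambda>n. ennreal ((norm (f n x - h x))\<^sup>2)) \<longlonglongrightarrow> 0" by simp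
    qed
  qed measurable
  then show ?thesis using hL by (simp add: L2_tendsto_def)
qed

lemma simple_functions_L2_dense:
  fixes f :: "'a \<Rightarrow> 'b::{real_normed_vector, second_countable_topology}"
  assumes f: "f \<in> L2_fun m"
  obtains F where "\<And>n. simple_function m (F n)" "\<And>n. F n \<in> L2_fun m"
    "L2_tendsto m F f" "\<And>n x. x \<in> space m \<Longrightarrow> norm (F n x) \<le> 2 * norm (f x)"
proof -
  have [measurable]: "f \<in> borel_measurable m" using f by (rule L2_funD)
  obtain F where F0: "(\<forall>i. simple_function m (F i)) \<and> (\<forall>x\<in>space m. (\<lambda>i. F i x) \<longlonglongrightarrow> f x) \<and>
    (\<forall>i. \<forall>x\<in>space m. dist (F i x) 0 \<le> 2 * dist (f x) 0)"
    using borel_measurable_implies_sequence_metric[of f m 0] L2_funD[OF f] by blast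
  then have F: "simple_function m (F n)" "x \<in> space m \<Longrightarrow> (\<lambda>n. F n x) \<longlonglongrightarrow> f x"
    "x \<in> space m \<Longrightarrow> norm (F n x) \<le> 2 * norm (f x)" for n x
    by simp_all
  have [measurable]: "F n \<in> borel_measurable m" for n using F(1) by (rule borel_measurable_simple_function)
  have FL: "F n \<in> L2_fun m" for n
    by (rule L2_fun_bound[OF L2_fun_scaleR[OF f, of 2]]) (simp_all add: F(3))
  have "L2_tendsto m F f"
    by (rule L2_dominated_convergence[OF _ _ L2_fun_scaleR[OF f, of 2]]) (simp_all add: F)
  from that[OF F(1) FL this F(3)] show thesis .
qed

section \<open>Isometric extension of an integral\<close>

text \<open>
  The common pattern of the Wiener and of the compensated Poisson integral: \<open>S\<close>
  ranges over formal elementary integrands, \<open>J S\<close> is the function whose norm counts,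
  and \<open>I S\<close> is the elementary integral.
\<close>

locale isometric_integral =
  fixes m :: "'a measure" and P :: "'w measure" and \<S> :: "'s set"
    and J :: "'s \<Rightarrow> 'a \<Rightarrow> 'b::{real_normed_vector, second_countable_topology}"
    and I :: "'s \<Rightarrow> 'w \<Rightarrow> real"
  assumes prob: "prob_space P"
    and J_L2: "\<And>S. S \<in> \<S> \<Longrightarrow> J S \<in> L2_fun m"
    and I_L2: "\<And>S. S \<in> \<S> \<Longrightarrow> I S \<in> L2_fun P"
    and combine: "\<And>S S' c. S \<in> \<S> \<Longrightarrow> S' \<in> \<S> \<Longrightarrow>
      \<exists>R\<in>\<S>. J R = (\<lambda>x. J S x + c *\<^sub>R J S' x) \<and> I R = (\<lambda>\<omega>. I S \<omega> + c *\<^sub>R I S' \<omega>)"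
    and isometry: "\<And>S. S \<in> \<S> \<Longrightarrow> norm2 P (I S) = norm2 m (J S)"
    and mean_zero: "\<And>S. S \<in> \<S> \<Longrightarrow> (LINT \<omega>|P. I S \<omega>) = 0"
begin

sublocale prob_space P by (rule prob)

text \<open>
  A relation between integrand and integral, since integrals are determined only almost surely.
  For the two concrete integrals it is the defining relation of the integral itself.
\<close>

definition has_ext :: "('a \<Rightarrow> 'b) \<Rightarrow> ('w \<Rightarrow> real) \<Rightarrow> bool"
  where "has_ext f Y \<longleftrightarrow>
    (\<exists>S. (\<forall>n. S n \<in> \<S>) \<and> L2_tendsto m (\<lambda>n. J (S n)) f \<and> L2_tendsto P (\<lambda>n. I (S n)) Y)"

lemma has_ext_L2: "has_ext f Y \<Longrightarrow> f \<in> L2_fun m" "has_ext f Y \<Longrightarrow> Y \<in> L2_fun P"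
  by (auto simp: has_ext_def L2_tendsto_def)

lemma has_ext_isometry:
  assumes "has_ext f Y"
  shows "norm2 P Y = norm2 m f"
proof -
  obtain S where S: "\<And>n. S n \<in> \<S>" "L2_tendsto m (\<lambda>n. J (S n)) f" "L2_tendsto P (\<lambda>n. I (S n)) Y"
    using assms by (auto simp: has_ext_def)
  have "(\<lambda>n. norm2 P (I (S n))) \<longlonglongrightarrow> norm2 P Y" by (intro norm2_tendsto S I_L2)
  moreover have "(\<lambda>n. norm2 m (J (S n))) \<longlonglongrightarrow> norm2 m f" by (intro norm2_tendsto S J_L2)
  ultimately show ?thesis using isometry[OF S(1)] by (simp add: LIMSEQ_unique)
qed

lemma has_ext_lincomb:
  assumes "has_ext f Y" "has_ext g Z"
  shows "has_ext (\<lambda>x. f x + c *\<^sub>R g x) (\<lambda>\<omega>. Y \<omega> + c * Z \<omega>)"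
proof -
  obtain S where S: "\<And>n. S n \<in> \<S>" "L2_tendsto m (\<lambda>n. J (S n)) f" "L2_tendsto P (\<lambda>n. I (S n)) Y"
    using assms(1) by (auto simp: has_ext_def)
  obtain S' where S': "\<And>n. S' n \<in> \<S>" "L2_tendsto m (\<lambda>n. J (S' n)) g" "L2_tendsto P (\<lambda>n. I (S' n)) Z"
    using assms(2) by (auto simp: has_ext_def)
  have "\<forall>n. \<exists>R\<in>\<S>. J R = (\<lambda>x. J (S n) x + c *\<^sub>R J (S' n) x) \<and> I R = (\<lambda>\<omega>. I (S n) \<omega> + c *\<^sub>R I (S' n) \<omega>)"
    using combine S(1) S'(1) by blast
  then obtain R where R: "\<And>n. R n \<in> \<S>" "\<And>n. J (R n) = (\<lambda>x. J (S n) x + c *\<^sub>R J (S' n) x)"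
    "\<And>n. I (R n) = (\<lambda>\<omega>. I (S n) \<omega> + c *\<^sub>R I (S' n) \<omega>)" by metis
  have "L2_tendsto m (\<lambda>n. J (R n)) (\<lambda>x. f x + c *\<^sub>R g x)"
    unfolding R(2) by (intro L2_tendsto_add_scaleR S S' J_L2)
  moreover have "L2_tendsto P (\<lambda>n. I (R n)) (\<lambda>\<omega>. Y \<omega> + c *\<^sub>R Z \<omega>)"
    unfolding R(3) by (intro L2_tendsto_add_scaleR S S' I_L2)
  ultimately show ?thesis using R(1) by (auto simp: has_ext_def)
qed

lemma has_ext_cong:
  assumes "\<And>x. x \<in> space m \<Longrightarrow> f x = g x" "has_ext f Y"
  shows "has_ext g Y"
  using assms L2_tendsto_cong[of m f g] unfolding has_ext_def by blast

lemma has_ext_unique: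
  assumes "has_ext f Y" "has_ext f Z"
  shows "AE \<omega> in P. Y \<omega> = Z \<omega>"
proof -
  have *: "has_ext (\<lambda>x. f x + (-1) *\<^sub>R f x) (\<lambda>\<omega>. Y \<omega> + (-1) * Z \<omega>)"
    by (intro has_ext_lincomb assms)
  then have "norm2 P (\<lambda>\<omega>. Y \<omega> + (-1) * Z \<omega>) = 0"
    using has_ext_isometry[OF *] by simp
  then have "sqnorm P (\<lambda>\<omega>. Y \<omega> - Z \<omega>) = 0"
    using sqnorm_eq_norm2[OF has_ext_L2(2)[OF *]] by simp
  moreover have "Y \<in> borel_measurable P" "Z \<in> borel_measurable P"
    using has_ext_L2(2) assms by (auto intro: L2_funD)
  ultimately show ?thesis unfolding sqnorm_def
    by (subst (asm) nn_integral_0_iff_AE) auto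
qed

lemma has_ext_mean_zero:
  assumes "has_ext f Y"
  shows "integrable P Y" "(LINT \<omega>|P. Y \<omega>) = 0"
proof -
  obtain S where S: "\<And>n. S n \<in> \<S>" "L2_tendsto P (\<lambda>n. I (S n)) Y"
    using assms by (auto simp: has_ext_def)
  have one: "(\<lambda>_. 1::real) \<in> L2_fun P" "norm2 P (\<lambda>_. 1::real) = 1"
    by (auto simp: L2_fun_iff norm2_def sqnorm_def emeasure_space_1)
  have int: "integrable P Z" "\<bar>LINT \<omega>|P. Z \<omega>\<bar> \<le> norm2 P Z" if "Z \<in> L2_fun P" for Z :: "'w \<Rightarrow> real"
  proof -
    have "integrable P (\<lambda>\<omega>. norm (Z \<omega>))" using L2_Cauchy_Schwarz(1)[OF that one(1)] by simp
    then show "integrable P Z" using that by (subst (asm) integrable_norm_iff) (auto intro: L2_funD)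
    have "\<bar>LINT \<omega>|P. Z \<omega>\<bar> \<le> (LINT \<omega>|P. \<bar>Z \<omega>\<bar>)" by (rule integral_abs_bound)
    also have "\<dots> \<le> norm2 P Z" using L2_Cauchy_Schwarz(2)[OF that one(1)] one(2) by simp
    finally show "\<bar>LINT \<omega>|P. Z \<omega>\<bar> \<le> norm2 P Z" .
  qed
  note Y = has_ext_L2(2)[OF assms]
  show "integrable P Y" by (rule int(1)[OF Y])
  have "(\<lambda>n. norm2 P (\<lambda>\<omega>. I (S n) \<omega> - Y \<omega>)) \<longlonglongrightarrow> 0" using S I_L2 by (simp add: L2_tendsto_iff)
  moreover have "\<bar>LINT \<omega>|P. Y \<omega>\<bar> \<le> norm2 P (\<lambda>\<omega>. I (S n) \<omega> - Y \<omega>)" for n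
    using int(2)[OF L2_fun_diff[OF I_L2[OF S(1)] Y], of n] int(1)[OF I_L2[OF S(1)], of n] int(1)[OF Y] mean_zero[OF S(1), of n]
    by simp
  ultimately have "\<bar>LINT \<omega>|P. Y \<omega>\<bar> \<le> 0" by (intro LIMSEQ_le_const) auto
  then show "(LINT \<omega>|P. Y \<omega>) = 0" by simp
qed

lemma has_ext_exists:
  assumes S: "\<And>n. S n \<in> \<S>" "L2_tendsto m (\<lambda>n. J (S n)) f"
  obtains Y where "has_ext f Y"
proof -
  have f: "f \<in> L2_fun m" "(\<lambda>n. norm2 m (\<lambda>x. J (S n) x - f x)) \<longlonglongrightarrow> 0"
    using S J_L2 by (auto simp: L2_tendsto_iff)
  have iso: "norm2 P (\<lambda>\<omega>. I (S k) \<omega> - I (S n) \<omega>) = norm2 m (\<lambda>x. J (S k) x - J (S n) x)" for k n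
  proof -
    obtain R where "R \<in> \<S>" "J R = (\<lambda>x. J (S k) x + (-1) *\<^sub>R J (S n) x)"
      "I R = (\<lambda>\<omega>. I (S k) \<omega> + (-1) *\<^sub>R I (S n) \<omega>)" using combine[OF S(1) S(1)] by blast
    with isometry[of R] show ?thesis by simp
  qed
  obtain Y where "L2_tendsto P (\<lambda>n. I (S n)) Y"
  proof (rule L2_complete[OF prob, of "\<lambda>n. I (S n)"])
    show "I (S n) \<in> L2_fun P" for n by (intro I_L2 S)
    fix e :: real assume "e > 0"
    then obtain N where N: "\<And>n. n \<ge> N \<Longrightarrow> norm2 m (\<lambda>x. J (S n) x - f x) < e / 2"
      using LIMSEQ_D[OF f(2), of "e/2"] by auto
    have "norm2 m (\<lambda>x. J (S k) x - J (S n) x) < e" if "k \<ge> N" "n \<ge> N" for k n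
      using norm2_triangle_diff[OF J_L2[OF S(1)] f(1) J_L2[OF S(1)], of k n] N[OF that(1)] N[OF that(2)]
      by (simp add: norm2_minus_commute[of m f])
    then show "\<exists>N. \<forall>m\<ge>N. \<forall>n\<ge>N. norm2 P (\<lambda>\<omega>. I (S m) \<omega> - I (S n) \<omega>) < e"
      unfolding iso by blast
  qed
  with S show thesis by (intro that) (auto simp: has_ext_def)
qed

lemma has_ext_simple:
  assumes "S \<in> \<S>"
  shows "has_ext (J S) (I S)"
  unfolding has_ext_def
  by (rule exI[of _ "\<lambda>_. S"]) (use assms J_L2 I_L2 in \<open>simp add: L2_tendsto_iff\<close>)

lemma has_ext_approx:
  assumes f: "has_ext f Y" and S: "\<And>n. S n \<in> \<S>" "L2_tendsto m (\<lambda>n. J (S n)) f"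
  shows "L2_tendsto P (\<lambda>n. I (S n)) Y"
proof -
  have "norm2 P (\<lambda>\<omega>. I (S n) \<omega> - Y \<omega>) = norm2 m (\<lambda>x. J (S n) x - f x)" for n
    using has_ext_isometry[OF has_ext_lincomb[OF has_ext_simple[OF S(1)] f, of n "-1"]] by simp
  then show ?thesis
    using S(2) has_ext_L2[OF f] by (simp add: L2_tendsto_iff J_L2 I_L2 S(1))
qed

lemma has_ext_zero:
  assumes "has_ext f Y"
  shows "has_ext (\<lambda>_. 0) (\<lambda>_. 0)"
  using has_ext_lincomb[OF assms assms, of "-1"] by simp

lemma has_ext_sum:
  fixes n :: nat
  assumes "\<And>k. has_ext (f k) (Y k)"
  shows "has_ext (\<lambda>x. \<Sum>k<n. t k *\<^sub>R f k x) (\<lambda>\<omega>. \<Sum>k<n. t k * Y k \<omega>)"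
proof (induction n)
  case 0
  then show ?case using has_ext_zero[OF assms] by simp
next
  case (Suc n)
  then show ?case using has_ext_lincomb[OF Suc assms[of n], of "t n"] by simp
qed

end

section \<open>Riesz representation and the adjoint of the embedding\<close>

text \<open>
  Minimizing \<open>s \<bullet> s - 2 * \<phi> s\<close> over the subspace gives at once Riesz
  representation (\<open>S = UNIV\<close>) and the orthogonal projection onto the closure of
  \<open>S\<close> (\<open>\<phi> = inner k0\<close>). Minimizing sequences are Cauchy by the
  parallelogram identity.
\<close>

lemma subspace_minimizer:
  fixes S :: "'k::{real_inner, banach} set"
  assumes S: "subspace S" and \<phi>: "bounded_linear \<phi>"
  obtains k where "k \<in> closure S" "\<And>s. s \<in> S \<Longrightarrow> k \<bullet> s = \<phi> s"
proof -
  interpret \<phi>: bounded_linear \<phi> by fact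
  define J where "J s = s \<bullet> s - 2 * \<phi> s" for s
  obtain B where B: "\<And>s. \<bar>\<phi> s\<bar> \<le> norm s * B" using \<phi>.bounded by auto
  have lower: "- B\<^sup>2 \<le> J s" for s
  proof -
    have "0 \<le> (norm s - B)\<^sup>2" by simp
    also have "\<dots> = norm s * norm s - 2 * (norm s * B) + B\<^sup>2" by (simp add: power2_eq_square algebra_simps)
    finally show ?thesis using B[of s] by (simp add: J_def dot_square_norm power2_eq_square abs_le_iff)
  qed
  have bdd: "bdd_below (J ` S)" by (rule bdd_belowI2[where m="- B\<^sup>2"]) (rule lower)
  have ne: "S \<noteq> {}" using subspace_0[OF S] by blast
  define d where "d = (INF s\<in>S. J s)"
  have dJ: "d \<le> J s" if "s \<in> S" for s unfolding d_def by (rule cINF_lower[OF bdd that])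
  have "\<exists>s\<in>S. J s < d + 1 / real (Suc n)" for n
    using cINF_less_iff[OF ne bdd, of "d + 1 / real (Suc n)"] unfolding d_def by simp
  then obtain s where s: "\<And>n. s n \<in> S" "\<And>n. J (s n) < d + 1 / real (Suc n)" by metis
  (* Parallelogram identity: the midpoint of a and b has value at least d. *)
  have par: "(norm (a - b))\<^sup>2 \<le> 2 * (J a - d) + 2 * (J b - d)" if "a \<in> S" "b \<in> S" for a b
  proof -
    have "(1/2) *\<^sub>R (a + b) \<in> S" using S that by (intro subspace_scale subspace_add)
    from dJ[OF this] have "4 * d \<le> 4 * J ((1/2) *\<^sub>R (a + b))" by simp
    also have "\<dots> = (a + b) \<bullet> (a + b) - 4 * \<phi> (a + b)"
      by (simp add: J_def \<phi>.scaleR \<phi>.add inner_simps) (simp add: field_simps)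
    finally show ?thesis
      by (simp add: J_def power2_norm_eq_inner \<phi>.add inner_simps inner_commute algebra_simps)
  qed
  have "Cauchy s"
  proof (rule metric_CauchyI)
    fix e :: real assume "e > 0"
    then obtain N where N: "4 / real (Suc N) < e\<^sup>2"
      using reals_Archimedean[of "e\<^sup>2 / 4"] by (auto simp: field_simps)
    have "dist (s j) (s k) < e" if "j \<ge> N" "k \<ge> N" for j k
    proof -
      have le: "1 / real (Suc n) \<le> 1 / real (Suc N)" if "n \<ge> N" for n
        using that by (intro divide_left_mono) auto
      have "(norm (s j - s k))\<^sup>2 \<le> 2 * (J (s j) - d) + 2 * (J (s k) - d)" by (intro par s)
      also have "\<dots> \<le> 2 * (1 / real (Suc N)) + 2 * (1 / real (Suc N))"
        using order_less_le_trans[OF s(2)[of j] add_left_mono[OF le[OF that(1)]]]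
          order_less_le_trans[OF s(2)[of k] add_left_mono[OF le[OF that(2)]]] by argo
      also have "\<dots> < e\<^sup>2" using N by simp
      finally show ?thesis using \<open>e > 0\<close> power_less_imp_less_base[of "norm (s j - s k)" 2 e]
        by (simp add: dist_norm)
    qed
    then show "\<exists>M. \<forall>m\<ge>M. \<forall>n\<ge>M. dist (s m) (s n) < e" by blast
  qed
  then obtain k where k: "s \<longlonglongrightarrow> k" using Cauchy_convergent convergent_def by blast
  have Jcont: "(\<lambda>n. J (s n + x)) \<longlonglongrightarrow> J (k + x)" for x
    unfolding J_def by (intro tendsto_intros k \<phi>.tendsto)
  have "J k \<le> d"
  proof (rule LIMSEQ_le[OF _ _ exI[of _ 0]])
    show "(\<lambda>n. J (s n)) \<longlonglongrightarrow> J k" using Jcont[of 0] by simp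
    show "(\<lambda>n. d + 1 / real (Suc n)) \<longlonglongrightarrow> d"
      using tendsto_add[OF tendsto_const LIMSEQ_Suc[OF lim_const_over_n], of d 1] by simp
    show "\<forall>n\<ge>0. J (s n) \<le> d + 1 / real (Suc n)" using s(2) less_imp_le by blast
  qed
  have "k \<bullet> x = \<phi> x" if x: "x \<in> S" for x
  proof (cases "x = 0")
    case False
    have ge: "d \<le> J (k + t *\<^sub>R x)" for t
    proof (rule LIMSEQ_le_const[OF Jcont])
      have "s n + t *\<^sub>R x \<in> S" for n using S s(1) x by (intro subspace_add subspace_scale)
      then show "\<exists>N. \<forall>n\<ge>N. d \<le> J (s n + t *\<^sub>R x)" using dJ by blast
    qed
    define a where "a = k \<bullet> x - \<phi> x"
    define q where "q = x \<bullet> x"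
    have "q > 0" using False by (simp add: q_def)
    have "J (k + t *\<^sub>R x) = J k + 2 * t * a + t * t * q" for t
      by (simp add: J_def a_def q_def \<phi>.add \<phi>.scaleR inner_simps inner_commute algebra_simps)
    (* The quadratic in t is smallest at - a / q, where nonnegativity forces a = 0. *)
    from ge[of "- (a / q)", unfolded this] \<open>J k \<le> d\<close>
    have "0 \<le> 2 * (- (a / q)) * a + (- (a / q)) * (- (a / q)) * q" by simp
    also have "\<dots> = - (a * a / q)" using \<open>q > 0\<close> by (simp add: field_simps)
    finally have "a * a / q \<le> 0" by simp
    then have "a * a \<le> 0" using \<open>q > 0\<close> by (simp add: divide_le_0_iff)
    then have "a = 0" by (auto simp: mult_le_0_iff)
    then show ?thesis by (simp add: a_def)
  qed (simp add: \<phi>.zero)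
  moreover have "k \<in> closure S" using k s(1) unfolding closure_sequential by blast
  ultimately show thesis by (intro that[of k])
qed

lemma hilbert_adjoint_inner:
  "hilbert_adjoint i u \<bullet> h = blinfun_apply u (blinfun_apply i h)"
proof -
  have "bounded_linear (\<lambda>h. blinfun_apply u (blinfun_apply i h))"
    by (intro bounded_linear_compose[OF blinfun.bounded_linear_right blinfun.bounded_linear_right])
  from subspace_minimizer[OF subspace_UNIV this]
  obtain k where k: "\<forall>h. k \<bullet> h = blinfun_apply u (blinfun_apply i h)" by (metis UNIV_I)
  have uniq: "k' = k" if "\<forall>h. k' \<bullet> h = blinfun_apply u (blinfun_apply i h)" for k'
  proof -
    have "(k' - k) \<bullet> (k' - k) = 0" using that k by (simp add: inner_diff_left)
    then show ?thesis by simp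
  qed
  have "\<forall>h. hilbert_adjoint i u \<bullet> h = blinfun_apply u (blinfun_apply i h)"
    unfolding hilbert_adjoint_def 
    by (rule theI[where P="\<lambda>k. \<forall>h. k \<bullet> h = blinfun_apply u (blinfun_apply i h)", OF k uniq])
  then show ?thesis by blast
qed

lemma hilbert_adjoint_eqI:
  assumes "\<And>h. k \<bullet> h = blinfun_apply u (blinfun_apply i h)"
  shows "hilbert_adjoint i u = k"
proof -
  have "(hilbert_adjoint i u - k) \<bullet> (hilbert_adjoint i u - k) = 0"
    by (simp only: inner_diff_left hilbert_adjoint_inner assms diff_self)
  then show ?thesis by simp
qed

lemma bounded_linear_hilbert_adjoint: "bounded_linear (hilbert_adjoint i)"
proof (rule bounded_linear_intro[where K="norm i"])
  show "hilbert_adjoint i (u + v) = hilbert_adjoint i u + hilbert_adjoint i v" for u v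
    by (rule hilbert_adjoint_eqI) (simp add: inner_add_left hilbert_adjoint_inner blinfun.add_left)
  show "hilbert_adjoint i (c *\<^sub>R u) = c *\<^sub>R hilbert_adjoint i u" for c u
    by (rule hilbert_adjoint_eqI) (simp add: hilbert_adjoint_inner blinfun.scaleR_left)
  fix u
  let ?k = "hilbert_adjoint i u"
  have "norm ?k * norm ?k = blinfun_apply u (blinfun_apply i ?k)"
    by (simp add: hilbert_adjoint_inner[symmetric] dot_square_norm power2_eq_square)
  also have "\<dots> \<le> norm u * norm (blinfun_apply i ?k)"
    using norm_blinfun[of u "blinfun_apply i ?k"] by simp
  also have "\<dots> \<le> norm u * (norm i * norm ?k)"
    by (intro mult_left_mono norm_blinfun) simp
  finally have "norm ?k * norm ?k \<le> (norm u * norm i) * norm ?k" by (simp add: mult.assoc)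
  then show "norm ?k \<le> norm u * norm i"
    by (cases "norm ?k = 0") (auto intro: mult_nonneg_nonneg dest: mult_right_le_imp_le)
qed

text \<open>
  The projection \<open>k\<close> of \<open>k0\<close> onto the closure of the range satisfies
  \<open>i k = i k0\<close>.
\<close>

lemma hilbert_adjoint_dense:
  assumes "inj (blinfun_apply i)"
  shows "closure (range (hilbert_adjoint i)) = UNIV"
proof (intro equalityI subset_UNIV subsetI)
  interpret bounded_linear "hilbert_adjoint i" by (rule bounded_linear_hilbert_adjoint)
  fix k0
  have sub: "subspace (range (hilbert_adjoint i))"
    by (rule subspace_UNIV[THEN linear_subspace_image[OF linear]])
  obtain k where k: "k \<in> closure (range (hilbert_adjoint i))"
    "\<And>s. s \<in> range (hilbert_adjoint i) \<Longrightarrow> k \<bullet> s = k0 \<bullet> s"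
    using subspace_minimizer[OF sub bounded_linear_inner_right[of k0]] by blast
  have "blinfun_apply u (blinfun_apply i (k0 - k)) = blinfun_apply u (blinfun_apply i 0)" for u :: "'b \<Rightarrow>\<^sub>L real"
    using k(2)[of "hilbert_adjoint i u"]
    by (simp add: hilbert_adjoint_inner[symmetric] inner_diff_right inner_commute)
  then have "blinfun_apply i (k0 - k) = blinfun_apply i 0"
    by (rule functionals_separate_points)
  from injD[OF assms this] have "k0 - k = 0" .
  with k(1) show "k0 \<in> closure (range (hilbert_adjoint i))" by simp
qed

section \<open>Boundedness of square integrable functionals, and the weak integral\<close>

text \<open>
  Pointwise bounded functionals that are square integrable for each argument form a bounded
  operator into \<open>L\<^sup>2\<close>. The sublevel sets of the norm are closed by Fatou's
  lemma, so by Baire's theorem one of them contains a ball.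
\<close>

lemma L2_valued_operator_bounded:
  fixes \<Phi> :: "'d::banach \<Rightarrow> 'a \<Rightarrow> 'b::{real_normed_vector, second_countable_topology}"
  assumes L2: "\<And>v. \<Phi> v \<in> L2_fun m"
    and lin: "\<And>x. x \<in> space m \<Longrightarrow> bounded_linear (\<lambda>v. \<Phi> v x)"
  obtains c where "c \<ge> 0" "\<And>v. norm2 m (\<Phi> v) \<le> c * norm v"
proof -
  define B where "B n = {v. norm2 m (\<Phi> v) \<le> real n}" for n
  have sq: "sqnorm m (\<Phi> v) \<le> ennreal ((real n)\<^sup>2) \<longleftrightarrow> v \<in> B n" for v n
    unfolding B_def by (simp add: sqnorm_eq_norm2 L2 abs_le_square_iff[symmetric])
  have closed: "closed (B n)" for n
    unfolding closed_sequential_limits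
  proof safe
    fix u v assume u: "\<forall>k. u k \<in> B n" "u \<longlonglongrightarrow> v"
    have "sqnorm m (\<Phi> v) = (\<integral>\<^sup>+ x. liminf (\<lambda>k. ennreal ((norm (\<Phi> (u k) x))\<^sup>2)) \<partial>m)"
      unfolding sqnorm_def
    proof (rule nn_integral_cong)
      fix x assume "x \<in> space m"
      then have "(\<lambda>k. ennreal ((norm (\<Phi> (u k) x))\<^sup>2)) \<longlonglongrightarrow> ennreal ((norm (\<Phi> v x))\<^sup>2)"
        by (intro tendsto_intros bounded_linear.tendsto[OF lin u(2)])
      then show "ennreal ((norm (\<Phi> v x))\<^sup>2) = liminf (\<lambda>k. ennreal ((norm (\<Phi> (u k) x))\<^sup>2))"
        by (rule lim_imp_Liminf[OF sequentially_bot, symmetric])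
    qed
    also have "\<dots> \<le> liminf (\<lambda>k. sqnorm m (\<Phi> (u k)))"
      unfolding sqnorm_def using L2_funD[OF L2] by (intro nn_integral_liminf) measurable
    also have "\<dots> \<le> limsup (\<lambda>k. sqnorm m (\<Phi> (u k)))" by (rule Liminf_le_Limsup) simp
    also have "\<dots> \<le> ennreal ((real n)\<^sup>2)"
      by (rule Limsup_bounded) (use u(1) sq in auto)
    finally show "v \<in> B n" by (simp only: sq)
  qed
  have cover: "(\<Union>n. B n) = UNIV"
  proof (intro equalityI subset_UNIV subsetI)
    fix v
    obtain n where "norm2 m (\<Phi> v) \<le> real n" using real_arch_simple by blast
    then show "v \<in> (\<Union>n. B n)" unfolding B_def by blast
  qed
  obtain n where "interior (B n) \<noteq> {}"
  proof (rule ccontr)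
    assume "\<not> thesis"
    then have "\<And>n. interior (B n) = {}" using that by blast
    then have "euclidean interior_of \<Union> (range B) = {}"
      using closed by (intro Baire_category_alt disjI1 completely_metrizable_space_euclidean) auto
    then show False using cover by simp
  qed
  then obtain v0 where "v0 \<in> interior (B n)" by blast
  then obtain r where r: "r > 0" "ball v0 r \<subseteq> B n" unfolding mem_interior by blast
  have v0: "v0 \<in> B n" using r by auto
  (* Differences of two points of the ball move it to the origin, at the cost of a factor two. *)
  have half: "norm2 m (\<Phi> u) \<le> 2 * real n" if "norm u < r" for u
  proof -
    have "v0 + u \<in> B n" using r(2) that by (auto simp: dist_norm)
    moreover have "norm2 m (\<Phi> u) = norm2 m (\<lambda>x. \<Phi> (v0 + u) x - \<Phi> v0 x)"
      by (rule norm2_cong) (simp add: linear_simps(1)[OF lin])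
    moreover have "norm2 m (\<lambda>x. \<Phi> (v0 + u) x - \<Phi> v0 x) \<le> norm2 m (\<Phi> (v0 + u)) + norm2 m (\<Phi> v0)"
      using norm2_triangle[OF L2[of "v0 + u"] L2_fun_scaleR[OF L2[of v0], of "-1"]] norm2_scaleR[OF L2[of v0], of "-1"]
      by simp
    ultimately show ?thesis using v0 by (simp add: B_def)
  qed
  show thesis
  proof (rule that)
    show "0 \<le> 4 * real n / r" using r(1) by simp
    fix v
    show "norm2 m (\<Phi> v) \<le> 4 * real n / r * norm v"
    proof (cases "v = 0")
      case True
      have "norm2 m (\<Phi> v) = norm2 m (\<lambda>x. 0 :: 'b)"
        by (rule norm2_cong) (simp add: True linear_simps(3)[OF lin])
      then show ?thesis using True by simp
    next
      case False
      define a where "a = 2 * norm v / r"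
      have a: "a > 0" using False r(1) by (simp add: a_def)
      have "norm (v /\<^sub>R a) < r" using False r(1) by (simp add: a_def field_simps)
      then have "norm2 m (\<Phi> (v /\<^sub>R a)) \<le> 2 * real n" by (rule half)
      moreover have "norm2 m (\<Phi> v) = norm2 m (\<lambda>x. a *\<^sub>R \<Phi> (v /\<^sub>R a) x)"
        using a by (intro norm2_cong) (simp add: linear_simps(5)[OF lin])
      ultimately have "norm2 m (\<Phi> v) \<le> a * (2 * real n)"
        using a by (simp add: norm2_scaleR[OF L2] mult_left_mono)
      also have "\<dots> = 4 * real n / r * norm v" by (simp add: a_def)
      finally show ?thesis .
    qed
  qed
qed

text \<open>
  The integrals \<open>a n\<close> over sets \<open>E n\<close> exhausting the space are Bochner
  integrals. They form a Cauchy sequence, since tested against any \<open>v\<close> in the norming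
  set \<open>D\<close> the missing mass is at most \<open>c\<close> times the norm of
  \<open>f\<close> off \<open>E n\<close>, uniformly in \<open>v\<close>. Testing only against
  \<open>D\<close> matters when the bound is known for countably many functionals only.
\<close>

lemma weak_integral_by_exhaustion:
  fixes \<Phi> :: "'a \<Rightarrow> 'v::{banach, second_countable_topology}"
    and f :: "'a \<Rightarrow> 'c::{real_normed_vector, second_countable_topology}"
    and g :: "('v \<Rightarrow>\<^sub>L real) \<Rightarrow> 'a \<Rightarrow> 'b::{real_normed_vector, second_countable_topology}"
  assumes D: "\<And>x a. (\<And>v. v \<in> D \<Longrightarrow> blinfun_apply v x \<le> a) \<Longrightarrow> norm x \<le> a"
    and f: "f \<in> L2_fun m" and g: "\<And>v. v \<in> D \<Longrightarrow> g v \<in> L2_fun m"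
    and c: "\<And>v. v \<in> D \<Longrightarrow> norm2 m (g v) \<le> c"
    and \<Phi>: "\<Phi> \<in> borel_measurable m"
    and bound: "\<And>v x. v \<in> D \<Longrightarrow> x \<in> space m \<Longrightarrow> \<bar>blinfun_apply v (\<Phi> x)\<bar> \<le> norm (g v x) * norm (f x)"
    and E: "\<And>n. E n \<in> sets m" "\<And>n. integrable m (\<lambda>x. indicator (E n) x *\<^sub>R \<Phi> x)"
      "\<And>x. x \<in> space m \<Longrightarrow> \<forall>\<^sub>F n in sequentially. x \<in> E n"
  defines "a \<equiv> \<lambda>n. LINT x|m. indicator (E n) x *\<^sub>R \<Phi> x"
  shows "convergent a"
    and "\<And>v. v \<in> D \<Longrightarrow> integrable m (\<lambda>x. blinfun_apply v (\<Phi> x))"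
    and "\<And>v. v \<in> D \<Longrightarrow> blinfun_apply v (lim a) = (LINT x|m. blinfun_apply v (\<Phi> x))"
proof -
  note [measurable] = \<Phi> E(1) L2_funD[OF f] L2_funD[OF g]
  define r where "r n x = indicator (- E n) x *\<^sub>R f x" for n x
  have rL: "r n \<in> L2_fun m" for n
    unfolding r_def by (rule L2_fun_indicator[OF f]) measurable
  have int: "integrable m (\<lambda>x. blinfun_apply v (\<Phi> x))" if v: "v \<in> D" for v
  proof (rule Bochner_Integration.integrable_bound)
    show "integrable m (\<lambda>x. norm (g v x) * norm (f x))" by (rule L2_Cauchy_Schwarz(1)[OF g[OF v] f])
    show "(\<lambda>x. blinfun_apply v (\<Phi> x)) \<in> borel_measurable m"
      by (rule measurable_compose[OF \<Phi>]) (intro borel_measurable_continuous_onI linear_continuous_on blinfun.bounded_linear_right)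
    show "AE x in m. norm (blinfun_apply v (\<Phi> x)) \<le> norm (norm (g v x) * norm (f x))"
      using bound[OF v] by (intro AE_I2) auto
  qed
  have "L2_tendsto m r (\<lambda>_. 0)"
  proof (rule L2_dominated_convergence[OF L2_funD[OF rL] _ f])
    show "norm (r n x) \<le> norm (f x)" for n x by (simp add: r_def split: split_indicator)
    fix x assume "x \<in> space m"
    from E(3)[OF this] have "\<forall>\<^sub>F n in sequentially. r n x = 0" by eventually_elim (simp add: r_def)
    then show "(\<lambda>n. r n x) \<longlonglongrightarrow> 0" by (rule tendsto_eventually)
  qed simp
  then have r0: "(\<lambda>n. norm2 m (r n)) \<longlonglongrightarrow> 0" by (simp add: L2_tendsto_iff[OF rL])
  have va: "blinfun_apply v (a n) = (LINT x|m. indicator (E n) x *\<^sub>R blinfun_apply v (\<Phi> x))" for v n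
    unfolding a_def
    by (subst integral_bounded_linear[OF blinfun.bounded_linear_right E(2), symmetric])
       (simp add: blinfun.scaleR_right)
  have close: "\<bar>blinfun_apply v (a n) - (LINT x|m. blinfun_apply v (\<Phi> x))\<bar> \<le> c * norm2 m (r n)"
    if v: "v \<in> D" for v n
  proof -
    have iE: "integrable m (\<lambda>x. indicator (E n) x *\<^sub>R blinfun_apply v (\<Phi> x))"
      using integrable_bounded_linear[OF blinfun.bounded_linear_right E(2), of v n]
      by (simp add: blinfun.scaleR_right)
    have "blinfun_apply v (a n) - (LINT x|m. blinfun_apply v (\<Phi> x))
      = (LINT x|m. indicator (E n) x *\<^sub>R blinfun_apply v (\<Phi> x) - blinfun_apply v (\<Phi> x))"
      unfolding va by (rule Bochner_Integration.integral_diff[OF iE int[OF v], symmetric])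
    also have "\<bar>\<dots>\<bar> \<le> (LINT x|m. norm (g v x) * norm (r n x))"
    proof -
      have "\<bar>LINT x|m. indicator (E n) x *\<^sub>R blinfun_apply v (\<Phi> x) - blinfun_apply v (\<Phi> x)\<bar>
        \<le> (LINT x|m. \<bar>indicator (E n) x *\<^sub>R blinfun_apply v (\<Phi> x) - blinfun_apply v (\<Phi> x)\<bar>)"
        by (rule integral_abs_bound)
      also have "\<dots> \<le> (LINT x|m. norm (g v x) * norm (r n x))"
      proof (rule integral_mono)
        show "integrable m (\<lambda>x. \<bar>indicator (E n) x *\<^sub>R blinfun_apply v (\<Phi> x) - blinfun_apply v (\<Phi> x)\<bar>)"
          by (intro integrable_abs Bochner_Integration.integrable_diff iE int v)
        show "integrable m (\<lambda>x. norm (g v x) * norm (r n x))" by (rule L2_Cauchy_Schwarz(1)[OF g[OF v] rL])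
        show "\<bar>indicator (E n) x *\<^sub>R blinfun_apply v (\<Phi> x) - blinfun_apply v (\<Phi> x)\<bar>
          \<le> norm (g v x) * norm (r n x)" if "x \<in> space m" for x
          using bound[OF v that] by (cases "x \<in> E n") (auto simp: r_def)
      qed
      finally show ?thesis .
    qed
    also have "\<dots> \<le> norm2 m (g v) * norm2 m (r n)" by (rule L2_Cauchy_Schwarz(2)[OF g[OF v] rL])
    also have "\<dots> \<le> c * norm2 m (r n)" by (intro mult_right_mono c v) simp
    finally show ?thesis .
  qed
  have dist: "norm (a n - a k) \<le> c * norm2 m (r n) + c * norm2 m (r k)" for n k
  proof (rule D)
    fix v assume "v \<in> D"
    from close[OF this, of n] close[OF this, of k]
    show "blinfun_apply v (a n - a k) \<le> c * norm2 m (r n) + c * norm2 m (r k)"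
      by (simp add: blinfun.diff_right abs_le_iff)
  qed
  have cr0: "(\<lambda>n. c * norm2 m (r n)) \<longlonglongrightarrow> 0" using tendsto_mult_left[OF r0, of c] by simp
  have "Cauchy a"
  proof (rule metric_CauchyI)
    fix e :: real assume "e > 0"
    then obtain N where N: "\<And>n. n \<ge> N \<Longrightarrow> \<bar>c * norm2 m (r n)\<bar> < e / 2"
      using LIMSEQ_D[OF cr0, of "e/2"] by auto
    have "dist (a j) (a k) < e" if "j \<ge> N" "k \<ge> N" for j k
      using dist[of j k] N[OF that(1)] N[OF that(2)] by (simp add: dist_norm)
    then show "\<exists>M. \<forall>m\<ge>M. \<forall>n\<ge>M. dist (a m) (a n) < e" by blast
  qed
  then show conv: "convergent a" by (rule Cauchy_convergent)
  show "integrable m (\<lambda>x. blinfun_apply v (\<Phi> x))" if "v \<in> D" for v by (rule int[OF that])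
  show "blinfun_apply v (lim a) = (LINT x|m. blinfun_apply v (\<Phi> x))" if v: "v \<in> D" for v
  proof (rule LIMSEQ_unique)
    show "(\<lambda>n. blinfun_apply v (a n)) \<longlonglongrightarrow> blinfun_apply v (lim a)"
      using conv by (intro bounded_linear.tendsto[OF blinfun.bounded_linear_right]) (simp add: convergent_LIMSEQ_iff)
    show "(\<lambda>n. blinfun_apply v (a n)) \<longlonglongrightarrow> (LINT x|m. blinfun_apply v (\<Phi> x))"
    proof (rule LIM_zero_cancel, rule Lim_null_comparison[OF _ cr0])
      show "\<forall>\<^sub>F n in sequentially. norm (blinfun_apply v (a n) - (LINT x|m. blinfun_apply v (\<Phi> x))) \<le> c * norm2 m (r n)"
        using close[OF v] by (intro always_eventually) simp
    qed
  qed
qed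

text \<open>
  This makes the definite descriptions of the two operators meaningful: the functional on
  \<open>V\<^sup>*\<close> given by integration is represented by a point of \<open>V\<close> and
  not just of its bidual.
\<close>

lemma weak_integral_exists:
  fixes \<Phi> :: "'a \<Rightarrow> 'v::{banach, second_countable_topology}"
    and f :: "'a \<Rightarrow> 'c::{real_normed_vector, second_countable_topology}"
    and g :: "('v \<Rightarrow>\<^sub>L real) \<Rightarrow> 'a \<Rightarrow> 'b::{real_normed_vector, second_countable_topology}"
  assumes m: "sigma_finite_measure m"
    and f: "f \<in> L2_fun m" and g: "\<And>v. g v \<in> L2_fun m"
    and c: "\<And>v. norm2 m (g v) \<le> c * norm v" "c \<ge> 0"
    and meas: "\<And>v :: 'v \<Rightarrow>\<^sub>L real. (\<lambda>x. blinfun_apply v (\<Phi> x)) \<in> borel_measurable m"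
    and bound: "\<And>v x. x \<in> space m \<Longrightarrow> \<bar>blinfun_apply v (\<Phi> x)\<bar> \<le> norm (g v x) * norm (f x)"
  obtains x where "\<And>v :: 'v \<Rightarrow>\<^sub>L real. blinfun_apply v x = (LINT y|m. blinfun_apply v (\<Phi> y))"
proof -
  interpret sigma_finite_measure m by fact
  have \<Phi>[measurable]: "\<Phi> \<in> borel_measurable m" by (rule weakly_measurable_imp_measurable[OF meas])
  obtain A :: "nat \<Rightarrow> 'a set" where A: "range A \<subseteq> sets m" "(\<Union>i. A i) = space m"
    "\<And>i. emeasure m (A i) \<noteq> \<infinity>" "incseq A"
    using sigma_finite_incseq by metis
  (* Finite measure and boundedness on E n make the restricted integrand Bochner integrable. *)
  define E where "E n = {x \<in> A n. norm (\<Phi> x) \<le> real n}" for n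
  have Am[measurable]: "A n \<in> sets m" for n using A(1) by blast
  have E1: "E n \<in> sets m" for n
  proof -
    have "E n = {x \<in> space m. x \<in> A n \<and> norm (\<Phi> x) \<le> real n}"
      using sets.sets_into_space[OF Am[of n]] by (auto simp: E_def)
    then show ?thesis by simp
  qed
  have E2: "integrable m (\<lambda>x. indicator (E n) x *\<^sub>R \<Phi> x)" for n
  proof (rule integrableI_bounded_set_indicator[where B="real n"])
    show "emeasure m (E n) < \<infinity>"
      using emeasure_mono[of "E n" "A n" m] A(3)[of n] Am[of n]
      by (auto simp: E_def less_top[symmetric] top_unique)
    show "AE x in m. x \<in> E n \<longrightarrow> norm (\<Phi> x) \<le> real n" by (auto simp: E_def)
  qed (use E1 in simp_all)
  have E3: "\<forall>\<^sub>F n in sequentially. x \<in> E n" if x: "x \<in> space m" for x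
  proof -
    obtain i where i: "x \<in> A i" using A(2) x by blast
    obtain k where k: "norm (\<Phi> x) \<le> real k" using real_arch_simple by blast
    show ?thesis
    proof (rule eventually_sequentiallyI[of "max i k"])
      fix n assume "n \<ge> max i k"
      then show "x \<in> E n" using incseqD[OF A(4), of i n] i k by (auto simp: E_def)
    qed
  qed
  let ?D = "{v :: 'v \<Rightarrow>\<^sub>L real. norm v \<le> 1}"
  have D: "norm x \<le> a" if "\<And>v. v \<in> ?D \<Longrightarrow> blinfun_apply v x \<le> a" for x :: 'v and a
  proof -
    obtain w :: "'v \<Rightarrow>\<^sub>L real" where "norm w \<le> 1" "blinfun_apply w x = norm x"
      using Hahn_Banach_norming_functional by blast
    with that[of w] show ?thesis by simp
  qed
  have cD: "norm2 m (g v) \<le> c" if "v \<in> ?D" for v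
  proof -
    have "c * norm v \<le> c * 1" using that c(2) by (intro mult_left_mono) auto
    then show ?thesis using c(1)[of v] by simp
  qed
  define x where "x = lim (\<lambda>n. LINT x|m. indicator (E n) x *\<^sub>R \<Phi> x)"
  have x: "blinfun_apply v x = (LINT y|m. blinfun_apply v (\<Phi> y))" if "v \<in> ?D" for v
    unfolding x_def
  proof (rule weak_integral_by_exhaustion(3)[where D="?D" and f=f and g=g and c=c])
    show "norm y \<le> a" if "\<And>v. v \<in> ?D \<Longrightarrow> blinfun_apply v y \<le> a" for y :: 'v and a by (rule D[OF that])
    show "norm2 m (g v) \<le> c" if "v \<in> ?D" for v by (rule cD[OF that])
    show "v \<in> ?D" by (rule that)
  qed (use f g \<Phi> bound E1 E2 E3 in simp_all)
  show thesis
  proof (rule that)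
    fix v :: "'v \<Rightarrow>\<^sub>L real"
    have "blinfun_apply v y = norm v * blinfun_apply (sgn v) y" for y
      by (cases "v = 0") (simp_all add: sgn_div_norm blinfun.scaleR_left)
    moreover have "sgn v \<in> ?D" by (simp add: norm_sgn)
    ultimately show "blinfun_apply v x = (LINT y|m. blinfun_apply v (\<Phi> y))"
      using x[of "sgn v"] by simp
  qed
qed

section \<open>Characteristic functions and joint distributions\<close>

definition cf :: "'w measure \<Rightarrow> ('w \<Rightarrow> real) \<Rightarrow> complex"
  where "cf P X = (CLINT \<omega>|P. iexp (X \<omega>))"

lemma integrable_bounded_iexp:
  assumes "finite_measure P" "q \<in> borel_measurable P" "X \<in> borel_measurable P"
    "\<And>\<omega>. \<bar>q \<omega>\<bar> \<le> (B::real)"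
  shows "integrable P (\<lambda>\<omega>. complex_of_real (q \<omega>) * iexp (X \<omega>))"
proof -
  interpret finite_measure P by fact
  have "complex_of_real \<circ> q \<in> borel_measurable P" "(\<lambda>\<omega>. iexp (X \<omega>)) \<in> borel_measurable P"
    using assms by (auto intro!: measurable_compose[OF assms(2)] measurable_compose[OF assms(3)] borel_measurable_continuous_onI continuous_intros simp: comp_def)
  then show ?thesis
    using assms(4) by (intro integrable_const_bound[where B=B] AE_I2 borel_measurable_times) (auto simp: norm_mult comp_def)
qed

lemma cf_cong_AE:
  assumes "X \<in> borel_measurable P" "Y \<in> borel_measurable P" "AE \<omega> in P. X \<omega> = Y \<omega>"
  shows "cf P X = cf P Y"
  unfolding cf_def
proof (rule integral_cong_AE)
  show "AE \<omega> in P. iexp (X \<omega>) = iexp (Y \<omega>)" using assms(3) by eventually_elim simp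
qed (use assms in measurable)

lemma cf_distr:
  assumes "X \<in> borel_measurable P"
  shows "char (distr P borel X) t = cf P (\<lambda>\<omega>. t * X \<omega>)"
  unfolding char_def cf_def using assms by (subst integral_distr) auto

text \<open>
  After normalization an integrable weight \<open>h\<close> turns \<open>Q\<close> into a
  probability measure, so that uniqueness of characteristic functions on the line becomes
  applicable to weighted ones.
\<close>

lemma weighted_distribution:
  fixes c :: real
  assumes Q: "integrable Q h" "X \<in> borel_measurable Q" "\<And>\<omega>. 0 \<le> h \<omega>" "c = (LINT \<omega>|Q. h \<omega>)"
    and c: "c > 0" and B[measurable]: "B \<in> sets borel"
  shows "real_distribution (distr (density Q (\<lambda>\<omega>. ennreal (h \<omega> / c))) borel X)"
    "char (distr (density Q (\<lambda>\<omega>. ennreal (h \<omega> / c))) borel X) t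
      = (CLINT \<omega>|Q. complex_of_real (h \<omega>) * iexp (t * X \<omega>)) / complex_of_real c"
    "measure (distr (density Q (\<lambda>\<omega>. ennreal (h \<omega> / c))) borel X) B
      = (LINT \<omega>|Q. h \<omega> * indicator B (X \<omega>)) / c"
proof -
  note [measurable] = borel_measurable_integrable[OF Q(1)] Q(2)
  let ?D = "density Q (\<lambda>\<omega>. ennreal (h \<omega> / c))"
  have "emeasure ?D (space ?D) = (\<integral>\<^sup>+ \<omega>. ennreal (h \<omega> / c) \<partial>Q)"
    by (simp add: emeasure_density cong: nn_integral_cong_simp)
  also have "\<dots> = ennreal (LINT \<omega>|Q. h \<omega> / c)"
    using Q c by (intro nn_integral_eq_integral) auto
  also have "\<dots> = 1" using Q(4) c by simp
  finally have D: "prob_space ?D" by (rule prob_spaceI)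
  interpret D: prob_space ?D by fact
  show "real_distribution (distr ?D borel X)" by (rule D.real_distribution_distr) simp
  show "char (distr ?D borel X) t
    = (CLINT \<omega>|Q. complex_of_real (h \<omega>) * iexp (t * X \<omega>)) / complex_of_real c"
  proof -
    have "char (distr ?D borel X) t = (CLINT \<omega>|Q. (h \<omega> / c) *\<^sub>R iexp (t * X \<omega>))"
      unfolding char_def using Q(3) c by (simp add: integral_distr integral_density)
    also have "\<dots> = (CLINT \<omega>|Q. (complex_of_real (h \<omega>) * iexp (t * X \<omega>)) / complex_of_real c)"
      by (intro Bochner_Integration.integral_cong) (simp_all add: scaleR_conv_of_real)
    finally show ?thesis by simp
  qed
  have "measure (distr ?D borel X) B = (LINT x|distr ?D borel X. indicator B x)" by simp
  also have "\<dots> = (LINT \<omega>|?D. indicator B (X \<omega>))" by (rule integral_distr) auto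
  also have "\<dots> = (LINT \<omega>|Q. (h \<omega> / c) *\<^sub>R indicator B (X \<omega>))"
    using Q(3) c by (intro integral_density) auto
  finally show "measure (distr ?D borel X) B = (LINT \<omega>|Q. h \<omega> * indicator B (X \<omega>)) / c" by simp
qed

lemma weighted_Levy_uniqueness:
  fixes P1 :: "'a measure" and P2 :: "'b measure"
  assumes P: "prob_space P1" "prob_space P2"
    and meas[measurable]: "h1 \<in> borel_measurable P1" "X1 \<in> borel_measurable P1"
      "h2 \<in> borel_measurable P2" "X2 \<in> borel_measurable P2"
    and h: "\<And>\<omega>. 0 \<le> h1 \<omega>" "\<And>\<omega>. h1 \<omega> \<le> K" "\<And>\<omega>. 0 \<le> h2 \<omega>" "\<And>\<omega>. h2 \<omega> \<le> (K::real)"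
    and eq: "\<And>t. (CLINT \<omega>|P1. complex_of_real (h1 \<omega>) * iexp (t * X1 \<omega>))
      = (CLINT \<omega>|P2. complex_of_real (h2 \<omega>) * iexp (t * X2 \<omega>))"
    and B[measurable]: "B \<in> sets borel"
  shows "(LINT \<omega>|P1. h1 \<omega> * indicator B (X1 \<omega>)) = (LINT \<omega>|P2. h2 \<omega> * indicator B (X2 \<omega>))"
proof -
  define c where "c = (LINT \<omega>|P1. h1 \<omega>)"
  have c2: "c = (LINT \<omega>|P2. h2 \<omega>)"
  proof -
    have "complex_of_real (LINT \<omega>|P1. h1 \<omega>) = complex_of_real (LINT \<omega>|P2. h2 \<omega>)"
      using eq[of 0] by (simp add: integral_complex_of_real)
    then show ?thesis by (simp add: c_def)
  qed
  have int1: "integrable P1 h1"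
  proof -
    interpret prob_space P1 by (rule P)
    show ?thesis using h by (intro integrable_const_bound[where B=K]) auto
  qed
  have int2: "integrable P2 h2"
  proof -
    interpret prob_space P2 by (rule P)
    show ?thesis using h by (intro integrable_const_bound[where B=K]) auto
  qed
  show ?thesis
  proof (cases "c = 0")
    case True
    have "AE \<omega> in P1. h1 \<omega> = 0" using True int1 h(1) by (simp add: c_def integral_nonneg_eq_0_iff_AE)
    then have "(LINT \<omega>|P1. h1 \<omega> * indicator B (X1 \<omega>)) = (LINT \<omega>|P1. 0)"
      by (intro integral_cong_AE) auto
    moreover have "AE \<omega> in P2. h2 \<omega> = 0" using True int2 h(3) by (simp add: c2 integral_nonneg_eq_0_iff_AE)
    then have "(LINT \<omega>|P2. h2 \<omega> * indicator B (X2 \<omega>)) = (LINT \<omega>|P2. 0)"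
      by (intro integral_cong_AE) auto
    ultimately show ?thesis by simp
  next
    case False
    have "c \<ge> 0" unfolding c_def by (rule Bochner_Integration.integral_nonneg) (rule h)
    with False have c: "c > 0" by simp
    note D1 = weighted_distribution[OF int1 meas(2) h(1) c_def c B]
    note D2 = weighted_distribution[OF int2 meas(4) h(3) c2 c B]
    have "distr (density P1 (\<lambda>\<omega>. ennreal (h1 \<omega> / c))) borel X1
      = distr (density P2 (\<lambda>\<omega>. ennreal (h2 \<omega> / c))) borel X2"
      using D1 D2 eq by (intro Levy_uniqueness ext) auto
    then show ?thesis using D1 D2 c by simp
  qed
qed

lemma complex_integral_Re_Im:
  assumes "integrable P (\<lambda>\<omega>. complex_of_real (q \<omega>) * iexp (s \<omega>))"
  shows "(LINT \<omega>|P. q \<omega> * cos (s \<omega>)) = Re (CLINT \<omega>|P. complex_of_real (q \<omega>) * iexp (s \<omega>))"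
    and "(LINT \<omega>|P. q \<omega> * sin (s \<omega>)) = Im (CLINT \<omega>|P. complex_of_real (q \<omega>) * iexp (s \<omega>))"
  using integral_Re[OF assms] integral_Im[OF assms] by (simp_all add: cis_conv_exp[symmetric])

text \<open>
  One coordinate of a characteristic function is converted into an indicator. Complex weights
  \<open>iexp s\<close> are handled through the nonnegative weights \<open>1 + cos s\<close> and
  \<open>1 + sin s\<close>, whose transforms are combinations of the assumed equalities at
  \<open>\<sigma> = 0, 1, - 1\<close>.
\<close>

lemma weighted_cf_indicator:
  fixes P1 :: "'a measure" and P2 :: "'b measure"
  assumes P: "prob_space P1" "prob_space P2"
    and meas[measurable]: "q1 \<in> borel_measurable P1" "X1 \<in> borel_measurable P1" "s1 \<in> borel_measurable P1"
      "q2 \<in> borel_measurable P2" "X2 \<in> borel_measurable P2" "s2 \<in> borel_measurable P2"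
    and q: "\<And>\<omega>. 0 \<le> q1 \<omega>" "\<And>\<omega>. q1 \<omega> \<le> 1" "\<And>\<omega>. 0 \<le> q2 \<omega>" "\<And>\<omega>. q2 \<omega> \<le> (1::real)"
    and eq: "\<And>r \<sigma>. (CLINT \<omega>|P1. complex_of_real (q1 \<omega>) * iexp (r * X1 \<omega> + \<sigma> * s1 \<omega>))
      = (CLINT \<omega>|P2. complex_of_real (q2 \<omega>) * iexp (r * X2 \<omega> + \<sigma> * s2 \<omega>))"
    and B[measurable]: "B \<in> sets borel"
  shows "(CLINT \<omega>|P1. complex_of_real (q1 \<omega> * indicator B (X1 \<omega>)) * iexp (s1 \<omega>))
      = (CLINT \<omega>|P2. complex_of_real (q2 \<omega> * indicator B (X2 \<omega>)) * iexp (s2 \<omega>))"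
proof -
  interpret P1: prob_space P1 by (rule P)
  interpret P2: prob_space P2 by (rule P)
  have q1: "\<bar>q1 \<omega>\<bar> \<le> 1" and q2: "\<bar>q2 \<omega>'\<bar> \<le> 1" for \<omega> \<omega>' using q by auto
  have i1: "integrable P1 (\<lambda>\<omega>. complex_of_real (q1 \<omega>) * iexp (r * X1 \<omega> + \<sigma> * s1 \<omega>))"
    and i2: "integrable P2 (\<lambda>\<omega>. complex_of_real (q2 \<omega>) * iexp (r * X2 \<omega> + \<sigma> * s2 \<omega>))" for r \<sigma>
    by (rule integrable_bounded_iexp[where B=1]; (rule P1.finite_measure_axioms P2.finite_measure_axioms q1 q2 | measurable))+
  (* Euler's formulas express the weights through iexp (sigma * s) with sigma = 0, 1, - 1. *)
  have cosid: "complex_of_real (q * (1 + cos s)) * iexp x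
      = complex_of_real q * iexp (x + 0 * s)
        + (complex_of_real q * iexp (x + 1 * s) + complex_of_real q * iexp (x + (-1) * s)) / 2"
    and sinid: "complex_of_real (q * (1 + sin s)) * iexp x
      = complex_of_real q * iexp (x + 0 * s)
        + (complex_of_real q * iexp (x + 1 * s) - complex_of_real q * iexp (x + (-1) * s)) / (2 * \<i>)" for q s x
  proof -
    have e: "iexp (x + 0 * s) = iexp x" "iexp (x + 1 * s) = iexp x * iexp s" "iexp (x + (-1) * s) = iexp x * iexp (- s)"
      by (simp_all add: exp_add[symmetric] distrib_left right_diff_distrib)
    have c: "complex_of_real (cos s) = (iexp s + iexp (- s)) / 2" "complex_of_real (sin s) = (iexp s - iexp (- s)) / (2 * \<i>)"
      by (simp_all add: cos_of_real[symmetric] sin_of_real[symmetric] cos_exp_eq sin_exp_eq)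
    have g: "z * (1 + (a + b) / 2) * E = z * E + (z * (E * a) + z * (E * b)) / 2"
      "z * (1 + (a - b) / (2 * \<i>)) * E = z * E + (z * (E * a) - z * (E * b)) / (2 * \<i>)" for z a b E :: complex
      by (simp_all add: field_simps)
    show "complex_of_real (q * (1 + cos s)) * iexp x
      = complex_of_real q * iexp (x + 0 * s)
        + (complex_of_real q * iexp (x + 1 * s) + complex_of_real q * iexp (x + (-1) * s)) / 2"
      unfolding e unfolding of_real_mult of_real_add of_real_1 c by (rule g)
    show "complex_of_real (q * (1 + sin s)) * iexp x
      = complex_of_real q * iexp (x + 0 * s)
        + (complex_of_real q * iexp (x + 1 * s) - complex_of_real q * iexp (x + (-1) * s)) / (2 * \<i>)"
      unfolding e unfolding of_real_mult of_real_add of_real_1 c by (rule g)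
  qed
  have "(LINT \<omega>|P1. q1 \<omega> * (1 + cos (s1 \<omega>)) * indicator B (X1 \<omega>))
      = (LINT \<omega>|P2. q2 \<omega> * (1 + cos (s2 \<omega>)) * indicator B (X2 \<omega>))"
  proof (rule weighted_Levy_uniqueness[OF P, where K=2])
    show "(CLINT \<omega>|P1. complex_of_real (q1 \<omega> * (1 + cos (s1 \<omega>))) * iexp (t * X1 \<omega>))
      = (CLINT \<omega>|P2. complex_of_real (q2 \<omega> * (1 + cos (s2 \<omega>))) * iexp (t * X2 \<omega>))" for t
      unfolding cosid
      by (simp only: Bochner_Integration.integral_add Bochner_Integration.integrable_add integrable_divide i1 i2
          integral_divide_zero eq)
    show "0 \<le> q1 \<omega> * (1 + cos (s1 \<omega>))" for \<omega>
      using cos_ge_minus_one[of "s1 \<omega>"] by (intro mult_nonneg_nonneg q(1)) linarith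
    show "0 \<le> q2 \<omega> * (1 + cos (s2 \<omega>))" for \<omega>
      using cos_ge_minus_one[of "s2 \<omega>"] by (intro mult_nonneg_nonneg q(3)) linarith
    show "q1 \<omega> * (1 + cos (s1 \<omega>)) \<le> 2" for \<omega>
      using mult_mono[OF q(2)[of \<omega>], of "1 + cos (s1 \<omega>)" 2] cos_le_one[of "s1 \<omega>"] cos_ge_minus_one[of "s1 \<omega>"] by linarith
    show "q2 \<omega> * (1 + cos (s2 \<omega>)) \<le> 2" for \<omega>
      using mult_mono[OF q(4)[of \<omega>], of "1 + cos (s2 \<omega>)" 2] cos_le_one[of "s2 \<omega>"] cos_ge_minus_one[of "s2 \<omega>"] by linarith
  qed measurable
  moreover have "(LINT \<omega>|P1. q1 \<omega> * (1 + sin (s1 \<omega>)) * indicator B (X1 \<omega>))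
      = (LINT \<omega>|P2. q2 \<omega> * (1 + sin (s2 \<omega>)) * indicator B (X2 \<omega>))"
  proof (rule weighted_Levy_uniqueness[OF P, where K=2])
    show "(CLINT \<omega>|P1. complex_of_real (q1 \<omega> * (1 + sin (s1 \<omega>))) * iexp (t * X1 \<omega>))
      = (CLINT \<omega>|P2. complex_of_real (q2 \<omega> * (1 + sin (s2 \<omega>))) * iexp (t * X2 \<omega>))" for t
      unfolding sinid
      by (simp only: Bochner_Integration.integral_add Bochner_Integration.integral_diff Bochner_Integration.integrable_add Bochner_Integration.integrable_diff integrable_divide i1 i2
          integral_divide_zero eq)
    show "0 \<le> q1 \<omega> * (1 + sin (s1 \<omega>))" for \<omega>
      using sin_ge_minus_one[of "s1 \<omega>"] by (intro mult_nonneg_nonneg q(1)) linarith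
    show "0 \<le> q2 \<omega> * (1 + sin (s2 \<omega>))" for \<omega>
      using sin_ge_minus_one[of "s2 \<omega>"] by (intro mult_nonneg_nonneg q(3)) linarith
    show "q1 \<omega> * (1 + sin (s1 \<omega>)) \<le> 2" for \<omega>
      using mult_mono[OF q(2)[of \<omega>], of "1 + sin (s1 \<omega>)" 2] sin_le_one[of "s1 \<omega>"] sin_ge_minus_one[of "s1 \<omega>"] by linarith
    show "q2 \<omega> * (1 + sin (s2 \<omega>)) \<le> 2" for \<omega>
      using mult_mono[OF q(4)[of \<omega>], of "1 + sin (s2 \<omega>)" 2] sin_le_one[of "s2 \<omega>"] sin_ge_minus_one[of "s2 \<omega>"] by linarith
  qed measurable
  moreover have "(LINT \<omega>|P1. q1 \<omega> * indicator B (X1 \<omega>)) = (LINT \<omega>|P2. q2 \<omega> * indicator B (X2 \<omega>))"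
    by (rule weighted_Levy_uniqueness[OF P, where K=1]) (use eq[of _ 0] q in simp_all)
  moreover have j1: "integrable P1 (\<lambda>\<omega>. q1 \<omega> * indicator B (X1 \<omega>))"
    "integrable P1 (\<lambda>\<omega>. q1 \<omega> * indicator B (X1 \<omega>) * cos (s1 \<omega>))"
    "integrable P1 (\<lambda>\<omega>. q1 \<omega> * indicator B (X1 \<omega>) * sin (s1 \<omega>))"
    using q1 abs_cos_le_one abs_sin_le_one
    by (auto intro!: P1.integrable_const_bound[where B=1] AE_I2 mult_le_one split: split_indicator simp: abs_mult)
  moreover have j2: "integrable P2 (\<lambda>\<omega>. q2 \<omega> * indicator B (X2 \<omega>))"
    "integrable P2 (\<lambda>\<omega>. q2 \<omega> * indicator B (X2 \<omega>) * cos (s2 \<omega>))"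
    "integrable P2 (\<lambda>\<omega>. q2 \<omega> * indicator B (X2 \<omega>) * sin (s2 \<omega>))"
    using q2 abs_cos_le_one abs_sin_le_one
    by (auto intro!: P2.integrable_const_bound[where B=1] AE_I2 mult_le_one split: split_indicator simp: abs_mult)
  ultimately have re: "(LINT \<omega>|P1. q1 \<omega> * indicator B (X1 \<omega>) * cos (s1 \<omega>)) = (LINT \<omega>|P2. q2 \<omega> * indicator B (X2 \<omega>) * cos (s2 \<omega>))"
    and im: "(LINT \<omega>|P1. q1 \<omega> * indicator B (X1 \<omega>) * sin (s1 \<omega>)) = (LINT \<omega>|P2. q2 \<omega> * indicator B (X2 \<omega>) * sin (s2 \<omega>))"
    by (simp_all add: distrib_left distrib_right mult.assoc mult.commute[of "indicator _ _"])
  have k1: "integrable P1 (\<lambda>\<omega>. complex_of_real (q1 \<omega> * indicator B (X1 \<omega>)) * iexp (s1 \<omega>))"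
    by (rule integrable_bounded_iexp[where B=1]) (use q1 in \<open>auto simp: P1.finite_measure_axioms split: split_indicator\<close>)
  have k2: "integrable P2 (\<lambda>\<omega>. complex_of_real (q2 \<omega> * indicator B (X2 \<omega>)) * iexp (s2 \<omega>))"
    by (rule integrable_bounded_iexp[where B=1]) (use q2 in \<open>auto simp: P2.finite_measure_axioms split: split_indicator\<close>)
  show ?thesis
    using re im unfolding complex_integral_Re_Im[OF k1] complex_integral_Re_Im[OF k2]
    by (intro complex_eqI)
qed

lemma measure_rectangle_eq_integral:
  assumes [measurable]: "\<And>i. X i \<in> borel_measurable Q" "\<And>i. B i \<in> sets borel"
  shows "complex_of_real (measure Q {\<omega>\<in>space Q. \<forall>i<n. X i \<omega> \<in> B i})
    = (CLINT \<omega>|Q. complex_of_real (\<Prod>i<(n::nat). indicator (B i) (X i \<omega>)))"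
proof -
  have "(LINT \<omega>|Q. (\<Prod>i<n. indicator (B i) (X i \<omega>)))
    = (LINT \<omega>|Q. indicat_real {\<omega>\<in>space Q. \<forall>i<n. X i \<omega> \<in> B i} \<omega>)"
  proof (rule Bochner_Integration.integral_cong[OF refl])
    fix \<omega> assume "\<omega> \<in> space Q"
    then show "(\<Prod>i<n. indicat_real (B i) (X i \<omega>)) = indicator {\<omega>\<in>space Q. \<forall>i<n. X i \<omega> \<in> B i} \<omega>"
      by (auto simp: indicator_def prod_zero_iff intro: prod.neutral)
  qed
  also have "\<dots> = measure Q {\<omega>\<in>space Q. \<forall>i<n. X i \<omega> \<in> B i}"
    by (simp add: Int_absorb2)
  finally show ?thesis by (simp only: integral_complex_of_real)
qed

text \<open>
  Coordinates are converted into indicators one after the other, which reduces uniqueness in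
  \<open>n\<close> dimensions to uniqueness in dimension one.
\<close>

lemma cf_determines_rectangles:
  fixes P1 :: "'a measure" and P2 :: "'b measure" and X1 :: "nat \<Rightarrow> 'a \<Rightarrow> real" and X2 :: "nat \<Rightarrow> 'b \<Rightarrow> real"
  assumes P: "prob_space P1" "prob_space P2"
    and meas[measurable]: "\<And>i. X1 i \<in> borel_measurable P1" "\<And>i. X2 i \<in> borel_measurable P2"
    and eq: "\<And>t. cf P1 (\<lambda>\<omega>. \<Sum>i<n. t i * X1 i \<omega>) = cf P2 (\<lambda>\<omega>. \<Sum>i<n. t i * X2 i \<omega>)"
    and B[measurable]: "\<And>i. B i \<in> sets borel"
  shows "measure P1 {\<omega>\<in>space P1. \<forall>i<n. X1 i \<omega> \<in> B i} = measure P2 {\<omega>\<in>space P2. \<forall>i<n. X2 i \<omega> \<in> B i}"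
proof -
  have step: "(CLINT \<omega>|P1. complex_of_real (\<Prod>i<k. indicator (B i) (X1 i \<omega>)) * iexp (\<Sum>i=k..<n. t i * X1 i \<omega>))
    = (CLINT \<omega>|P2. complex_of_real (\<Prod>i<k. indicator (B i) (X2 i \<omega>)) * iexp (\<Sum>i=k..<n. t i * X2 i \<omega>))"
    if "k \<le> n" for k t
    using that
  proof (induction k arbitrary: t)
    case 0
    then show ?case using eq[of t] by (simp add: cf_def atLeast0LessThan)
  next
    case (Suc k)
    have "(CLINT \<omega>|P1. complex_of_real ((\<Prod>i<k. indicator (B i) (X1 i \<omega>)) * indicator (B k) (X1 k \<omega>))
        * iexp (\<Sum>i=Suc k..<n. t i * X1 i \<omega>))
      = (CLINT \<omega>|P2. complex_of_real ((\<Prod>i<k. indicator (B i) (X2 i \<omega>)) * indicator (B k) (X2 k \<omega>))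
        * iexp (\<Sum>i=Suc k..<n. t i * X2 i \<omega>))"
    proof (rule weighted_cf_indicator[OF P])
      fix r \<sigma> :: real
      (* Coefficients for which the induction hypothesis gives the two-parameter family in r and
         sigma. *)
      define u where "u i = (if i = k then r else \<sigma> * t i)" for i
      have split: "(\<Sum>i=k..<n. u i * x i) = r * x k + \<sigma> * (\<Sum>i=Suc k..<n. t i * x i)" for x :: "nat \<Rightarrow> real"
      proof -
        have "(\<Sum>i=k..<n. u i * x i) = u k * x k + (\<Sum>i=Suc k..<n. u i * x i)"
          using Suc.prems by (simp add: sum.atLeast_Suc_lessThan)
        also have "(\<Sum>i=Suc k..<n. u i * x i) = (\<Sum>i=Suc k..<n. \<sigma> * (t i * x i))"
          by (intro sum.cong) (auto simp: u_def)
        finally show ?thesis by (simp add: u_def sum_distrib_left)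
      qed
      show "(CLINT \<omega>|P1. complex_of_real (\<Prod>i<k. indicator (B i) (X1 i \<omega>))
          * iexp (r * X1 k \<omega> + \<sigma> * (\<Sum>i=Suc k..<n. t i * X1 i \<omega>)))
        = (CLINT \<omega>|P2. complex_of_real (\<Prod>i<k. indicator (B i) (X2 i \<omega>))
          * iexp (r * X2 k \<omega> + \<sigma> * (\<Sum>i=Suc k..<n. t i * X2 i \<omega>)))"
        using Suc.IH[of u] Suc.prems by (simp only: split Suc_leD)
    qed (auto intro!: prod_nonneg prod_le_1)
    then show ?case by simp
  qed
  have "complex_of_real (measure P1 {\<omega>\<in>space P1. \<forall>i<n. X1 i \<omega> \<in> B i})
    = complex_of_real (measure P2 {\<omega>\<in>space P2. \<forall>i<n. X2 i \<omega> \<in> B i})"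
    using step[of n "\<lambda>_. 0"] measure_rectangle_eq_integral[OF meas(1) B, of n]
      measure_rectangle_eq_integral[OF meas(2) B, of n] by simp
  then show ?thesis by simp
qed

theorem cf_determines_joint_distribution:
  fixes P1 :: "'a measure" and P2 :: "'b measure" and X1 :: "nat \<Rightarrow> 'a \<Rightarrow> real" and X2 :: "nat \<Rightarrow> 'b \<Rightarrow> real"
  assumes P: "prob_space P1" "prob_space P2"
    and meas[measurable]: "\<And>i. X1 i \<in> borel_measurable P1" "\<And>i. X2 i \<in> borel_measurable P2"
    and eq: "\<And>n t. cf P1 (\<lambda>\<omega>. \<Sum>i<n. t i * X1 i \<omega>) = cf P2 (\<lambda>\<omega>. \<Sum>i<n. t i * X2 i \<omega>)"
  shows "distr P1 (PiM UNIV (\<lambda>_. borel)) (\<lambda>\<omega> i. X1 i \<omega>) = distr P2 (PiM UNIV (\<lambda>_. borel)) (\<lambda>\<omega> i. X2 i \<omega>)"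
proof (rule measure_eqI_PiM_infinite[where I=UNIV and M="\<lambda>_::nat. borel :: real measure"])
  interpret P1: prob_space P1 by (rule P)
  interpret P2: prob_space P2 by (rule P)
  have m1[measurable]: "(\<lambda>\<omega> i. X1 i \<omega>) \<in> measurable P1 (PiM UNIV (\<lambda>_. borel))"
    and m2[measurable]: "(\<lambda>\<omega> i. X2 i \<omega>) \<in> measurable P2 (PiM UNIV (\<lambda>_. borel))"
    by (auto intro!: measurable_PiM_single')
  show "finite_measure (distr P1 (PiM UNIV (\<lambda>_. borel)) (\<lambda>\<omega> i. X1 i \<omega>))"
    by (intro prob_space.finite_measure P1.prob_space_distr m1)
  fix A :: "nat \<Rightarrow> real set" and J :: "nat set"
  assume J: "finite J" "J \<subseteq> UNIV" and A: "\<And>i. i \<in> J \<Longrightarrow> A i \<in> sets borel"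
  (* The first n coordinates include J; the remaining sides are UNIV. *)
  define n where "n = Suc (Max (insert 0 J))"
  have Jn: "i < n" if "i \<in> J" for i using that J(1) unfolding n_def by (simp add: less_Suc_eq_le)
  define B where "B i = (if i \<in> J then A i else UNIV)" for i
  have B: "B i \<in> sets borel" for i using A by (simp add: B_def)
  let ?E = "prod_emb UNIV (\<lambda>_. borel) J (Pi\<^sub>E J A)"
  have mem: "x \<in> ?E \<longleftrightarrow> (\<forall>i<n. x i \<in> B i)" for x :: "nat \<Rightarrow> real"
    using Jn by (auto simp: prod_emb_iff B_def PiE_iff)
  have E: "?E \<in> sets (PiM UNIV (\<lambda>_. borel))"
    using J A by (intro sets_PiM_I) auto
  have "emeasure (distr P1 (PiM UNIV (\<lambda>_. borel)) (\<lambda>\<omega> i. X1 i \<omega>)) ?E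
    = ennreal (measure P1 {\<omega>\<in>space P1. \<forall>i<n. X1 i \<omega> \<in> B i})"
    by (simp add: emeasure_distr[OF m1 E] vimage_def mem P1.emeasure_eq_measure Int_def conj_commute)
  also have "\<dots> = ennreal (measure P2 {\<omega>\<in>space P2. \<forall>i<n. X2 i \<omega> \<in> B i})"
    by (simp only: cf_determines_rectangles[OF P meas eq B])
  also have "\<dots> = emeasure (distr P2 (PiM UNIV (\<lambda>_. borel)) (\<lambda>\<omega> i. X2 i \<omega>)) ?E"
    by (simp add: emeasure_distr[OF m2 E] vimage_def mem P2.emeasure_eq_measure Int_def conj_commute)
  finally show "emeasure (distr P1 (PiM UNIV (\<lambda>_. borel)) (\<lambda>\<omega> i. X1 i \<omega>)) ?E
    = emeasure (distr P2 (PiM UNIV (\<lambda>_. borel)) (\<lambda>\<omega> i. X2 i \<omega>)) ?E" .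
qed simp_all

section \<open>Cylindrical random variables induced by genuine ones\<close>

text \<open>
  Linearity holds almost surely, with an exceptional set that depends on the arguments, as the
  values are random variables up to null sets.
\<close>

definition cyl_random_variable ::
    "'w measure \<Rightarrow> (('v::real_normed_vector \<Rightarrow>\<^sub>L real) \<Rightarrow> 'w \<Rightarrow> real) \<Rightarrow> bool"
  where "cyl_random_variable P X \<longleftrightarrow> (\<forall>v. X v \<in> borel_measurable P) \<and>
    (\<forall>u v c. AE \<omega> in P. X (u + c *\<^sub>R v) \<omega> = X u \<omega> + c * X v \<omega>)"

definition induced_by_variable ::
    "'w measure \<Rightarrow> (('v::real_normed_vector \<Rightarrow>\<^sub>L real) \<Rightarrow> 'w \<Rightarrow> real) \<Rightarrow> bool"
  where "induced_by_variable P X \<longleftrightarrow>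
    (\<exists>Z\<in>borel_measurable P. \<forall>v. AE \<omega> in P. blinfun_apply v (Z \<omega>) = X v \<omega>)"

lemma cyl_random_variable_measurable: "cyl_random_variable P X \<Longrightarrow> X v \<in> borel_measurable P"
  by (simp add: cyl_random_variable_def)

lemma cyl_random_variable_zero:
  assumes "cyl_random_variable P X"
  shows "AE \<omega> in P. X 0 \<omega> = 0"
proof -
  have "AE \<omega> in P. X (0 + (-1) *\<^sub>R 0) \<omega> = X 0 \<omega> + (-1) * X 0 \<omega>"
    using assms unfolding cyl_random_variable_def by blast
  then show ?thesis by simp
qed

lemma cyl_random_variable_scale:
  assumes "cyl_random_variable P X"
  shows "AE \<omega> in P. X (c *\<^sub>R v) \<omega> = c * X v \<omega>"
proof -
  have "AE \<omega> in P. X (0 + c *\<^sub>R v) \<omega> = X 0 \<omega> + c * X v \<omega>"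
    using assms unfolding cyl_random_variable_def by blast
  then show ?thesis using cyl_random_variable_zero[OF assms] by eventually_elim simp
qed

lemma cyl_random_variable_sum:
  fixes n :: nat
  assumes "cyl_random_variable P X"
  shows "AE \<omega> in P. X (\<Sum>i<n. t i *\<^sub>R w i) \<omega> = (\<Sum>i<n. t i * X (w i) \<omega>)"
proof (induction n)
  case 0
  then show ?case using cyl_random_variable_zero[OF assms] by simp
next
  case (Suc n)
  have "AE \<omega> in P. X ((\<Sum>i<n. t i *\<^sub>R w i) + t n *\<^sub>R w n) \<omega> = X (\<Sum>i<n. t i *\<^sub>R w i) \<omega> + t n * X (w n) \<omega>"
    using assms unfolding cyl_random_variable_def by blast
  with Suc.IH show ?case by eventually_elim simp
qed

text \<open>
  A variable that is right on one norming sequence is right for every functional \<open>v\<close>: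
  a second variable, right on the sequence with \<open>v\<close> adjoined, coincides with the
  first almost surely because the original sequence separates points.
\<close>

lemma induced_by_variableI_norming:
  fixes X :: "('v::{banach, second_countable_topology} \<Rightarrow>\<^sub>L real) \<Rightarrow> 'w \<Rightarrow> real"
  assumes X: "cyl_random_variable P X"
    and Z: "\<And>w :: nat \<Rightarrow> 'v \<Rightarrow>\<^sub>L real. norming w \<Longrightarrow>
      \<exists>Z\<in>borel_measurable P. AE \<omega> in P. \<forall>n. blinfun_apply (w n) (Z \<omega>) = X (w n) \<omega>"
  shows "induced_by_variable P X"
proof -
  obtain w :: "nat \<Rightarrow> 'v \<Rightarrow>\<^sub>L real" where w: "norming w" using norming_sequence_exists by blast
  obtain Z0 where Z0: "Z0 \<in> borel_measurable P" "AE \<omega> in P. \<forall>n. blinfun_apply (w n) (Z0 \<omega>) = X (w n) \<omega>"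
    using Z[OF w] by blast
  have "AE \<omega> in P. blinfun_apply v (Z0 \<omega>) = X v \<omega>" for v
  proof -
    let ?c = "1 + norm v"
    have c: "?c > 0" by (simp add: add_pos_nonneg)
    let ?w = "case_nat (v /\<^sub>R ?c) w"
    obtain Z1 where "AE \<omega> in P. \<forall>n. blinfun_apply (?w n) (Z1 \<omega>) = X (?w n) \<omega>"
      using Z[OF norming_adjoin[OF w, of v]] by blast
    with Z0(2) cyl_random_variable_scale[OF X, of "inverse ?c" v] show ?thesis
    proof eventually_elim
      case (elim \<omega>)
      have "Z1 \<omega> = Z0 \<omega>"
      proof (rule norming_separates[OF w])
        fix n
        show "blinfun_apply (w n) (Z1 \<omega>) = blinfun_apply (w n) (Z0 \<omega>)"
          using elim(1)[rule_format, of n] elim(3)[rule_format, of "Suc n"] by simp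
      qed
      with elim(2) elim(3)[rule_format, of 0]
      have "inverse ?c * blinfun_apply v (Z0 \<omega>) = inverse ?c * X v \<omega>"
        by (simp add: blinfun.scaleR_left)
      then show ?case using c by simp
    qed
  qed
  with Z0(1) show ?thesis unfolding induced_by_variable_def by blast
qed

text \<open>
  The set of sequences \<open>y\<close> on which evaluation inverts \<open>R\<close> is measurable
  and has full measure for the law of evaluation under \<open>\<nu>\<close>, hence also for the
  law of the sequence \<open>X (w n)\<close>.
\<close>

lemma cyl_variable_with_Radon_law_on_norming:
  fixes X :: "('v::{banach, second_countable_topology} \<Rightarrow>\<^sub>L real) \<Rightarrow> 'w \<Rightarrow> real"
  assumes P: "prob_space P" and X: "cyl_random_variable P X"
    and \<nu>: "prob_space \<nu>" "sets \<nu> = sets borel"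
    and eq: "\<And>v. cf P (X v) = cf \<nu> (blinfun_apply v)"
    and w: "norming w"
  obtains Z where "Z \<in> borel_measurable P" "AE \<omega> in P. \<forall>n. blinfun_apply (w n) (Z \<omega>) = X (w n) \<omega>"
proof -
  note XM[measurable] = cyl_random_variable_measurable[OF X]
  have vM: "blinfun_apply v \<in> borel_measurable \<nu>" for v :: "'v \<Rightarrow>\<^sub>L real"
    using \<nu>(2) by (simp add: measurable_cong_sets[OF \<nu>(2) refl] borel_measurable_continuous_onI linear_continuous_on blinfun.bounded_linear_right)
  obtain R where R: "R \<in> borel_measurable (PiM UNIV (\<lambda>_::nat. borel))" "\<And>x. R (\<lambda>n. blinfun_apply (w n) x) = x"
    using measurable_left_inverse_of_evaluation[OF w] by blast
  note [measurable] = R(1)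
  have law: "distr P (PiM UNIV (\<lambda>_. borel)) (\<lambda>\<omega> n. X (w n) \<omega>)
    = distr \<nu> (PiM UNIV (\<lambda>_. borel)) (\<lambda>x n. blinfun_apply (w n) x)"
  proof (rule cf_determines_joint_distribution[OF P \<nu>(1) XM vM])
    fix n :: nat and t :: "nat \<Rightarrow> real"
    have "cf P (\<lambda>\<omega>. \<Sum>i<n. t i * X (w i) \<omega>) = cf P (X (\<Sum>i<n. t i *\<^sub>R w i))"
      using cyl_random_variable_sum[OF X, of t w n] by (intro cf_cong_AE) auto
    also have "\<dots> = cf \<nu> (\<lambda>x. \<Sum>i<n. t i * blinfun_apply (w i) x)"
    proof -
      have "blinfun_apply (\<Sum>i<n. t i *\<^sub>R w i) = (\<lambda>x. \<Sum>i<n. t i * blinfun_apply (w i) x)"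
        by (rule ext) (simp add: blinfun.sum_left blinfun.scaleR_left)
      then show ?thesis unfolding eq by simp
    qed
    finally show "cf P (\<lambda>\<omega>. \<Sum>i<n. t i * X (w i) \<omega>) = cf \<nu> (\<lambda>x. \<Sum>i<n. t i * blinfun_apply (w i) x)" .
  qed
  have m1: "(\<lambda>\<omega> n. X (w n) \<omega>) \<in> measurable P (PiM UNIV (\<lambda>_. borel))"
    by (intro measurable_PiM_single') auto
  have m2: "(\<lambda>x n. blinfun_apply (w n) x) \<in> measurable \<nu> (PiM UNIV (\<lambda>_. borel))"
    by (intro measurable_PiM_single') (auto intro: vM)
  have "Measurable.pred (PiM UNIV (\<lambda>_. borel)) (\<lambda>y. blinfun_apply (w n) (R y) = y n)" for n
  proof -
    have [measurable]: "blinfun_apply (w n) \<in> borel_measurable borel"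
      by (intro borel_measurable_continuous_onI linear_continuous_on blinfun.bounded_linear_right)
    have wR: "(\<lambda>y. blinfun_apply (w n) (R y)) \<in> borel_measurable (PiM UNIV (\<lambda>_. borel))"
      by (rule measurable_compose[OF R(1)]) measurable
    show ?thesis unfolding pred_def
      by (rule borel_measurable_eq[OF wR measurable_component_singleton[OF UNIV_I]])
  qed
  then have S: "Measurable.pred (PiM UNIV (\<lambda>_. borel)) (\<lambda>y. \<forall>n. blinfun_apply (w n) (R y) = y n)"
    by measurable
  have "AE y in distr \<nu> (PiM UNIV (\<lambda>_. borel)) (\<lambda>x n. blinfun_apply (w n) x). \<forall>n. blinfun_apply (w n) (R y) = y n"
    using S by (subst AE_distr_iff[OF m2]) (auto simp: R(2) pred_def)
  then have "AE \<omega> in P. \<forall>n. blinfun_apply (w n) (R (\<lambda>n. X (w n) \<omega>)) = X (w n) \<omega>"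
    unfolding law[symmetric] by (rule AE_distrD[OF m1])
  with measurable_compose[OF m1 R(1)] show thesis by (rule that)
qed

theorem cyl_variable_with_Radon_law_induced:
  fixes X :: "('v::{banach, second_countable_topology} \<Rightarrow>\<^sub>L real) \<Rightarrow> 'w \<Rightarrow> real"
  assumes P: "prob_space P" and X: "cyl_random_variable P X"
    and \<nu>: "prob_space \<nu>" "sets \<nu> = sets borel"
    and eq: "\<And>v. cf P (X v) = cf \<nu> (blinfun_apply v)"
  shows "induced_by_variable P X"
proof (rule induced_by_variableI_norming[OF X])
  fix w :: "nat \<Rightarrow> 'v \<Rightarrow>\<^sub>L real" assume "norming w"
  from cyl_variable_with_Radon_law_on_norming[OF assms this]
  show "\<exists>Z\<in>borel_measurable P. AE \<omega> in P. \<forall>n. blinfun_apply (w n) (Z \<omega>) = X (w n) \<omega>" by blast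
qed

section \<open>Cancelling an independent summand\<close>

text \<open>
  An independent copy of \<open>Y\<close> is integrated out. The product formula says that
  \<open>X(\<omega>) + Y(\<omega>')\<close> on the square of the probability space has the
  characteristic functions of \<open>X + Y\<close>, hence a Radon law, hence is induced by some
  \<open>Z'\<close>. For almost every fixed \<open>\<omega>\<close> the weak integral of
  \<open>Z'(\<omega>, \<cdot>)\<close> exists and equals \<open>X(\<omega>)\<close> tested against
  \<open>w n\<close>, because \<open>Y\<close> is centred. It is the limit of the truncated
  integrals \<open>S k\<close>, which shows that it depends measurably on \<open>\<omega>\<close>.
\<close>

theorem induced_cancel_independent_summand:
  fixes X Y :: "('v::{banach, second_countable_topology} \<Rightarrow>\<^sub>L real) \<Rightarrow> 'w \<Rightarrow> real"
  assumes P: "prob_space P" and X: "cyl_random_variable P X" and Y: "cyl_random_variable P Y"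
    and Y2: "\<And>v. Y v \<in> L2_fun P" "\<And>v. norm2 P (Y v) \<le> c * norm v" "c \<ge> 0"
    and Y0: "\<And>v. (LINT \<omega>|P. Y v \<omega>) = 0"
    and indep: "\<And>v. cf P (\<lambda>\<omega>. X v \<omega> + Y v \<omega>) = cf P (X v) * cf P (Y v)"
    and ind: "induced_by_variable P (\<lambda>v \<omega>. X v \<omega> + Y v \<omega>)"
  shows "induced_by_variable P X"
proof (rule induced_by_variableI_norming[OF X])
  interpret prob_space P by (rule P)
  interpret PP: pair_prob_space P P ..
  note XM[measurable] = cyl_random_variable_measurable[OF X]
  note YM[measurable] = cyl_random_variable_measurable[OF Y]
  fix w :: "nat \<Rightarrow> 'v \<Rightarrow>\<^sub>L real" assume w: "norming w"
  let ?Q = "P \<Otimes>\<^sub>M P"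
  let ?XY = "\<lambda>v z. X v (fst z) + Y v (snd z)"
  obtain Z where Z[measurable]: "Z \<in> borel_measurable P"
    and ZXY: "\<And>v. AE \<omega> in P. blinfun_apply v (Z \<omega>) = X v \<omega> + Y v \<omega>"
    using ind by (auto simp: induced_by_variable_def)
  have fM: "blinfun_apply v \<in> borel_measurable borel" for v :: "'v \<Rightarrow>\<^sub>L real"
    by (intro borel_measurable_continuous_onI linear_continuous_on blinfun.bounded_linear_right)
  note [measurable] = fM
  have XY: "cyl_random_variable ?Q ?XY"
    unfolding cyl_random_variable_def
  proof (intro conjI allI)
    show "?XY v \<in> borel_measurable ?Q" for v by measurable
    fix u v and c :: real
    have "AE \<omega> in P. X (u + c *\<^sub>R v) \<omega> = X u \<omega> + c * X v \<omega>"
      "AE \<omega> in P. Y (u + c *\<^sub>R v) \<omega> = Y u \<omega> + c * Y v \<omega>"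
      using X Y by (auto simp: cyl_random_variable_def)
    then have "AE \<omega> in P. AE \<omega>' in P. X (u + c *\<^sub>R v) \<omega> + Y (u + c *\<^sub>R v) \<omega>' = X u \<omega> + Y u \<omega>' + c * (X v \<omega> + Y v \<omega>')"
    proof eventually_elim
      case (elim \<omega>)
      from \<open>AE \<omega> in P. Y (u + c *\<^sub>R v) \<omega> = Y u \<omega> + c * Y v \<omega>\<close> show ?case
        by eventually_elim (simp add: elim distrib_left)
    qed
    then show "AE z in ?Q. ?XY (u + c *\<^sub>R v) z = ?XY u z + c * ?XY v z"
      by (intro PP.AE_pair_measure) (simp_all, measurable)
  qed
  obtain Z' where Z'[measurable]: "Z' \<in> borel_measurable ?Q"
    and "AE z in ?Q. \<forall>n. blinfun_apply (w n) (Z' z) = ?XY (w n) z"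
  proof (rule cyl_variable_with_Radon_law_on_norming[OF PP.prob_space_axioms XY _ _ _ w])
    show "prob_space (distr P borel Z)" by (rule prob_space_distr) simp
    show "sets (distr P borel Z) = sets borel" by simp
    fix v
    have i: "integrable ?Q (\<lambda>z. iexp (?XY v z))"
      using integrable_bounded_iexp[OF PP.finite_measure_axioms, of "\<lambda>_. 1" "?XY v" 1] by simp
    have "cf ?Q (?XY v) = (CLINT \<omega>|P. (CLINT \<omega>'|P. iexp (X v \<omega>) * iexp (Y v \<omega>')))"
      unfolding cf_def using PP.integral_fst'[OF i] by (simp add: distrib_left exp_add)
    also have "\<dots> = cf P (X v) * cf P (Y v)" by (simp add: cf_def)
    also have "\<dots> = cf P (\<lambda>\<omega>. blinfun_apply v (Z \<omega>))"
      unfolding indep[symmetric] using ZXY[of v] by (intro cf_cong_AE) (auto simp: eq_commute)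
    also have "\<dots> = cf (distr P borel Z) (blinfun_apply v)"
      unfolding cf_def by (subst integral_distr) auto
    finally show "cf ?Q (?XY v) = cf (distr P borel Z) (blinfun_apply v)" .
  qed
  from PP.AE_pair[OF this(2)]
  have AE2: "AE \<omega> in P. AE \<omega>' in P. \<forall>n. blinfun_apply (w n) (Z' (\<omega>, \<omega>')) = X (w n) \<omega> + Y (w n) \<omega>'" by simp
  (* Truncation makes the inner integrals Bochner integrals, measurable in the first variable. *)
  define S where "S k \<omega> = (LINT \<omega>'|P. indicator {\<omega>'\<in>space P. norm (Z' (\<omega>, \<omega>')) \<le> real k} \<omega>' *\<^sub>R Z' (\<omega>, \<omega>'))" for k \<omega>
  have Salt: "S k \<omega> = (LINT \<omega>'|P. (if norm (Z' (\<omega>, \<omega>')) \<le> real k then Z' (\<omega>, \<omega>') else 0))" for k \<omega>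
    unfolding S_def by (intro Bochner_Integration.integral_cong) auto
  have [measurable]: "S k \<in> borel_measurable P" for k
    unfolding Salt[abs_def] by measurable
  have limM: "(\<lambda>\<omega>. lim (\<lambda>k. S k \<omega>)) \<in> borel_measurable P"
    by (intro borel_measurable_lim_metric) measurable
  have "AE \<omega> in P. \<forall>n. blinfun_apply (w n) (lim (\<lambda>k. S k \<omega>)) = X (w n) \<omega>"
    using AE2 AE_space
  proof eventually_elim
    case (elim \<omega>)
    let ?\<Phi> = "\<lambda>\<omega>'. Z' (\<omega>, \<omega>')"
    have [measurable]: "?\<Phi> \<in> borel_measurable P" using elim(2) by measurable
    have one: "(\<lambda>_. 1::real) \<in> L2_fun P" "norm2 P (\<lambda>_. 1::real) = 1"
      by (auto simp: L2_fun_iff norm2_def sqnorm_def emeasure_space_1)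
    have eqn: "AE \<omega>' in P. blinfun_apply (w n) (?\<Phi> \<omega>') = X (w n) \<omega> + Y (w n) \<omega>'" for n
      using elim(1) by eventually_elim blast
    have wn: "norm (w n) \<le> 1" for n using w by (simp add: norming_def)
    have Yn: "norm2 P (Y (w n)) \<le> c" for n
      using Y2(2)[of "w n"] mult_left_mono[OF wn[of n] Y2(3)] by simp
    have Yint: "integrable P (Y v)" for v
      using L2_Cauchy_Schwarz(1)[OF Y2(1)[of v] one(1)] by (subst integrable_norm_iff[symmetric]) auto
    (* For fixed omega nothing is known about the size of X (w n), uniformly in n. On a set of
       probability above 1/2 the norm of Z' is at most r, which bounds X (w n) there up to Y (w
       n), and so everywhere because it does not depend on the second variable. *)
    obtain r :: nat where r: "measure P {\<omega>'\<in>space P. norm (?\<Phi> \<omega>') \<le> real r} > 1/2"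
    proof -
      let ?A = "\<lambda>k::nat. {\<omega>'\<in>space P. norm (?\<Phi> \<omega>') \<le> real k}"
      have "(\<lambda>k. measure P (?A k)) \<longlonglongrightarrow> measure P (\<Union>k. ?A k)"
      proof (intro finite_Lim_measure_incseq)
        show "incseq ?A" by (auto simp: incseq_def)
      qed auto
      moreover have "(\<Union>k. ?A k) = space P" by (auto simp: real_arch_simple)
      ultimately have "(\<lambda>k. measure P (?A k)) \<longlonglongrightarrow> 1" by (simp add: prob_space)
      then have "\<forall>\<^sub>F k in sequentially. measure P (?A k) > 1/2" by (rule order_tendstoD) simp
      then show thesis using that by (auto simp: eventually_sequentially)
    qed
    let ?A = "{\<omega>'\<in>space P. norm (?\<Phi> \<omega>') \<le> real r}"
    have xbound: "\<bar>X (w n) \<omega>\<bar> \<le> 2 * (real r + c)" for n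
    proof -
      have "\<bar>X (w n) \<omega>\<bar> * measure P ?A = (LINT \<omega>'|P. indicator ?A \<omega>' * \<bar>X (w n) \<omega>\<bar>)"
        by (simp add: Int_absorb2)
      also have "\<dots> \<le> (LINT \<omega>'|P. real r + \<bar>Y (w n) \<omega>'\<bar>)"
      proof (rule integral_mono_AE)
        show "integrable P (\<lambda>\<omega>'. indicator ?A \<omega>' * \<bar>X (w n) \<omega>\<bar>)"
          by (intro integrable_mult_left integrable_real_indicator) (auto simp: emeasure_eq_measure)
        show "integrable P (\<lambda>\<omega>'. real r + \<bar>Y (w n) \<omega>'\<bar>)"
          by (intro Bochner_Integration.integrable_add integrable_abs Yint) simp
        show "AE \<omega>' in P. indicator ?A \<omega>' * \<bar>X (w n) \<omega>\<bar> \<le> real r + \<bar>Y (w n) \<omega>'\<bar>"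
          using eqn[of n]
        proof eventually_elim
          case (elim \<omega>')
          have "\<bar>blinfun_apply (w n) (?\<Phi> \<omega>')\<bar> \<le> norm (w n) * norm (?\<Phi> \<omega>')"
            using norm_blinfun[of "w n" "?\<Phi> \<omega>'"] by simp
          also have "\<dots> \<le> 1 * norm (?\<Phi> \<omega>')" by (intro mult_right_mono wn) simp
          finally show ?case using elim by (auto split: split_indicator)
        qed
      qed
      also have "\<dots> = real r + (LINT \<omega>'|P. \<bar>Y (w n) \<omega>'\<bar>)"
        using Yint by (simp add: prob_space)
      also have "\<dots> \<le> real r + c"
        using L2_Cauchy_Schwarz(2)[OF Y2(1)[of "w n"] one(1)] one(2) Yn[of n] by simp
      finally have le: "\<bar>X (w n) \<omega>\<bar> * measure P ?A \<le> real r + c" .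
      have "\<bar>X (w n) \<omega>\<bar> * (1/2) \<le> \<bar>X (w n) \<omega>\<bar> * measure P ?A"
        using r by (intro mult_left_mono) auto
      with le show ?thesis by simp
    qed
    let ?g = "\<lambda>v \<omega>'. blinfun_apply v (?\<Phi> \<omega>')"
    have g: "?g (w n) \<in> L2_fun P \<and> norm2 P (?g (w n)) \<le> 2 * (real r + c) + c" for n
    proof -
      let ?h = "\<lambda>\<omega>'. X (w n) \<omega> *\<^sub>R 1 + Y (w n) \<omega>'"
      have h: "?h \<in> L2_fun P" by (intro L2_fun_add L2_fun_scaleR one Y2)
      have eqs: "sqnorm P (?g (w n)) = sqnorm P ?h"
        unfolding sqnorm_def
      proof (rule nn_integral_cong_AE)
        show "AE \<omega>' in P. ennreal ((norm (?g (w n) \<omega>'))\<^sup>2) = ennreal ((norm (?h \<omega>'))\<^sup>2)"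
          using eqn[of n] by eventually_elim simp
      qed
      have "norm2 P ?h \<le> \<bar>X (w n) \<omega>\<bar> + norm2 P (Y (w n))"
        using norm2_triangle[OF L2_fun_scaleR[OF one(1), of "X (w n) \<omega>"] Y2(1)[of "w n"]]
        by (simp only: norm2_scaleR[OF one(1)] one(2) mult_1_right)
      also have "\<dots> \<le> 2 * (real r + c) + c" using xbound Yn by (intro add_mono)
      finally show ?thesis using h eqs by (simp add: L2_fun_iff norm2_def)
    qed
    have w_norming: "norm x \<le> a" if "\<And>v. v \<in> range w \<Longrightarrow> blinfun_apply v x \<le> a" for x a
      using w that unfolding norming_def by blast
    have exh: "blinfun_apply v (lim (\<lambda>k. S k \<omega>)) = (LINT \<omega>'|P. blinfun_apply v (?\<Phi> \<omega>'))" if v: "v \<in> range w" for v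
      unfolding S_def
    proof (rule weak_integral_by_exhaustion(3)[where D="range w" and f="\<lambda>_. 1::real" and g="?g" and c="2 * (real r + c) + c"])
      show "norm x \<le> a" if "\<And>v. v \<in> range w \<Longrightarrow> blinfun_apply v x \<le> a" for x a by (rule w_norming[OF that])
      show "?g v \<in> L2_fun P" "norm2 P (?g v) \<le> 2 * (real r + c) + c" if "v \<in> range w" for v using that g by auto
      show "integrable P (\<lambda>x. indicator {\<omega>'\<in>space P. norm (?\<Phi> \<omega>') \<le> real k} x *\<^sub>R ?\<Phi> x)" for k
        by (rule integrableI_bounded_set_indicator[where B="real k"]) (auto simp: emeasure_eq_measure)
      show "\<forall>\<^sub>F k in sequentially. x \<in> {\<omega>'\<in>space P. norm (?\<Phi> \<omega>') \<le> real k}" if "x \<in> space P" for x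
      proof -
        obtain k0 where "norm (?\<Phi> x) \<le> real k0" using real_arch_simple by blast
        then show ?thesis using that by (intro eventually_sequentiallyI[of k0]) auto
      qed
    qed (use one v in auto)
    show ?case
    proof
      fix n
      have "blinfun_apply (w n) (lim (\<lambda>k. S k \<omega>)) = (LINT \<omega>'|P. blinfun_apply (w n) (?\<Phi> \<omega>'))" by (rule exh) simp
      also have "\<dots> = (LINT \<omega>'|P. X (w n) \<omega> + Y (w n) \<omega>')"
        by (rule integral_cong_AE) (use eqn[of n] in measurable)
      also have "\<dots> = X (w n) \<omega>" using Yint Y0 by (simp add: prob_space)
      finally show "blinfun_apply (w n) (lim (\<lambda>k. S k \<omega>)) = X (w n) \<omega>" .
    qed
  qed
  then show "\<exists>Z\<in>borel_measurable P. AE \<omega> in P. \<forall>n. blinfun_apply (w n) (Z \<omega>) = X (w n) \<omega>"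
    by (rule bexI[OF _ limM])
qed

section \<open>Mean square convergence and approximation of integrands\<close>

lemma integral_abs_le_norm2:
  assumes "prob_space P" "(Z :: 'w \<Rightarrow> real) \<in> L2_fun P"
  shows "integrable P Z" "(LINT \<omega>|P. \<bar>Z \<omega>\<bar>) \<le> norm2 P Z"
proof -
  interpret prob_space P by fact
  have one: "(\<lambda>_. 1::real) \<in> L2_fun P" "norm2 P (\<lambda>_. 1::real) = 1"
    by (auto simp: L2_fun_iff norm2_def sqnorm_def emeasure_space_1)
  show "integrable P Z"
    using L2_Cauchy_Schwarz(1)[OF assms(2) one(1)] L2_funD[OF assms(2)]
    by (subst integrable_norm_iff[symmetric]) auto
  show "(LINT \<omega>|P. \<bar>Z \<omega>\<bar>) \<le> norm2 P Z"
    using L2_Cauchy_Schwarz(2)[OF assms(2) one(1)] one(2) by simp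
qed

text \<open>
  The function \<open>iexp\<close> has Lipschitz constant one.
\<close>

lemma cf_tendsto:
  assumes P: "prob_space P" and Y: "\<And>n. Y n \<in> L2_fun P" "L2_tendsto P Y Z"
  shows "(\<lambda>n. cf P (Y n)) \<longlonglongrightarrow> cf P Z"
proof (rule LIM_zero_cancel, rule Lim_null_comparison)
  interpret prob_space P by (rule P)
  have Z: "Z \<in> L2_fun P" using Y by (simp add: L2_tendsto_iff)
  note [measurable] = L2_funD[OF Y(1)] L2_funD[OF Z]
  show "(\<lambda>n. norm2 P (\<lambda>\<omega>. Y n \<omega> - Z \<omega>)) \<longlonglongrightarrow> 0" using Y by (simp add: L2_tendsto_iff)
  have i: "integrable P (\<lambda>\<omega>. iexp (X \<omega>))" if "X \<in> borel_measurable P" for X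
    using integrable_bounded_iexp[OF finite_measure_axioms, of "\<lambda>_. 1" X 1] that by simp
  have "norm (cf P (Y n) - cf P Z) \<le> norm2 P (\<lambda>\<omega>. Y n \<omega> - Z \<omega>)" for n
  proof -
    have "cf P (Y n) - cf P Z = (CLINT \<omega>|P. iexp (Y n \<omega>) - iexp (Z \<omega>))"
      unfolding cf_def by (intro Bochner_Integration.integral_diff[symmetric] i) measurable
    also have "norm \<dots> \<le> (LINT \<omega>|P. norm (iexp (Y n \<omega>) - iexp (Z \<omega>)))" by (rule integral_norm_bound)
    also have "\<dots> \<le> (LINT \<omega>|P. \<bar>Y n \<omega> - Z \<omega>\<bar>)"
    proof (rule integral_mono)
      show "integrable P (\<lambda>\<omega>. norm (iexp (Y n \<omega>) - iexp (Z \<omega>)))"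
        by (intro integrable_norm Bochner_Integration.integrable_diff i) measurable
      show "integrable P (\<lambda>\<omega>. \<bar>Y n \<omega> - Z \<omega>\<bar>)"
        by (intro integrable_abs integral_abs_le_norm2[OF P L2_fun_diff[OF Y(1) Z]])
      fix \<omega>
      have "iexp (Y n \<omega>) - iexp (Z \<omega>) = iexp (Z \<omega>) * (iexp (Y n \<omega> - Z \<omega>) - 1)"
        by (simp add: right_diff_distrib exp_diff)
      then have "norm (iexp (Y n \<omega>) - iexp (Z \<omega>)) = norm (iexp (Y n \<omega> - Z \<omega>) - 1)"
        by (simp only: norm_mult norm_exp_i_times mult_1)
      also have "\<dots> \<le> \<bar>Y n \<omega> - Z \<omega>\<bar>" using iexp_approx1[of "Y n \<omega> - Z \<omega>" 0] by simp
      finally show "norm (iexp (Y n \<omega>) - iexp (Z \<omega>)) \<le> \<bar>Y n \<omega> - Z \<omega>\<bar>" .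
    qed
    also have "\<dots> \<le> norm2 P (\<lambda>\<omega>. Y n \<omega> - Z \<omega>)" by (rule integral_abs_le_norm2[OF P L2_fun_diff[OF Y(1) Z]])
    finally show ?thesis .
  qed
  then show "\<forall>\<^sub>F n in sequentially. norm (cf P (Y n) - cf P Z) \<le> norm2 P (\<lambda>\<omega>. Y n \<omega> - Z \<omega>)" by simp
qed

lemma norm2_cong_AE:
  assumes "f \<in> borel_measurable m" "g \<in> borel_measurable m" "AE x in m. f x = g x"
  shows "norm2 m f = norm2 m g"
proof -
  have "sqnorm m f = sqnorm m g" unfolding sqnorm_def
  proof (rule nn_integral_cong_AE)
    show "AE x in m. ennreal ((norm (f x))\<^sup>2) = ennreal ((norm (g x))\<^sup>2)"
      using assms(3) by eventually_elim simp
  qed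
  then show ?thesis by (simp add: norm2_def)
qed

lemma L2_fun_indicator_const:
  fixes y :: "'b::{real_normed_vector, second_countable_topology}"
  assumes "A \<in> sets m" "emeasure m A < \<infinity>"
  shows "(\<lambda>x. indicator A x *\<^sub>R y) \<in> L2_fun m"
proof -
  have "sqnorm m (\<lambda>x. indicator A x *\<^sub>R y) = (\<integral>\<^sup>+ x. ennreal ((norm y)\<^sup>2) * indicator A x \<partial>m)"
    unfolding sqnorm_def by (intro nn_integral_cong) (auto split: split_indicator)
  also have "\<dots> = ennreal ((norm y)\<^sup>2) * emeasure m A" using assms(1) by (rule nn_integral_cmult_indicator)
  also have "\<dots> < \<infinity>" using assms(2) by (simp add: ennreal_mult_less_top)
  finally show ?thesis using assms(1) by (simp add: L2_fun_iff)
qed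

lemma norm2_disjoint_sum:
  fixes y :: "nat \<Rightarrow> 'b::{real_normed_vector, second_countable_topology}"
  assumes A: "\<And>k. k < n \<Longrightarrow> A k \<in> sets m" "\<And>k. k < n \<Longrightarrow> emeasure m (A k) < \<infinity>"
    and disj: "disjoint_family_on A {..<n}"
  shows "(\<lambda>x. \<Sum>k<n. indicator (A k) x *\<^sub>R y k) \<in> L2_fun m"
    and "(norm2 m (\<lambda>x. \<Sum>k<n. indicator (A k) x *\<^sub>R y k))\<^sup>2 = (\<Sum>k<n. measure m (A k) * (norm (y k))\<^sup>2)"
proof -
  let ?f = "\<lambda>x. \<Sum>k<n. indicator (A k) x *\<^sub>R y k"
  show L: "?f \<in> L2_fun m" using A by (intro L2_fun_sum L2_fun_indicator_const) auto
  have pw: "(norm (?f x))\<^sup>2 = (\<Sum>k<n. indicator (A k) x * (norm (y k))\<^sup>2)" for x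
  proof (cases "\<exists>j<n. x \<in> A j")
    case True
    then obtain j where j: "j < n" "x \<in> A j" by blast
    then have ij: "indicator (A k) x = (if k = j then 1 else (0::real))" if "k < n" for k
      using that disj by (cases "k = j") (auto simp: disjoint_family_on_def disjoint_iff)
    have "?f x = (\<Sum>k<n. if k = j then y k else 0)" by (intro sum.cong) (auto simp: ij)
    moreover have "(\<Sum>k<n. indicator (A k) x * (norm (y k))\<^sup>2) = (\<Sum>k<n. if k = j then (norm (y k))\<^sup>2 else 0)"
      by (intro sum.cong) (auto simp: ij)
    ultimately show ?thesis using j by (simp add: sum.delta)
  next
    case False
    then have "?f x = 0" "(\<Sum>k<n. indicator (A k) x * (norm (y k))\<^sup>2) = 0" by (auto intro!: sum.neutral)
    then show ?thesis by simp
  qed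
  have "(norm2 m ?f)\<^sup>2 = (LINT x|m. (\<Sum>k<n. indicator (A k) x * (norm (y k))\<^sup>2))"
    by (simp only: norm2_power2[OF L] pw)
  also have "\<dots> = (\<Sum>k<n. LINT x|m. indicator (A k) x * (norm (y k))\<^sup>2)"
    using A by (intro Bochner_Integration.integral_sum integrable_mult_left integrable_real_indicator) auto
  also have "\<dots> = (\<Sum>k<n. measure m (A k) * (norm (y k))\<^sup>2)"
    using A(1)[THEN sets.sets_into_space] by (intro sum.cong refl) (simp add: Int_absorb2)
  finally show "(norm2 m ?f)\<^sup>2 = (\<Sum>k<n. measure m (A k) * (norm (y k))\<^sup>2)" .
qed

context isometric_integral
begin

definition approximable :: "('a \<Rightarrow> 'b) \<Rightarrow> bool"
  where "approximable f \<longleftrightarrow> f \<in> L2_fun m \<and> (\<forall>e>0. \<exists>S\<in>\<S>. norm2 m (\<lambda>x. J S x - f x) < e)"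

lemma approximable_L2: "approximable f \<Longrightarrow> f \<in> L2_fun m"
  by (simp add: approximable_def)

lemma approximable_J: "S \<in> \<S> \<Longrightarrow> approximable (J S)"
  unfolding approximable_def using J_L2 by force

lemma approximable_cong_AE:
  assumes "approximable f" "g \<in> L2_fun m" "AE x in m. f x = g x"
  shows "approximable g"
proof -
  have "norm2 m (\<lambda>x. J S x - f x) = norm2 m (\<lambda>x. J S x - g x)" if "S \<in> \<S>" for S
    using assms L2_funD[OF J_L2[OF that]] L2_funD[OF approximable_L2[OF assms(1)]] L2_funD[OF assms(2)]
    by (intro norm2_cong_AE) auto
  then have "(\<exists>S\<in>\<S>. norm2 m (\<lambda>x. J S x - f x) < e) = (\<exists>S\<in>\<S>. norm2 m (\<lambda>x. J S x - g x) < e)" for e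
    by (intro bex_cong refl) (simp only:)
  then show ?thesis using assms(1,2) unfolding approximable_def by blast
qed

lemma approximable_add_scaleR:
  assumes "approximable f" "approximable g"
  shows "approximable (\<lambda>x. f x + c *\<^sub>R g x)"
  unfolding approximable_def
proof (intro conjI allI impI)
  note fL = approximable_L2[OF assms(1)] and gL = approximable_L2[OF assms(2)]
  show "(\<lambda>x. f x + c *\<^sub>R g x) \<in> L2_fun m" by (intro L2_fun_add L2_fun_scaleR fL gL)
  fix e :: real assume "e > 0"
  obtain S where S: "S \<in> \<S>" "norm2 m (\<lambda>x. J S x - f x) < e / 2"
    using assms(1) \<open>e > 0\<close> unfolding approximable_def by (metis half_gt_zero)
  have "e / (2 * (1 + \<bar>c\<bar>)) > 0" using \<open>e > 0\<close> by (simp add: add_pos_nonneg)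
  then obtain S' where S': "S' \<in> \<S>" "norm2 m (\<lambda>x. J S' x - g x) < e / (2 * (1 + \<bar>c\<bar>))"
    using assms(2) unfolding approximable_def by blast
  obtain R where R: "R \<in> \<S>" "J R = (\<lambda>x. J S x + c *\<^sub>R J S' x)" using combine[OF S(1) S'(1)] by blast
  note D = L2_fun_diff[OF J_L2[OF S(1)] fL] and D' = L2_fun_diff[OF J_L2[OF S'(1)] gL]
  have "norm2 m (\<lambda>x. J R x - (f x + c *\<^sub>R g x)) = norm2 m (\<lambda>x. (J S x - f x) + c *\<^sub>R (J S' x - g x))"
    by (simp add: R(2) algebra_simps)
  also have "\<dots> \<le> norm2 m (\<lambda>x. J S x - f x) + \<bar>c\<bar> * norm2 m (\<lambda>x. J S' x - g x)"
    using norm2_triangle[OF D L2_fun_scaleR[OF D', of c]] by (simp only: norm2_scaleR[OF D'])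
  also have "\<bar>c\<bar> * norm2 m (\<lambda>x. J S' x - g x) \<le> (1 + \<bar>c\<bar>) * norm2 m (\<lambda>x. J S' x - g x)"
    by (intro mult_right_mono) auto
  also have "\<dots> < (1 + \<bar>c\<bar>) * (e / (2 * (1 + \<bar>c\<bar>)))"
    by (rule mult_strict_left_mono[OF S'(2)]) (simp add: add_pos_nonneg)
  also have "\<dots> = e / 2"
  proof -
    have "1 + \<bar>c\<bar> \<noteq> 0" by (simp add: add_pos_nonneg order_less_imp_not_eq2)
    then show ?thesis by (simp add: field_simps)
  qed
  finally have "norm2 m (\<lambda>x. J R x - (f x + c *\<^sub>R g x)) < e" using S(2) by simp
  then show "\<exists>S\<in>\<S>. norm2 m (\<lambda>x. J S x - (f x + c *\<^sub>R g x)) < e" using R(1) by blast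
qed

lemma approximable_zero:
  assumes "approximable f"
  shows "approximable (\<lambda>_. 0)"
  using approximable_add_scaleR[OF assms assms, of "-1"] by simp

lemma approximable_sum:
  assumes "finite A" "approximable (\<lambda>_. 0)" "\<And>i. i \<in> A \<Longrightarrow> approximable (f i)"
  shows "approximable (\<lambda>x. \<Sum>i\<in>A. f i x)"
  using assms
proof (induction A rule: finite_induct)
  case (insert i A)
  then show ?case using approximable_add_scaleR[of "f i" "\<lambda>x. \<Sum>i\<in>A. f i x" 1] by simp
qed simp

lemma approximable_limit:
  assumes f: "\<And>n. approximable (f n)" and lim: "L2_tendsto m f h"
  shows "approximable h"
  unfolding approximable_def
proof (intro conjI allI impI)
  note fL = approximable_L2[OF f]
  have h: "h \<in> L2_fun m" "(\<lambda>n. norm2 m (\<lambda>x. f n x - h x)) \<longlonglongrightarrow> 0"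
    using lim fL by (auto simp: L2_tendsto_iff)
  show "h \<in> L2_fun m" by (rule h)
  fix e :: real assume "e > 0"
  then obtain n where n: "norm2 m (\<lambda>x. f n x - h x) < e / 2"
    using LIMSEQ_D[OF h(2), of "e/2"] by auto
  obtain S where S: "S \<in> \<S>" "norm2 m (\<lambda>x. J S x - f n x) < e / 2"
    using f[of n] \<open>e > 0\<close> unfolding approximable_def by (metis half_gt_zero)
  have "norm2 m (\<lambda>x. J S x - h x) < e"
    using norm2_triangle_diff[OF J_L2[OF S(1)] fL[of n] h(1)] n S(2) by simp
  then show "\<exists>S\<in>\<S>. norm2 m (\<lambda>x. J S x - h x) < e" using S(1) by blast
qed

lemma approximable_has_ext:
  assumes "approximable f"
  shows "\<exists>Y. has_ext f Y"
proof -
  have "\<forall>n. \<exists>S\<in>\<S>. norm2 m (\<lambda>x. J S x - f x) < 1 / real (Suc n)"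
    using assms unfolding approximable_def by (metis divide_pos_pos of_nat_0_less_iff zero_less_Suc zero_less_one)
  then obtain S where S: "\<And>n. S n \<in> \<S>" "\<And>n. norm2 m (\<lambda>x. J (S n) x - f x) < 1 / real (Suc n)" by metis
  have "(\<lambda>n. norm2 m (\<lambda>x. J (S n) x - f x)) \<longlonglongrightarrow> 0"
  proof (rule Lim_null_comparison)
    show "\<forall>\<^sub>F n in sequentially. norm (norm2 m (\<lambda>x. J (S n) x - f x)) \<le> 1 / real (Suc n)"
      using S(2) by (intro always_eventually allI) (simp add: less_imp_le)
    show "(\<lambda>n. 1 / real (Suc n)) \<longlonglongrightarrow> 0" by (rule LIMSEQ_Suc[OF lim_const_over_n])
  qed
  then have "L2_tendsto m (\<lambda>n. J (S n)) f"
    using J_L2[OF S(1)] approximable_L2[OF assms] by (simp add: L2_tendsto_iff)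
  from has_ext_exists[OF S(1) this] show ?thesis by blast
qed

text \<open>
  Simple functions are dense in \<open>L\<^sup>2\<close>, and a square integrable simple function
  has level sets of finite measure away from zero.
\<close>

lemma approximable_if_indicators:
  assumes ind: "\<And>A y. A \<in> sets m \<Longrightarrow> emeasure m A < \<infinity> \<Longrightarrow> approximable (\<lambda>x. indicator A x *\<^sub>R y)"
    and f: "f \<in> L2_fun m"
  shows "approximable f"
proof -
  have zero: "approximable (\<lambda>_. 0)" using ind[of "{}" 0] by simp
  obtain F where F: "\<And>n. simple_function m (F n)" "\<And>n. F n \<in> L2_fun m" "L2_tendsto m F f"
    by (rule simple_functions_L2_dense[OF f]) blast
  have "approximable (F n)" for n
  proof -
    let ?A = "\<lambda>y. F n -` {y} \<inter> space m"
    have A: "?A y \<in> sets m" for y using F(1) by (rule simple_functionD)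
    have fin: "emeasure m (?A y) < \<infinity>" if "y \<noteq> 0" for y
    proof -
      have "ennreal ((norm y)\<^sup>2) * emeasure m (?A y) = (\<integral>\<^sup>+ x. ennreal ((norm y)\<^sup>2) * indicator (?A y) x \<partial>m)"
        by (rule nn_integral_cmult_indicator[OF A, symmetric])
      also have "\<dots> \<le> sqnorm m (F n)"
        unfolding sqnorm_def by (intro nn_integral_mono) (auto split: split_indicator)
      also have "\<dots> < \<infinity>" using F(2) by (simp add: L2_fun_iff)
      finally show ?thesis using that by (auto simp: ennreal_mult_less_top ennreal_mult_eq_top_iff less_top)
    qed
    have "approximable (\<lambda>x. \<Sum>y\<in>F n ` space m - {0}. indicator (?A y) x *\<^sub>R y)"
      using F(1)[of n] A fin by (intro approximable_sum zero ind) (auto dest: simple_functionD)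
    moreover have "AE x in m. (\<Sum>y\<in>F n ` space m - {0}. indicator (?A y) x *\<^sub>R y) = F n x"
    proof (rule AE_I2)
      fix x assume x: "x \<in> space m"
      have fin: "finite (F n ` space m)" using F(1) by (rule simple_functionD)
      have "(\<Sum>y\<in>F n ` space m - {0}. indicator (?A y) x *\<^sub>R y) = (\<Sum>y\<in>F n ` space m. indicator (?A y) x *\<^sub>R y)"
        using fin by (intro sum.mono_neutral_left) auto
      also have "\<dots> = (\<Sum>y\<in>F n ` space m. if y = F n x then y else 0)"
        using x by (intro sum.cong) auto
      also have "\<dots> = F n x" using fin x by (simp add: sum.delta)
      finally show "(\<Sum>y\<in>F n ` space m - {0}. indicator (?A y) x *\<^sub>R y) = F n x" .
    qed
    ultimately show ?thesis by (rule approximable_cong_AE[OF _ F(2)])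
  qed
  from approximable_limit[OF this F(3)] show ?thesis .
qed

end

section \<open>Gaussian variables\<close>

text \<open>
  The law is that of \<open>sqrt q\<close> times a standard normal variable, which also covers
  \<open>q = 0\<close>.
\<close>

lemma gaussian_moments:
  assumes P: "prob_space P" and X[measurable]: "X \<in> borel_measurable P" and q: "q \<ge> 0"
    and cf: "\<And>x. cf P (\<lambda>\<omega>. x * X \<omega>) = complex_of_real (exp (- (x\<^sup>2 * q / 2)))"
  shows "X \<in> L2_fun P" "(norm2 P X)\<^sup>2 = q" "(LINT \<omega>|P. X \<omega>) = 0"
proof -
  interpret prob_space P by (rule P)
  let ?N = "std_normal_distribution"
  interpret N: prob_space ?N by (rule prob_space_normal_density) simp
  define f where "f = (\<lambda>z::real. sqrt q * z)"
  have fM[measurable]: "f \<in> borel_measurable ?N" by (simp add: f_def)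
  have law: "distr P borel X = distr ?N borel f"
  proof (rule Levy_uniqueness)
    show "real_distribution (distr P borel X)" "real_distribution (distr ?N borel f)"
      by (auto intro!: real_distribution_distr N.real_distribution_distr)
    show "char (distr P borel X) = char (distr ?N borel f)"
    proof
      fix x
      have "char (distr ?N borel f) x = char ?N (x * sqrt q)"
        unfolding char_def by (subst integral_distr) (auto simp: f_def mult.assoc)
      also have "\<dots> = complex_of_real (exp (- (x\<^sup>2 * q / 2)))"
        using q by (simp add: char_std_normal_distribution power_mult_distrib)
      finally show "char (distr P borel X) x = char (distr ?N borel f) x"
        by (simp add: cf_distr cf)
    qed
  qed
  have int2: "integrable ?N (\<lambda>z. z\<^sup>2)" "(LINT z|?N. z\<^sup>2) = 1"
    using std_normal_distribution_even_moments[of 1] by (auto simp: fact_numeral)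
  have int1: "integrable ?N (\<lambda>z. z)" "(LINT z|?N. z) = 0"
    using integral_std_normal_distribution_moment_odd[of 1] integrable_std_normal_distribution_moment[of 1] by auto
  have "integrable (distr ?N borel f) (\<lambda>z. z\<^sup>2)"
    by (subst integrable_distr_eq) (auto simp: f_def power_mult_distrib intro!: integrable_mult_right int2)
  then have i: "integrable P (\<lambda>\<omega>. (X \<omega>)\<^sup>2)"
    unfolding law[symmetric] by (subst (asm) integrable_distr_eq) auto
  then show L: "X \<in> L2_fun P" by (simp add: L2_fun_def)
  have "(norm2 P X)\<^sup>2 = (LINT z|distr P borel X. z\<^sup>2)"
    by (simp add: norm2_power2[OF L] integral_distr)
  also have "\<dots> = (LINT z|?N. q * z\<^sup>2)" unfolding law
    by (subst integral_distr) (use q in \<open>auto simp: f_def power_mult_distrib\<close>)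
  finally show "(norm2 P X)\<^sup>2 = q" using int2 by simp
  have "(LINT \<omega>|P. X \<omega>) = (LINT z|distr P borel X. z)" by (simp add: integral_distr)
  also have "\<dots> = (LINT z|?N. sqrt q * z)" unfolding law by (subst integral_distr) (auto simp: f_def)
  finally show "(LINT \<omega>|P. X \<omega>) = 0" using int1 by simp
qed

section \<open>The Wiener integral\<close>

definition admissible_steps :: "real \<Rightarrow> (real \<times> real \<times> 'd) list set"
  where "admissible_steps T = {S. \<forall>(r, t, _)\<in>set S. 0 \<le> r \<and> r \<le> t \<and> t \<le> T}"

lemma telescope_over_partition:
  fixes f :: "real \<Rightarrow> 'e::ab_group_add"
  assumes t: "\<And>j k. j < k \<Longrightarrow> k \<le> n \<Longrightarrow> t j < t k" and pq: "p \<le> q" "q \<le> n"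
  shows "f (t q) - f (t p) = (\<Sum>k<n. if t p \<le> t k \<and> t (Suc k) \<le> t q then f (t (Suc k)) - f (t k) else 0)"
proof -
  have le: "t j \<le> t k \<longleftrightarrow> j \<le> k" if "j \<le> n" "k \<le> n" for j k
    using t[of j k] t[of k j] that by (metis less_imp_le linorder_not_less nat_less_le order_refl)
  have "(\<Sum>k<n. if t p \<le> t k \<and> t (Suc k) \<le> t q then f (t (Suc k)) - f (t k) else 0)
    = (\<Sum>k<n. if k \<in> {p..<q} then f (t (Suc k)) - f (t k) else 0)"
  proof (rule sum.cong[OF refl])
    fix k assume "k \<in> {..<n}"
    then have "t p \<le> t k \<and> t (Suc k) \<le> t q \<longleftrightarrow> k \<in> {p..<q}"
      using le[of p k] le[of "Suc k" q] pq by auto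
    then show "(if t p \<le> t k \<and> t (Suc k) \<le> t q then f (t (Suc k)) - f (t k) else 0)
      = (if k \<in> {p..<q} then f (t (Suc k)) - f (t k) else 0)" by simp
  qed
  also have "\<dots> = (\<Sum>k\<in>{..<n} \<inter> {p..<q}. f (t (Suc k)) - f (t k))" by (rule sum.inter_restrict[symmetric]) simp
  also have "{..<n} \<inter> {p..<q} = {p..<q}" using pq by auto
  also have "(\<Sum>k\<in>{p..<q}. f (t (Suc k)) - f (t k)) = f (t q) - f (t p)"
    using pq(1) by (rule sum_Suc_diff')
  finally show ?thesis by simp
qed

text \<open>
  The sequence \<open>t\<close> is constant after index \<open>n\<close>; this keeps it monotone
  on all of the naturals, as the definition of independent increments requires.
\<close>

lemma partition_of_steps:
  fixes S :: "(real \<times> real \<times> 'd) list"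
  assumes S: "S \<in> admissible_steps T" and T: "T \<ge> 0"
  obtains n :: nat and t :: "nat \<Rightarrow> real"
  where "mono t" "\<And>k. 0 \<le> t k" "\<And>k. t k \<le> T" "\<And>j k. j < k \<Longrightarrow> k \<le> n \<Longrightarrow> t j < t k"
    "\<And>a b g. (a, b, g) \<in> set S \<Longrightarrow> \<exists>p q. p \<le> q \<and> q \<le> n \<and> a = t p \<and> b = t q"
proof -
  define E where "E = insert 0 (\<Union>(a, b, g)\<in>set S. {a, b})"
  have E: "finite E" "0 \<in> E" "\<And>x. x \<in> E \<Longrightarrow> 0 \<le> x \<and> x \<le> T"
    using S T by (auto simp: E_def admissible_steps_def split_beta)
  define ts where "ts = sorted_list_of_set E"
  have ts: "set ts = E" "sorted_wrt (<) ts" using E(1) by (auto simp: ts_def)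
  have ne: "ts \<noteq> []" using ts(1) E(2) by auto
  define n where "n = length ts - 1"
  define t where "t k = ts ! min k n" for k
  have n: "length ts = Suc n" using ne by (simp add: n_def)
  have strict: "t j < t k" if "j < k" "k \<le> n" for j k
    using that n sorted_wrt_nth_less[OF ts(2), of j k] by (simp add: t_def)
  have "t k \<in> E" for k
    unfolding t_def ts(1)[symmetric] by (rule nth_mem) (simp add: n)
  then have bounds: "0 \<le> t k" "t k \<le> T" for k using E(3) by auto
  have mono: "mono t"
  proof (rule monoI)
    fix j k :: nat assume "j \<le> k"
    then consider "min j n = min k n" | "min j n < min k n" by linarith
    then show "t j \<le> t k"
    proof cases
      case 1 then show ?thesis by (simp add: t_def)
    next
      case 2
      then have "t (min j n) < t (min k n)" by (intro strict) auto
      then show ?thesis by (simp add: t_def)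
    qed
  qed
  have idx: "\<exists>p\<le>n. x = t p" if "x \<in> E" for x
  proof -
    have "x \<in> set ts" using that ts(1) by simp
    then obtain p where "p < length ts" "x = ts ! p" by (metis in_set_conv_nth)
    then show ?thesis using n by (intro exI[of _ p]) (simp add: t_def less_Suc_eq_le)
  qed
  have "\<exists>p q. p \<le> q \<and> q \<le> n \<and> a = t p \<and> b = t q" if "(a, b, g) \<in> set S" for a b g
  proof -
    have "a \<in> E" "b \<in> E" "a \<le> b"
      using that S by (auto simp: E_def admissible_steps_def intro!: bexI[of _ "(a, b, g)"])
    then obtain p q where pq: "p \<le> n" "a = t p" "q \<le> n" "b = t q" using idx by metis
    have "p \<le> q"
    proof (rule ccontr)
      assume "\<not> p \<le> q"
      then have "t q < t p" using strict pq(1) by simp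
      with \<open>a \<le> b\<close> pq show False by simp
    qed
    with pq show ?thesis by blast
  qed
  with mono bounds strict show thesis by (rule that)
qed

text \<open>
  The value of the step function on the \<open>k\<close>-th cell of the partition.
\<close>

definition partition_coeff :: "(nat \<Rightarrow> real) \<Rightarrow> (real \<times> real \<times> 'd::real_vector) list \<Rightarrow> nat \<Rightarrow> 'd"
  where "partition_coeff t S k = (\<Sum>(a, b, g)\<leftarrow>S. if a \<le> t k \<and> t (Suc k) \<le> b then g else 0)"

text \<open>
  Stated for a general \<open>f\<close> and pairing \<open>B\<close> because it is used twice:
  with indicators for \<open>f\<close> it rewrites the step function, and with the paths of
  \<open>W\<close> its integral.
\<close>

lemma sum_over_partition:
  fixes S :: "(real \<times> real \<times> 'd::real_vector) list" and f :: "real \<Rightarrow> 'e::real_vector"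
    and B :: "'d \<Rightarrow> 'e \<Rightarrow> 'f::real_vector"
  assumes strict: "\<And>j k. j < k \<Longrightarrow> k \<le> n \<Longrightarrow> t j < t k"
    and ends: "\<And>a b g. (a, b, g) \<in> set S \<Longrightarrow> \<exists>p q. p \<le> q \<and> q \<le> n \<and> a = t p \<and> b = t q"
    and add: "\<And>x y e. B (x + y) e = B x e + B y e" and lin: "\<And>x. linear (B x)"
  shows "(\<Sum>(a, b, g)\<leftarrow>S. B g (f b - f a)) = (\<Sum>k<n. B (partition_coeff t S k) (f (t (Suc k)) - f (t k)))"
proof -
  have B0: "B 0 e = 0" for e using add[of 0 0 e] by simp
  have one: "B g (f b - f a) = (\<Sum>k<n. B (if a \<le> t k \<and> t (Suc k) \<le> b then g else 0) (f (t (Suc k)) - f (t k)))"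
    if abg: "(a, b, g) \<in> set S" for a b g
  proof -
    obtain p q where pq: "p \<le> q" "q \<le> n" "a = t p" "b = t q" using ends[OF abg] by blast
    have "B g (f b - f a) = B g (\<Sum>k<n. if t p \<le> t k \<and> t (Suc k) \<le> t q then f (t (Suc k)) - f (t k) else 0)"
      unfolding pq(3,4) by (subst telescope_over_partition[where t=t and f=f, OF strict pq(1,2)]) auto
    also have "\<dots> = (\<Sum>k<n. B g (if t p \<le> t k \<and> t (Suc k) \<le> t q then f (t (Suc k)) - f (t k) else 0))"
      by (rule linear_sum[OF lin])
    also have "\<dots> = (\<Sum>k<n. B (if a \<le> t k \<and> t (Suc k) \<le> b then g else 0) (f (t (Suc k)) - f (t k)))"
      using pq by (intro sum.cong) (auto simp: B0 linear_0[OF lin])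
    finally show ?thesis .
  qed
  have "(\<Sum>(a, b, g)\<leftarrow>R. B g (f b - f a)) = (\<Sum>k<n. B (partition_coeff t R k) (f (t (Suc k)) - f (t k)))"
    if "set R \<subseteq> set S" for R
    using that
  proof (induction R)
    case (Cons z R)
    obtain a b g where z: "z = (a, b, g)" by (cases z) auto
    then show ?case using Cons one[of a b g] by (simp add: add sum.distrib partition_coeff_def)
  qed (simp add: B0 partition_coeff_def)
  then show ?thesis by simp
qed

locale wiener_integral_setting =
  fixes P :: "'w measure" and T :: real and W :: "real \<Rightarrow> 'w \<Rightarrow> 'u::{banach, second_countable_topology}"
    and C :: "('u \<Rightarrow>\<^sub>L real) \<Rightarrow>\<^sub>L 'u" and i :: "'k::{real_inner, banach, second_countable_topology} \<Rightarrow>\<^sub>L 'u"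
  assumes T: "T > 0" and W: "wiener_process P W C" and K: "rkhs_embedding C i"
begin

lemma prob_space_P: "prob_space P"
  using W by (simp add: wiener_process_def levy_process_def)

sublocale prob_space P by (rule prob_space_P)

abbreviation J :: "(real \<times> real \<times> ('u \<Rightarrow>\<^sub>L real)) list \<Rightarrow> real \<Rightarrow> 'k"
  where "J S s \<equiv> hilbert_adjoint i (step_fun S s)"

lemma W_measurable [measurable]: "t \<ge> 0 \<Longrightarrow> W t \<in> borel_measurable P"
  using W by (simp add: wiener_process_def levy_process_def)

lemma functional_measurable [measurable]: "blinfun_apply g \<in> borel_measurable borel" for g :: "'x::real_normed_vector \<Rightarrow>\<^sub>L real"
  by (intro borel_measurable_continuous_onI linear_continuous_on blinfun.bounded_linear_right)

lemma covariance: "blinfun_apply u (blinfun_apply C u) = (norm (hilbert_adjoint i u))\<^sup>2"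
  using K by (simp add: rkhs_embedding_def hilbert_adjoint_inner[symmetric] power2_norm_eq_inner)

lemma cf_increment:
  assumes "0 \<le> s" "s \<le> t"
  shows "cf P (\<lambda>\<omega>. x * blinfun_apply u (W t \<omega> - W s \<omega>))
    = complex_of_real (exp (- (x\<^sup>2 * ((t - s) * (norm (hilbert_adjoint i u))\<^sup>2) / 2)))"
proof -
  have law: "distr P borel (\<lambda>\<omega>. W t \<omega> - W s \<omega>) = distr P borel (W (t - s))"
    using W assms by (simp add: wiener_process_def levy_process_def)
  have [measurable]: "W t \<in> borel_measurable P" "W s \<in> borel_measurable P" "W (t - s) \<in> borel_measurable P"
    using assms by auto
  have "cf P (\<lambda>\<omega>. x * blinfun_apply u (W t \<omega> - W s \<omega>))
    = (CLINT z|distr P borel (\<lambda>\<omega>. W t \<omega> - W s \<omega>). iexp (x * blinfun_apply u z))"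
    unfolding cf_def by (subst integral_distr) auto
  also have "\<dots> = cf P (\<lambda>\<omega>. x * blinfun_apply u (W (t - s) \<omega>))"
    unfolding law cf_def by (subst integral_distr) auto
  also have "\<dots> = char (distr P borel (\<lambda>\<omega>. blinfun_apply u (W (t - s) \<omega>))) x"
    by (simp add: cf_distr)
  finally show ?thesis
    using W assms by (simp add: wiener_process_def covariance[symmetric] algebra_simps)
qed

lemma step_integral_measurable:
  assumes "S \<in> admissible_steps T"
  shows "step_integral W S \<in> borel_measurable P"
  using assms
proof (induction S)
  case Nil
  then show ?case by (simp add: step_integral_def)
next
  case (Cons z S)
  obtain a b g where z: "z = (a, b, g)" by (cases z) auto
  have "step_integral W S \<in> borel_measurable P" using Cons by (intro Cons.IH) (auto simp: admissible_steps_def)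
  moreover have [measurable]: "W b \<in> borel_measurable P" "W a \<in> borel_measurable P"
    using Cons.prems by (auto simp: z admissible_steps_def)
  moreover have "(\<lambda>\<omega>. blinfun_apply g (W b \<omega> - W a \<omega>)) \<in> borel_measurable P"
    by measurable
  ultimately have "(\<lambda>\<omega>. blinfun_apply g (W b \<omega> - W a \<omega>) + step_integral W S \<omega>) \<in> borel_measurable P"
    by simp
  then show ?case by (simp add: step_integral_def z)
qed

text \<open>
  Over a common partition the integral is a sum of independent Gaussian variables whose variances
  add up to the squared norm of the integrand.
\<close>

lemma step_integral_gaussian:
  assumes S: "S \<in> admissible_steps T"
  shows "J S \<in> L2_fun (lborel_upto T)"
    and "cf P (\<lambda>\<omega>. x * step_integral W S \<omega>) = complex_of_real (exp (- (x\<^sup>2 * (norm2 (lborel_upto T) (J S))\<^sup>2 / 2)))"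
proof -
  let ?m = "lborel_upto T"
  interpret h: bounded_linear "hilbert_adjoint i" by (rule bounded_linear_hilbert_adjoint)
  obtain n :: nat and t :: "nat \<Rightarrow> real"
    where t: "mono t" "\<And>k. 0 \<le> t k" "\<And>k. t k \<le> T" "\<And>j k. j < k \<Longrightarrow> k \<le> n \<Longrightarrow> t j < t k"
    "\<And>a b g. (a, b, g) \<in> set S \<Longrightarrow> \<exists>p q. p \<le> q \<and> q \<le> n \<and> a = t p \<and> b = t q"
    by (rule partition_of_steps[OF S less_imp_le[OF T]]) (rule that)
  define u where "u = partition_coeff t S"
  have tS: "t k \<le> t (Suc k)" for k using t(1) by (simp add: mono_def)
  define A where "A k = {t k<..t (Suc k)}" for k
  (* As a difference of two functions of the end points, the indicator telescopes over a
     partition. *)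
  have ind: "indicator {a<..b} s = (if s \<le> b then 1 else 0) - (if s \<le> a then 1 else (0::real))" if "a \<le> b" for a b s :: real
    using that by (auto split: split_indicator)
  have "step_fun S s = (\<Sum>(a, b, g)\<leftarrow>S. ((if s \<le> b then 1 else 0) - (if s \<le> a then 1 else (0::real))) *\<^sub>R g)" for s
    unfolding step_fun_def using S ind
    by (intro arg_cong[where f=sum_list] map_cong refl) (auto simp: admissible_steps_def)
  also have "\<dots> s = (\<Sum>k<n. ((if s \<le> t (Suc k) then 1 else 0) - (if s \<le> t k then 1 else (0::real))) *\<^sub>R u k)" for s
    unfolding u_def
    by (rule sum_over_partition[where B="\<lambda>g e. e *\<^sub>R g" and f="\<lambda>\<tau>. if s \<le> \<tau> then 1 else (0::real)", OF t(4,5)])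
       (auto simp: scaleR_add_right intro!: linearI simp: scaleR_add_left)
  finally have "step_fun S s = (\<Sum>k<n. indicator (A k) s *\<^sub>R u k)" for s
    using tS by (simp add: ind A_def)
  then have JSs: "J S s = (\<Sum>k<n. indicator (A k) s *\<^sub>R hilbert_adjoint i (u k))" for s
    by (simp add: h.sum h.scaleR)
  then have JS: "J S = (\<lambda>s. \<Sum>k<n. indicator (A k) s *\<^sub>R hilbert_adjoint i (u k))" by blast
  have IS: "step_integral W S \<omega> = (\<Sum>k<n. blinfun_apply (u k) (W (t (Suc k)) \<omega> - W (t k) \<omega>))" for \<omega>
    unfolding step_integral_def u_def
    by (rule sum_over_partition[where B=blinfun_apply and f="\<lambda>\<tau>. W \<tau> \<omega>", OF t(4,5)])
       (auto simp: blinfun.add_left intro!: bounded_linear.linear blinfun.bounded_linear_right)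
  have Am: "A k \<in> sets ?m" for k
    using t(2)[of k] t(3)[of "Suc k"] by (auto simp: A_def sets_restrict_space_iff)
  have Ae: "emeasure ?m (A k) = ennreal (t (Suc k) - t k)" for k
  proof -
    have "A k \<subseteq> {0..T}" using t(2)[of k] t(3)[of "Suc k"] by (auto simp: A_def)
    then have "emeasure ?m (A k) = emeasure lborel (A k)" by (intro emeasure_restrict_space) auto
    then show ?thesis using tS[of k] by (simp add: A_def)
  qed
  have "A j \<inter> A k = {}" if "j \<noteq> k" for j k
  proof -
    have "t (Suc j) \<le> t k \<or> t (Suc k) \<le> t j"
      using that t(1) by (metis Suc_leI linorder_neqE_nat monoD)
    then show ?thesis by (auto simp: A_def)
  qed
  then have disj: "disjoint_family_on A {..<n}" by (simp add: disjoint_family_on_def)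
  have mA: "measure ?m (A k) = t (Suc k) - t k" for k using tS[of k] by (simp add: measure_def Ae)
  show "J S \<in> L2_fun ?m"
    unfolding JS by (rule norm2_disjoint_sum(1)[OF Am _ disj]) (simp add: Ae)
  have norm: "(norm2 ?m (J S))\<^sup>2 = (\<Sum>k<n. (t (Suc k) - t k) * (norm (hilbert_adjoint i (u k)))\<^sup>2)"
    unfolding JS by (subst norm2_disjoint_sum(2)[OF Am _ disj]) (simp_all add: Ae mA)
  let ?X = "\<lambda>k \<omega>. blinfun_apply (u k) (W (t (Suc k)) \<omega> - W (t k) \<omega>)"
  have XM[measurable]: "?X k \<in> borel_measurable P" for k
  proof -
    have [measurable]: "W (t (Suc k)) \<in> borel_measurable P" "W (t k) \<in> borel_measurable P" using t(2) by auto
    show ?thesis by measurable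
  qed
  have "indep_vars (\<lambda>_. borel) (\<lambda>k \<omega>. W (t (Suc k)) \<omega> - W (t k) \<omega>) {..<n}"
    using W t(1) t(2)[of 0] by (simp add: wiener_process_def levy_process_def)
  then have "indep_vars (\<lambda>_. borel) ?X {..<n}"
    by (rule indep_vars_compose2) auto
  from char_distr_sum[OF this, of x]
  have "cf P (\<lambda>\<omega>. x * step_integral W S \<omega>) = (\<Prod>k<n. cf P (\<lambda>\<omega>. x * ?X k \<omega>))"
    by (simp add: IS cf_distr)
  also have "\<dots> = (\<Prod>k<n. complex_of_real (exp (- (x\<^sup>2 * ((t (Suc k) - t k) * (norm (hilbert_adjoint i (u k)))\<^sup>2) / 2))))"
    using t(2) tS by (intro prod.cong refl cf_increment) auto
  also have "\<dots> = complex_of_real (exp (\<Sum>k<n. - (x\<^sup>2 * ((t (Suc k) - t k) * (norm (hilbert_adjoint i (u k)))\<^sup>2) / 2)))"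
    by (simp add: exp_sum)
  also have "(\<Sum>k<n. - (x\<^sup>2 * ((t (Suc k) - t k) * (norm (hilbert_adjoint i (u k)))\<^sup>2) / 2)) = - (x\<^sup>2 * (norm2 ?m (J S))\<^sup>2 / 2)"
    unfolding norm by (simp add: sum_negf sum_distrib_left sum_divide_distrib)
  finally show "cf P (\<lambda>\<omega>. x * step_integral W S \<omega>) = complex_of_real (exp (- (x\<^sup>2 * (norm2 ?m (J S))\<^sup>2 / 2)))" .
qed

sublocale wiener: isometric_integral "lborel_upto T" P "admissible_steps T" J "step_integral W"
proof
  fix S S' :: "(real \<times> real \<times> ('u \<Rightarrow>\<^sub>L real)) list" and c :: real
  assume S: "S \<in> admissible_steps T"
  note g = gaussian_moments[OF prob_space_P step_integral_measurable[OF S] zero_le_power2 step_integral_gaussian(2)[OF S]]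
  show "J S \<in> L2_fun (lborel_upto T)" by (rule step_integral_gaussian[OF S])
  show "step_integral W S \<in> L2_fun P" "(LINT \<omega>|P. step_integral W S \<omega>) = 0" by (rule g)+
  show "norm2 P (step_integral W S) = norm2 (lborel_upto T) (J S)"
    using g(2) by (simp add: power2_eq_iff_nonneg)
  assume S': "S' \<in> admissible_steps T"
  interpret h: bounded_linear "hilbert_adjoint i" by (rule bounded_linear_hilbert_adjoint)
  let ?R = "S @ map (\<lambda>(r, t, g). (r, t, c *\<^sub>R g)) S'"
  have "?R \<in> admissible_steps T" using S S' by (auto simp: admissible_steps_def)
  moreover have "step_fun (map (\<lambda>(r, t, g). (r, t, c *\<^sub>R g)) S') s = c *\<^sub>R step_fun S' s" for s
    by (induction S') (auto simp: step_fun_def scaleR_add_right)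
  moreover have "step_fun (S @ S'') s = step_fun S s + step_fun S'' s" for S'' s
    by (simp add: step_fun_def)
  moreover have "step_integral W (map (\<lambda>(r, t, g). (r, t, c *\<^sub>R g)) S') \<omega> = c *\<^sub>R step_integral W S' \<omega>" for \<omega>
    by (induction S') (auto simp: step_integral_def distrib_left blinfun.scaleR_left)
  moreover have "step_integral W (S @ S'') \<omega> = step_integral W S \<omega> + step_integral W S'' \<omega>" for S'' \<omega>
    by (simp add: step_integral_def)
  ultimately show "\<exists>R\<in>admissible_steps T. J R = (\<lambda>x. J S x + c *\<^sub>R J S' x) \<and>
    step_integral W R = (\<lambda>\<omega>. step_integral W S \<omega> + c *\<^sub>R step_integral W S' \<omega>)"
    by (intro bexI[of _ ?R]) (auto simp: h.add h.scaleR)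
qed

lemma approximable_interval:
  assumes "0 \<le> a" "a \<le> b" "b \<le> T"
  shows "wiener.approximable (\<lambda>s. indicator {a<..b} s *\<^sub>R hilbert_adjoint i u)"
proof -
  interpret h: bounded_linear "hilbert_adjoint i" by (rule bounded_linear_hilbert_adjoint)
  have "wiener.approximable (J [(a, b, u)])"
    using assms by (intro wiener.approximable_J) (simp add: admissible_steps_def)
  then show ?thesis by (simp add: step_fun_def h.scaleR)
qed

text \<open>
  Intervals \<open>{0<..a}\<close> are step functions, and the Borel sets for which the claim
  holds form a Dynkin system. The point zero is excluded because steps are open on the left.
\<close>

lemma approximable_range:
  assumes "A \<in> sets borel"
  shows "wiener.approximable (\<lambda>s. indicator (A \<inter> {0<..T}) s *\<^sub>R hilbert_adjoint i u)"
proof -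
  let ?h = "hilbert_adjoint i u"
  let ?m = "lborel_upto T"
  let ?D = "{A. A \<in> sets borel \<and> wiener.approximable (\<lambda>s. indicator (A \<inter> {0<..T}) s *\<^sub>R ?h)}"
  have full: "wiener.approximable (\<lambda>s. indicator {0<..T} s *\<^sub>R ?h)"
    using T by (intro approximable_interval) auto
  note zero = wiener.approximable_zero[OF full]
  have sigma: "sets borel = sigma_sets UNIV (range (\<lambda>a::real. {..a}))"
    by (subst borel_eq_atMost) (simp add: sets_measure_of)
  have "Int_stable (range (\<lambda>a::real. {..a}))" by (auto simp: Int_stable_def)
  moreover have "range (\<lambda>a::real. {..a}) \<subseteq> Pow UNIV" by simp
  moreover have "A \<in> sigma_sets UNIV (range (\<lambda>a::real. {..a}))" using assms sigma by simp
  ultimately show ?thesis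
  proof (induction rule: sigma_sets_induct_disjoint)
    case (basic A)
    then obtain a where A: "A = {..a}" by blast
    show ?case
    proof (cases "a \<le> 0")
      case True
      then have "A \<inter> {0<..T} = {}" using A by auto
      then show ?thesis using zero by simp
    next
      case False
      then have "A \<inter> {0<..T} = {0<..min a T}" using A by auto
      then show ?thesis using False T approximable_interval[of 0 "min a T" u] by simp
    qed
  next
    case empty
    then show ?case using zero by simp
  next
    case (compl A)
    have "indicator ((UNIV - A) \<inter> {0<..T}) s *\<^sub>R ?h
      = indicator {0<..T} s *\<^sub>R ?h + (-1) *\<^sub>R (indicator (A \<inter> {0<..T}) s *\<^sub>R ?h)" for s
      by (auto split: split_indicator)
    then show ?case using wiener.approximable_add_scaleR[OF full compl.IH, of "-1"] by simp
  next
    case (union A)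
    have "range A \<subseteq> sets borel" using union.hyps(2) sigma by simp
    then have Am[measurable]: "A n \<in> sets borel" for n by blast
    let ?f = "\<lambda>n s. \<Sum>j<n. indicator (A j \<inter> {0<..T}) s *\<^sub>R ?h"
    have fa: "wiener.approximable (?f n)" for n
      using union.IH by (intro wiener.approximable_sum zero) auto
    have fU: "?f n s = indicator ((\<Union>j<n. A j) \<inter> {0<..T}) s *\<^sub>R ?h" for n s
    proof -
      have "?f n s = (\<Sum>j<n. indicator (A j \<inter> {0<..T}) s) *\<^sub>R ?h" by (simp add: scaleR_sum_left)
      also have "(\<Sum>j<n. indicator (A j \<inter> {0<..T}) s) = (indicator (\<Union>j<n. A j \<inter> {0<..T}) s :: real)"
        using union.hyps(1) by (intro indicator_UN_disjoint[symmetric]) (auto simp: disjoint_family_on_def)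
      also have "(\<Union>j<n. A j \<inter> {0<..T}) = (\<Union>j<n. A j) \<inter> {0<..T}" by blast
      finally show ?thesis .
    qed
    have "L2_tendsto ?m ?f (\<lambda>s. indicator ((\<Union>j. A j) \<inter> {0<..T}) s *\<^sub>R ?h)"
    proof (rule L2_dominated_convergence[OF L2_funD[OF wiener.approximable_L2[OF fa]] _ wiener.approximable_L2[OF full]])
      have "(\<lambda>s. indicator ((\<Union>j. A j) \<inter> {0<..T}) s *\<^sub>R ?h) \<in> borel_measurable borel" by measurable
      then show "(\<lambda>s. indicator ((\<Union>j. A j) \<inter> {0<..T}) s *\<^sub>R ?h) \<in> borel_measurable ?m"
        by (intro measurable_restrict_space1) simp
      show "norm (?f n s) \<le> norm (indicator {0<..T} s *\<^sub>R ?h)" for n s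
        unfolding fU by (auto split: split_indicator)
      show "(\<lambda>n. ?f n s) \<longlonglongrightarrow> indicator ((\<Union>j. A j) \<inter> {0<..T}) s *\<^sub>R ?h" for s
      proof (cases "\<exists>j. s \<in> A j")
        case True
        then obtain j where j: "s \<in> A j" by blast
        have "\<forall>\<^sub>F n in sequentially. ?f n s = indicator ((\<Union>j. A j) \<inter> {0<..T}) s *\<^sub>R ?h"
          unfolding fU using j by (intro eventually_sequentiallyI[of "Suc j"]) (auto simp: indicator_def)
        then show ?thesis by (rule tendsto_eventually)
      next
        case False
        then have "?f n s = indicator ((\<Union>j. A j) \<inter> {0<..T}) s *\<^sub>R ?h" for n
          unfolding fU by (simp add: indicator_def)
        then show ?thesis by simp
      qed
    qed
    from wiener.approximable_limit[OF fa this] show ?case .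
  qed
qed

text \<open>
  Injectivity of \<open>i\<close> makes the range of the adjoint dense, so the value may be any
  \<open>k\<close>.
\<close>

lemma approximable_indicator:
  assumes A: "A \<in> sets (lborel_upto T)"
  shows "wiener.approximable (\<lambda>s. indicator A s *\<^sub>R k)"
proof -
  let ?m = "lborel_upto T"
  have A': "A \<in> sets borel" "A \<subseteq> {0..T}" using A by (auto simp: sets_restrict_space)
  have fin: "emeasure ?m B < \<infinity>" for B
  proof -
    have "emeasure ?m B \<le> emeasure ?m (space ?m)" by (rule emeasure_space)
    also have "\<dots> = ennreal T" using T by (simp add: emeasure_restrict_space space_restrict_space)
    finally show ?thesis by (auto intro: le_less_trans)
  qed
  note L2 = L2_fun_indicator_const[OF A fin]
  have "AE s in ?m. s \<noteq> 0"
    using AE_lborel_singleton[of 0] by (subst AE_restrict_space_iff) auto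
  then have AE0: "AE s in ?m. indicator (A \<inter> {0<..T}) s *\<^sub>R y = indicator A s *\<^sub>R y" for y :: 'k
    by eventually_elim (use A'(2) in \<open>auto simp: indicator_def\<close>)
  have range: "wiener.approximable (\<lambda>s. indicator A s *\<^sub>R hilbert_adjoint i u)" for u
    by (rule wiener.approximable_cong_AE[OF approximable_range[OF A'(1)] L2 AE0])
  have "k \<in> closure (range (hilbert_adjoint i))"
    using hilbert_adjoint_dense K by (auto simp: rkhs_embedding_def)
  then obtain x where x: "\<And>n. x n \<in> range (hilbert_adjoint i)" "x \<longlonglongrightarrow> k"
    unfolding closure_sequential by blast
  obtain B where B: "\<And>n. norm (x n) \<le> B" using convergent_imp_Bseq[OF convergentI[OF x(2)]] by (auto simp: Bseq_def)
  have fa: "wiener.approximable (\<lambda>s. indicator A s *\<^sub>R x n)" for n using x(1)[of n] range by auto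
  have "L2_tendsto ?m (\<lambda>n s. indicator A s *\<^sub>R x n) (\<lambda>s. indicator A s *\<^sub>R k)"
  proof (rule L2_dominated_convergence[OF L2_funD[OF L2] L2_funD[OF L2] L2_fun_indicator_const[OF A fin, of B]])
    show "norm (indicator A s *\<^sub>R x n) \<le> norm (indicator A s *\<^sub>R B)" for n s
      using order_trans[OF B[of n] abs_ge_self[of B]] by (auto split: split_indicator)
    show "(\<lambda>n. indicator A s *\<^sub>R x n) \<longlonglongrightarrow> indicator A s *\<^sub>R k" for s
      by (intro tendsto_intros x)
  qed
  from wiener.approximable_limit[OF fa this] show ?thesis .
qed

lemma has_wiener_integral_iff:
  "has_wiener_integral P T i W g Y \<longleftrightarrow> wiener.has_ext (\<lambda>s. hilbert_adjoint i (g s)) Y"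
  unfolding has_wiener_integral_def wiener.has_ext_def by (simp add: admissible_steps_def)

lemma wiener_integral_has_ext:
  assumes "(\<lambda>s. hilbert_adjoint i (g s)) \<in> L2_fun (lborel_upto T)"
  shows "wiener.has_ext (\<lambda>s. hilbert_adjoint i (g s)) (wiener_integral P T i W g)"
proof -
  have "\<exists>Y. has_wiener_integral P T i W g Y"
    unfolding has_wiener_integral_iff
    by (intro wiener.approximable_has_ext wiener.approximable_if_indicators[OF approximable_indicator] assms)
  then show ?thesis
    unfolding has_wiener_integral_iff[symmetric] wiener_integral_def by (rule someI_ex)
qed

lemma cf_wiener:
  assumes "wiener.has_ext f Y"
  shows "cf P Y = complex_of_real (exp (- ((norm2 (lborel_upto T) f)\<^sup>2 / 2)))"
proof -
  obtain S where S: "\<And>n. S n \<in> admissible_steps T" "L2_tendsto (lborel_upto T) (\<lambda>n. J (S n)) f"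
    "L2_tendsto P (\<lambda>n. step_integral W (S n)) Y"
    using assms by (auto simp: wiener.has_ext_def)
  have "(\<lambda>n. cf P (step_integral W (S n))) \<longlonglongrightarrow> cf P Y"
    by (rule cf_tendsto[OF prob_space_P wiener.I_L2[OF S(1)] S(3)])
  moreover have "(\<lambda>n. cf P (step_integral W (S n))) \<longlonglongrightarrow> complex_of_real (exp (- ((norm2 (lborel_upto T) f)\<^sup>2 / 2)))"
  proof -
    have "cf P (step_integral W (S n)) = complex_of_real (exp (- ((norm2 (lborel_upto T) (J (S n)))\<^sup>2 / 2)))" for n
      using step_integral_gaussian(2)[OF S(1), of 1 n] by simp
    then show ?thesis
      by (simp only:) (intro tendsto_intros norm2_tendsto wiener.J_L2 S; simp)
  qed
  ultimately show ?thesis by (rule LIMSEQ_unique)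
qed

end

section \<open>The compensated Poisson integral\<close>

lemma integral_nat_valued:
  assumes P: "prob_space P" and K: "K \<in> measurable P (count_space UNIV)"
    and p: "\<And>k. measure P {\<omega>\<in>space P. K \<omega> = k} = p k"
    and f: "\<And>k::nat. 0 \<le> f k" "(\<lambda>k. p k * f k) sums (s::real)"
  shows "integrable P (\<lambda>\<omega>. f (K \<omega>))" "(LINT \<omega>|P. f (K \<omega>)) = s"
proof -
  interpret prob_space P by (rule P)
  have p0: "0 \<le> p k" for k using p[of k] measure_nonneg[of P] by metis
  have law: "distr P (count_space UNIV) K = density (count_space UNIV) (\<lambda>k. ennreal (p k))"
  proof (rule measure_eqI)
    fix A :: "nat set" assume "A \<in> sets (distr P (count_space UNIV) K)"
    have "emeasure (distr P (count_space UNIV) K) A = (\<integral>\<^sup>+ k. emeasure (distr P (count_space UNIV) K) {k} \<partial>count_space A)"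
      by (rule emeasure_countable_singleton) auto
    also have "\<dots> = (\<integral>\<^sup>+ k. ennreal (p k) \<partial>count_space A)"
    proof (rule nn_integral_cong)
      fix k
      have "emeasure (distr P (count_space UNIV) K) {k} = emeasure P {\<omega>\<in>space P. K \<omega> = k}"
        using K by (simp add: emeasure_distr vimage_def Int_def conj_commute)
      then show "emeasure (distr P (count_space UNIV) K) {k} = ennreal (p k)"
        by (simp add: emeasure_eq_measure p)
    qed
    also have "\<dots> = emeasure (density (count_space UNIV) (\<lambda>k. ennreal (p k))) A"
      by (simp add: emeasure_density nn_integral_count_space_indicator)
    finally show "emeasure (distr P (count_space UNIV) K) A = emeasure (density (count_space UNIV) (\<lambda>k. ennreal (p k))) A" .
  qed simp
  have i: "integrable (count_space UNIV) (\<lambda>k. p k *\<^sub>R f k)"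
    using f p0 by (simp add: integrable_count_space_nat_iff sums_iff abs_mult)
  then have "integrable (distr P (count_space UNIV) K) f"
    unfolding law by (subst integrable_density) (auto simp: p0)
  then show "integrable P (\<lambda>\<omega>. f (K \<omega>))" using K by (subst (asm) integrable_distr_eq) auto
  have "(LINT \<omega>|P. f (K \<omega>)) = (LINT k|distr P (count_space UNIV) K. f k)"
    using K by (simp add: integral_distr)
  also have "\<dots> = (LINT k|count_space UNIV. p k *\<^sub>R f k)"
    unfolding law by (subst integral_density) (auto simp: p0)
  also have "\<dots> = s" using i f(2) by (simp add: integral_count_space_nat sums_iff)
  finally show "(LINT \<omega>|P. f (K \<omega>)) = s" .
qed

lemma poisson_moment_sums:
  fixes l :: real
  defines "p \<equiv> \<lambda>k. l ^ k / fact k * exp (- l)"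
  shows "p sums 1" "(\<lambda>k. p k * real k) sums l" "(\<lambda>k. p k * (real k)\<^sup>2) sums (l\<^sup>2 + l)"
proof -
  have e: "exp l * exp (- l) = 1" by (simp add: exp_minus)
  have "(\<lambda>k. l ^ k / fact k) sums exp l"
    using exp_converges[of l] by (simp add: divide_inverse mult.commute)
  from sums_mult2[OF this, of "exp (- l)"] show p1: "p sums 1" by (simp add: p_def e)
  have shift: "p (Suc k) * real (Suc k) = l * p k" for k
    by (simp add: p_def field_simps del: of_nat_Suc)
  have "(\<lambda>k. p (Suc k) * real (Suc k)) sums (l * 1)" unfolding shift by (intro sums_mult p1)
  from sums_Suc[OF this] show p2: "(\<lambda>k. p k * real k) sums l" by simp
  have "p (Suc k) * (real (Suc k))\<^sup>2 = l * (p k * real k) + l * p k" for k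
    using shift[of k] by (simp add: power2_eq_square mult.assoc[symmetric]) (simp add: algebra_simps)
  moreover have "(\<lambda>k. l * (p k * real k) + l * p k) sums (l * l + l * 1)"
    by (intro sums_add sums_mult p1 p2)
  ultimately have "(\<lambda>k. p (Suc k) * (real (Suc k))\<^sup>2) sums (l * l + l * 1)" by simp
  from sums_Suc[OF this] show "(\<lambda>k. p k * (real k)\<^sup>2) sums (l\<^sup>2 + l)" by (simp add: power2_eq_square)
qed

definition admissible_simple :: "'a measure \<Rightarrow> (real \<times> 'a set) list set"
  where "admissible_simple \<rho> = {S. \<forall>(_, G)\<in>set S. G \<in> sets \<rho> \<and> emeasure \<rho> G < \<infinity>}"

text \<open>
  The cell of the partition generated by \<open>\<G>\<close> on which exactly the members of
  \<open>\<H>\<close> contain the point; \<open>\<H>\<close> is meant to be a subset of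
  \<open>\<G>\<close>.
\<close>

definition atom :: "'a set set \<Rightarrow> 'a set set \<Rightarrow> 'a set"
  where "atom \<G> \<H> = {x. \<forall>G\<in>\<G>. x \<in> G \<longleftrightarrow> G \<in> \<H>}"

lemma atom_disjoint: "disjoint_family_on (atom \<G>) (Pow \<G>)"
  by (auto simp: disjoint_family_on_def atom_def)

lemma union_of_atoms:
  assumes "G \<in> \<G>"
  shows "G = (\<Union>\<H>\<in>{\<H>\<in>Pow \<G> - {{}}. G \<in> \<H>}. atom \<G> \<H>)"
proof
  show "G \<subseteq> (\<Union>\<H>\<in>{\<H>\<in>Pow \<G> - {{}}. G \<in> \<H>}. atom \<G> \<H>)"
  proof
    fix x assume "x \<in> G"
    then show "x \<in> (\<Union>\<H>\<in>{\<H>\<in>Pow \<G> - {{}}. G \<in> \<H>}. atom \<G> \<H>)"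
      using assms by (intro UN_I[of "{H\<in>\<G>. x \<in> H}"]) (auto simp: atom_def)
  qed
qed (use assms in \<open>auto simp: atom_def\<close>)

lemma atom_sets:
  assumes "finite \<G>" "\<G> \<subseteq> sets m" "\<H> \<in> Pow \<G> - {{}}"
  shows "atom \<G> \<H> \<in> sets m" "atom \<G> \<H> \<subseteq> \<Union>\<G>" "G \<in> \<H> \<Longrightarrow> atom \<G> \<H> \<subseteq> G"
proof -
  obtain G0 where G: "G0 \<in> \<H>" "G0 \<in> \<G>" using assms(3) by blast
  have "G0 \<subseteq> space m" using G(2) assms(2) by (intro sets.sets_into_space) blast
  then have "atom \<G> \<H> = {x\<in>space m. \<forall>G\<in>\<G>. x \<in> G \<longleftrightarrow> G \<in> \<H>}"
    using G by (auto simp: atom_def)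
  also have "\<dots> \<in> sets m"
  proof (rule sets.sets_Collect_finite_All[OF _ assms(1)])
    fix H assume "H \<in> \<G>"
    then have [measurable]: "H \<in> sets m" using assms(2) by blast
    show "{x\<in>space m. x \<in> H \<longleftrightarrow> H \<in> \<H>} \<in> sets m" by measurable
  qed
  finally show "atom \<G> \<H> \<in> sets m" .
  show "atom \<G> \<H> \<subseteq> \<Union>\<G>" using G by (auto simp: atom_def)
  show "G \<in> \<H> \<Longrightarrow> atom \<G> \<H> \<subseteq> G" using assms(3) by (auto simp: atom_def)
qed

text \<open>
  Used for indicators, for the intensity and for the random measure, each of which is additive
  over atoms.
\<close>

lemma sum_list_over_atoms:
  fixes \<phi> :: "'a set \<Rightarrow> real"
  assumes fin: "finite \<G>" and S: "snd ` set S \<subseteq> \<G>"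
    and add: "\<And>G. G \<in> \<G> \<Longrightarrow> \<phi> G = (\<Sum>\<H>\<in>{\<H>\<in>Pow \<G> - {{}}. G \<in> \<H>}. \<phi> (atom \<G> \<H>))"
  shows "(\<Sum>(a, G)\<leftarrow>S. a * \<phi> G)
    = (\<Sum>\<H>\<in>Pow \<G> - {{}}. (\<Sum>(a, G)\<leftarrow>S. if G \<in> \<H> then a else 0) * \<phi> (atom \<G> \<H>))"
  using S
proof (induction S)
  case (Cons z S)
  obtain a G where z: "z = (a, G)" by (cases z) auto
  have "a * \<phi> G = (\<Sum>\<H>\<in>{\<H>\<in>Pow \<G> - {{}}. G \<in> \<H>}. a * \<phi> (atom \<G> \<H>))"
    using add[of G] Cons.prems by (simp add: z sum_distrib_left)
  also have "\<dots> = (\<Sum>\<H>\<in>Pow \<G> - {{}}. if G \<in> \<H> then a * \<phi> (atom \<G> \<H>) else 0)"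
    using fin by (intro sum.inter_filter) simp
  also have "\<dots> = (\<Sum>\<H>\<in>Pow \<G> - {{}}. (if G \<in> \<H> then a else 0) * \<phi> (atom \<G> \<H>))"
    by (intro sum.cong) auto
  finally show ?case using Cons by (simp add: z distrib_right sum.distrib)
qed simp

lemma measure_over_atoms:
  assumes "finite \<G>" "\<G> \<subseteq> sets m" "\<And>G. G \<in> \<G> \<Longrightarrow> emeasure m G < \<infinity>" "G \<in> \<G>"
  shows "measure m G = (\<Sum>\<H>\<in>{\<H>\<in>Pow \<G> - {{}}. G \<in> \<H>}. measure m (atom \<G> \<H>))"
proof -
  have "measure m (\<Union>\<H>\<in>{\<H>\<in>Pow \<G> - {{}}. G \<in> \<H>}. atom \<G> \<H>)
    = (\<Sum>\<H>\<in>{\<H>\<in>Pow \<G> - {{}}. G \<in> \<H>}. measure m (atom \<G> \<H>))"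
  proof (rule measure_finite_Union)
    show "finite {\<H> \<in> Pow \<G> - {{}}. G \<in> \<H>}" using assms(1) by simp
    show "atom \<G> ` {\<H> \<in> Pow \<G> - {{}}. G \<in> \<H>} \<subseteq> sets m"
      using atom_sets(1)[OF assms(1,2)] by auto
    show "disjoint_family_on (atom \<G>) {\<H> \<in> Pow \<G> - {{}}. G \<in> \<H>}"
      by (rule disjoint_family_on_mono[OF _ atom_disjoint]) auto
    fix \<H> assume "\<H> \<in> {\<H> \<in> Pow \<G> - {{}}. G \<in> \<H>}"
    then have "emeasure m (atom \<G> \<H>) \<le> emeasure m G"
      using assms(2,4) atom_sets(3)[OF assms(1,2)] by (intro emeasure_mono) auto
    then show "emeasure m (atom \<G> \<H>) \<noteq> \<infinity>" using assms(3)[OF assms(4)] by auto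
  qed
  then show ?thesis using union_of_atoms[OF assms(4)] by simp
qed

locale poisson_setting =
  fixes P :: "'w measure" and \<rho> :: "'a measure" and N :: "'w \<Rightarrow> 'a measure"
  assumes prob_space_P: "prob_space P" and prm: "poisson_random_measure P \<rho> N"
    and N_sets: "\<And>G \<omega>. G \<in> sets \<rho> \<Longrightarrow> G \<in> sets (N \<omega>)"
begin

sublocale prob_space P by (rule prob_space_P)

abbreviation fin_sets :: "'a set set"
  where "fin_sets \<equiv> {G\<in>sets \<rho>. emeasure \<rho> G < \<infinity>}"

definition compensated :: "'a set \<Rightarrow> 'w \<Rightarrow> real"
  where "compensated G \<omega> = measure (N \<omega>) G - measure \<rho> G"

lemma N_measurable [measurable]: "G \<in> sets \<rho> \<Longrightarrow> (\<lambda>\<omega>. emeasure (N \<omega>) G) \<in> borel_measurable P"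
  using prm by (simp add: poisson_random_measure_def)

lemma compensated_measurable [measurable]: "G \<in> sets \<rho> \<Longrightarrow> compensated G \<in> borel_measurable P"
  unfolding compensated_def measure_def[of "N _"]
  by (intro borel_measurable_diff measurable_compose[OF N_measurable]) simp_all

lemma N_finite:
  assumes G: "G \<in> fin_sets"
  shows "AE \<omega> in P. \<exists>k::nat. emeasure (N \<omega>) G = of_nat k"
proof -
  let ?E = "\<lambda>k::nat. {\<omega>\<in>space P. emeasure (N \<omega>) G = of_nat k}"
  have [measurable]: "G \<in> sets \<rho>" using G by simp
  have E: "range ?E \<subseteq> sets P" by auto
  have disj: "disjoint_family ?E" by (auto simp: disjoint_family_on_def)
  have "(\<lambda>k. measure P (?E k)) sums measure P (\<Union>k. ?E k)"
    by (rule measure_UNION[OF E disj]) (simp add: emeasure_eq_measure)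
  moreover have "(\<lambda>k. measure P (?E k)) = (\<lambda>k. measure \<rho> G ^ k / fact k * exp (- measure \<rho> G))"
    using prm G by (auto simp: poisson_random_measure_def)
  ultimately have "measure P (\<Union>k. ?E k) = 1"
    using sums_unique2[OF _ poisson_moment_sums(1)[of "measure \<rho> G"]] by simp
  then have "AE \<omega> in P. \<omega> \<in> (\<Union>k. ?E k)" using E by (subst prob_eq_1[symmetric]) auto
  then show ?thesis by eventually_elim auto
qed

lemma compensated_moments:
  assumes G: "G \<in> fin_sets"
  shows "compensated G \<in> L2_fun P" "(LINT \<omega>|P. compensated G \<omega>) = 0"
    "(LINT \<omega>|P. (compensated G \<omega>)\<^sup>2) = measure \<rho> G"
proof -
  let ?l = "measure \<rho> G"
  have [measurable]: "G \<in> sets \<rho>" using G by simp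
  (* The number of points as a natural number, where the random measure is finite. *)
  define K where "K \<omega> = nat \<lfloor>measure (N \<omega>) G\<rfloor>" for \<omega>
  have "(\<lambda>\<omega>. measure (N \<omega>) G) \<in> borel_measurable P"
    unfolding measure_def by (rule measurable_compose[OF N_measurable]) simp_all
  then have KM: "K \<in> measurable P (count_space UNIV)" unfolding K_def by measurable
  have KN: "AE \<omega> in P. emeasure (N \<omega>) G = of_nat (K \<omega>) \<and> real (K \<omega>) = measure (N \<omega>) G"
    using N_finite[OF G]
  proof eventually_elim
    case (elim \<omega>)
    then obtain k :: nat where k: "emeasure (N \<omega>) G = of_nat k" by blast
    then have "measure (N \<omega>) G = real k" by (simp add: measure_def ennreal_of_nat_eq_real_of_nat)
    then show ?case using k by (simp add: K_def)
  qed
  have p: "measure P {\<omega>\<in>space P. K \<omega> = k} = ?l ^ k / fact k * exp (- ?l)" for k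
  proof -
    have "measure P {\<omega>\<in>space P. K \<omega> = k} = measure P {\<omega>\<in>space P. emeasure (N \<omega>) G = of_nat k}"
    proof (rule finite_measure_eq_AE)
      show "AE \<omega> in P. \<omega> \<in> {\<omega>\<in>space P. K \<omega> = k} \<longleftrightarrow> \<omega> \<in> {\<omega>\<in>space P. emeasure (N \<omega>) G = of_nat k}"
        using KN by eventually_elim auto
      show "{\<omega>\<in>space P. K \<omega> = k} \<in> sets P" using KM by measurable
    qed measurable
    then show ?thesis using prm G by (simp add: poisson_random_measure_def)
  qed
  note m1 = integral_nat_valued[OF prob_space_P KM p _ poisson_moment_sums(2)[of ?l]]
  note m2 = integral_nat_valued[OF prob_space_P KM p _ poisson_moment_sums(3)[of ?l]]
  have KM'[measurable]: "(\<lambda>\<omega>. real (K \<omega>)) \<in> borel_measurable P"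
    by (rule measurable_compose[OF KM]) simp
  have eq: "AE \<omega> in P. compensated G \<omega> = real (K \<omega>) - ?l"
    using KN by eventually_elim (simp add: compensated_def)
  have eq2: "AE \<omega> in P. (compensated G \<omega>)\<^sup>2 = (real (K \<omega>))\<^sup>2 - 2 * ?l * real (K \<omega>) + ?l\<^sup>2"
    using eq by eventually_elim (simp add: power2_diff)
  have i: "integrable P (\<lambda>\<omega>. (real (K \<omega>))\<^sup>2 - 2 * ?l * real (K \<omega>) + ?l\<^sup>2)"
    using m1(1) m2(1) by (intro Bochner_Integration.integrable_add Bochner_Integration.integrable_diff integrable_mult_right) auto
  then have "integrable P (\<lambda>\<omega>. (compensated G \<omega>)\<^sup>2)"
    by (subst integrable_cong_AE[OF _ _ eq2]) measurable
  then show "compensated G \<in> L2_fun P" by (simp add: L2_fun_def)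
  have "(LINT \<omega>|P. compensated G \<omega>) = (LINT \<omega>|P. real (K \<omega>) - ?l)"
    by (rule integral_cong_AE[OF _ _ eq]) measurable
  then show "(LINT \<omega>|P. compensated G \<omega>) = 0" using m1 by (simp add: prob_space)
  have "(LINT \<omega>|P. (compensated G \<omega>)\<^sup>2) = (LINT \<omega>|P. (real (K \<omega>))\<^sup>2 - 2 * ?l * real (K \<omega>) + ?l\<^sup>2)"
    by (rule integral_cong_AE[OF _ _ eq2]) measurable
  also have "\<dots> = ?l\<^sup>2 + ?l - 2 * ?l * ?l + ?l\<^sup>2"
    using m1 m2 by (simp add: prob_space)
  finally show "(LINT \<omega>|P. (compensated G \<omega>)\<^sup>2) = ?l" by (simp add: power2_eq_square)
qed

lemma compensated_indep:
  fixes n :: nat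
  assumes D: "\<And>k. k < n \<Longrightarrow> D k \<in> fin_sets" and disj: "disjoint_family_on D {..<n}"
  shows "indep_vars (\<lambda>_. borel) (\<lambda>k. compensated (D k)) {..<n}"
proof -
  have "indep_vars (\<lambda>_. borel) (\<lambda>k \<omega>. emeasure (N \<omega>) (D k)) {..<n}"
  proof -
    have "(\<forall>i<n. D i \<in> sets \<rho> \<and> emeasure \<rho> (D i) < \<infinity>) \<and> disjoint_family_on D {..<n}"
      using D disj by simp
    then show ?thesis
      using prm[unfolded poisson_random_measure_def, THEN conjunct2, THEN conjunct2, rule_format, of n D] by blast
  qed
  then have "indep_vars (\<lambda>_. borel) (\<lambda>k \<omega>. enn2real (emeasure (N \<omega>) (D k)) - measure \<rho> (D k)) {..<n}"
    by (rule indep_vars_compose2) measurable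
  then show ?thesis by (simp add: compensated_def[abs_def] measure_def)
qed

lemma cf_disjoint_sum:
  fixes n :: nat
  assumes D: "\<And>k. k < n \<Longrightarrow> D k \<in> fin_sets" and disj: "disjoint_family_on D {..<n}"
  shows "cf P (\<lambda>\<omega>. \<Sum>k<n. c k * compensated (D k) \<omega>) = (\<Prod>k<n. cf P (\<lambda>\<omega>. c k * compensated (D k) \<omega>))"
proof -
  have i: "indep_vars (\<lambda>_. borel) (\<lambda>k \<omega>. c k * compensated (D k) \<omega>) {..<n}"
    by (rule indep_vars_compose2[OF compensated_indep[OF D disj]]) measurable
  have "(\<lambda>\<omega>. c k * compensated (D k) \<omega>) \<in> borel_measurable P" if "k < n" for k
    using D[OF that] by (intro borel_measurable_times compensated_measurable) auto
  then show ?thesis using char_distr_sum[OF i, of 1] by (simp add: cf_distr)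
qed

lemma norm2_disjoint_sum_compensated:
  fixes n :: nat
  assumes D: "\<And>k. k < n \<Longrightarrow> D k \<in> fin_sets" and disj: "disjoint_family_on D {..<n}"
  shows "(norm2 P (\<lambda>\<omega>. \<Sum>k<n. c k * compensated (D k) \<omega>))\<^sup>2 = (\<Sum>k<n. measure \<rho> (D k) * (norm (c k))\<^sup>2)"
proof -
  let ?X = "\<lambda>k. compensated (D k)"
  have XL: "?X k \<in> L2_fun P" if "k < n" for k using compensated_moments(1)[OF D[OF that]] .
  have Xint: "integrable P (?X k)" if "k < n" for k by (rule integral_abs_le_norm2(1)[OF prob_space_P XL[OF that]])
  have L: "(\<lambda>\<omega>. \<Sum>k<n. c k * ?X k \<omega>) \<in> L2_fun P"
    using XL by (intro L2_fun_sum L2_fun_scaleR[where 'b=real, unfolded real_scaleR_def]) auto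
  have XX: "integrable P (\<lambda>\<omega>. ?X j \<omega> * ?X k \<omega>)" if "j < n" "k < n" for j k
  proof -
    have [measurable]: "?X j \<in> borel_measurable P" "?X k \<in> borel_measurable P"
      using XL[THEN L2_funD] that by auto
    have "integrable P (\<lambda>\<omega>. norm (?X j \<omega> * ?X k \<omega>))"
      using L2_Cauchy_Schwarz(1)[OF XL[OF that(1)] XL[OF that(2)]] by (simp add: abs_mult)
    then show ?thesis by (subst (asm) integrable_norm_iff) auto
  qed
  have cov: "(LINT \<omega>|P. ?X j \<omega> * ?X k \<omega>) = (if j = k then measure \<rho> (D k) else 0)" if jk: "j < n" "k < n" for j k
  proof (cases "j = k")
    case True
    then show ?thesis using compensated_moments(3)[OF D[OF jk(2)]] by (simp add: power2_eq_square)
  next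
    case False
    have "indep_vars (\<lambda>_. borel) ?X {j, k}"
      by (rule indep_vars_subset[OF compensated_indep[OF D disj]]) (use jk in auto)
    then have "(LINT \<omega>|P. (\<Prod>l\<in>{j, k}. ?X l \<omega>)) = (\<Prod>l\<in>{j, k}. LINT \<omega>|P. ?X l \<omega>)"
      using jk Xint by (intro indep_vars_lebesgue_integral) auto
    then show ?thesis using False compensated_moments(2)[OF D[OF jk(1)]] by simp
  qed
  have "(norm2 P (\<lambda>\<omega>. \<Sum>k<n. c k * ?X k \<omega>))\<^sup>2 = (LINT \<omega>|P. (\<Sum>j<n. \<Sum>k<n. c j * c k * (?X j \<omega> * ?X k \<omega>)))"
    unfolding norm2_power2[OF L] by (simp add: power2_eq_square sum_product algebra_simps)
  also have "\<dots> = (\<Sum>j<n. \<Sum>k<n. c j * c k * (LINT \<omega>|P. ?X j \<omega> * ?X k \<omega>))"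
    using XX by (subst Bochner_Integration.integral_sum; (intro sum.cong refl, subst Bochner_Integration.integral_sum)?) auto
  also have "\<dots> = (\<Sum>j<n. \<Sum>k<n. if j = k then measure \<rho> (D k) * (norm (c k))\<^sup>2 else 0)"
    using cov by (intro sum.cong refl) (auto simp: power2_eq_square)
  also have "\<dots> = (\<Sum>k<n. measure \<rho> (D k) * (norm (c k))\<^sup>2)"
    by (intro sum.cong refl) (simp add: sum.delta')
  finally show ?thesis .
qed

text \<open>
  The empty \<open>\<H>\<close> is left out: its atom is the complement of the union and can have
  infinite measure. The equation for the integral holds only almost surely because the random
  measure may be infinite on a set of finite intensity with probability zero, where
  \<open>measure\<close> has the value zero.
\<close>

lemma disjoint_representation:
  assumes S: "S \<in> admissible_simple \<rho>"
  obtains n :: nat and D :: "nat \<Rightarrow> 'a set" and c :: "nat \<Rightarrow> real"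
  where "\<And>k. k < n \<Longrightarrow> D k \<in> fin_sets" "disjoint_family_on D {..<n}"
    "\<And>k. k < n \<Longrightarrow> D k \<subseteq> \<Union>(snd ` set S)"
    "simple_fun S = (\<lambda>z. \<Sum>k<n. indicator (D k) z *\<^sub>R c k)"
    "AE \<omega> in P. compensated_simple_integral N \<rho> S \<omega> = (\<Sum>k<n. c k * compensated (D k) \<omega>)"
proof -
  define \<G> where "\<G> = snd ` set S"
  have fin: "finite \<G>" by (simp add: \<G>_def)
  have G: "\<G> \<subseteq> sets \<rho>" "\<And>G. G \<in> \<G> \<Longrightarrow> emeasure \<rho> G < \<infinity>"
    using S by (auto simp: \<G>_def admissible_simple_def)
  let ?I = "Pow \<G> - {{}}"
  obtain h where h: "bij_betw h {0..<card ?I} ?I" 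
    using ex_bij_betw_nat_finite[OF finite_Diff[OF finite_Pow_iff[THEN iffD2, OF fin]]] by blast
  define n where "n = card ?I"
  define D where "D k = atom \<G> (h k)" for k
  define c where "c k = (\<Sum>(a, G)\<leftarrow>S. if G \<in> h k then a else 0)" for k
  have hI: "h k \<in> ?I" if "k < n" for k
    by (rule bij_betwE[OF h, rule_format]) (use that in \<open>simp add: n_def\<close>)
  have reindex: "(\<Sum>k<n. f (h k)) = (\<Sum>\<H>\<in>?I. f \<H>)" for f :: "'a set set \<Rightarrow> real"
    using sum.reindex_bij_betw[OF h, of f] by (simp add: n_def atLeast0LessThan)
  have D: "D k \<in> fin_sets" if kn: "k < n" for k
  proof -
    obtain G where "G \<in> h k" "G \<in> \<G>" using hI[OF kn] by blast
    then have "emeasure \<rho> (D k) \<le> emeasure \<rho> G"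
      unfolding D_def using atom_sets(3)[OF fin G(1) hI[OF kn]] G(1) by (intro emeasure_mono) auto
    also have "\<dots> < \<infinity>" using G(2) \<open>G \<in> \<G>\<close> by blast
    finally show ?thesis using atom_sets(1)[OF fin G(1) hI[OF kn]] by (simp add: D_def)
  qed
  moreover have "disjoint_family_on D {..<n}"
    unfolding disjoint_family_on_def
  proof (intro ballI impI)
    fix j k assume jk: "j \<in> {..<n}" "k \<in> {..<n}" "j \<noteq> k"
    then have "h j \<noteq> h k"
      using inj_on_eq_iff[OF bij_betw_imp_inj_on[OF h], of j k] by (simp add: n_def)
    then show "D j \<inter> D k = {}" using atom_disjoint[of \<G>] hI jk by (auto simp: disjoint_family_on_def D_def)
  qed
  moreover have "D k \<subseteq> \<Union>(snd ` set S)" if "k < n" for k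
    using atom_sets(2)[OF fin G(1) hI[OF that]] by (simp add: D_def \<G>_def)
  moreover have "simple_fun S = (\<lambda>z. \<Sum>k<n. indicator (D k) z *\<^sub>R c k)"
  proof
    fix z
    have "simple_fun S z = (\<Sum>\<H>\<in>?I. (\<Sum>(a, G)\<leftarrow>S. if G \<in> \<H> then a else 0) * indicator (atom \<G> \<H>) z)"
      unfolding simple_fun_def
    proof (rule sum_list_over_atoms[OF fin])
      show "snd ` set S \<subseteq> \<G>" by (simp add: \<G>_def)
      fix G assume "G \<in> \<G>"
      have "(indicator G z :: real) = indicator (\<Union>\<H>\<in>{\<H>\<in>?I. G \<in> \<H>}. atom \<G> \<H>) z"
        using union_of_atoms[OF \<open>G \<in> \<G>\<close>] by simp
      also have "\<dots> = (\<Sum>\<H>\<in>{\<H>\<in>?I. G \<in> \<H>}. indicator (atom \<G> \<H>) z)"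
        using fin by (intro indicator_UN_disjoint disjoint_family_on_mono[OF _ atom_disjoint]) auto
      finally show "(indicator G z :: real) = (\<Sum>\<H>\<in>{\<H>\<in>?I. G \<in> \<H>}. indicator (atom \<G> \<H>) z)" .
    qed
    also have "\<dots> = (\<Sum>k<n. indicator (D k) z *\<^sub>R c k)"
      unfolding reindex[symmetric] D_def c_def by (simp add: mult.commute)
    finally show "simple_fun S z = (\<Sum>k<n. indicator (D k) z *\<^sub>R c k)" .
  qed
  moreover have "AE \<omega> in P. compensated_simple_integral N \<rho> S \<omega> = (\<Sum>k<n. c k * compensated (D k) \<omega>)"
  proof -
    have "AE \<omega> in P. \<forall>G\<in>\<G>. emeasure (N \<omega>) G < \<infinity>"
    proof (rule AE_finite_allI[OF fin])
      fix G assume "G \<in> \<G>"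
      then have "AE \<omega> in P. \<exists>k::nat. emeasure (N \<omega>) G = of_nat k" using G by (intro N_finite) auto
      then show "AE \<omega> in P. emeasure (N \<omega>) G < \<infinity>" by eventually_elim (auto simp: of_nat_less_top)
    qed
    then show ?thesis
    proof eventually_elim
      case (elim \<omega>)
      have "compensated_simple_integral N \<rho> S \<omega>
        = (\<Sum>\<H>\<in>?I. (\<Sum>(a, G)\<leftarrow>S. if G \<in> \<H> then a else 0) * compensated (atom \<G> \<H>) \<omega>)"
        unfolding compensated_simple_integral_def compensated_def
      proof (rule sum_list_over_atoms[OF fin])
        show "snd ` set S \<subseteq> \<G>" by (simp add: \<G>_def)
        fix G assume g: "G \<in> \<G>"
        have "measure (N \<omega>) G = (\<Sum>\<H>\<in>{\<H>\<in>?I. G \<in> \<H>}. measure (N \<omega>) (atom \<G> \<H>))"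
          by (rule measure_over_atoms[OF fin _ _ g]) (use G N_sets elim in auto)
        moreover have "measure \<rho> G = (\<Sum>\<H>\<in>{\<H>\<in>?I. G \<in> \<H>}. measure \<rho> (atom \<G> \<H>))"
          by (rule measure_over_atoms[OF fin _ _ g]) (use G in auto)
        ultimately show "measure (N \<omega>) G - measure \<rho> G
          = (\<Sum>\<H>\<in>{\<H>\<in>?I. G \<in> \<H>}. measure (N \<omega>) (atom \<G> \<H>) - measure \<rho> (atom \<G> \<H>))"
          by (simp add: sum_subtractf)
      qed
      also have "\<dots> = (\<Sum>k<n. c k * compensated (D k) \<omega>)"
        unfolding reindex[symmetric] D_def c_def ..
      finally show ?case .
    qed
  qed
  ultimately show thesis by (rule that)
qed

lemma compensated_simple_integral_L2:
  assumes "S \<in> admissible_simple \<rho>"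
  shows "compensated_simple_integral N \<rho> S \<in> L2_fun P" "(LINT \<omega>|P. compensated_simple_integral N \<rho> S \<omega>) = 0"
proof -
  have "compensated_simple_integral N \<rho> S \<in> L2_fun P \<and> (LINT \<omega>|P. compensated_simple_integral N \<rho> S \<omega>) = 0"
    using assms
  proof (induction S)
    case Nil
    then show ?case by (simp add: compensated_simple_integral_def)
  next
    case (Cons z S)
    obtain a G where z: "z = (a, G)" by (cases z) auto
    have G: "G \<in> fin_sets" using Cons.prems by (auto simp: z admissible_simple_def)
    have IH: "compensated_simple_integral N \<rho> S \<in> L2_fun P" "(LINT \<omega>|P. compensated_simple_integral N \<rho> S \<omega>) = 0"
      using Cons by (auto simp: admissible_simple_def)
    have eq: "compensated_simple_integral N \<rho> (z # S) = (\<lambda>\<omega>. a *\<^sub>R compensated G \<omega> + compensated_simple_integral N \<rho> S \<omega>)"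
      by (auto simp: z compensated_simple_integral_def compensated_def)
    note aG = L2_fun_scaleR[OF compensated_moments(1)[OF G], of a]
    show ?case
    proof
      show "compensated_simple_integral N \<rho> (z # S) \<in> L2_fun P" unfolding eq by (rule L2_fun_add[OF aG IH(1)])
      have "(LINT \<omega>|P. a *\<^sub>R compensated G \<omega> + compensated_simple_integral N \<rho> S \<omega>)
        = (LINT \<omega>|P. a *\<^sub>R compensated G \<omega>) + (LINT \<omega>|P. compensated_simple_integral N \<rho> S \<omega>)"
        by (intro Bochner_Integration.integral_add integral_abs_le_norm2[OF prob_space_P] aG IH)
      then show "(LINT \<omega>|P. compensated_simple_integral N \<rho> (z # S) \<omega>) = 0"
        unfolding eq using IH(2) compensated_moments(2)[OF G] by simp
    qed
  qed
  then show "compensated_simple_integral N \<rho> S \<in> L2_fun P" "(LINT \<omega>|P. compensated_simple_integral N \<rho> S \<omega>) = 0" by auto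
qed

sublocale poisson: isometric_integral \<rho> P "admissible_simple \<rho>" simple_fun "compensated_simple_integral N \<rho>"
proof
  fix S S' and c :: real
  assume S: "S \<in> admissible_simple \<rho>"
  show I: "compensated_simple_integral N \<rho> S \<in> L2_fun P" and "(LINT \<omega>|P. compensated_simple_integral N \<rho> S \<omega>) = 0"
    by (rule compensated_simple_integral_L2[OF S])+
  obtain n :: nat and D c' where D: "\<And>k. k < n \<Longrightarrow> D k \<in> fin_sets" "disjoint_family_on D {..<n}"
    and J: "simple_fun S = (\<lambda>z. \<Sum>k<n. indicator (D k) z *\<^sub>R c' k)"
    and E: "AE \<omega> in P. compensated_simple_integral N \<rho> S \<omega> = (\<Sum>k<n. c' k * compensated (D k) \<omega>)"
    by (rule disjoint_representation[OF S]) (rule that)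
  have D': "D k \<in> sets \<rho>" "emeasure \<rho> (D k) < \<infinity>" if "k < n" for k using D(1)[OF that] by auto
  show "simple_fun S \<in> L2_fun \<rho>" unfolding J by (rule norm2_disjoint_sum(1)[OF D' D(2)])
  have "norm2 P (compensated_simple_integral N \<rho> S) = norm2 P (\<lambda>\<omega>. \<Sum>k<n. c' k * compensated (D k) \<omega>)"
    using D' by (intro norm2_cong_AE[OF L2_funD[OF I] _ E] borel_measurable_sum borel_measurable_times compensated_measurable) auto
  moreover have "(norm2 P (\<lambda>\<omega>. \<Sum>k<n. c' k * compensated (D k) \<omega>))\<^sup>2 = (norm2 \<rho> (simple_fun S))\<^sup>2"
    unfolding J by (rule trans[OF norm2_disjoint_sum_compensated[OF D] norm2_disjoint_sum(2)[OF D' D(2), symmetric]])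
  ultimately show "norm2 P (compensated_simple_integral N \<rho> S) = norm2 \<rho> (simple_fun S)"
    by (simp add: power2_eq_iff_nonneg)
  assume S': "S' \<in> admissible_simple \<rho>"
  let ?R = "S @ map (\<lambda>(a, G). (c * a, G)) S'"
  have "?R \<in> admissible_simple \<rho>" using S S' by (auto simp: admissible_simple_def)
  moreover have "simple_fun (map (\<lambda>(a, G). (c * a, G)) S') z = c *\<^sub>R simple_fun S' z" for z
    by (induction S') (auto simp: simple_fun_def distrib_left)
  moreover have "simple_fun (S @ S'') z = simple_fun S z + simple_fun S'' z" for S'' z
    by (simp add: simple_fun_def)
  moreover have "compensated_simple_integral N \<rho> (map (\<lambda>(a, G). (c * a, G)) S') \<omega> = c *\<^sub>R compensated_simple_integral N \<rho> S' \<omega>" for \<omega>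
    by (induction S') (auto simp: compensated_simple_integral_def distrib_left)
  moreover have "compensated_simple_integral N \<rho> (S @ S'') \<omega> = compensated_simple_integral N \<rho> S \<omega> + compensated_simple_integral N \<rho> S'' \<omega>" for S'' \<omega>
    by (simp add: compensated_simple_integral_def)
  ultimately show "\<exists>R\<in>admissible_simple \<rho>. simple_fun R = (\<lambda>x. simple_fun S x + c *\<^sub>R simple_fun S' x) \<and>
    compensated_simple_integral N \<rho> R = (\<lambda>\<omega>. compensated_simple_integral N \<rho> S \<omega> + c *\<^sub>R compensated_simple_integral N \<rho> S' \<omega>)"
    by (intro bexI[of _ ?R]) auto
qed

lemma has_compensated_integral_iff: "has_compensated_integral P N \<rho> f Y \<longleftrightarrow> poisson.has_ext f Y"
  unfolding has_compensated_integral_def poisson.has_ext_def by (simp add: admissible_simple_def)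

lemma compensated_integral_has_ext:
  assumes "f \<in> L2_fun \<rho>"
  shows "poisson.has_ext f (SOME Y. has_compensated_integral P N \<rho> f Y)"
proof -
  have "poisson.approximable (\<lambda>x. indicator A x *\<^sub>R y)" if "A \<in> sets \<rho>" "emeasure \<rho> A < \<infinity>" for A y
  proof -
    have "poisson.approximable (simple_fun [(y, A)])"
      using that by (intro poisson.approximable_J) (simp add: admissible_simple_def)
    moreover have "simple_fun [(y, A)] = (\<lambda>x. indicator A x *\<^sub>R y)"
      by (rule ext) (simp add: simple_fun_def)
    ultimately show ?thesis by simp
  qed
  from poisson.approximable_has_ext[OF poisson.approximable_if_indicators[OF this assms]]
  have "\<exists>Y. has_compensated_integral P N \<rho> f Y" unfolding has_compensated_integral_iff by simp
  then show ?thesis unfolding has_compensated_integral_iff[symmetric] by (rule someI_ex)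
qed

lemma cf_simple_disjoint_supports:
  assumes S: "S \<in> admissible_simple \<rho>" "\<Union>(snd ` set S) \<subseteq> B"
    and S': "S' \<in> admissible_simple \<rho>" "\<Union>(snd ` set S') \<inter> B = {}"
  shows "cf P (\<lambda>\<omega>. compensated_simple_integral N \<rho> S \<omega> + compensated_simple_integral N \<rho> S' \<omega>)
    = cf P (compensated_simple_integral N \<rho> S) * cf P (compensated_simple_integral N \<rho> S')"
proof -
  let ?I = "compensated_simple_integral N \<rho>"
  obtain n :: nat and D c where D: "\<And>k. k < n \<Longrightarrow> D k \<in> fin_sets" "disjoint_family_on D {..<n}"
    "\<And>k. k < n \<Longrightarrow> D k \<subseteq> \<Union>(snd ` set S)"
    and E: "AE \<omega> in P. ?I S \<omega> = (\<Sum>k<n. c k * compensated (D k) \<omega>)"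
    by (rule disjoint_representation[OF S(1)]) (rule that)
  obtain n' :: nat and D' c' where D': "\<And>k. k < n' \<Longrightarrow> D' k \<in> fin_sets" "disjoint_family_on D' {..<n'}"
    "\<And>k. k < n' \<Longrightarrow> D' k \<subseteq> \<Union>(snd ` set S')"
    and E': "AE \<omega> in P. ?I S' \<omega> = (\<Sum>k<n'. c' k * compensated (D' k) \<omega>)"
    by (rule disjoint_representation[OF S'(1)]) (rule that)
  (* The two disjoint families are concatenated into one. *)
  define A where "A k = (if k < n then D k else D' (k - n))" for k
  define a where "a k = (if k < n then c k else c' (k - n))" for k
  have A: "A k \<in> fin_sets" if "k < n + n'" for k
    using that D(1)[of k] D'(1)[of "k - n"] by (auto simp: A_def)
  have DB: "D k \<subseteq> B" if "k < n" for k using D(3)[OF that] S(2) by blast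
  have DB': "D' k \<inter> B = {}" if "k < n'" for k using D'(3)[OF that] S'(2) by blast
  have disj: "disjoint_family_on A {..<n + n'}"
    unfolding disjoint_family_on_def
  proof (intro ballI impI)
    fix j k assume jk: "j \<in> {..<n + n'}" "k \<in> {..<n + n'}" "j \<noteq> k"
    consider "j < n" "k < n" | "j < n" "\<not> k < n" | "\<not> j < n" "k < n" | "\<not> j < n" "\<not> k < n" by blast
    then show "A j \<inter> A k = {}"
    proof cases
      case 1 then show ?thesis using D(2) jk by (auto simp: A_def disjoint_family_on_def)
    next
      case 2
      then have "k - n < n'" using jk by auto
      then show ?thesis using 2 DB[of j] DB'[of "k - n"] by (auto simp: A_def)
    next
      case 3
      then have "j - n < n'" using jk by auto
      then show ?thesis using 3 DB[of k] DB'[of "j - n"] by (auto simp: A_def)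
    next
      case 4
      then have "j - n \<in> {..<n'}" "k - n \<in> {..<n'}" "j - n \<noteq> k - n" using jk by auto
      then show ?thesis using 4 D'(2) by (simp add: A_def disjoint_family_on_def)
    qed
  qed
  have sum_split: "(\<Sum>k<n + j. f k) = (\<Sum>k<n. f k) + (\<Sum>k<j. f (n + k))" for j and f :: "nat \<Rightarrow> real"
    by (induction j) (simp_all add: add.assoc)
  have prod_split: "(\<Prod>k<n + j. f k) = (\<Prod>k<n. f k) * (\<Prod>k<j. f (n + k))" for j and f :: "nat \<Rightarrow> complex"
    by (induction j) (simp_all add: mult.assoc)
  have m: "(\<lambda>\<omega>. \<Sum>k<j. b k * compensated (G k) \<omega>) \<in> borel_measurable P" if "\<And>k. k < j \<Longrightarrow> G k \<in> fin_sets" for j b G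
    using that by (intro borel_measurable_sum borel_measurable_times compensated_measurable) auto
  note [measurable] = L2_funD[OF poisson.I_L2[OF S(1)]] L2_funD[OF poisson.I_L2[OF S'(1)]] m[of n D] m[of n' D'] m[of "n + n'" A]
  have "cf P (\<lambda>\<omega>. ?I S \<omega> + ?I S' \<omega>) = cf P (\<lambda>\<omega>. \<Sum>k<n + n'. a k * compensated (A k) \<omega>)"
  proof (rule cf_cong_AE)
    show "AE \<omega> in P. ?I S \<omega> + ?I S' \<omega> = (\<Sum>k<n + n'. a k * compensated (A k) \<omega>)"
      using E E'
    proof eventually_elim
      case (elim \<omega>)
      then show ?case unfolding sum_split by (simp add: a_def A_def)
    qed
    show "(\<lambda>\<omega>. \<Sum>k<n + n'. a k * compensated (A k) \<omega>) \<in> borel_measurable P" by (rule m[OF A])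
  qed measurable
  also have "\<dots> = (\<Prod>k<n + n'. cf P (\<lambda>\<omega>. a k * compensated (A k) \<omega>))" by (rule cf_disjoint_sum[OF A disj])
  also have "\<dots> = (\<Prod>k<n. cf P (\<lambda>\<omega>. c k * compensated (D k) \<omega>)) * (\<Prod>k<n'. cf P (\<lambda>\<omega>. c' k * compensated (D' k) \<omega>))"
    unfolding prod_split by (simp add: a_def A_def)
  also have "(\<Prod>k<n. cf P (\<lambda>\<omega>. c k * compensated (D k) \<omega>)) = cf P (?I S)"
  proof -
    have "cf P (?I S) = cf P (\<lambda>\<omega>. \<Sum>k<n. c k * compensated (D k) \<omega>)"
      by (rule cf_cong_AE[OF L2_funD[OF poisson.I_L2[OF S(1)]] m[OF D(1)] E])
    also have "\<dots> = (\<Prod>k<n. cf P (\<lambda>\<omega>. c k * compensated (D k) \<omega>))" by (rule cf_disjoint_sum[OF D(1,2)])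
    finally show ?thesis by simp
  qed
  also have "(\<Prod>k<n'. cf P (\<lambda>\<omega>. c' k * compensated (D' k) \<omega>)) = cf P (?I S')"
  proof -
    have "cf P (?I S') = cf P (\<lambda>\<omega>. \<Sum>k<n'. c' k * compensated (D' k) \<omega>)"
      by (rule cf_cong_AE[OF L2_funD[OF poisson.I_L2[OF S'(1)]] m[OF D'(1)] E'])
    also have "\<dots> = (\<Prod>k<n'. cf P (\<lambda>\<omega>. c' k * compensated (D' k) \<omega>))" by (rule cf_disjoint_sum[OF D'(1,2)])
    finally show ?thesis by simp
  qed
  finally show ?thesis .
qed

lemma supported_approximation:
  assumes f: "poisson.has_ext f Y" and B: "B \<in> sets \<rho>" and supp: "\<And>x. x \<in> space \<rho> \<Longrightarrow> x \<notin> B \<Longrightarrow> f x = 0"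
  obtains S where "\<And>n. S n \<in> admissible_simple \<rho>" "\<And>n. \<Union>(snd ` set (S n)) \<subseteq> B"
    "L2_tendsto P (\<lambda>n. compensated_simple_integral N \<rho> (S n)) Y"
proof -
  obtain S where S: "\<And>n. S n \<in> admissible_simple \<rho>" "L2_tendsto \<rho> (\<lambda>n. simple_fun (S n)) f"
    using f by (auto simp: poisson.has_ext_def)
  (* Intersecting every set with B multiplies the simple function by the indicator of B and only
     decreases the distance to f. *)
  define R where "R n = map (\<lambda>(a, G). (a, G \<inter> B)) (S n)" for n
  have R: "R n \<in> admissible_simple \<rho>" for n
    unfolding admissible_simple_def
  proof (intro CollectI ballI)
    fix z assume "z \<in> set (R n)"
    then obtain a G where z: "z = (a, G \<inter> B)" "(a, G) \<in> set (S n)" by (auto simp: R_def)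
    then have G: "G \<in> sets \<rho>" "emeasure \<rho> G < \<infinity>" using S(1)[of n] by (auto simp: admissible_simple_def)
    have "emeasure \<rho> (G \<inter> B) \<le> emeasure \<rho> G" using G(1) B by (intro emeasure_mono) auto
    then show "case z of (_, G) \<Rightarrow> G \<in> sets \<rho> \<and> emeasure \<rho> G < \<infinity>"
      using G B by (auto simp: z intro: le_less_trans)
  qed
  have RB: "\<Union>(snd ` set (R n)) \<subseteq> B" for n by (auto simp: R_def)
  have sR: "simple_fun (R n) x = indicator B x * simple_fun (S n) x" for n x
  proof -
    have "simple_fun (map (\<lambda>(a, G). (a, G \<inter> B)) Q) x = indicator B x * simple_fun Q x" for Q
      by (induction Q) (auto simp: simple_fun_def distrib_left indicator_inter_arith)
    then show ?thesis by (simp add: R_def)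
  qed
  note fL = poisson.has_ext_L2(1)[OF f]
  have "L2_tendsto \<rho> (\<lambda>n. simple_fun (R n)) f"
    unfolding L2_tendsto_iff[OF poisson.J_L2[OF R]]
  proof (rule conjI[OF fL], rule Lim_null_comparison)
    show "(\<lambda>n. norm2 \<rho> (\<lambda>x. simple_fun (S n) x - f x)) \<longlonglongrightarrow> 0"
      using S poisson.J_L2[OF S(1)] by (simp add: L2_tendsto_iff)
    have "norm2 \<rho> (\<lambda>x. simple_fun (R n) x - f x) \<le> norm2 \<rho> (\<lambda>x. simple_fun (S n) x - f x)" for n
    proof (rule norm2_mono[OF L2_fun_diff[OF poisson.J_L2[OF S(1)] fL]])
      fix x assume "x \<in> space \<rho>"
      then show "norm (simple_fun (R n) x - f x) \<le> norm (simple_fun (S n) x - f x)"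
        using supp[of x] by (cases "x \<in> B") (auto simp: sR)
    qed
    then show "\<forall>\<^sub>F n in sequentially. norm (norm2 \<rho> (\<lambda>x. simple_fun (R n) x - f x)) \<le> norm2 \<rho> (\<lambda>x. simple_fun (S n) x - f x)"
      by simp
  qed
  from that[OF R RB poisson.has_ext_approx[OF f R this]] show thesis .
qed

text \<open>
  Integrals of functions with disjoint supports are independent. Restricting the approximating
  simple functions to the supports reduces this to disjoint families of sets.
\<close>

theorem cf_disjoint_supports:
  assumes f: "poisson.has_ext f Y" and g: "poisson.has_ext g Z" and B: "B \<in> sets \<rho>"
    and supp: "\<And>x. x \<in> space \<rho> \<Longrightarrow> x \<notin> B \<Longrightarrow> f x = 0" "\<And>x. x \<in> space \<rho> \<Longrightarrow> x \<in> B \<Longrightarrow> g x = 0"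
  shows "cf P (\<lambda>\<omega>. Y \<omega> + Z \<omega>) = cf P Y * cf P Z"
proof -
  let ?I = "compensated_simple_integral N \<rho>"
  obtain S where S: "\<And>n. S n \<in> admissible_simple \<rho>" "\<And>n. \<Union>(snd ` set (S n)) \<subseteq> B" "L2_tendsto P (\<lambda>n. ?I (S n)) Y"
  proof (rule supported_approximation[OF f B])
    show "f x = 0" if "x \<in> space \<rho>" "x \<notin> B" for x using that by (rule supp(1))
  qed (rule that)
  obtain S' where S': "\<And>n. S' n \<in> admissible_simple \<rho>" "\<And>n. \<Union>(snd ` set (S' n)) \<subseteq> space \<rho> - B"
      "L2_tendsto P (\<lambda>n. ?I (S' n)) Z"
  proof (rule supported_approximation[OF g sets.compl_sets[OF B]])
    show "g x = 0" if "x \<in> space \<rho>" "x \<notin> space \<rho> - B" for x using that supp(2) by blast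
  qed (rule that)
  note L = poisson.I_L2[OF S(1)] and L' = poisson.I_L2[OF S'(1)]
  have "(\<lambda>n. cf P (\<lambda>\<omega>. ?I (S n) \<omega> + 1 *\<^sub>R ?I (S' n) \<omega>)) \<longlonglongrightarrow> cf P (\<lambda>\<omega>. Y \<omega> + 1 *\<^sub>R Z \<omega>)"
    by (intro cf_tendsto prob_space_P L2_tendsto_add_scaleR L L' S S' L2_fun_add L2_fun_scaleR)
  moreover have "(\<lambda>n. cf P (?I (S n)) * cf P (?I (S' n))) \<longlonglongrightarrow> cf P Y * cf P Z"
    by (intro tendsto_mult cf_tendsto prob_space_P L L' S S')
  moreover have "cf P (\<lambda>\<omega>. ?I (S n) \<omega> + 1 *\<^sub>R ?I (S' n) \<omega>) = cf P (?I (S n)) * cf P (?I (S' n))" for n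
    using cf_simple_disjoint_supports[OF S(1,2) S'(1), of n n] S'(2)[of n] by force
  ultimately show ?thesis using LIMSEQ_unique by force
qed

end

section \<open>Jumps of a process with cadlag paths\<close>

definition jump_in :: "(real \<Rightarrow> 'w \<Rightarrow> 'u::real_normed_vector) \<Rightarrow> 'w \<Rightarrow> 'u set \<Rightarrow> real \<Rightarrow> real \<Rightarrow> bool"
  where "jump_in M \<omega> F r t \<longleftrightarrow> (\<exists>s. r < s \<and> s \<le> t \<and> jump M \<omega> s \<in> F)"

lemma cadlag_near:
  assumes M: "cadlag P M" "\<omega> \<in> space P" and e: "e > 0"
  shows "s \<ge> 0 \<Longrightarrow> \<exists>d>0. \<forall>p. s \<le> p \<longrightarrow> p < s + d \<longrightarrow> dist (M p \<omega>) (M s \<omega>) < e"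
    and "s > 0 \<Longrightarrow> \<exists>d>0. \<forall>p. s - d < p \<longrightarrow> p < s \<longrightarrow> dist (M p \<omega>) (M s \<omega> - jump M \<omega> s) < e"
proof -
  assume "s \<ge> 0"
  then have "((\<lambda>s. M s \<omega>) \<longlongrightarrow> M s \<omega>) (at_right s)" using M by (auto simp: cadlag_def)
  then have "\<forall>\<^sub>F p in at_right s. dist (M p \<omega>) (M s \<omega>) < e" using e by (rule tendstoD)
  then obtain b where b: "b > s" "\<forall>y>s. y < b \<longrightarrow> dist (M y \<omega>) (M s \<omega>) < e"
    unfolding eventually_at_right_field by blast
  have "dist (M p \<omega>) (M s \<omega>) < e" if "s \<le> p" "p < s + (b - s)" for p
    using that b(2) e by (cases "p = s") auto
  then show "\<exists>d>0. \<forall>p. s \<le> p \<longrightarrow> p < s + d \<longrightarrow> dist (M p \<omega>) (M s \<omega>) < e"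
    using b(1) by (intro exI[of _ "b - s"]) auto
next
  assume "s > 0"
  then obtain l where l: "((\<lambda>s. M s \<omega>) \<longlongrightarrow> l) (at_left s)" using M unfolding cadlag_def by blast
  then have "M s \<omega> - jump M \<omega> s = l" by (simp add: jump_def tendsto_Lim)
  moreover have "\<forall>\<^sub>F p in at_left s. dist (M p \<omega>) l < e" using l e by (rule tendstoD)
  then obtain b where b: "b < s" "\<forall>y>b. y < s \<longrightarrow> dist (M y \<omega>) l < e"
    unfolding eventually_at_left_field by blast
  ultimately show "\<exists>d>0. \<forall>p. s - d < p \<longrightarrow> p < s \<longrightarrow> dist (M p \<omega>) (M s \<omega> - jump M \<omega> s) < e"
    by (intro exI[of _ "s - b"]) auto
qed

text \<open>
  Rational times do not suffice: a jump exactly at the right end point \<open>t\<close> is seen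
  only by the value at \<open>t\<close>.
\<close>

definition test_times :: "real \<Rightarrow> real \<Rightarrow> real set"
  where "test_times r t = insert t {q\<in>\<rat>. r < q \<and> q < t}"

lemma countable_test_times: "countable (test_times r t)"
  unfolding test_times_def by (intro countable_insert countable_subset[OF _ countable_rat]) auto

text \<open>
  Increments across a jump time \<open>s\<close> over a short interval are close to the jump.
\<close>

lemma jump_in_imp_increments:
  assumes M: "cadlag P M" "\<omega> \<in> space P" and r: "0 \<le> r"
    and J: "jump_in M \<omega> F r t" and e: "e > 0"
  shows "\<exists>p\<in>test_times r t. \<exists>q\<in>test_times r t. p < q \<and> q - p < e \<and> infdist (M q \<omega> - M p \<omega>) F < e"
proof -
  obtain s where s: "r < s" "s \<le> t" "jump M \<omega> s \<in> F" using J by (auto simp: jump_in_def)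
  have e4: "e / 2 > 0" using e by simp
  obtain d where d: "d > 0" "\<And>p. s \<le> p \<Longrightarrow> p < s + d \<Longrightarrow> dist (M p \<omega>) (M s \<omega>) < e / 2"
    using cadlag_near(1)[OF M e4, of s] s r by auto
  obtain d' where d': "d' > 0" "\<And>p. s - d' < p \<Longrightarrow> p < s \<Longrightarrow> dist (M p \<omega>) (M s \<omega> - jump M \<omega> s) < e / 2"
    using cadlag_near(2)[OF M e4, of s] s r by auto
  obtain p where p: "p \<in> \<rat>" "max r (max (s - d') (s - e / 2)) < p" "p < s"
    using Rats_dense_in_real[of "max r (max (s - d') (s - e / 2))" s] s(1) d'(1) e4 by auto
  obtain q where q: "q \<in> test_times r t" "s \<le> q" "q < s + d" "q < s + e / 2"
  proof (cases "s = t")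
    case True
    then show thesis using that[of t] d(1) e4 by (simp add: test_times_def)
  next
    case False
    then obtain q where "q \<in> \<rat>" "s < q" "q < min t (min (s + d) (s + e / 2))"
      using Rats_dense_in_real[of s "min t (min (s + d) (s + e / 2))"] s(2) d(1) e4 by auto
    then show thesis using that[of q] s(1) by (simp add: test_times_def)
  qed
  have pt: "p \<in> test_times r t" using p s by (simp add: test_times_def)
  have "infdist (M q \<omega> - M p \<omega>) F \<le> dist (M q \<omega> - M p \<omega>) (jump M \<omega> s)" by (rule infdist_le[OF s(3)])
  also have "\<dots> = norm ((M q \<omega> - M s \<omega>) - (M p \<omega> - (M s \<omega> - jump M \<omega> s)))"
    by (simp add: dist_norm algebra_simps)
  also have "\<dots> \<le> norm (M q \<omega> - M s \<omega>) + norm (M p \<omega> - (M s \<omega> - jump M \<omega> s))" by (rule norm_triangle_ineq4)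
  also have "\<dots> < e" using d(2)[of q] d'(2)[of p] q p by (simp add: dist_norm)
  finally show ?thesis using pt q p by (intro bexI[of _ p] bexI[of _ q]) auto
qed

text \<open>
  Shorter and shorter intervals with increments close to \<open>F\<close> accumulate at some time
  \<open>s\<close>. Near \<open>s\<close> the increments of a cadlag path are close either to
  zero, which is not in the closed set \<open>F\<close>, or to the jump at \<open>s\<close>.
\<close>

lemma increments_imp_jump_in:
  assumes M: "cadlag P M" "\<omega> \<in> space P" and r: "0 \<le> r" "r < t"
    and F: "closed F" "0 \<notin> F" "F \<noteq> {}"
    and inc: "\<And>n. \<exists>p\<in>test_times r t. \<exists>q\<in>test_times r t.
      p < q \<and> q - p < 1 / real (Suc n) \<and> infdist (M q \<omega> - M p \<omega>) F < 1 / real (Suc n)"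
  shows "jump_in M \<omega> F r t"
proof (rule ccontr)
  assume no: "\<not> jump_in M \<omega> F r t"
  have pos: "infdist x F > 0" if "x \<notin> F" for x
    using in_closed_iff_infdist_zero[OF F(1,3), of x] that infdist_nonneg[of x F] by (simp add: less_le)
  (* No increment between times near s comes within e of F; at s = r there is no left limit to
     consider, and times up to r are excluded. *)
  have local: "\<exists>e>0. \<exists>d>0. \<forall>p q. r < p \<longrightarrow> p < q \<longrightarrow> \<bar>p - s\<bar> < d \<longrightarrow> \<bar>q - s\<bar> < d \<longrightarrow> e \<le> infdist (M q \<omega> - M p \<omega>) F"
    if s: "r \<le> s" "s \<le> t" for s
  proof -
    define dJ where "dJ = (if s > r then infdist (jump M \<omega> s) F else 1)"
    have "dJ > 0" using no s by (auto simp: dJ_def jump_in_def intro!: pos)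
    define e where "e = min (infdist 0 F) dJ / 3"
    have e: "e > 0" using pos[OF F(2)] \<open>dJ > 0\<close> by (simp add: e_def)
    have e0: "3 * e \<le> infdist 0 F" "3 * e \<le> dJ" by (simp_all add: e_def)
    obtain d where d: "d > 0" "\<And>p. s \<le> p \<Longrightarrow> p < s + d \<Longrightarrow> dist (M p \<omega>) (M s \<omega>) < e"
      using cadlag_near(1)[OF M e, of s] s r by auto
    obtain d' where d': "d' > 0" "\<And>p. r < p \<Longrightarrow> s - d' < p \<Longrightarrow> p < s \<Longrightarrow> dist (M p \<omega>) (M s \<omega> - jump M \<omega> s) < e"
    proof (cases "s > r")
      case True
      then show thesis using cadlag_near(2)[OF M e, of s] r that by auto
    next
      case False
      then show thesis using that[of 1] s by auto
    qed
    have near: "e \<le> infdist x F" if "dist x y \<le> 2 * e" "3 * e \<le> infdist y F" for x y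
      using infdist_triangle[of y F x] that by (simp add: dist_commute)
    have "e \<le> infdist (M q \<omega> - M p \<omega>) F" if pq: "r < p" "p < q" "\<bar>p - s\<bar> < min d d'" "\<bar>q - s\<bar> < min d d'" for p q
    proof -
      consider "q < s" | "s \<le> p" | "p < s" "s \<le> q" by linarith
      then show ?thesis
      proof cases
        case 1
        then have "dist (M q \<omega>) (M p \<omega>) < e + e"
          using d'(2)[of p] d'(2)[of q] pq by (intro dist_triangle_less_add[where y="M s \<omega> - jump M \<omega> s"]) auto
        then show ?thesis using e0(1) by (intro near[of _ 0]) (auto simp: dist_norm)
      next
        case 2
        then have "dist (M q \<omega>) (M p \<omega>) < e + e"
          using d(2)[of p] d(2)[of q] pq by (intro dist_triangle_less_add[where y="M s \<omega>"]) auto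
        then show ?thesis using e0(1) by (intro near[of _ 0]) (auto simp: dist_norm)
      next
        case 3
        have "norm ((M q \<omega> - M s \<omega>) - (M p \<omega> - (M s \<omega> - jump M \<omega> s)))
          \<le> norm (M q \<omega> - M s \<omega>) + norm (M p \<omega> - (M s \<omega> - jump M \<omega> s))" by (rule norm_triangle_ineq4)
        also have "\<dots> \<le> 2 * e" using d(2)[of q] d'(2)[of p] 3 pq by (auto simp: dist_norm)
        finally have "dist (M q \<omega> - M p \<omega>) (jump M \<omega> s) \<le> 2 * e" by (simp add: dist_norm algebra_simps)
        moreover have "3 * e \<le> infdist (jump M \<omega> s) F" using e0(2) 3 pq by (simp add: dJ_def)
        ultimately show ?thesis by (rule near)
      qed
    qed
    then show ?thesis using e d(1) d'(1) by (intro exI[of _ e] conjI exI[of _ "min d d'"]) auto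
  qed
  (* By compactness the given intervals accumulate at some s, contradicting the above. *)
  obtain p q where pq: "\<And>n. p n \<in> test_times r t" "\<And>n. q n \<in> test_times r t" "\<And>n. p n < q n"
    "\<And>n. q n - p n < 1 / real (Suc n)" "\<And>n. infdist (M (q n) \<omega> - M (p n) \<omega>) F < 1 / real (Suc n)"
    using inc by metis
  have pr: "r < p n" "p n \<le> t" for n using pq(1)[of n] r by (auto simp: test_times_def)
  then have "p n \<in> {r..t}" for n by (simp add: less_imp_le)
  then obtain s \<phi> where s: "s \<in> {r..t}" and \<phi>: "strict_mono \<phi>" "(p \<circ> \<phi>) \<longlonglongrightarrow> s"
    using compact_Icc[of r t] unfolding compact_def by metis
  obtain e d where ed: "e > 0" "d > 0"
    "\<And>p q. r < p \<Longrightarrow> p < q \<Longrightarrow> \<bar>p - s\<bar> < d \<Longrightarrow> \<bar>q - s\<bar> < d \<Longrightarrow> e \<le> infdist (M q \<omega> - M p \<omega>) F"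
    using local[of s] s by auto
  have inv0: "(\<lambda>n. 1 / real (Suc (\<phi> n))) \<longlonglongrightarrow> 0"
    using LIMSEQ_subseq_LIMSEQ[OF LIMSEQ_Suc[OF lim_const_over_n] \<phi>(1), of 1] by (simp add: comp_def)
  have "\<forall>\<^sub>F n in sequentially. \<bar>p (\<phi> n) - s\<bar> < d / 2"
    using tendstoD[OF \<phi>(2), of "d/2"] ed(2) by (simp add: dist_real_def)
  moreover have "\<forall>\<^sub>F n in sequentially. 1 / real (Suc (\<phi> n)) < min e (d / 2)"
    using order_tendstoD(2)[OF inv0, of "min e (d/2)"] ed by simp
  ultimately have "\<forall>\<^sub>F n in sequentially. False"
  proof eventually_elim
    case (elim n)
    have "\<bar>q (\<phi> n) - s\<bar> < d" using elim pq(3,4)[of "\<phi> n"] by linarith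
    then have "e \<le> infdist (M (q (\<phi> n)) \<omega> - M (p (\<phi> n)) \<omega>) F"
      using elim ed(2) pr pq(3) by (intro ed(3)) auto
    then show ?case using pq(5)[of "\<phi> n"] elim by linarith
  qed
  then show False by simp
qed

definition at_least_jumps :: "nat \<Rightarrow> (real \<Rightarrow> 'w \<Rightarrow> 'u::real_normed_vector) \<Rightarrow> 'w \<Rightarrow> 'u set \<Rightarrow> real \<Rightarrow> real \<Rightarrow> bool"
  where "at_least_jumps m M \<omega> F r t \<longleftrightarrow>
    (\<exists>Y. finite Y \<and> card Y = m \<and> (\<forall>s\<in>Y. r < s \<and> s \<le> t \<and> jump M \<omega> s \<in> F))"

text \<open>
  A rational time separates the last jump from the earlier ones, so counting jumps reduces to
  countable combinations of the existence of a jump.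
\<close>

lemma at_least_jumps_Suc:
  "at_least_jumps (Suc m) M \<omega> F r t \<longleftrightarrow> (\<exists>c\<in>{c\<in>\<rat>. r < c \<and> c < t}. at_least_jumps m M \<omega> F r c \<and> jump_in M \<omega> F c t)"
proof
  assume "at_least_jumps (Suc m) M \<omega> F r t"
  then obtain Y where Y: "finite Y" "card Y = Suc m" "\<And>s. s \<in> Y \<Longrightarrow> r < s \<and> s \<le> t \<and> jump M \<omega> s \<in> F"
    unfolding at_least_jumps_def by blast
  have "Y \<noteq> {}" using Y(2) by auto
  define x where "x = Max Y"
  have x: "x \<in> Y" "\<And>y. y \<in> Y \<Longrightarrow> y \<le> x" using Y(1) \<open>Y \<noteq> {}\<close> by (auto simp: x_def)
  (* The second largest jump time, or r if there is none. *)
  define y where "y = Max (insert r (Y - {x}))"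
  have "y < x" using x Y(1) Y(3)[OF x(1)] unfolding y_def by (subst Max_less_iff) (auto simp: less_le)
  then obtain c where c: "c \<in> \<rat>" "y < c" "c < x" using Rats_dense_in_real by blast
  have "r \<le> y" "\<And>s. s \<in> Y - {x} \<Longrightarrow> s \<le> y" using Y(1) by (auto simp: y_def)
  then have "at_least_jumps m M \<omega> F r c"
    unfolding at_least_jumps_def using Y x(1) c by (intro exI[of _ "Y - {x}"]) force
  moreover have "jump_in M \<omega> F c t" using Y(3)[OF x(1)] c by (auto simp: jump_in_def)
  moreover have "r < c" "c < t" using \<open>r \<le> y\<close> c Y(3)[OF x(1)] by auto
  ultimately show "\<exists>c\<in>{c\<in>\<rat>. r < c \<and> c < t}. at_least_jumps m M \<omega> F r c \<and> jump_in M \<omega> F c t"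
    using c by blast
next
  assume "\<exists>c\<in>{c\<in>\<rat>. r < c \<and> c < t}. at_least_jumps m M \<omega> F r c \<and> jump_in M \<omega> F c t"
  then obtain c Y s where c: "r < c" "c < t" and Y: "finite Y" "card Y = m" "\<And>s. s \<in> Y \<Longrightarrow> r < s \<and> s \<le> c \<and> jump M \<omega> s \<in> F"
    and s: "c < s" "s \<le> t" "jump M \<omega> s \<in> F"
    unfolding at_least_jumps_def jump_in_def by blast
  have "s \<notin> Y" using Y(3)[of s] s by auto
  then show "at_least_jumps (Suc m) M \<omega> F r t"
    unfolding at_least_jumps_def using Y c s by (intro exI[of _ "insert s Y"]) force
qed

lemma jump_measure_rectangle:
  assumes "0 \<le> r" "0 \<notin> F" "F \<in> sets borel"
  shows "emeasure (jump_measure M \<omega>) ({r<..t} \<times> F) = (SUP m. if at_least_jumps m M \<omega> F r t then of_nat m else 0)"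
proof -
  let ?X = "{s. r < s \<and> s \<le> t \<and> jump M \<omega> s \<in> F}"
  have X: "(\<lambda>t. (t, jump M \<omega> t)) -` ({r<..t} \<times> F) \<inter> {t. 0 < t \<and> jump M \<omega> t \<noteq> 0} = ?X"
    using assms by auto
  have ge: "at_least_jumps m M \<omega> F r t \<longleftrightarrow> (\<exists>Y\<subseteq>?X. finite Y \<and> card Y = m)" for m
    unfolding at_least_jumps_def by blast
  have "emeasure (jump_measure M \<omega>) ({r<..t} \<times> F) = emeasure (count_space {t. 0 < t \<and> jump M \<omega> t \<noteq> 0}) ?X"
    unfolding jump_measure_def using assms(3) by (subst emeasure_distr) (auto simp: X space_pair_measure)
  also have "\<dots> = (if finite ?X then of_nat (card ?X) else \<infinity>)"
    using assms by (subst emeasure_count_space) auto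
  also have "\<dots> = (SUP m. if at_least_jumps m M \<omega> F r t then of_nat m else 0)"
  proof (cases "finite ?X")
    case True
    show ?thesis
    proof (rule antisym)
      show "(if finite ?X then of_nat (card ?X) else \<infinity>) \<le> (SUP m. if at_least_jumps m M \<omega> F r t then of_nat m else (0::ennreal))"
        using True ge[of "card ?X"] by (intro SUP_upper2[of "card ?X"]) auto
      show "(SUP m. if at_least_jumps m M \<omega> F r t then of_nat m else (0::ennreal)) \<le> (if finite ?X then of_nat (card ?X) else \<infinity>)"
      proof (rule SUP_least)
        fix m :: nat
        have "m \<le> card ?X" if "at_least_jumps m M \<omega> F r t"
          using that ge[of m] card_mono[OF True] by auto
        then show "(if at_least_jumps m M \<omega> F r t then of_nat m else (0::ennreal)) \<le> (if finite ?X then of_nat (card ?X) else \<infinity>)"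
          using True by auto
      qed
    qed
  next
    case False
    then have all: "at_least_jumps m M \<omega> F r t" for m
      using ge[of m] infinite_arbitrarily_large[of ?X m] by blast
    show ?thesis using False by (simp add: all ennreal_SUP_of_nat_eq_top)
  qed
  finally show ?thesis .
qed

section \<open>The jumps are determined by the history of the process\<close>

text \<open>
  The \<sigma>-algebra generated by the process alone, without completion; this is the one that
  occurs in the independence of processes.
\<close>

definition history :: "'w measure \<Rightarrow> (real \<Rightarrow> 'w \<Rightarrow> 'u::topological_space) \<Rightarrow> 'w measure"
  where "history P X = sigma (space P) (\<Union>t\<in>{0..}. {X t -` B \<inter> space P | B. B \<in> sets borel})"

lemma sets_history: "sets (history P X) = sigma_sets (space P) (\<Union>t\<in>{0..}. {X t -` B \<inter> space P | B. B \<in> sets borel})"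
  unfolding history_def by (intro sets_measure_of) auto

lemma space_history [simp]: "space (history P X) = space P"
  unfolding history_def by (intro space_measure_of) auto

lemma measurable_history: "t \<ge> 0 \<Longrightarrow> X t \<in> borel_measurable (history P X)"
  by (intro measurableI) (auto simp: sets_history intro!: sigma_sets.Basic)

lemma jump_in_measurable:
  fixes M :: "real \<Rightarrow> 'w \<Rightarrow> 'u::{real_normed_vector, second_countable_topology}"
  assumes M: "cadlag P M" and F: "closed F" "0 \<notin> F" and r: "0 \<le> r"
  shows "{\<omega>\<in>space P. jump_in M \<omega> F r t} \<in> sets (history P M)"
proof (cases "F = {} \<or> t \<le> r")
  case True
  then have "{\<omega>\<in>space P. jump_in M \<omega> F r t} = {}" by (auto simp: jump_in_def)
  then show ?thesis by (simp only: sets.empty_sets)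
next
  case False
  let ?T = "test_times r t"
  let ?D = "\<lambda>n p q. {\<omega>\<in>space P. p < q \<and> q - p < 1 / real (Suc n) \<and> infdist (M q \<omega> - M p \<omega>) F < 1 / real (Suc n)}"
  have Tr: "0 \<le> p" if "p \<in> ?T" for p using that r False by (auto simp: test_times_def)
  have D: "?D n p q \<in> sets (history P M)" if "p \<in> ?T" "q \<in> ?T" for n p q
  proof -
    have [measurable]: "M p \<in> borel_measurable (history P M)" "M q \<in> borel_measurable (history P M)"
      using that Tr by (auto intro: measurable_history)
    have [measurable]: "(\<lambda>x. infdist x F) \<in> borel_measurable borel"
      by (intro borel_measurable_continuous_onI continuous_on_infdist continuous_on_id)
    have m: "(\<lambda>\<omega>. infdist (M q \<omega> - M p \<omega>) F) \<in> borel_measurable (history P M)" by measurable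
    have A: "(\<lambda>\<omega>. infdist (M q \<omega> - M p \<omega>) F) -` {..<1 / real (Suc n)} \<inter> space (history P M) \<in> sets (history P M)"
      by (rule measurable_sets[OF m]) simp
    show ?thesis
    proof (cases "p < q \<and> q - p < 1 / real (Suc n)")
      case True
      then have "?D n p q = (\<lambda>\<omega>. infdist (M q \<omega> - M p \<omega>) F) -` {..<1 / real (Suc n)} \<inter> space (history P M)"
        by auto
      with A show ?thesis by (simp only:)
    next
      case False
      then have "?D n p q = {}" by blast
      then show ?thesis by (simp only: sets.empty_sets)
    qed
  qed
  have "{\<omega>\<in>space P. jump_in M \<omega> F r t} = (\<Inter>n. \<Union>p\<in>?T. \<Union>q\<in>?T. ?D n p q)"
  proof (intro equalityI subsetI)
    fix \<omega> assume w: "\<omega> \<in> {\<omega>\<in>space P. jump_in M \<omega> F r t}"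
    show "\<omega> \<in> (\<Inter>n. \<Union>p\<in>?T. \<Union>q\<in>?T. ?D n p q)"
    proof
      fix n :: nat
      show "\<omega> \<in> (\<Union>p\<in>?T. \<Union>q\<in>?T. ?D n p q)"
        using jump_in_imp_increments[OF M, of \<omega> r F t "1 / real (Suc n)"] w r by auto
    qed
  next
    fix \<omega> assume w: "\<omega> \<in> (\<Inter>n. \<Union>p\<in>?T. \<Union>q\<in>?T. ?D n p q)"
    then have wP: "\<omega> \<in> space P" by auto
    have ne: "r < t" "F \<noteq> {}" using False by auto
    have "jump_in M \<omega> F r t"
    proof (rule increments_imp_jump_in[OF M wP r ne(1) F ne(2)])
      fix n
      have "\<omega> \<in> (\<Union>p\<in>?T. \<Union>q\<in>?T. ?D n p q)" using w by blast
      then show "\<exists>p\<in>?T. \<exists>q\<in>?T. p < q \<and> q - p < 1 / real (Suc n) \<and> infdist (M q \<omega> - M p \<omega>) F < 1 / real (Suc n)"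
        by blast
    qed
    with wP show "\<omega> \<in> {\<omega>\<in>space P. jump_in M \<omega> F r t}" by simp
  qed
  also have "\<dots> \<in> sets (history P M)"
  proof (rule sets.countable_INT)
    have "(\<Union>p\<in>?T. \<Union>q\<in>?T. ?D n p q) \<in> sets (history P M)" for n
      by (rule sets.countable_UN''[OF countable_test_times], rule sets.countable_UN''[OF countable_test_times], rule D)
    then show "range (\<lambda>n. \<Union>p\<in>?T. \<Union>q\<in>?T. ?D n p q) \<subseteq> sets (history P M)" by blast
  qed simp
  finally show ?thesis .
qed

lemma at_least_jumps_measurable:
  fixes M :: "real \<Rightarrow> 'w \<Rightarrow> 'u::{real_normed_vector, second_countable_topology}"
  assumes M: "cadlag P M" and F: "closed F" "0 \<notin> F" and r: "0 \<le> r"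
  shows "{\<omega>\<in>space P. at_least_jumps m M \<omega> F r t} \<in> sets (history P M)"
proof (induction m arbitrary: t)
  case 0
  have "{\<omega>\<in>space P. at_least_jumps 0 M \<omega> F r t} = space (history P M)" by (auto simp: at_least_jumps_def)
  then show ?case by (simp only: sets.top)
next
  case (Suc m)
  let ?C = "{c\<in>\<rat>. r < c \<and> c < t}"
  have "{\<omega>\<in>space P. at_least_jumps (Suc m) M \<omega> F r t}
    = (\<Union>c\<in>?C. {\<omega>\<in>space P. at_least_jumps m M \<omega> F r c} \<inter> {\<omega>\<in>space P. jump_in M \<omega> F c t})"
    unfolding at_least_jumps_Suc by blast
  also have "\<dots> \<in> sets (history P M)"
  proof (rule sets.countable_UN'')
    show "countable ?C" by (rule countable_subset[OF _ countable_rat]) auto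
    fix c assume "c \<in> ?C"
    then have "0 \<le> c" using r by simp
    then show "{\<omega>\<in>space P. at_least_jumps m M \<omega> F r c} \<inter> {\<omega>\<in>space P. jump_in M \<omega> F c t} \<in> sets (history P M)"
      using Suc.IH jump_in_measurable[OF M F] by (intro sets.Int)
  qed
  finally show ?case .
qed

lemma jump_measure_rectangle_measurable:
  fixes M :: "real \<Rightarrow> 'w \<Rightarrow> 'u::{real_normed_vector, second_countable_topology}"
  assumes M: "cadlag P M" and F: "closed F" "0 \<notin> F" and r: "0 \<le> r"
  shows "(\<lambda>\<omega>. emeasure (jump_measure M \<omega>) ({r<..t} \<times> F)) \<in> borel_measurable (history P M)"
proof -
  have "(\<lambda>\<omega>. SUP m. if at_least_jumps m M \<omega> F r t then of_nat m else (0::ennreal)) \<in> borel_measurable (history P M)"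
  proof (intro borel_measurable_SUP measurable_If)
    show "{\<omega>\<in>space (history P M). at_least_jumps m M \<omega> F r t} \<in> sets (history P M)" for m
      using at_least_jumps_measurable[OF M F r] by simp
  qed auto
  then show ?thesis using F r by (simp add: jump_measure_rectangle borel_closed)
qed

text \<open>
  The Dynkin argument for a random set function. The formula for complements is a hypothesis since
  subtraction of infinite values would not give it.
\<close>

lemma measurable_by_generator:
  fixes f :: "'a \<Rightarrow> 'b set \<Rightarrow> ennreal"
  assumes E: "Int_stable E" "E \<subseteq> Pow \<Omega>"
    and f: "\<And>\<omega>. f \<omega> {} = 0" "\<And>\<omega> A. A \<in> sigma_sets \<Omega> E \<Longrightarrow> f \<omega> (\<Omega> - A) = f \<omega> \<Omega> - f \<omega> A"
      "\<And>\<omega> A. disjoint_family A \<Longrightarrow> range A \<subseteq> sigma_sets \<Omega> E \<Longrightarrow> f \<omega> (\<Union>i::nat. A i) = (\<Sum>i. f \<omega> (A i))"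
    and m: "\<And>A. A \<in> E \<Longrightarrow> (\<lambda>\<omega>. f \<omega> A) \<in> borel_measurable Q" "(\<lambda>\<omega>. f \<omega> \<Omega>) \<in> borel_measurable Q"
    and A: "A \<in> sigma_sets \<Omega> E"
  shows "(\<lambda>\<omega>. f \<omega> A) \<in> borel_measurable Q"
  using E A
proof (induction rule: sigma_sets_induct_disjoint)
  case (compl A)
  then show ?case using m(2) by (simp add: f(2))
next
  case (union A)
  then show ?case by (simp add: f(3))
qed (simp_all add: f(1) m(1))

lemma sets_jump_measure [simp]: "sets (jump_measure M \<omega>) = sets (borel \<Otimes>\<^sub>M borel)"
  by (simp add: jump_measure_def)

text \<open>
  Intersecting with \<open>E\<close> and replacing the value by zero when there are infinitely
  many jumps in \<open>E\<close> makes the measure finite, as complements in the Dynkin argument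
  require. Starting from rectangles with closed sides, the argument is applied to the time side,
  to the space side and to the product.
\<close>

lemma jump_measure_measurable:
  fixes M :: "real \<Rightarrow> 'w \<Rightarrow> 'u::{real_normed_vector, second_countable_topology}"
  assumes M: "cadlag P M" and K: "closed K" "0 \<notin> K"
    and G: "G \<in> sets (borel \<Otimes>\<^sub>M borel)"
  fixes t :: real
  defines "E \<equiv> {0<..t} \<times> K"
  shows "(\<lambda>\<omega>. if emeasure (jump_measure M \<omega>) E = \<infinity> then 0 else emeasure (jump_measure M \<omega>) (G \<inter> E))
    \<in> borel_measurable (history P M)"
proof -
  let ?N = "jump_measure M"
  let ?B = "borel \<Otimes>\<^sub>M borel :: (real \<times> 'u) measure"
  define g where "g \<omega> G = (if emeasure (?N \<omega>) E = \<infinity> then 0 else emeasure (?N \<omega>) (G \<inter> E))" for \<omega> G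
  have K': "K \<in> sets borel" using K(1) by (rule borel_closed)
  have Es: "E \<in> sets ?B" unfolding E_def using K' by (intro pair_measureI) auto
  have NE: "(\<lambda>\<omega>. emeasure (?N \<omega>) E) \<in> borel_measurable (history P M)"
    unfolding E_def by (rule jump_measure_rectangle_measurable[OF M K]) simp
  have g0: "g \<omega> {} = 0" for \<omega> by (simp add: g_def)
  have gd: "g \<omega> (G - H) = g \<omega> G - g \<omega> H" if "G \<in> sets ?B" "H \<in> sets ?B" "H \<subseteq> G" for \<omega> G H
  proof (cases "emeasure (?N \<omega>) E = \<infinity>")
    case False
    have "emeasure (?N \<omega>) (H \<inter> E) \<le> emeasure (?N \<omega>) E" using Es by (intro emeasure_mono) auto
    then have "emeasure (?N \<omega>) (H \<inter> E) \<noteq> \<infinity>" using False by (auto simp: top_unique)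
    then have "emeasure (?N \<omega>) (G \<inter> E - H \<inter> E) = emeasure (?N \<omega>) (G \<inter> E) - emeasure (?N \<omega>) (H \<inter> E)"
      using that Es by (intro emeasure_Diff) auto
    moreover have "(G - H) \<inter> E = G \<inter> E - H \<inter> E" by blast
    ultimately show ?thesis using False by (simp add: g_def)
  qed (simp add: g_def)
  have gU: "g \<omega> (\<Union>i::nat. A i) = (\<Sum>i. g \<omega> (A i))" if A: "disjoint_family A" "\<And>i. A i \<in> sets ?B" for \<omega> A
  proof (cases "emeasure (?N \<omega>) E = \<infinity>")
    case False
    have "(\<Sum>i. emeasure (?N \<omega>) (A i \<inter> E)) = emeasure (?N \<omega>) (\<Union>i. A i \<inter> E)"
      using A Es by (intro suminf_emeasure) (auto simp: disjoint_family_on_def)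
    then show ?thesis using False by (simp add: g_def)
  qed (simp add: g_def)
  (* Closed sets are stable under intersection with K, and then avoid zero. *)
  have rect: "(\<lambda>\<omega>. g \<omega> ({..a} \<times> F)) \<in> borel_measurable (history P M)" "(\<lambda>\<omega>. g \<omega> (UNIV \<times> F)) \<in> borel_measurable (history P M)"
    if F: "closed F" for a F
  proof -
    have FK: "closed (F \<inter> K)" "0 \<notin> F \<inter> K" using F K by auto
    have eq: "({..a} \<times> F) \<inter> E = {0<..min a t} \<times> (F \<inter> K)" "(UNIV \<times> F) \<inter> E = {0<..t} \<times> (F \<inter> K)"
      by (auto simp: E_def)
    note [measurable] = NE jump_measure_rectangle_measurable[OF M FK order_refl, of "min a t"]
      jump_measure_rectangle_measurable[OF M FK order_refl, of t]
    show "(\<lambda>\<omega>. g \<omega> ({..a} \<times> F)) \<in> borel_measurable (history P M)" unfolding g_def eq by measurable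
    show "(\<lambda>\<omega>. g \<omega> (UNIV \<times> F)) \<in> borel_measurable (history P M)" unfolding g_def eq by measurable
  qed
  have sR: "sets borel = sigma_sets UNIV (range (\<lambda>a::real. {..a}))"
    by (subst borel_eq_atMost) (simp add: sets_measure_of)
  have sU: "sets borel = sigma_sets UNIV (Collect closed :: 'u set set)"
    by (subst borel_eq_closed) (simp add: sets_measure_of)
  have stage1: "(\<lambda>\<omega>. g \<omega> (A \<times> F)) \<in> borel_measurable (history P M)" if F: "closed F" and A: "A \<in> sets borel" for A F
  proof (rule measurable_by_generator[where f="\<lambda>\<omega> A. g \<omega> (A \<times> F)" and \<Omega>=UNIV and E="range (\<lambda>a::real. {..a})"])
    have Fb: "F \<in> sets borel" using F by (rule borel_closed)
    show "Int_stable (range (\<lambda>a::real. {..a}))" by (auto simp: Int_stable_def)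
    show "A \<in> sigma_sets UNIV (range (\<lambda>a::real. {..a}))" using A sR by simp
    show "g \<omega> ((UNIV - A) \<times> F) = g \<omega> (UNIV \<times> F) - g \<omega> (A \<times> F)" if "A \<in> sigma_sets UNIV (range (\<lambda>a::real. {..a}))" for \<omega> A
    proof -
      have "A \<in> sets borel" using that sR by simp
      then have "g \<omega> (UNIV \<times> F - A \<times> F) = g \<omega> (UNIV \<times> F) - g \<omega> (A \<times> F)"
        using Fb by (intro gd pair_measureI) auto
      then show ?thesis by (simp add: Sigma_Diff_distrib1)
    qed
    show "g \<omega> ((\<Union>i::nat. A i) \<times> F) = (\<Sum>i. g \<omega> (A i \<times> F))"
      if "disjoint_family A" "range A \<subseteq> sigma_sets UNIV (range (\<lambda>a::real. {..a}))" for \<omega> A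
    proof -
      have "A i \<in> sets borel" for i using that(2) sR by auto
      then have "g \<omega> (\<Union>i. A i \<times> F) = (\<Sum>i. g \<omega> (A i \<times> F))"
        using Fb that(1) by (intro gU pair_measureI) (auto simp: disjoint_family_on_def)
      then show ?thesis by (simp add: Sigma_Union UN_extend_simps)
    qed
  qed (use rect F in \<open>auto simp: g0\<close>)
  have stage2: "(\<lambda>\<omega>. g \<omega> (A \<times> B)) \<in> borel_measurable (history P M)" if A: "A \<in> sets borel" and B: "B \<in> sets borel" for A B
  proof (rule measurable_by_generator[where f="\<lambda>\<omega> B. g \<omega> (A \<times> B)" and \<Omega>=UNIV and E="Collect closed"])
    show "Int_stable (Collect closed)" by (auto simp: Int_stable_def)
    show "B \<in> sigma_sets UNIV (Collect closed)" using B sU by simp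
    show "g \<omega> (A \<times> (UNIV - B)) = g \<omega> (A \<times> UNIV) - g \<omega> (A \<times> B)" if "B \<in> sigma_sets UNIV (Collect closed)" for \<omega> B
    proof -
      have "B \<in> sets borel" using that sU by simp
      then have "g \<omega> (A \<times> UNIV - A \<times> B) = g \<omega> (A \<times> UNIV) - g \<omega> (A \<times> B)"
        using A by (intro gd pair_measureI) auto
      moreover have "A \<times> (UNIV - B) = A \<times> UNIV - A \<times> B" by blast
      ultimately show ?thesis by simp
    qed
    show "g \<omega> (A \<times> (\<Union>i::nat. B i)) = (\<Sum>i. g \<omega> (A \<times> B i))"
      if "disjoint_family B" "range B \<subseteq> sigma_sets UNIV (Collect closed)" for \<omega> B
    proof -
      have "B i \<in> sets borel" for i using that(2) sU by auto
      then have "g \<omega> (\<Union>i. A \<times> B i) = (\<Sum>i. g \<omega> (A \<times> B i))"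
        using A that(1) by (intro gU pair_measureI) (auto simp: disjoint_family_on_def)
      moreover have "A \<times> (\<Union>i. B i) = (\<Union>i. A \<times> B i)" by blast
      ultimately show ?thesis by simp
    qed
  qed (use stage1 A in \<open>auto simp: g0\<close>)
  have sB: "sets ?B = sigma_sets UNIV {a \<times> b | a b. a \<in> sets borel \<and> b \<in> sets borel}"
    by (simp add: sets_pair_measure)
  have "(\<lambda>\<omega>. g \<omega> G) \<in> borel_measurable (history P M)"
  proof (rule measurable_by_generator[where f=g and \<Omega>=UNIV and E="{a \<times> b | a b. a \<in> sets borel \<and> b \<in> sets borel}"])
    show "Int_stable {a \<times> b | a b. a \<in> sets (borel :: real measure) \<and> b \<in> sets (borel :: 'u measure)}"
      using Int_stable_pair_measure_generator[of borel borel] by simp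
    show "G \<in> sigma_sets UNIV {a \<times> b | a b. a \<in> sets borel \<and> b \<in> sets borel}" using G sB by simp
    show "g \<omega> (UNIV - A) = g \<omega> UNIV - g \<omega> A" if "A \<in> sigma_sets UNIV {a \<times> b | a b. a \<in> sets borel \<and> b \<in> sets borel}" for \<omega> A
    proof (rule gd)
      show "A \<in> sets ?B" using that sB by simp
      show "UNIV \<in> sets ?B" using sets.top[of ?B] by (simp add: space_pair_measure)
    qed simp
    show "g \<omega> (\<Union>i. A i) = (\<Sum>i. g \<omega> (A i))"
      if "disjoint_family A" "range A \<subseteq> sigma_sets UNIV {a \<times> b | a b. a \<in> sets borel \<and> b \<in> sets borel}"
      for \<omega> and A :: "nat \<Rightarrow> (real \<times> 'u) set"
    proof (rule gU[OF that(1)])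
      show "A i \<in> sets ?B" for i using that(2) sB by auto
    qed
    show "(\<lambda>\<omega>. g \<omega> UNIV) \<in> borel_measurable (history P M)"
      using stage2[of UNIV UNIV] by simp
  qed (use stage2 in \<open>auto simp: g0\<close>)
  then show ?thesis by (simp add: g_def)
qed

section \<open>Independence of the two integrals\<close>

lemma sigma_sets_vimage_history:
  assumes Z: "Z \<in> borel_measurable (history P X)"
  shows "sigma_sets (space P) {Z -` E \<inter> space P | E. E \<in> sets borel} \<subseteq> sets (history P X)"
proof -
  have "{Z -` E \<inter> space P | E. E \<in> sets borel} \<subseteq> sets (history P X)"
    using measurable_sets[OF Z] by auto
  from sets.sigma_sets_subset[OF this] show ?thesis by simp
qed

lemma cf_indep_processes:
  assumes P: "prob_space P" and ind: "indep_processes P X Y"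
    and A: "A \<in> borel_measurable (history P X)" and B: "B \<in> borel_measurable (history P Y)"
  shows "cf P (\<lambda>\<omega>. A \<omega> + B \<omega>) = cf P A * cf P B"
proof -
  interpret prob_space P by (rule P)
  have ind': "sets (history P X) \<subseteq> events" "sets (history P Y) \<subseteq> events"
    "\<And>a b. a \<in> sets (history P X) \<Longrightarrow> b \<in> sets (history P Y) \<Longrightarrow> prob (a \<inter> b) = prob a * prob b"
    using ind unfolding indep_processes_def sets_history[symmetric] indep_sets2_eq by auto
  have m: "random_variable borel A" "random_variable borel B"
    using measurable_sets[OF A] measurable_sets[OF B] ind'(1,2) by (auto intro!: measurableI)
  have "indep_var borel A borel B"
    unfolding indep_var_eq indep_sets2_eq
  proof (intro conjI m ballI)
    note sub = sigma_sets_vimage_history[OF A] sigma_sets_vimage_history[OF B]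
    show "sigma_sets (space P) {A -` E \<inter> space P | E. E \<in> sets borel} \<subseteq> events"
      "sigma_sets (space P) {B -` E \<inter> space P | E. E \<in> sets borel} \<subseteq> events"
      using sub ind'(1,2) by blast+
    fix a b assume "a \<in> sigma_sets (space P) {A -` E \<inter> space P | E. E \<in> sets borel}"
      "b \<in> sigma_sets (space P) {B -` E \<inter> space P | E. E \<in> sets borel}"
    then show "prob (a \<inter> b) = prob a * prob b" using sub by (intro ind'(3)) blast+
  qed
  from char_distr_add[OF this, of 1] m show ?thesis by (simp add: cf_distr)
qed

lemma sigma_sets_subset_sets:
  assumes "E \<subseteq> sets N" "\<Omega> \<in> sets N"
  shows "sigma_sets \<Omega> E \<subseteq> sets N"
proof
  fix A assume "A \<in> sigma_sets \<Omega> E"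
  then show "A \<in> sets N" by (induction rule: sigma_sets.induct) (use assms in auto)
qed

text \<open>
  The intensity \<open>\<nu>\<close> of the full jump measure lives on
  \<open>[0,\<infinity>)\<close>; its restriction \<open>\<rho>\<close> to \<open>[0,T]\<close> is
  the one in the integral.
\<close>

locale jump_setting =
  fixes P :: "'w measure" and T :: real and M :: "real \<Rightarrow> 'w \<Rightarrow> 'u::{banach, second_countable_topology}"
    and \<mu> :: "'u measure"
  assumes prob_space_P': "prob_space P" and cadlag: "cadlag P M" and \<mu>: "levy_measure P M \<mu>"
begin

abbreviation \<rho> :: "(real \<times> 'u) measure" where "\<rho> \<equiv> jump_intensity T \<mu>"

abbreviation \<nu> :: "(real \<times> 'u) measure" where "\<nu> \<equiv> restrict_space lborel {0..} \<Otimes>\<^sub>M \<mu>"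

lemma sets_\<mu> [measurable_cong]: "sets \<mu> = sets borel" and \<mu>_0: "emeasure \<mu> {0} = 0"
  and \<mu>_tail: "e > 0 \<Longrightarrow> emeasure \<mu> {u. e \<le> norm u} < \<infinity>"
  and prm_\<nu>: "poisson_random_measure P \<nu> (jump_measure M)"
  using \<mu> by (auto simp: levy_measure_def)

lemma sigma_finite_\<mu>: "sigma_finite_measure \<mu>"
proof
  let ?A = "insert {0} (range (\<lambda>n. {u :: 'u. 1 / real (Suc n) \<le> norm u}))"
  have "\<Union>?A = UNIV"
  proof (intro equalityI subset_UNIV subsetI)
    fix u :: 'u
    show "u \<in> \<Union>?A"
    proof (cases "u = 0")
      case False
      then obtain n where "1 / real (Suc n) < norm u" using reals_Archimedean[of "norm u"] by (auto simp: divide_inverse)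
      then have "u \<in> {u. 1 / real (Suc n) \<le> norm u}" by simp
      then show ?thesis by blast
    qed simp
  qed
  moreover have "space \<mu> = UNIV" using sets_eq_imp_space_eq[OF sets_\<mu>] by simp
  moreover have "?A \<subseteq> sets \<mu>" unfolding sets_\<mu>
    by (auto intro!: borel_closed closed_Collect_le continuous_intros)
  moreover have "\<forall>a\<in>?A. emeasure \<mu> a \<noteq> \<infinity>"
    using \<mu>_0 \<mu>_tail by (auto simp: less_top[symmetric] simp del: of_nat_Suc)
  ultimately show "\<exists>A. countable A \<and> A \<subseteq> sets \<mu> \<and> \<Union>A = space \<mu> \<and> (\<forall>a\<in>A. emeasure \<mu> a \<noteq> \<infinity>)"
    by (intro exI[of _ ?A]) auto
qed

lemma sets_product_subset:
  assumes "sets N \<subseteq> sets borel" "space N \<in> sets borel" "G \<in> sets (N \<Otimes>\<^sub>M \<mu>)"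
  shows "G \<in> sets (borel \<Otimes>\<^sub>M borel)"
proof -
  have sp: "space \<mu> = UNIV" using sets_eq_imp_space_eq[OF sets_\<mu>] by simp
  have "{a \<times> b | a b. a \<in> sets N \<and> b \<in> sets \<mu>} \<subseteq> sets (borel \<Otimes>\<^sub>M borel)"
    using assms(1) sets_\<mu> by (auto intro!: pair_measureI)
  moreover have "space N \<times> space \<mu> \<in> sets (borel \<Otimes>\<^sub>M borel)" using assms(2) sp by (auto intro!: pair_measureI)
  ultimately have "sigma_sets (space N \<times> space \<mu>) {a \<times> b | a b. a \<in> sets N \<and> b \<in> sets \<mu>} \<subseteq> sets (borel \<Otimes>\<^sub>M borel)"
    by (rule sigma_sets_subset_sets)
  then show ?thesis using assms(3) by (auto simp: sets_pair_measure)
qed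

lemma sets_restrict_lborel: "A \<in> sets borel \<Longrightarrow> sets (restrict_space lborel A) \<subseteq> sets (borel :: real measure)"
  by (auto simp: sets_restrict_space)

lemma \<rho>_sets_borel: "G \<in> sets \<rho> \<Longrightarrow> G \<in> sets (borel \<Otimes>\<^sub>M borel)"
  by (rule sets_product_subset[OF sets_restrict_lborel]) (auto simp: space_restrict_space)

lemma \<nu>_sets_borel: "G \<in> sets \<nu> \<Longrightarrow> G \<in> sets (borel \<Otimes>\<^sub>M borel)"
  by (rule sets_product_subset[OF sets_restrict_lborel]) (auto simp: space_restrict_space)

lemma borel_rectangle_in_\<nu>:
  assumes "A \<in> sets borel" "A \<subseteq> {0..}" "B \<in> sets borel"
  shows "A \<times> B \<in> sets \<nu>"
proof (rule pair_measureI)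
  show "A \<in> sets (restrict_space lborel {0..})" using assms by (subst sets_restrict_space_iff) auto
qed (use assms sets_\<mu> in simp)

lemma \<rho>_subset_\<nu>:
  assumes G: "G \<in> sets \<rho>"
  shows "G \<in> sets \<nu>" "emeasure \<rho> G = emeasure \<nu> G"
proof -
  interpret \<mu>: sigma_finite_measure \<mu> by (rule sigma_finite_\<mu>)
  have "sets \<rho> \<subseteq> sets \<nu>"
  proof -
    have sub: "a \<in> sets (restrict_space lborel {0..})" if "a \<in> sets (lborel_upto T)" for a
    proof -
      have "a \<subseteq> {0..T} \<and> a \<in> sets borel" using that by (subst (asm) sets_restrict_space_iff) auto
      then show ?thesis by (subst sets_restrict_space_iff) auto
    qed
    have "{a \<times> b | a b. a \<in> sets (lborel_upto T) \<and> b \<in> sets \<mu>} \<subseteq> sets \<nu>"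
      using sub by (auto intro!: pair_measureI)
    moreover have "space (lborel_upto T) \<times> space \<mu> \<in> sets \<nu>"
      using sub[OF sets.top] by (auto intro!: pair_measureI)
    ultimately have "sigma_sets (space (lborel_upto T) \<times> space \<mu>) {a \<times> b | a b. a \<in> sets (lborel_upto T) \<and> b \<in> sets \<mu>} \<subseteq> sets \<nu>"
      by (rule sigma_sets_subset_sets)
    then show ?thesis by (simp add: sets_pair_measure)
  qed
  then show G\<nu>: "G \<in> sets \<nu>" using G by blast
  have Gx: "x \<in> {0..T}" if "Pair x -` G \<noteq> {}" for x
    using sets.sets_into_space[OF G] that by (auto simp: space_pair_measure space_restrict_space)
  have "emeasure \<rho> G = (\<integral>\<^sup>+x. emeasure \<mu> (Pair x -` G) * indicator {0..T} x \<partial>lborel)"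
    using G by (simp add: \<mu>.emeasure_pair_measure_alt nn_integral_restrict_space)
  also have "\<dots> = (\<integral>\<^sup>+x. emeasure \<mu> (Pair x -` G) * indicator {0..} x \<partial>lborel)"
  proof (rule nn_integral_cong)
    fix x
    show "emeasure \<mu> (Pair x -` G) * indicator {0..T} x = emeasure \<mu> (Pair x -` G) * indicator {0..} x"
      using Gx[of x] by (cases "Pair x -` G = {}") (auto simp: indicator_def)
  qed
  also have "\<dots> = emeasure \<nu> G"
    using G\<nu> by (simp add: \<mu>.emeasure_pair_measure_alt nn_integral_restrict_space)
  finally show "emeasure \<rho> G = emeasure \<nu> G" .
qed

sublocale poisson_setting P \<rho> "jump_measure M"
proof (rule poisson_setting.intro)
  show "prob_space P" by (rule prob_space_P')
  show "poisson_random_measure P \<rho> (jump_measure M)"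
    unfolding poisson_random_measure_def
  proof (intro conjI ballI allI impI)
    fix G assume G: "G \<in> sets \<rho>"
    note G' = \<rho>_subset_\<nu>[OF G]
    show "(\<lambda>\<omega>. emeasure (jump_measure M \<omega>) G) \<in> borel_measurable P"
      using prm_\<nu> G' by (simp add: poisson_random_measure_def)
    assume "emeasure \<rho> G < \<infinity>"
    then have fin: "emeasure \<nu> G < \<infinity>" using G' by simp
    have "measure \<rho> G = measure \<nu> G" using G' by (simp add: measure_def)
    then show "measure P {\<omega>\<in>space P. emeasure (jump_measure M \<omega>) G = of_nat k}
        = measure \<rho> G ^ k / fact k * exp (- measure \<rho> G)" for k
      using prm_\<nu>[unfolded poisson_random_measure_def, THEN conjunct2, THEN conjunct1, rule_format, OF G'(1) fin, of k]
      by simp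
  next
    fix n and G :: "nat \<Rightarrow> (real \<times> 'u) set"
    assume G: "(\<forall>i<n. G i \<in> sets \<rho> \<and> emeasure \<rho> (G i) < \<infinity>) \<and> disjoint_family_on G {..<n}"
    then have "(\<forall>i<n. G i \<in> sets \<nu> \<and> emeasure \<nu> (G i) < \<infinity>) \<and> disjoint_family_on G {..<n}"
      using \<rho>_subset_\<nu> by auto
    then show "prob_space.indep_vars P (\<lambda>_. borel) (\<lambda>i \<omega>. emeasure (jump_measure M \<omega>) (G i)) {..<n}"
      using prm_\<nu> unfolding poisson_random_measure_def by blast
  qed
  show "G \<in> sets (jump_measure M \<omega>)" if "G \<in> sets \<rho>" for G \<omega> using \<rho>_sets_borel[OF that] by simp
qed

definition tail :: "nat \<Rightarrow> (real \<times> 'u) set"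
  where "tail n = {0<..real n} \<times> {u. 1 / real (Suc n) \<le> norm u}"

lemma tail_closed: "closed {u::'u. 1 / real (Suc n) \<le> norm u}" "0 \<notin> {u::'u. 1 / real (Suc n) \<le> norm u}"
  by (auto intro!: closed_Collect_le continuous_intros)

lemma tail_sets: "tail n \<in> sets (borel \<Otimes>\<^sub>M borel)"
  unfolding tail_def using borel_closed[OF tail_closed(1)] by (intro pair_measureI) auto

text \<open>
  There are only finitely many jumps of size at least \<open>1 / (n + 1)\<close> up to time
  \<open>n\<close>, since their expected number is finite.
\<close>

lemma tail_finite: "AE \<omega> in P. emeasure (jump_measure M \<omega>) (tail n) \<noteq> \<infinity>"
proof -
  interpret \<mu>: sigma_finite_measure \<mu> by (rule sigma_finite_\<mu>)
  (* The intensity on all of [0, infinity), since tail n reaches beyond T. *)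
  interpret \<nu>: poisson_setting P \<nu> "jump_measure M"
    by (rule poisson_setting.intro) (use prm_\<nu> prob_space_P' \<nu>_sets_borel in auto)
  have "tail n \<in> sets \<nu>"
    unfolding tail_def using borel_closed[OF tail_closed(1)] by (intro borel_rectangle_in_\<nu>) auto
  moreover have "emeasure \<nu> (tail n) < \<infinity>"
  proof -
    have "emeasure \<nu> (tail n) = emeasure (restrict_space lborel {0..}) {0<..real n} * emeasure \<mu> {u. 1 / real (Suc n) \<le> norm u}"
      unfolding tail_def using borel_closed[OF tail_closed(1)] sets_\<mu>
      by (intro \<mu>.emeasure_pair_measure_Times) (auto simp: sets_restrict_space_iff)
    also have "emeasure (restrict_space lborel {0..}) {0<..real n} = ennreal (real n)"
      by (subst emeasure_restrict_space) auto
    finally show ?thesis using \<mu>_tail[of "1 / real (Suc n)"] by (simp add: ennreal_mult_less_top del: of_nat_Suc)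
  qed
  ultimately have "AE \<omega> in P. \<exists>k::nat. emeasure (jump_measure M \<omega>) (tail n) = of_nat k"
    by (intro \<nu>.N_finite) auto
  then show ?thesis by eventually_elim auto
qed

text \<open>
  The jump measure is a supremum of finite ones, outside the null event on which some \<open>tail
  n\<close> carries infinitely many jumps.
\<close>

lemma jump_measure_history:
  assumes G: "G \<in> sets (borel \<Otimes>\<^sub>M borel)"
  obtains Y where "Y \<in> borel_measurable (history P M)" "AE \<omega> in P. emeasure (jump_measure M \<omega>) G = Y \<omega>"
proof
  let ?N = "jump_measure M"
  let ?g = "\<lambda>n \<omega>. if emeasure (?N \<omega>) (tail n) = \<infinity> then 0 else emeasure (?N \<omega>) (G \<inter> tail n)"
  show "(\<lambda>\<omega>. SUP n. ?g n \<omega>) \<in> borel_measurable (history P M)"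
    unfolding tail_def by (intro borel_measurable_SUP jump_measure_measurable[OF cadlag tail_closed G]) auto
  have "AE \<omega> in P. \<forall>n. emeasure (?N \<omega>) (tail n) \<noteq> \<infinity>"
    using tail_finite by (simp add: AE_all_countable)
  then show "AE \<omega> in P. emeasure (?N \<omega>) G = (SUP n. ?g n \<omega>)"
  proof eventually_elim
    case (elim \<omega>)
    have inc: "incseq (\<lambda>n. G \<inter> tail n)"
    proof (rule incseq_SucI)
      fix n
      have "1 / real (Suc (Suc n)) \<le> 1 / real (Suc n)" by (intro divide_left_mono) auto
      then show "G \<inter> tail n \<subseteq> G \<inter> tail (Suc n)" by (auto simp: tail_def simp del: of_nat_Suc)
    qed
    have U: "(\<Union>n. G \<inter> tail n) = G \<inter> ({0<..} \<times> - {0})"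
    proof (intro equalityI subsetI)
      fix z assume z: "z \<in> G \<inter> ({0<..} \<times> - {0})"
      obtain s u where su: "z = (s, u)" "s > 0" "u \<noteq> 0" using z by auto
      obtain k where k: "s \<le> real k" using real_arch_simple by blast
      obtain j where j: "1 / real (Suc j) < norm u" using reals_Archimedean[of "norm u"] su(3) by (auto simp: divide_inverse)
      have "1 / real (Suc (max j k)) \<le> 1 / real (Suc j)" by (intro divide_left_mono) auto
      then have "z \<in> tail (max j k)" using su k j by (auto simp: tail_def simp del: of_nat_Suc)
      then show "z \<in> (\<Union>n. G \<inter> tail n)" using z by blast
    qed (auto simp: tail_def simp del: of_nat_Suc)
    have "(SUP n. ?g n \<omega>) = (SUP n. emeasure (?N \<omega>) (G \<inter> tail n))" using elim by simp
    also have "\<dots> = emeasure (?N \<omega>) (\<Union>n. G \<inter> tail n)"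
      using G tail_sets by (intro SUP_emeasure_incseq inc) auto
    also have "\<dots> = emeasure (?N \<omega>) G"
    proof -
      have "{0<..} \<times> - {0} \<in> sets (borel \<Otimes>\<^sub>M borel :: (real \<times> 'u) measure)" by (intro pair_measureI) auto
      then have "G \<inter> ({0<..} \<times> - {0}) \<in> sets (borel \<Otimes>\<^sub>M borel)" using G by (rule sets.Int[rotated])
      moreover have "(\<lambda>t. (t, jump M \<omega> t)) -` (G \<inter> ({0<..} \<times> - {0})) \<inter> {t. 0 < t \<and> jump M \<omega> t \<noteq> 0}
        = (\<lambda>t. (t, jump M \<omega> t)) -` G \<inter> {t. 0 < t \<and> jump M \<omega> t \<noteq> 0}" by auto
      ultimately show ?thesis unfolding U jump_measure_def using G
        by (subst (1 2) emeasure_distr) (auto simp: space_pair_measure)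
    qed
    finally show ?case by simp
  qed
qed

lemma compensated_simple_integral_history:
  assumes S: "S \<in> admissible_simple \<rho>"
  shows "\<exists>Z\<in>borel_measurable (history P M). AE \<omega> in P. compensated_simple_integral (jump_measure M) \<rho> S \<omega> = Z \<omega>"
  using S
proof (induction S)
  case Nil
  then show ?case by (intro bexI[of _ "\<lambda>_. 0"]) (auto simp: compensated_simple_integral_def)
next
  case (Cons z S)
  obtain a G where z: "z = (a, G)" by (cases z) auto
  have G: "G \<in> sets \<rho>" using Cons.prems by (auto simp: z admissible_simple_def)
  obtain Y where Y: "Y \<in> borel_measurable (history P M)" "AE \<omega> in P. emeasure (jump_measure M \<omega>) G = Y \<omega>"
    by (rule jump_measure_history[OF \<rho>_sets_borel[OF G]]) (rule that)
  obtain Z where Z: "Z \<in> borel_measurable (history P M)" "AE \<omega> in P. compensated_simple_integral (jump_measure M) \<rho> S \<omega> = Z \<omega>"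
    using Cons by (auto simp: admissible_simple_def)
  have "AE \<omega> in P. compensated_simple_integral (jump_measure M) \<rho> (z # S) \<omega> = a * (enn2real (Y \<omega>) - measure \<rho> G) + Z \<omega>"
    using Y(2) Z(2) by eventually_elim (simp add: z compensated_simple_integral_def measure_def[of "jump_measure M _"])
  moreover have "(\<lambda>\<omega>. a * (enn2real (Y \<omega>) - measure \<rho> G) + Z \<omega>) \<in> borel_measurable (history P M)"
    using Y(1) Z(1) by measurable
  ultimately show ?case by (rule bexI[where x="\<lambda>\<omega>. a * (enn2real (Y \<omega>) - measure \<rho> G) + Z \<omega>"])
qed

end

lemma step_integral_history:
  assumes "S \<in> admissible_steps T"
  shows "step_integral W S \<in> borel_measurable (history P (W :: real \<Rightarrow> 'w \<Rightarrow> 'u::{banach, second_countable_topology}))"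
  using assms
proof (induction S)
  case Nil
  then show ?case by (simp add: step_integral_def)
next
  case (Cons z S)
  obtain a b g where z: "z = (a, b, g)" by (cases z) auto
  have S: "step_integral W S \<in> borel_measurable (history P W)" using Cons by (intro Cons.IH) (auto simp: admissible_steps_def)
  have [measurable]: "W b \<in> borel_measurable (history P W)" "W a \<in> borel_measurable (history P W)"
    using Cons.prems by (auto simp: z admissible_steps_def intro: measurable_history)
  have [measurable]: "blinfun_apply g \<in> borel_measurable borel"
    by (intro borel_measurable_continuous_onI linear_continuous_on blinfun.bounded_linear_right)
  have "(\<lambda>\<omega>. blinfun_apply g (W b \<omega> - W a \<omega>)) \<in> borel_measurable (history P W)" by measurable
  then have "(\<lambda>\<omega>. blinfun_apply g (W b \<omega> - W a \<omega>) + step_integral W S \<omega>) \<in> borel_measurable (history P W)"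
    using S by simp
  then show ?case by (simp add: step_integral_def z)
qed

locale levy_integral_setting = wiener_integral_setting P T W C i + jump_setting P T M \<mu>
  for P :: "'w measure" and T and W :: "real \<Rightarrow> 'w \<Rightarrow> 'u::{banach, second_countable_topology}"
    and C and i :: "'k::{real_inner, banach, second_countable_topology} \<Rightarrow>\<^sub>L 'u" and M :: "real \<Rightarrow> 'w \<Rightarrow> 'u" and \<mu> +
  assumes indep_WM: "indep_processes P W M"
begin

text \<open>
  Elementary integrals of the two kinds are, up to null sets, measurable for the histories of
  \<open>W\<close> and \<open>M\<close>; the product formula passes to limits in mean square.
\<close>

theorem cf_wiener_plus_poisson:
  assumes f: "wiener.has_ext f Y" and g: "poisson.has_ext g Z"
  shows "cf P (\<lambda>\<omega>. Y \<omega> + Z \<omega>) = cf P Y * cf P Z"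
proof -
  let ?I = "compensated_simple_integral (jump_measure M) \<rho>"
  obtain S where S: "\<And>n. S n \<in> admissible_steps T" "L2_tendsto P (\<lambda>n. step_integral W (S n)) Y"
    using f by (auto simp: wiener.has_ext_def)
  obtain R where R: "\<And>n. R n \<in> admissible_simple \<rho>" "L2_tendsto P (\<lambda>n. ?I (R n)) Z"
    using g by (auto simp: poisson.has_ext_def)
  note L = wiener.I_L2[OF S(1)] and L' = poisson.I_L2[OF R(1)]
  have "(\<lambda>n. cf P (\<lambda>\<omega>. step_integral W (S n) \<omega> + 1 *\<^sub>R ?I (R n) \<omega>)) \<longlonglongrightarrow> cf P (\<lambda>\<omega>. Y \<omega> + 1 *\<^sub>R Z \<omega>)"
    by (intro cf_tendsto prob_space_P L2_tendsto_add_scaleR L L' S R L2_fun_add L2_fun_scaleR)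
  moreover have "(\<lambda>n. cf P (step_integral W (S n)) * cf P (?I (R n))) \<longlonglongrightarrow> cf P Y * cf P Z"
    by (intro tendsto_mult cf_tendsto prob_space_P L L' S R)
  moreover have "cf P (\<lambda>\<omega>. step_integral W (S n) \<omega> + 1 *\<^sub>R ?I (R n) \<omega>) = cf P (step_integral W (S n)) * cf P (?I (R n))" for n
  proof -
    obtain B where B: "B \<in> borel_measurable (history P M)" "AE \<omega> in P. ?I (R n) \<omega> = B \<omega>"
      using compensated_simple_integral_history[OF R(1)] by blast
    have sub: "sets (history P M) \<subseteq> events"
      using indep_WM unfolding indep_processes_def sets_history[symmetric] indep_sets2_eq by auto
    have BM: "B \<in> borel_measurable P" using measurable_sets[OF B(1)] sub by (auto intro!: measurableI)
    note [measurable] = BM L2_funD[OF L[of n]] L2_funD[OF L'[of n]]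
    have "cf P (\<lambda>\<omega>. step_integral W (S n) \<omega> + 1 *\<^sub>R ?I (R n) \<omega>) = cf P (\<lambda>\<omega>. step_integral W (S n) \<omega> + B \<omega>)"
      using B(2) by (intro cf_cong_AE) auto
    also have "\<dots> = cf P (step_integral W (S n)) * cf P B"
      by (rule cf_indep_processes[OF prob_space_P indep_WM step_integral_history[OF S(1)] B(1)])
    also have "cf P B = cf P (?I (R n))" by (rule cf_cong_AE[OF L2_funD[OF L'] BM B(2), symmetric])
    finally show ?thesis .
  qed
  ultimately show ?thesis using LIMSEQ_unique by force
qed

end

section \<open>Radonifying operators and induced variables\<close>

lemma induced_by_variable_cong_AE:
  assumes "induced_by_variable P X" "\<And>v. AE \<omega> in P. X v \<omega> = Y v \<omega>"
  shows "induced_by_variable P Y"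
proof -
  obtain Z where Z: "Z \<in> borel_measurable P" "\<And>v. AE \<omega> in P. blinfun_apply v (Z \<omega>) = X v \<omega>"
    using assms(1) by (auto simp: induced_by_variable_def)
  have "AE \<omega> in P. blinfun_apply v (Z \<omega>) = Y v \<omega>" for v
    using Z(2)[of v] assms(2)[of v] by eventually_elim simp
  with Z(1) show ?thesis unfolding induced_by_variable_def by blast
qed

lemma induced_by_variable_lincomb:
  fixes X :: "('v::{banach, second_countable_topology} \<Rightarrow>\<^sub>L real) \<Rightarrow> 'w \<Rightarrow> real"
  assumes "induced_by_variable P X" "induced_by_variable P Y"
  shows "induced_by_variable P (\<lambda>v \<omega>. X v \<omega> + c * Y v \<omega>)"
proof -
  obtain Z where Z: "Z \<in> borel_measurable P" "\<And>v. AE \<omega> in P. blinfun_apply v (Z \<omega>) = X v \<omega>"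
    using assms(1) by (auto simp: induced_by_variable_def)
  obtain Z' where Z': "Z' \<in> borel_measurable P" "\<And>v. AE \<omega> in P. blinfun_apply v (Z' \<omega>) = Y v \<omega>"
    using assms(2) by (auto simp: induced_by_variable_def)
  have "AE \<omega> in P. blinfun_apply v (Z \<omega> + c *\<^sub>R Z' \<omega>) = X v \<omega> + c * Y v \<omega>" for v
    using Z(2)[of v] Z'(2)[of v] by eventually_elim (simp add: blinfun.add_right blinfun.scaleR_right)
  then have "\<forall>v. AE \<omega> in P. blinfun_apply v (Z \<omega> + c *\<^sub>R Z' \<omega>) = X v \<omega> + c * Y v \<omega>" by blast
  moreover have "(\<lambda>\<omega>. Z \<omega> + c *\<^sub>R Z' \<omega>) \<in> borel_measurable P"
    using Z(1) Z'(1) by (intro borel_measurable_add borel_measurable_scaleR) auto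
  ultimately show ?thesis
    unfolding induced_by_variable_def by (rule bexI[where x="\<lambda>\<omega>. Z \<omega> + c *\<^sub>R Z' \<omega>"])
qed

text \<open>
  A random point with almost surely constant evaluations along a norming sequence is almost surely
  constant.
\<close>

lemma induced_deterministic:
  fixes d :: "('v::{banach, second_countable_topology} \<Rightarrow>\<^sub>L real) \<Rightarrow> real"
  assumes P: "prob_space P"
  shows "induced_by_variable P (\<lambda>v _. d v) \<longleftrightarrow> (\<exists>x. \<forall>v. blinfun_apply v x = d v)"
proof
  assume "\<exists>x. \<forall>v. blinfun_apply v x = d v"
  then obtain x where x: "\<And>v. blinfun_apply v x = d v" by blast
  have "\<forall>v. AE \<omega> in P. blinfun_apply v ((\<lambda>_. x) \<omega>) = d v" by (simp add: x)
  moreover have "(\<lambda>_. x) \<in> borel_measurable P" by simp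
  ultimately show "induced_by_variable P (\<lambda>v _. d v)"
    unfolding induced_by_variable_def by (rule bexI[where x="\<lambda>_. x"])
next
  assume "induced_by_variable P (\<lambda>v _. d v)"
  then obtain Z where Z: "\<And>v. AE \<omega> in P. blinfun_apply v (Z \<omega>) = d v" by (auto simp: induced_by_variable_def)
  obtain w :: "nat \<Rightarrow> 'v \<Rightarrow>\<^sub>L real" where w: "norming w" using norming_sequence_exists by blast
  have AEw: "AE \<omega> in P. \<forall>n. blinfun_apply (w n) (Z \<omega>) = d (w n)" using Z by (simp add: AE_all_countable)
  note ex = eventually_happens'[OF prob_space.ae_filter_bot[OF P]]
  obtain \<omega>0 where \<omega>0: "\<forall>n. blinfun_apply (w n) (Z \<omega>0) = d (w n)" using ex[OF AEw] by blast
  have "blinfun_apply v (Z \<omega>0) = d v" for v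
  proof -
    obtain \<omega> where \<omega>: "\<forall>n. blinfun_apply (w n) (Z \<omega>) = d (w n)" "blinfun_apply v (Z \<omega>) = d v"
      using ex[OF eventually_conj[OF AEw Z[of v]]] by blast
    have "Z \<omega> = Z \<omega>0" by (rule norming_separates[OF w]) (simp add: \<omega> \<omega>0)
    then show ?thesis using \<omega>(2) by simp
  qed
  then show "\<exists>x. \<forall>v. blinfun_apply v x = d v" by blast
qed

text \<open>
  The map \<open>\<psi>\<close> is the adjoint of \<open>j\<close>, and \<open>X\<close> is a
  cylindrical variable on the underlying probability space that realizes the image of the
  cylindrical measure under \<open>j\<close>. An inducing variable has the required extension as
  its law; an extension is a Radon law for \<open>X\<close>.
\<close>

theorem radonifying_iff_induced:
  fixes j :: "'x \<Rightarrow> 'v::{banach, second_countable_topology}" and \<psi> :: "('v \<Rightarrow>\<^sub>L real) \<Rightarrow> 'd"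
  assumes P: "prob_space P" and X: "cyl_random_variable P X"
    and j: "\<And>f v. f \<in> H \<Longrightarrow> blinfun_apply v (j f) = pair f (\<psi> v)"
    and \<theta>: "\<And>n \<phi> B. B \<in> sets (borel_fin n) \<Longrightarrow>
      \<theta> (cylinder H pair n (\<lambda>i. \<psi> (\<phi> i)) B) = emeasure P {\<omega>\<in>space P. (\<lambda>i\<in>{..<n}. X (\<phi> i) \<omega>) \<in> B}"
  shows "radonifying H \<theta> j \<longleftrightarrow> induced_by_variable P X"
proof -
  interpret prob_space P by (rule P)
  note XM[measurable] = cyl_random_variable_measurable[OF X]
  have vM[measurable]: "blinfun_apply v \<in> borel_measurable borel" for v :: "'v \<Rightarrow>\<^sub>L real"
    by (intro borel_measurable_continuous_onI linear_continuous_on blinfun.bounded_linear_right)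
  have pre: "j -` cylinder UNIV dual_pairing n \<phi> B \<inter> H = cylinder H pair n (\<lambda>i. \<psi> (\<phi> i)) B" for n \<phi> B
    by (auto simp: cylinder_def dual_pairing_def j cong: restrict_cong)
  have eM: "(\<lambda>x. \<lambda>i\<in>{..<n}. blinfun_apply (\<phi> i) x) \<in> measurable borel (borel_fin n)" for n and \<phi> :: "nat \<Rightarrow> 'v \<Rightarrow>\<^sub>L real"
    by (intro measurable_restrict) auto
  have XnM: "(\<lambda>\<omega>. \<lambda>i\<in>{..<n}. X (\<phi> i) \<omega>) \<in> measurable P (borel_fin n)" for n and \<phi> :: "nat \<Rightarrow> 'v \<Rightarrow>\<^sub>L real"
    by (intro measurable_restrict) auto
  have cyl: "cylinder UNIV dual_pairing n \<phi> B = (\<lambda>x. \<lambda>i\<in>{..<n}. blinfun_apply (\<phi> i) x) -` B" for n \<phi> and B :: "(nat \<Rightarrow> real) set"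
    by (auto simp: cylinder_def dual_pairing_def)
  have cylM: "cylinder UNIV dual_pairing n \<phi> B \<in> sets borel" if "B \<in> sets (borel_fin n)" for n and \<phi> :: "nat \<Rightarrow> 'v \<Rightarrow>\<^sub>L real" and B
    using measurable_sets[OF eM that] by (simp add: cyl)
  show ?thesis
  proof
    assume "radonifying H \<theta> j"
    then obtain \<nu> where \<nu>: "prob_space \<nu>" "sets \<nu> = sets borel"
      and ext: "\<And>C. C \<in> cylindrical_sets UNIV dual_pairing UNIV \<Longrightarrow> emeasure \<nu> C = \<theta> (j -` C \<inter> H)"
      unfolding radonifying_def by blast
    have sp: "space \<nu> = UNIV" using sets_eq_imp_space_eq[OF \<nu>(2)] by simp
    show "induced_by_variable P X"
    proof (rule cyl_variable_with_Radon_law_induced[OF P X \<nu>])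
      fix v :: "'v \<Rightarrow>\<^sub>L real"
      let ?e = "\<lambda>x. \<lambda>i\<in>{..<1::nat}. blinfun_apply v x" and ?X = "\<lambda>\<omega>. \<lambda>i\<in>{..<1::nat}. X v \<omega>"
      have eM\<nu>: "?e \<in> measurable \<nu> (borel_fin 1)"
        using eM[of "\<lambda>_. v" 1] by (simp add: measurable_cong_sets[OF \<nu>(2) refl])
      have law: "distr \<nu> (borel_fin 1) ?e = distr P (borel_fin 1) ?X"
      proof (rule measure_eqI)
        fix B assume "B \<in> sets (distr \<nu> (borel_fin 1) ?e)"
        then have B: "B \<in> sets (borel_fin 1)" by simp
        have "emeasure (distr \<nu> (borel_fin 1) ?e) B = emeasure \<nu> (cylinder UNIV dual_pairing 1 (\<lambda>_. v) B)"
          using B by (simp add: emeasure_distr[OF eM\<nu>] cyl sp del: One_nat_def)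
        also have "\<dots> = \<theta> (j -` cylinder UNIV dual_pairing 1 (\<lambda>_. v) B \<inter> H)"
          using B by (intro ext) (auto simp: cylindrical_sets_def cylinder_sigma_def)
        also have "\<dots> = emeasure P {\<omega>\<in>space P. ?X \<omega> \<in> B}"
          unfolding pre using \<theta>[OF B, of "\<lambda>_. v"] by simp
        also have "\<dots> = emeasure (distr P (borel_fin 1) ?X) B"
          using B by (simp add: emeasure_distr[OF XnM] vimage_def Int_def conj_commute)
        finally show "emeasure (distr \<nu> (borel_fin 1) ?e) B = emeasure (distr P (borel_fin 1) ?X) B" .
      qed simp
      have c0: "(\<lambda>y. iexp (y 0)) \<in> borel_measurable (borel_fin 1)" by measurable
      have "cf P (X v) = (CLINT y|distr P (borel_fin 1) ?X. iexp (y 0))"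
        unfolding cf_def by (subst integral_distr[OF XnM c0]) simp
      also have "\<dots> = cf \<nu> (blinfun_apply v)"
        unfolding law[symmetric] cf_def by (subst integral_distr[OF eM\<nu> c0]) simp
      finally show "cf P (X v) = cf \<nu> (blinfun_apply v)" .
    qed
  next
    assume "induced_by_variable P X"
    then obtain Z where Z[measurable]: "Z \<in> borel_measurable P" and ZX: "\<And>v. AE \<omega> in P. blinfun_apply v (Z \<omega>) = X v \<omega>"
      by (auto simp: induced_by_variable_def)
    show "radonifying H \<theta> j"
      unfolding radonifying_def
    proof (intro exI[of _ "distr P borel Z"] conjI ballI)
      show "prob_space (distr P borel Z)" by (rule prob_space_distr) simp
      fix C :: "'v set" assume "C \<in> cylindrical_sets UNIV dual_pairing UNIV"
      then obtain n \<phi> B where B: "B \<in> sets (borel_fin n)" and C: "C = cylinder UNIV dual_pairing n \<phi> B"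
        by (auto simp: cylindrical_sets_def cylinder_sigma_def)
      have "emeasure (distr P borel Z) C = emeasure P {\<omega>\<in>space P. (\<lambda>i\<in>{..<n}. blinfun_apply (\<phi> i) (Z \<omega>)) \<in> B}"
        unfolding C by (subst emeasure_distr[OF Z cylM[OF B]]) (simp add: cyl vimage_def Int_def conj_commute)
      also have "\<dots> = emeasure P {\<omega>\<in>space P. (\<lambda>i\<in>{..<n}. X (\<phi> i) \<omega>) \<in> B}"
      proof (rule emeasure_eq_AE)
        have "AE \<omega> in P. \<forall>i. blinfun_apply (\<phi> i) (Z \<omega>) = X (\<phi> i) \<omega>" using ZX by (simp add: AE_all_countable)
        then show "AE \<omega> in P. \<omega> \<in> {\<omega>\<in>space P. (\<lambda>i\<in>{..<n}. blinfun_apply (\<phi> i) (Z \<omega>)) \<in> B}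
          \<longleftrightarrow> \<omega> \<in> {\<omega>\<in>space P. (\<lambda>i\<in>{..<n}. X (\<phi> i) \<omega>) \<in> B}" by eventually_elim simp
        show "{\<omega>\<in>space P. (\<lambda>i\<in>{..<n}. blinfun_apply (\<phi> i) (Z \<omega>)) \<in> B} \<in> sets P"
          using measurable_sets[OF measurable_compose[OF Z eM] B] by (simp add: vimage_def Int_def conj_commute)
        show "{\<omega>\<in>space P. (\<lambda>i\<in>{..<n}. X (\<phi> i) \<omega>) \<in> B} \<in> sets P"
          using measurable_sets[OF XnM B] by (simp add: vimage_def Int_def conj_commute)
      qed
      also have "\<dots> = \<theta> (j -` C \<inter> H)" unfolding C pre using \<theta>[OF B, of \<phi>] by simp
      finally show "emeasure (distr P borel Z) C = \<theta> (j -` C \<inter> H)" .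
    qed simp
  qed
qed

context isometric_integral
begin

lemma has_ext_cyl_random_variable:
  assumes X: "\<And>v. has_ext (\<Phi> v) (X v)"
    and lin: "\<And>u v c x. x \<in> space m \<Longrightarrow> \<Phi> (u + c *\<^sub>R v) x = \<Phi> u x + c *\<^sub>R \<Phi> v x"
  shows "cyl_random_variable P X"
  unfolding cyl_random_variable_def
proof (intro conjI allI)
  show "X v \<in> borel_measurable P" for v by (rule L2_funD[OF has_ext_L2(2)[OF X]])
  fix u v c
  have "has_ext (\<Phi> u) (X u)" "has_ext (\<Phi> v) (X v)" by (rule X)+
  then have "has_ext (\<Phi> (u + c *\<^sub>R v)) (\<lambda>\<omega>. X u \<omega> + c * X v \<omega>)"
    by (intro has_ext_cong[OF lin[symmetric] has_ext_lincomb])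
  from has_ext_unique[OF X this] show "AE \<omega> in P. X (u + c *\<^sub>R v) \<omega> = X u \<omega> + c * X v \<omega>" .
qed

end

section \<open>The canonical Gaussian cylindrical measure\<close>

lemma L2_inner_sum_right:
  fixes n :: nat
  assumes "f \<in> L2_fun m" "\<And>k. \<psi> k \<in> L2_fun m"
  shows "L2_inner m f (\<lambda>x. \<Sum>k<n. t k *\<^sub>R \<psi> k x) = (\<Sum>k<n. t k * L2_inner m f (\<psi> k))"
proof -
  have i: "integrable m (\<lambda>x. f x \<bullet> \<psi> k x)" for k
  proof (rule Bochner_Integration.integrable_bound[OF L2_Cauchy_Schwarz(1)[OF assms(1) assms(2)[of k]]])
    show "(\<lambda>x. f x \<bullet> \<psi> k x) \<in> borel_measurable m"
      using L2_funD[OF assms(1)] L2_funD[OF assms(2)[of k]] by (rule borel_measurable_inner)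
    show "AE x in m. norm (f x \<bullet> \<psi> k x) \<le> norm (norm (f x) * norm (\<psi> k x))"
      by (intro AE_I2) (simp add: Cauchy_Schwarz_ineq2)
  qed
  have "L2_inner m f (\<lambda>x. \<Sum>k<n. t k *\<^sub>R \<psi> k x) = (LINT x|m. (\<Sum>k<n. t k * (f x \<bullet> \<psi> k x)))"
    by (simp add: L2_inner_def inner_sum_right)
  also have "\<dots> = (\<Sum>k<n. LINT x|m. t k * (f x \<bullet> \<psi> k x))"
    by (rule Bochner_Integration.integral_sum) (intro integrable_mult_right i)
  finally show ?thesis by (simp add: L2_inner_def)
qed

text \<open>
  The canonical Gaussian cylindrical measure is the cylindrical distribution of the Wiener
  integral, since both have the Gaussian characteristic function. It is a measure only on the
  \<sigma>-algebra of finitely many \<open>\<psi> k\<close> at a time, written \<open>Q n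
  \<psi>\<close>.
\<close>

lemma (in wiener_integral_setting) canonical_gaussian_cylinder:
  assumes \<gamma>: "canonical_gaussian (lborel_upto T) \<gamma>"
    and X: "\<And>k. wiener.has_ext (\<psi> k) (X k)"
    and B: "B \<in> sets (borel_fin n)"
  shows "\<gamma> (cylinder (L2_fun (lborel_upto T)) (L2_inner (lborel_upto T)) n \<psi> B)
    = emeasure P {\<omega>\<in>space P. (\<lambda>k\<in>{..<n}. X k \<omega>) \<in> B}"
proof -
  let ?m = "lborel_upto T"
  let ?H = "L2_fun ?m :: (real \<Rightarrow> 'k) set"
  let ?pair = "L2_inner ?m :: (real \<Rightarrow> 'k) \<Rightarrow> (real \<Rightarrow> 'k) \<Rightarrow> real"
  have cp: "cylindrical_prob ?H ?pair ?H \<gamma>"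
    and char: "\<And>h. h \<in> ?H \<Longrightarrow> cylindrical_char ?H ?pair \<gamma> h = of_real (exp (- ?pair h h / 2))"
    using \<gamma> by (auto simp: canonical_gaussian_def)
  define Q where "Q n \<psi> = measure_of ?H (cylinder_sigma ?H ?pair n \<psi>) \<gamma>" for n \<psi>
  have ms: "measure_space ?H (cylinder_sigma ?H ?pair n \<psi>) \<gamma>" if "\<And>k. \<psi> k \<in> ?H" for n \<psi>
    using cp that by (auto simp: cylindrical_prob_def)
  have sQ: "sets (Q n \<psi>) = cylinder_sigma ?H ?pair n \<psi>" "space (Q n \<psi>) = ?H"
    "\<And>S. S \<in> cylinder_sigma ?H ?pair n \<psi> \<Longrightarrow> emeasure (Q n \<psi>) S = \<gamma> S" if \<psi>: "\<And>k. \<psi> k \<in> ?H" for n \<psi>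
  proof -
    note m = ms[OF \<psi>, of n]
    have sa: "sigma_algebra ?H (cylinder_sigma ?H ?pair n \<psi>)" using m by (simp add: measure_space_def)
    then have sub: "cylinder_sigma ?H ?pair n \<psi> \<subseteq> Pow ?H" by (rule sigma_algebra.axioms(1)[THEN algebra.axioms(1), THEN ring_of_sets.axioms(1), THEN semiring_of_sets.axioms(1), THEN subset_class.space_closed])
    show "sets (Q n \<psi>) = cylinder_sigma ?H ?pair n \<psi>" unfolding Q_def by (rule sigma_algebra.sets_measure_of_eq[OF sa])
    show "space (Q n \<psi>) = ?H" unfolding Q_def by (rule space_measure_of[OF sub])
    show "emeasure (Q n \<psi>) S = \<gamma> S" if "S \<in> cylinder_sigma ?H ?pair n \<psi>" for S
      using m that unfolding Q_def measure_space_def by (intro emeasure_measure_of_sigma) auto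
  qed
  have HM: "{f\<in>?H. ?pair f (\<psi> k) \<in> A} \<in> cylinder_sigma ?H ?pair n \<psi>" if "k < n" "A \<in> sets borel" for k n \<psi> A
  proof -
    have "(\<lambda>y. y k) -` A \<inter> space (borel_fin n) \<in> sets (borel_fin n)"
      using that by (intro measurable_sets[OF measurable_component_singleton[of k "{..<n}" "\<lambda>_. borel"]]) auto
    moreover have "{f\<in>?H. ?pair f (\<psi> k) \<in> A} = cylinder ?H ?pair n \<psi> ((\<lambda>y. y k) -` A \<inter> space (borel_fin n))"
      using that by (auto simp: cylinder_def space_PiM)
    ultimately show ?thesis unfolding cylinder_sigma_def by blast
  qed
  have pM: "(\<lambda>f. ?pair f (\<psi> k)) \<in> borel_measurable (Q n \<psi>)" if "\<And>k. \<psi> k \<in> ?H" "k < n" for k n \<psi>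
    using HM[OF that(2)] sQ[OF that(1)] by (intro measurableI) (auto simp: vimage_def Int_def conj_commute)
  have \<psi>H: "\<psi> k \<in> ?H" for k by (rule wiener.has_ext_L2(1)[OF X])
  note pM\<psi> = pM[OF \<psi>H]
  have HQ: "?H \<in> cylinder_sigma ?H ?pair n \<psi>" for n \<psi>
  proof -
    have "?H = cylinder ?H ?pair n \<psi> (space (borel_fin n))" by (auto simp: cylinder_def space_PiM)
    then show ?thesis unfolding cylinder_sigma_def using sets.top by blast
  qed
  have prQ: "prob_space (Q n \<psi>)" for n
    by (rule prob_spaceI) (use sQ[OF \<psi>H] HQ cp in \<open>simp add: cylindrical_prob_def\<close>)
  (* Padding by zero beyond n allows the use of the result on infinite sequences. *)
  define \<psi>' where "\<psi>' k = (if k < n then \<psi> k else (\<lambda>_. 0))" for k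
  define X' where "X' k = (if k < n then X k else (\<lambda>_. 0))" for k
  have X': "wiener.has_ext (\<psi>' k) (X' k)" for k
    using X wiener.has_ext_zero[OF X] by (simp add: \<psi>'_def X'_def)
  have \<psi>'H: "\<psi>' k \<in> ?H" for k by (rule wiener.has_ext_L2(1)[OF X'])
  have Y1: "(\<lambda>f. ?pair f (\<psi>' k)) \<in> borel_measurable (Q n \<psi>)" for k
    using pM\<psi>[of k n] by (cases "k < n") (auto simp: \<psi>'_def L2_inner_def)
  have Y2: "X' k \<in> borel_measurable P" for k by (rule L2_funD[OF wiener.has_ext_L2(2)[OF X']])
  have law: "distr (Q n \<psi>) (PiM UNIV (\<lambda>_. borel)) (\<lambda>f k. ?pair f (\<psi>' k)) = distr P (PiM UNIV (\<lambda>_. borel)) (\<lambda>\<omega> k. X' k \<omega>)"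
  proof (rule cf_determines_joint_distribution[OF prQ prob_space_P Y1 Y2])
    fix N :: nat and t :: "nat \<Rightarrow> real"
    define h where "h = (\<lambda>x. \<Sum>k<N. t k *\<^sub>R \<psi>' k x)"
    have hX: "wiener.has_ext h (\<lambda>\<omega>. \<Sum>k<N. t k * X' k \<omega>)" unfolding h_def by (rule wiener.has_ext_sum[OF X'])
    have hH: "h \<in> ?H" by (rule wiener.has_ext_L2(1)[OF hX])
    have eq: "?pair f h = (\<Sum>k<N. t k * ?pair f (\<psi>' k))" if "f \<in> ?H" for f
      unfolding h_def by (rule L2_inner_sum_right[OF that \<psi>'H])
    have m1: "(\<lambda>f. ?pair f h) \<in> borel_measurable (Q n \<psi>)"
    proof (subst measurable_cong)
      show "(\<lambda>f. \<Sum>k<N. t k * ?pair f (\<psi>' k)) \<in> borel_measurable (Q n \<psi>)"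
        using Y1 by (intro borel_measurable_sum borel_measurable_times) auto
      show "?pair f h = (\<Sum>k<N. t k * ?pair f (\<psi>' k))" if "f \<in> space (Q n \<psi>)" for f
        using that sQ(2)[OF \<psi>H] by (intro eq) simp
    qed
    have m2: "(\<lambda>f. ?pair f h) \<in> borel_measurable (Q 1 (\<lambda>_. h))"
      using pM[of "\<lambda>_. h" 0 1] hH by simp
    (* The given characteristic function at h refers to the sigma-algebra of h alone; both
       measures are restrictions of gamma and agree on the sets defined by h. *)
    have "distr (Q n \<psi>) borel (\<lambda>f. ?pair f h) = distr (Q 1 (\<lambda>_. h)) borel (\<lambda>f. ?pair f h)"
    proof (rule measure_eqI)
      fix A assume "A \<in> sets (distr (Q n \<psi>) borel (\<lambda>f. ?pair f h))"
      then have A: "A \<in> sets borel" by simp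
      have s: "{f\<in>?H. ?pair f h \<in> A} \<in> cylinder_sigma ?H ?pair n \<psi>"
        using measurable_sets[OF m1 A] sQ(1)[OF \<psi>H] sQ(2)[OF \<psi>H] by (simp add: vimage_def Int_def conj_commute)
      have s1: "{f\<in>?H. ?pair f h \<in> A} \<in> cylinder_sigma ?H ?pair 1 (\<lambda>_. h)"
        using HM[of 0 1 A "\<lambda>_. h"] A by simp
      have "emeasure (distr (Q n \<psi>) borel (\<lambda>f. ?pair f h)) A = emeasure (Q n \<psi>) {f\<in>?H. ?pair f h \<in> A}"
        using A sQ(2)[OF \<psi>H] by (simp add: emeasure_distr[OF m1] vimage_def Int_def conj_commute)
      also have "\<dots> = emeasure (Q 1 (\<lambda>_. h)) {f\<in>?H. ?pair f h \<in> A}"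
        using sQ(3)[OF \<psi>H s] sQ(3)[OF hH s1] by simp
      also have "\<dots> = emeasure (distr (Q 1 (\<lambda>_. h)) borel (\<lambda>f. ?pair f h)) A"
        using A sQ(2)[of "\<lambda>_. h" 1] hH by (simp add: emeasure_distr[OF m2] vimage_def Int_def conj_commute del: One_nat_def)
      finally show "emeasure (distr (Q n \<psi>) borel (\<lambda>f. ?pair f h)) A = emeasure (distr (Q 1 (\<lambda>_. h)) borel (\<lambda>f. ?pair f h)) A" .
    qed simp
    then have "cf (Q n \<psi>) (\<lambda>f. 1 * ?pair f h) = cf (Q 1 (\<lambda>_. h)) (\<lambda>f. 1 * ?pair f h)"
      unfolding cf_distr[OF m1, symmetric] cf_distr[OF m2, symmetric] by simp
    then have "cf (Q n \<psi>) (\<lambda>f. ?pair f h) = cylindrical_char ?H ?pair \<gamma> h"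
      by (simp add: cf_def cylindrical_char_def Q_def)
    also have "\<dots> = complex_of_real (exp (- ((norm2 ?m h)\<^sup>2 / 2)))"
      by (simp add: char[OF hH] norm2_power2[OF hH] L2_inner_def power2_norm_eq_inner)
    also have "\<dots> = cf P (\<lambda>\<omega>. \<Sum>k<N. t k * X' k \<omega>)" by (rule cf_wiener[OF hX, symmetric])
    also have "cf (Q n \<psi>) (\<lambda>f. ?pair f h) = cf (Q n \<psi>) (\<lambda>f. \<Sum>k<N. t k * ?pair f (\<psi>' k))"
      unfolding cf_def by (intro Bochner_Integration.integral_cong refl) (simp add: eq sQ(2)[OF \<psi>H])
    finally show "cf (Q n \<psi>) (\<lambda>f. \<Sum>k<N. t k * ?pair f (\<psi>' k)) = cf P (\<lambda>\<omega>. \<Sum>k<N. t k * X' k \<omega>)" .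
  qed
  define E where "E = {y\<in>space (PiM UNIV (\<lambda>_::nat. borel :: real measure)). restrict y {..<n} \<in> B}"
  have E: "E \<in> sets (PiM UNIV (\<lambda>_. borel))"
  proof -
    have "(\<lambda>y. restrict y {..<n}) \<in> measurable (PiM UNIV (\<lambda>_. borel :: real measure)) (borel_fin n)"
      by (rule measurable_restrict_subset) simp
    from measurable_sets[OF this B] show ?thesis by (simp add: E_def vimage_def Int_def conj_commute)
  qed
  have m1: "(\<lambda>f k. ?pair f (\<psi>' k)) \<in> measurable (Q n \<psi>) (PiM UNIV (\<lambda>_. borel))" using Y1 by (intro measurable_PiM_single') auto
  have m2: "(\<lambda>\<omega> k. X' k \<omega>) \<in> measurable P (PiM UNIV (\<lambda>_. borel))" using Y2 by (intro measurable_PiM_single') auto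
  have r: "restrict (\<lambda>k. ?pair f (\<psi>' k)) {..<n} = (\<lambda>k\<in>{..<n}. ?pair f (\<psi> k))"
    "restrict (\<lambda>k. X' k \<omega>) {..<n} = (\<lambda>k\<in>{..<n}. X k \<omega>)" for f \<omega>
    by (auto simp: \<psi>'_def X'_def restrict_def)
  have cyl: "cylinder ?H ?pair n \<psi> B = (\<lambda>f k. ?pair f (\<psi>' k)) -` E \<inter> space (Q n \<psi>)"
    using sQ(2)[OF \<psi>H] by (auto simp: cylinder_def E_def r space_PiM)
  have "\<gamma> (cylinder ?H ?pair n \<psi> B) = emeasure (Q n \<psi>) (cylinder ?H ?pair n \<psi> B)"
    using B by (intro sQ(3)[OF \<psi>H, symmetric]) (auto simp: cylinder_sigma_def)
  also have "\<dots> = emeasure (distr P (PiM UNIV (\<lambda>_. borel)) (\<lambda>\<omega> k. X' k \<omega>)) E"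
    by (simp only: cyl emeasure_distr[OF m1 E, symmetric] law)
  also have "\<dots> = emeasure P {\<omega>\<in>space P. (\<lambda>k\<in>{..<n}. X k \<omega>) \<in> B}"
    unfolding emeasure_distr[OF m2 E] by (intro arg_cong[where f="emeasure P"]) (auto simp: E_def r space_PiM)
  finally show ?thesis .
qed

section \<open>The cylindrical integral and its three parts\<close>

lemma cf_shift: "cf P (\<lambda>\<omega>. a + X \<omega>) = iexp a * cf P X"
  by (simp add: cf_def distrib_left exp_add)

locale integrand_setting = levy_integral_setting P T W C i M \<mu>
  for P :: "'w measure" and T and W :: "real \<Rightarrow> 'w \<Rightarrow> 'u::{banach, second_countable_topology}"
    and C and i :: "'k::{real_inner, banach, second_countable_topology} \<Rightarrow>\<^sub>L 'u" and M :: "real \<Rightarrow> 'w \<Rightarrow> 'u" and \<mu> +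
  fixes F :: "real \<Rightarrow> 'u \<Rightarrow>\<^sub>L 'v::{banach, second_countable_topology}" and b :: 'u
  assumes F_M: "\<And>v :: 'v \<Rightarrow>\<^sub>L real.
      (\<lambda>(s, u). blinfun_apply v (blinfun_apply (F s) u)) \<in> L2_fun (jump_intensity T \<mu>)"
    and F_W: "\<And>v :: 'v \<Rightarrow>\<^sub>L real. (\<lambda>s. hilbert_adjoint i (v o\<^sub>L F s)) \<in> L2_fun (lborel_upto T)"
    and F_b: "\<And>v :: 'v \<Rightarrow>\<^sub>L real. integrable (lborel_upto T) (\<lambda>s. blinfun_apply (v o\<^sub>L F s) b)"
begin

abbreviation leb :: "real measure" where "leb \<equiv> lborel_upto T"

text \<open>
  This function and the next are the values at \<open>v\<close> of the adjoints of
  \<open>j_W\<close> and \<open>j_M\<close>.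
\<close>

definition adj_W :: "('v \<Rightarrow>\<^sub>L real) \<Rightarrow> real \<Rightarrow> 'k"
  where "adj_W v s = hilbert_adjoint i (v o\<^sub>L F s)"

definition adj_M :: "('v \<Rightarrow>\<^sub>L real) \<Rightarrow> real \<times> 'u \<Rightarrow> real"
  where "adj_M v = (\<lambda>(s, u). blinfun_apply v (blinfun_apply (F s) u))"

definition drift :: "real set \<Rightarrow> ('v \<Rightarrow>\<^sub>L real) \<Rightarrow> real"
  where "drift A v = (LINT s|leb. indicator A s * blinfun_apply (v o\<^sub>L F s) b)"

definition wiener_part :: "real set \<Rightarrow> ('v \<Rightarrow>\<^sub>L real) \<Rightarrow> 'w \<Rightarrow> real"
  where "wiener_part A v = wiener_integral P T i W (\<lambda>s. indicator A s *\<^sub>R (v o\<^sub>L F s))"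

definition jump_part :: "real set \<Rightarrow> ('v \<Rightarrow>\<^sub>L real) \<Rightarrow> 'w \<Rightarrow> real"
  where "jump_part A v = jump_integral P T M \<mu> (\<lambda>s. indicator A s *\<^sub>R (v o\<^sub>L F s))"

lemma cyl_integral_eq: "cyl_integral P T b i W M \<mu> F A v \<omega> = drift A v + wiener_part A v \<omega> + jump_part A v \<omega>"
  by (simp add: cyl_integral_def drift_def wiener_part_def jump_part_def)

lemma adj_W_L2: "adj_W v \<in> L2_fun leb"
  using F_W[of v] by (simp add: adj_W_def[abs_def])

lemma adj_M_L2: "adj_M v \<in> L2_fun \<rho>"
  using F_M[of v] by (simp add: adj_M_def)

lemma adj_M_apply: "adj_M v z = blinfun_apply v (blinfun_apply (F (fst z)) (snd z))"
  by (simp add: adj_M_def split_beta)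

lemma bounded_linear_adj_W: "bounded_linear (\<lambda>v. adj_W v s)"
  unfolding adj_W_def
  by (rule bounded_linear_compose[OF bounded_linear_hilbert_adjoint
        bounded_bilinear.bounded_linear_left[OF bounded_bilinear_blinfun_compose]])

lemma bounded_linear_adj_M: "bounded_linear (\<lambda>v. adj_M v z)"
  unfolding adj_M_apply by (rule blinfun.bounded_linear_left)

lemma adj_W_lincomb: "adj_W (u + c *\<^sub>R v) s = adj_W u s + c *\<^sub>R adj_W v s"
  using linear_add[OF bounded_linear.linear[OF bounded_linear_adj_W[of s]], of u "c *\<^sub>R v"]
    linear_scale[OF bounded_linear.linear[OF bounded_linear_adj_W[of s]], of c v] by simp

lemma adj_M_lincomb: "adj_M (u + c *\<^sub>R v) z = adj_M u z + c *\<^sub>R adj_M v z"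
  using linear_add[OF bounded_linear.linear[OF bounded_linear_adj_M[of z]], of u "c *\<^sub>R v"]
    linear_scale[OF bounded_linear.linear[OF bounded_linear_adj_M[of z]], of c v] by simp

lemma adj_W_bounded: "\<exists>c\<ge>0. \<forall>v. norm2 leb (adj_W v) \<le> c * norm v"
proof -
  obtain c where "c \<ge> 0" "\<And>v. norm2 leb (adj_W v) \<le> c * norm v"
    using L2_valued_operator_bounded[OF adj_W_L2 bounded_linear_adj_W] by blast
  then show ?thesis by blast
qed

lemma adj_M_bounded: "\<exists>c\<ge>0. \<forall>v. norm2 \<rho> (adj_M v) \<le> c * norm v"
proof -
  obtain c where "c \<ge> 0" "\<And>v. norm2 \<rho> (adj_M v) \<le> c * norm v"
    using L2_valued_operator_bounded[OF adj_M_L2 bounded_linear_adj_M] by blast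
  then show ?thesis by blast
qed

lemma upto_sets: "{0..T} \<in> sets leb" "{0..T} = space leb"
  using sets.top[of leb] by (simp_all add: space_restrict_space)

lemma slab_sets: "A \<in> sets leb \<Longrightarrow> A \<times> space \<mu> \<in> sets \<rho>"
  by (intro pair_measureI) auto

lemma wiener_part_has_ext:
  assumes A: "A \<in> sets leb"
  shows "wiener.has_ext (\<lambda>s. indicator A s *\<^sub>R adj_W v s) (wiener_part A v)"
proof -
  have e: "hilbert_adjoint i (indicator A s *\<^sub>R (v o\<^sub>L F s)) = indicator A s *\<^sub>R adj_W v s" for s
    using linear_scale[OF bounded_linear.linear[OF bounded_linear_hilbert_adjoint[of i]]] by (simp add: adj_W_def)
  have "{x \<in> space leb. x \<in> A} = A" using sets.sets_into_space[OF A] by auto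
  then have "(\<lambda>s. indicator A s *\<^sub>R adj_W v s) \<in> L2_fun leb"
    using A by (intro L2_fun_indicator adj_W_L2) simp
  then show ?thesis
    using wiener_integral_has_ext[of "\<lambda>s. indicator A s *\<^sub>R (v o\<^sub>L F s)"] unfolding e wiener_part_def by simp
qed

lemma jump_part_has_ext:
  assumes A: "A \<in> sets leb"
  shows "poisson.has_ext (\<lambda>z. indicator A (fst z) *\<^sub>R adj_M v z) (jump_part A v)"
proof -
  have e: "(\<lambda>(s, u). blinfun_apply (indicator A s *\<^sub>R (v o\<^sub>L F s)) u) = (\<lambda>z. indicator A (fst z) *\<^sub>R adj_M v z)"
    by (auto simp: fun_eq_iff adj_M_apply blinfun.scaleR_left)
  have "{z \<in> space \<rho>. z \<in> fst -` A} = A \<times> space \<mu>"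
    using sets.sets_into_space[OF A] by (auto simp: space_pair_measure)
  then have "(\<lambda>z. indicator (fst -` A) z *\<^sub>R adj_M v z) \<in> L2_fun \<rho>"
    using slab_sets[OF A] by (intro L2_fun_indicator adj_M_L2) simp
  moreover have "(\<lambda>z. indicator (fst -` A) z *\<^sub>R adj_M v z) = (\<lambda>z. indicator A (fst z) *\<^sub>R adj_M v z)"
    by (simp add: indicator_def fun_eq_iff)
  ultimately show ?thesis
    using compensated_integral_has_ext[of "\<lambda>z. indicator A (fst z) *\<^sub>R adj_M v z"]
    unfolding jump_part_def jump_integral_def Theta_M_def e by simp
qed

lemma wiener_part_full_has_ext: "wiener.has_ext (adj_W v) (wiener_part {0..T} v)"
  by (rule wiener.has_ext_cong[OF _ wiener_part_has_ext[OF upto_sets(1)]]) (simp add: upto_sets(2)[symmetric])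

lemma jump_part_full_has_ext: "poisson.has_ext (adj_M v) (jump_part {0..T} v)"
  by (rule poisson.has_ext_cong[OF _ jump_part_has_ext[OF upto_sets(1)]])
    (auto simp: upto_sets(2)[symmetric] space_pair_measure)

lemma wiener_part_cyl: "A \<in> sets leb \<Longrightarrow> cyl_random_variable P (wiener_part A)"
  by (rule wiener.has_ext_cyl_random_variable[OF wiener_part_has_ext]) (auto simp: adj_W_lincomb scaleR_add_right)

lemma jump_part_cyl: "A \<in> sets leb \<Longrightarrow> cyl_random_variable P (jump_part A)"
  by (rule poisson.has_ext_cyl_random_variable[OF jump_part_has_ext]) (auto simp: adj_M_lincomb algebra_simps)

lemma drift_lincomb:
  assumes A: "A \<in> sets leb"
  shows "drift A (u + c *\<^sub>R v) = drift A u + c * drift A v"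
proof -
  have int: "integrable leb (\<lambda>s. indicator A s * blinfun_apply (v o\<^sub>L F s) b)" for v :: "'v \<Rightarrow>\<^sub>L real"
    using integrable_mult_indicator[OF A F_b[of v]] by simp
  have "drift A (u + c *\<^sub>R v) = (LINT s|leb. indicator A s * blinfun_apply (u o\<^sub>L F s) b
      + c * (indicator A s * blinfun_apply (v o\<^sub>L F s) b))"
    unfolding drift_def
    by (intro Bochner_Integration.integral_cong refl) (simp add: blinfun.add_left blinfun.scaleR_left algebra_simps)
  also have "\<dots> = drift A u + c * drift A v"
    unfolding drift_def using int[of u] int[of v] by simp
  finally show ?thesis .
qed

lemma drift_cyl: "A \<in> sets leb \<Longrightarrow> cyl_random_variable P (\<lambda>v _. drift A v)"
  by (simp add: cyl_random_variable_def drift_lincomb)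

lemma drift_wiener_part_cyl:
  assumes A: "A \<in> sets leb"
  shows "cyl_random_variable P (\<lambda>v \<omega>. drift A v + wiener_part A v \<omega>)"
  unfolding cyl_random_variable_def
proof (intro conjI allI)
  note W = wiener_part_cyl[OF A, unfolded cyl_random_variable_def]
  show "(\<lambda>\<omega>. drift A v + wiener_part A v \<omega>) \<in> borel_measurable P" for v
    using cyl_random_variable_measurable[OF wiener_part_cyl[OF A], of v] by (intro borel_measurable_add) auto
  show "AE \<omega> in P. drift A (u + c *\<^sub>R v) + wiener_part A (u + c *\<^sub>R v) \<omega>
      = drift A u + wiener_part A u \<omega> + c * (drift A v + wiener_part A v \<omega>)" for u v c
  proof -
    have "AE \<omega> in P. wiener_part A (u + c *\<^sub>R v) \<omega> = wiener_part A u \<omega> + c * wiener_part A v \<omega>" using W by blast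
    then show ?thesis by eventually_elim (simp add: drift_lincomb[OF A] algebra_simps)
  qed
qed

text \<open>
  The bound in \<open>L\<^sup>2\<close> required for cancelling is the one of
  \<open>adj_W\<close>, which the isometry transports.
\<close>

lemma induced_cancel_wiener_part:
  assumes A: "A \<in> sets leb" and X: "cyl_random_variable P X"
    and indep: "\<And>v. cf P (\<lambda>\<omega>. X v \<omega> + wiener_part A v \<omega>) = cf P (X v) * cf P (wiener_part A v)"
    and ind: "induced_by_variable P (\<lambda>v \<omega>. X v \<omega> + wiener_part A v \<omega>)"
  shows "induced_by_variable P X"
proof -
  obtain c where c: "c \<ge> 0" "\<forall>v. norm2 leb (adj_W v) \<le> c * norm v" using adj_W_bounded by blast
  note ext = wiener_part_has_ext[OF A]
  have "norm2 P (wiener_part A v) \<le> c * norm v" for v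
  proof -
    have "norm2 P (wiener_part A v) = norm2 leb (\<lambda>s. indicator A s *\<^sub>R adj_W v s)" by (rule wiener.has_ext_isometry[OF ext])
    also have "\<dots> \<le> norm2 leb (adj_W v)" by (rule norm2_mono[OF adj_W_L2]) (simp split: split_indicator)
    finally show ?thesis using c(2)[rule_format, of v] by linarith
  qed
  from induced_cancel_independent_summand[OF prob_space_P X wiener_part_cyl[OF A] wiener.has_ext_L2(2)[OF ext] this c(1)
      wiener.has_ext_mean_zero(2)[OF ext] indep ind]
  show ?thesis .
qed

lemma induced_cancel_jump_part:
  assumes A: "A \<in> sets leb" and X: "cyl_random_variable P X"
    and indep: "\<And>v. cf P (\<lambda>\<omega>. X v \<omega> + jump_part A v \<omega>) = cf P (X v) * cf P (jump_part A v)"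
    and ind: "induced_by_variable P (\<lambda>v \<omega>. X v \<omega> + jump_part A v \<omega>)"
  shows "induced_by_variable P X"
proof -
  obtain c where c: "c \<ge> 0" "\<forall>v. norm2 \<rho> (adj_M v) \<le> c * norm v" using adj_M_bounded by blast
  note ext = jump_part_has_ext[OF A]
  have "norm2 P (jump_part A v) \<le> c * norm v" for v
  proof -
    have "norm2 P (jump_part A v) = norm2 \<rho> (\<lambda>z. indicator A (fst z) *\<^sub>R adj_M v z)" by (rule poisson.has_ext_isometry[OF ext])
    also have "\<dots> \<le> norm2 \<rho> (adj_M v)" by (rule norm2_mono[OF adj_M_L2]) (simp split: split_indicator)
    finally show ?thesis using c(2)[rule_format, of v] by linarith
  qed
  from induced_cancel_independent_summand[OF prob_space_P X jump_part_cyl[OF A] poisson.has_ext_L2(2)[OF ext] this c(1)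
      poisson.has_ext_mean_zero(2)[OF ext] indep ind]
  show ?thesis .
qed

section \<open>Splitting the integral\<close>

text \<open>
  The drift and the Wiener part together are independent of the jump part, and the constant drift
  is independent of the Wiener part.
\<close>

theorem cyl_integral_induced_imp_parts_induced:
  assumes A: "A \<in> sets leb"
    and ind: "induced_by_variable P (cyl_integral P T b i W M \<mu> F A)"
  shows "induced_by_variable P (\<lambda>v _. drift A v)" "induced_by_variable P (wiener_part A)" "induced_by_variable P (jump_part A)"
proof -
  have cyl: "cyl_integral P T b i W M \<mu> F A = (\<lambda>v \<omega>. drift A v + wiener_part A v \<omega> + jump_part A v \<omega>)"
    by (simp add: fun_eq_iff cyl_integral_eq)
  have DW: "induced_by_variable P (\<lambda>v \<omega>. drift A v + wiener_part A v \<omega>)"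
  proof (rule induced_cancel_jump_part[OF A drift_wiener_part_cyl[OF A]])
    show "cf P (\<lambda>\<omega>. drift A v + wiener_part A v \<omega> + jump_part A v \<omega>) = cf P (\<lambda>\<omega>. drift A v + wiener_part A v \<omega>) * cf P (jump_part A v)" for v
      using cf_wiener_plus_poisson[OF wiener_part_has_ext[OF A] jump_part_has_ext[OF A], of v v]
      by (simp add: add.assoc cf_shift)
    show "induced_by_variable P (\<lambda>v \<omega>. drift A v + wiener_part A v \<omega> + jump_part A v \<omega>)" using ind by (simp only: cyl)
  qed
  show D: "induced_by_variable P (\<lambda>v _. drift A v)"
  proof (rule induced_cancel_wiener_part[OF A drift_cyl[OF A] _ DW])
    have "cf P (\<lambda>_. a) = iexp a" for a :: real by (simp add: cf_def prob_space)
    then show "cf P (\<lambda>\<omega>. drift A v + wiener_part A v \<omega>) = cf P (\<lambda>_. drift A v) * cf P (wiener_part A v)" for v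
      by (simp add: cf_shift)
  qed
  (* Subtract what is already known to be induced. *)
  show "induced_by_variable P (wiener_part A)"
    using induced_by_variable_lincomb[OF DW D, of "-1"] by simp
  show "induced_by_variable P (jump_part A)"
    using induced_by_variable_lincomb[OF ind DW, of "-1"] by (simp add: cyl)
qed

lemma wiener_part_split:
  assumes A: "A \<in> sets leb" 
  shows "wiener.has_ext (adj_W v) (\<lambda>\<omega>. wiener_part A v \<omega> + wiener_part ({0..T} - A) v \<omega>)"
proof (rule wiener.has_ext_cong)
  have A': "{0..T} - A \<in> sets leb" using A upto_sets(1) by (rule sets.Diff[rotated])
  show "wiener.has_ext (\<lambda>s. indicator A s *\<^sub>R adj_W v s + 1 *\<^sub>R (indicator ({0..T} - A) s *\<^sub>R adj_W v s))
      (\<lambda>\<omega>. wiener_part A v \<omega> + wiener_part ({0..T} - A) v \<omega>)"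
    using wiener.has_ext_lincomb[OF wiener_part_has_ext[OF A] wiener_part_has_ext[OF A'], of v 1 v] by simp
  show "indicator A s *\<^sub>R adj_W v s + 1 *\<^sub>R (indicator ({0..T} - A) s *\<^sub>R adj_W v s) = adj_W v s" if "s \<in> space leb" for s
    using that upto_sets(2) by (auto simp: indicator_def)
qed

lemma jump_part_split:
  assumes A: "A \<in> sets leb" 
  shows "poisson.has_ext (adj_M v) (\<lambda>\<omega>. jump_part A v \<omega> + jump_part ({0..T} - A) v \<omega>)"
proof (rule poisson.has_ext_cong)
  have A': "{0..T} - A \<in> sets leb" using A upto_sets(1) by (rule sets.Diff[rotated])
  show "poisson.has_ext (\<lambda>z. indicator A (fst z) *\<^sub>R adj_M v z + 1 *\<^sub>R (indicator ({0..T} - A) (fst z) *\<^sub>R adj_M v z))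
      (\<lambda>\<omega>. jump_part A v \<omega> + jump_part ({0..T} - A) v \<omega>)"
    using poisson.has_ext_lincomb[OF jump_part_has_ext[OF A] jump_part_has_ext[OF A'], of v 1 v] by simp
  show "indicator A (fst z) *\<^sub>R adj_M v z + 1 *\<^sub>R (indicator ({0..T} - A) (fst z) *\<^sub>R adj_M v z) = adj_M v z" if "z \<in> space \<rho>" for z
    using that upto_sets(2) by (auto simp: indicator_def space_pair_measure)
qed

text \<open>
  The parts over \<open>A\<close> and over its complement sum to the induced part over
  \<open>[0,T]\<close>. Their characteristic functions multiply because the squared norms of the
  integrands add.
\<close>

theorem wiener_part_induced_on_subset:
  assumes A: "A \<in> sets leb" and ind: "induced_by_variable P (wiener_part {0..T})"
  shows "induced_by_variable P (wiener_part A)"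
proof -
  have A': "{0..T} - A \<in> sets leb" using A upto_sets(1) by (rule sets.Diff[rotated])
  show ?thesis
  proof (rule induced_cancel_wiener_part[OF A' wiener_part_cyl[OF A]])
    fix v
    let ?f = "\<lambda>A s. indicator A s *\<^sub>R adj_W v s"
    note L2 = wiener.has_ext_L2(1)[OF wiener_part_has_ext]
    have "(norm2 leb (adj_W v))\<^sup>2 = (LINT s|leb. (norm (?f A s))\<^sup>2 + (norm (?f ({0..T} - A) s))\<^sup>2)"
      unfolding norm2_power2[OF adj_W_L2] using upto_sets(2)
      by (intro Bochner_Integration.integral_cong refl) (auto simp: indicator_def)
    also have "\<dots> = (norm2 leb (?f A))\<^sup>2 + (norm2 leb (?f ({0..T} - A)))\<^sup>2"
      unfolding norm2_power2[OF L2[OF A]] norm2_power2[OF L2[OF A']]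
      using L2[OF A, of v] L2[OF A', of v] by (intro Bochner_Integration.integral_add) (auto simp: L2_fun_def)
    finally have n: "(norm2 leb (adj_W v))\<^sup>2 = (norm2 leb (?f A))\<^sup>2 + (norm2 leb (?f ({0..T} - A)))\<^sup>2" .
    show "cf P (\<lambda>\<omega>. wiener_part A v \<omega> + wiener_part ({0..T} - A) v \<omega>) = cf P (wiener_part A v) * cf P (wiener_part ({0..T} - A) v)"
      unfolding cf_wiener[OF wiener_part_split[OF A]] cf_wiener[OF wiener_part_has_ext[OF A]] cf_wiener[OF wiener_part_has_ext[OF A']] n
      by (simp add: add_divide_distrib exp_add[symmetric] flip: of_real_mult)
  next
    show "induced_by_variable P (\<lambda>v \<omega>. wiener_part A v \<omega> + wiener_part ({0..T} - A) v \<omega>)"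
      by (rule induced_by_variable_cong_AE[OF ind wiener.has_ext_unique[OF wiener_part_full_has_ext wiener_part_split[OF A]]])
  qed
qed

theorem jump_part_induced_on_subset:
  assumes A: "A \<in> sets leb" and ind: "induced_by_variable P (jump_part {0..T})"
  shows "induced_by_variable P (jump_part A)"
proof -
  have A': "{0..T} - A \<in> sets leb" using A upto_sets(1) by (rule sets.Diff[rotated])
  show ?thesis
  proof (rule induced_cancel_jump_part[OF A' jump_part_cyl[OF A]])
    show "cf P (\<lambda>\<omega>. jump_part A v \<omega> + jump_part ({0..T} - A) v \<omega>) = cf P (jump_part A v) * cf P (jump_part ({0..T} - A) v)" for v
      by (rule cf_disjoint_supports[OF jump_part_has_ext[OF A] jump_part_has_ext[OF A'] slab_sets[OF A]])
        (auto simp: space_pair_measure indicator_def)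
  next
    show "induced_by_variable P (\<lambda>v \<omega>. jump_part A v \<omega> + jump_part ({0..T} - A) v \<omega>)"
      by (rule induced_by_variable_cong_AE[OF ind poisson.has_ext_unique[OF jump_part_full_has_ext jump_part_split[OF A]]])
  qed
qed

section \<open>The operators of the Gaussian and of the jump part\<close>

lemma sigma_finite_leb: "sigma_finite_measure leb"
proof -
  have "finite_measure leb" using T by (intro finite_measureI) (simp add: emeasure_restrict_space space_restrict_space)
  then show ?thesis by (rule finite_measure.axioms(1))
qed

lemma sigma_finite_\<rho>: "sigma_finite_measure \<rho>"
  by (rule sigma_finite_pair_measure[OF sigma_finite_leb sigma_finite_\<mu>])

text \<open>
  Here \<open>F s (i (f s))\<close> is a function with values in \<open>V\<close> whose weak
  integral is \<open>j_W f\<close>.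
\<close>

lemma j_W_eq:
  assumes f: "f \<in> L2_fun leb"
  shows "blinfun_apply v (j_W T i F f) = L2_inner leb f (adj_W v)"
proof -
  obtain c where c: "c \<ge> 0" "\<forall>v. norm2 leb (adj_W v) \<le> c * norm v" using adj_W_bounded by blast
  have \<Phi>: "blinfun_apply v (blinfun_apply (F s) (blinfun_apply i (f s))) = adj_W v s \<bullet> f s" for v :: "'v \<Rightarrow>\<^sub>L real" and s
    by (simp add: adj_W_def hilbert_adjoint_inner)
  obtain x where x: "\<And>v :: 'v \<Rightarrow>\<^sub>L real. blinfun_apply v x = (LINT s|leb. blinfun_apply v (blinfun_apply (F s) (blinfun_apply i (f s))))"
  proof (rule weak_integral_exists[OF sigma_finite_leb f adj_W_L2 c(2)[rule_format] c(1)])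
    show "(\<lambda>s. blinfun_apply v (blinfun_apply (F s) (blinfun_apply i (f s)))) \<in> borel_measurable leb" for v :: "'v \<Rightarrow>\<^sub>L real"
      unfolding \<Phi> using L2_funD[OF adj_W_L2] L2_funD[OF f] by (rule borel_measurable_inner)
    show "\<bar>blinfun_apply v (blinfun_apply (F s) (blinfun_apply i (f s)))\<bar> \<le> norm (adj_W v s) * norm (f s)" for v :: "'v \<Rightarrow>\<^sub>L real" and s
      unfolding \<Phi> by (rule Cauchy_Schwarz_ineq2)
    fix x assume "\<And>v :: 'v \<Rightarrow>\<^sub>L real. blinfun_apply v x = (LINT s|leb. blinfun_apply v (blinfun_apply (F s) (blinfun_apply i (f s))))"
    then show thesis by (rule that)
  qed
  then have *: "\<forall>v. blinfun_apply v x = L2_inner leb (\<lambda>s. hilbert_adjoint i (v o\<^sub>L F s)) f"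
    by (simp add: \<Phi> L2_inner_def adj_W_def)
  have "j_W T i F f = x"
    unfolding j_W_def
  proof (rule the_equality[where P="\<lambda>x. \<forall>v. blinfun_apply v x = L2_inner leb (\<lambda>s. hilbert_adjoint i (v o\<^sub>L F s)) f", OF *])
    fix y assume "\<forall>v :: 'v \<Rightarrow>\<^sub>L real. blinfun_apply v y = L2_inner leb (\<lambda>s. hilbert_adjoint i (v o\<^sub>L F s)) f"
    with * show "y = x" by (intro functionals_separate_points[of y x]) simp
  qed
  then show ?thesis using * by (simp add: L2_inner_def adj_W_def inner_commute)
qed

lemma j_M_eq:
  assumes f: "f \<in> L2_fun \<rho>"
  shows "blinfun_apply v (j_M T \<mu> F f) = L2_inner \<rho> f (adj_M v)"
proof -
  obtain c where c: "c \<ge> 0" "\<forall>v. norm2 \<rho> (adj_M v) \<le> c * norm v" using adj_M_bounded by blast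
  let ?\<Phi> = "\<lambda>z. f z *\<^sub>R blinfun_apply (F (fst z)) (snd z)"
  have \<Phi>: "blinfun_apply v (?\<Phi> z) = adj_M v z \<bullet> f z" for v :: "'v \<Rightarrow>\<^sub>L real" and z
    by (simp add: adj_M_apply blinfun.scaleR_right)
  obtain x where x: "\<And>v :: 'v \<Rightarrow>\<^sub>L real. blinfun_apply v x = (LINT z|\<rho>. blinfun_apply v (?\<Phi> z))"
  proof (rule weak_integral_exists[OF sigma_finite_\<rho> f adj_M_L2 c(2)[rule_format] c(1)])
    show "(\<lambda>z. blinfun_apply v (?\<Phi> z)) \<in> borel_measurable \<rho>" for v :: "'v \<Rightarrow>\<^sub>L real"
      unfolding \<Phi> using L2_funD[OF adj_M_L2] L2_funD[OF f] by (rule borel_measurable_inner)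
    show "\<bar>blinfun_apply v (?\<Phi> z)\<bar> \<le> norm (adj_M v z) * norm (f z)" for v :: "'v \<Rightarrow>\<^sub>L real" and z
      unfolding \<Phi> by (rule Cauchy_Schwarz_ineq2)
    fix x assume "\<And>v :: 'v \<Rightarrow>\<^sub>L real. blinfun_apply v x = (LINT z|\<rho>. blinfun_apply v (?\<Phi> z))"
    then show thesis by (rule that)
  qed
  then have *: "\<forall>v. blinfun_apply v x = L2_inner \<rho> (\<lambda>(s, u). blinfun_apply v (blinfun_apply (F s) u)) f"
    unfolding \<Phi> L2_inner_def adj_M_def by blast
  have "j_M T \<mu> F f = x"
    unfolding j_M_def
  proof (rule the_equality[where P="\<lambda>x. \<forall>v. blinfun_apply v x = L2_inner \<rho> (\<lambda>(s, u). blinfun_apply v (blinfun_apply (F s) u)) f", OF *])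
    fix y assume "\<forall>v :: 'v \<Rightarrow>\<^sub>L real. blinfun_apply v y = L2_inner \<rho> (\<lambda>(s, u). blinfun_apply v (blinfun_apply (F s) u)) f"
    with * show "y = x" by (intro functionals_separate_points[of y x]) simp
  qed
  then show ?thesis using * by (simp add: L2_inner_def adj_M_def mult.commute)
qed

lemma j_W_radonifying_iff:
  assumes \<gamma>: "canonical_gaussian leb \<gamma>"
  shows "radonifying (L2_fun leb) \<gamma> (j_W T i F) \<longleftrightarrow> induced_by_variable P (wiener_part {0..T})"
proof (rule radonifying_iff_induced[where pair="L2_inner leb" and \<psi>=adj_W, OF prob_space_P wiener_part_cyl[OF upto_sets(1)]])
  show "blinfun_apply v (j_W T i F f) = L2_inner leb f (adj_W v)" if "f \<in> L2_fun leb" for f v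
    using that by (rule j_W_eq)
  show "\<gamma> (cylinder (L2_fun leb) (L2_inner leb) n (\<lambda>k. adj_W (\<phi> k)) B)
      = emeasure P {\<omega> \<in> space P. (\<lambda>k\<in>{..<n}. wiener_part {0..T} (\<phi> k) \<omega>) \<in> B}" if "B \<in> sets (borel_fin n)" for n \<phi> B
    using \<gamma> wiener_part_full_has_ext that by (rule canonical_gaussian_cylinder)
qed

lemma j_M_radonifying_iff:
  assumes \<theta>: "cylindrical_distribution P (L2_fun \<rho>) (L2_inner \<rho>) (L2_fun \<rho>) (Theta_M P T M \<mu>) \<theta>"
  shows "radonifying (L2_fun \<rho>) \<theta> (j_M T \<mu> F) \<longleftrightarrow> induced_by_variable P (jump_part {0..T})"
proof -
  have ext: "poisson.has_ext (adj_M v) (Theta_M P T M \<mu> (adj_M v))" for v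
    unfolding Theta_M_def by (rule compensated_integral_has_ext[OF adj_M_L2])
  have cyl: "cyl_random_variable P (\<lambda>v. Theta_M P T M \<mu> (adj_M v))"
    by (rule poisson.has_ext_cyl_random_variable[OF ext adj_M_lincomb])
  have "radonifying (L2_fun \<rho>) \<theta> (j_M T \<mu> F) \<longleftrightarrow> induced_by_variable P (\<lambda>v. Theta_M P T M \<mu> (adj_M v))"
  proof (rule radonifying_iff_induced[where pair="L2_inner \<rho>" and \<psi>=adj_M, OF prob_space_P cyl])
    show "blinfun_apply v (j_M T \<mu> F f) = L2_inner \<rho> f (adj_M v)" if "f \<in> L2_fun \<rho>" for f v
      using that by (rule j_M_eq)
    show "\<theta> (cylinder (L2_fun \<rho>) (L2_inner \<rho>) n (\<lambda>k. adj_M (\<phi> k)) B)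
        = emeasure P {\<omega> \<in> space P. (\<lambda>k\<in>{..<n}. Theta_M P T M \<mu> (adj_M (\<phi> k)) \<omega>) \<in> B}"
      if "B \<in> sets (borel_fin n)" for n \<phi> B
      using \<theta>[unfolded cylindrical_distribution_def, rule_format, of n "\<lambda>k. adj_M (\<phi> k)" B] adj_M_L2 that by simp
  qed
  also have "\<dots> \<longleftrightarrow> induced_by_variable P (jump_part {0..T})"
  proof
    assume "induced_by_variable P (\<lambda>v. Theta_M P T M \<mu> (adj_M v))"
    then show "induced_by_variable P (jump_part {0..T})"
      by (rule induced_by_variable_cong_AE) (rule poisson.has_ext_unique[OF ext jump_part_full_has_ext])
  next
    assume "induced_by_variable P (jump_part {0..T})"
    then show "induced_by_variable P (\<lambda>v. Theta_M P T M \<mu> (adj_M v))"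
      by (rule induced_by_variable_cong_AE) (rule poisson.has_ext_unique[OF jump_part_full_has_ext ext])
  qed
  finally show ?thesis .
qed

section \<open>Stochastic integrability\<close>

lemma pettis_integrable_iff:
  "pettis_integrable leb (\<lambda>s. blinfun_apply (F s) b) \<longleftrightarrow>
    (\<forall>A\<in>sets leb. induced_by_variable P (\<lambda>v _. drift A v))"
  unfolding induced_deterministic[OF prob_space_P] pettis_integrable_def set_lebesgue_integral_def drift_def
  using F_b by simp

theorem stochastically_integrable_iff:
  assumes \<gamma>: "canonical_gaussian leb \<gamma>"
    and \<theta>: "cylindrical_distribution P (L2_fun \<rho>) (L2_inner \<rho>) (L2_fun \<rho>) (Theta_M P T M \<mu>) \<theta>"
  shows "stochastically_integrable P T b i W M \<mu> F \<longleftrightarrow>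
    pettis_integrable leb (\<lambda>s. blinfun_apply (F s) b) \<and>
    radonifying (L2_fun leb) \<gamma> (j_W T i F) \<and> radonifying (L2_fun \<rho>) \<theta> (j_M T \<mu> F)"
proof -
  have "stochastically_integrable P T b i W M \<mu> F \<longleftrightarrow>
      (\<forall>A\<in>sets leb. induced_by_variable P (cyl_integral P T b i W M \<mu> F A))"
    by (simp add: stochastically_integrable_def induced_by_variable_def)
  also have "\<dots> \<longleftrightarrow> (\<forall>A\<in>sets leb. induced_by_variable P (\<lambda>v _. drift A v)) \<and>
      induced_by_variable P (wiener_part {0..T}) \<and> induced_by_variable P (jump_part {0..T})"
  proof (intro iffI conjI ballI)
    assume ind: "\<forall>A\<in>sets leb. induced_by_variable P (cyl_integral P T b i W M \<mu> F A)"
    then show "induced_by_variable P (\<lambda>v _. drift A v)" if "A \<in> sets leb" for A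
      using cyl_integral_induced_imp_parts_induced(1)[OF that] that by blast
    show "induced_by_variable P (wiener_part {0..T})" "induced_by_variable P (jump_part {0..T})"
      using cyl_integral_induced_imp_parts_induced(2,3)[OF upto_sets(1)] ind upto_sets(1) by blast+
  next
    fix A assume A: "A \<in> sets leb"
      and *: "(\<forall>A\<in>sets leb. induced_by_variable P (\<lambda>v _. drift A v)) \<and>
        induced_by_variable P (wiener_part {0..T}) \<and> induced_by_variable P (jump_part {0..T})"
    have D: "induced_by_variable P (\<lambda>v _. drift A v)"
      and WM: "induced_by_variable P (wiener_part A)" "induced_by_variable P (jump_part A)"
      using A * wiener_part_induced_on_subset[OF A] jump_part_induced_on_subset[OF A] by blast+
    have "induced_by_variable P (\<lambda>v \<omega>. (drift A v + 1 * wiener_part A v \<omega>) + 1 * jump_part A v \<omega>)"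
      by (rule induced_by_variable_lincomb[OF induced_by_variable_lincomb[OF D WM(1)] WM(2)])
    then show "induced_by_variable P (cyl_integral P T b i W M \<mu> F A)"
      by (simp add: cyl_integral_eq[abs_def])
  qed
  finally show ?thesis
    by (simp add: pettis_integrable_iff j_W_radonifying_iff[OF \<gamma>] j_M_radonifying_iff[OF \<theta>])
qed

end

theorem theorem5p1:
  fixes P :: "'w measure"
    and T :: real
    and L W M :: "real \<Rightarrow> 'w \<Rightarrow> 'u::{banach, second_countable_topology}"
    and b :: 'u
    and C :: "('u \<Rightarrow>\<^sub>L real) \<Rightarrow>\<^sub>L 'u"
    and \<mu> :: "'u measure"
    and i\<^sub>C :: "'k::{real_inner, banach, second_countable_topology} \<Rightarrow>\<^sub>L 'u"
    and F :: "real \<Rightarrow> 'u \<Rightarrow>\<^sub>L 'v::{banach, second_countable_topology}"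
    and \<gamma> :: "(real \<Rightarrow> 'k) set \<Rightarrow> ennreal"
    and \<theta>\<^sub>M :: "(real \<times> 'u \<Rightarrow> real) set \<Rightarrow> ennreal"
  assumes "T > 0"
    and L: "levy_process P L" "weak_second_moments P L"
    and L_decomp: "\<And>t. t \<ge> 0 \<Longrightarrow> AE \<omega> in P. L t \<omega> = t *\<^sub>R b + W t \<omega> + M t \<omega>"
    and W: "wiener_process P W C"
    and M: "levy_process P M" "cadlag P M" "weak_second_moments P M" "weak_mean_zero P M"
      "levy_measure P M \<mu>" "purely_discontinuous P M \<mu>"
    and "indep_processes P W M"
    and K: "rkhs_embedding C i\<^sub>C"
    and \<gamma>: "canonical_gaussian (lborel_upto T) \<gamma>"
    and \<theta>\<^sub>M: "cylindrical_distribution P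
      (L2_fun (jump_intensity T \<mu>)) (L2_inner (jump_intensity T \<mu>)) (L2_fun (jump_intensity T \<mu>))
      (Theta_M P T M \<mu>) \<theta>\<^sub>M"
    and F_M: "\<And>v :: 'v \<Rightarrow>\<^sub>L real.
      (\<lambda>(s, u). blinfun_apply v (blinfun_apply (F s) u)) \<in> L2_fun (jump_intensity T \<mu>)"
    and F_W: "\<And>v :: 'v \<Rightarrow>\<^sub>L real.
      (\<lambda>s. hilbert_adjoint i\<^sub>C (v o\<^sub>L F s)) \<in> L2_fun (lborel_upto T)"
    and F_b: "\<And>v :: 'v \<Rightarrow>\<^sub>L real.
      integrable (lborel_upto T) (\<lambda>s. blinfun_apply (v o\<^sub>L F s) b)"
  shows "stochastically_integrable P T b i\<^sub>C W M \<mu> F \<longleftrightarrow>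
    pettis_integrable (lborel_upto T) (\<lambda>s. blinfun_apply (F s) b) \<and>
    radonifying (L2_fun (lborel_upto T)) \<gamma> (j_W T i\<^sub>C F) \<and>
    radonifying (L2_fun (jump_intensity T \<mu>)) \<theta>\<^sub>M (j_M T \<mu> F)"
proof -
  interpret integrand_setting P T W C i\<^sub>C M \<mu> F b
  proof (intro integrand_setting.intro levy_integral_setting.intro wiener_integral_setting.intro
      jump_setting.intro levy_integral_setting_axioms.intro integrand_setting_axioms.intro)
    show "prob_space P" using L(1) by (simp add: levy_process_def)
  qed fact+
  show ?thesis by (rule stochastically_integrable_iff[OF \<gamma> \<theta>\<^sub>M])
qed

end
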